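(* Let $d>2$ be an integer, $c_0\in(0,1]$ and $\varepsilon\in(0,1)$. There exist constants $\mathbf{c},\mathbf{C}>0$ depending only on $(d,c_0)$, and $\boldsymbol{\delta}\in(0,1)$ depending only on $(d,c_0,\varepsilon)$, such that the following holds. Suppose that $J$ is an admissible kernel with constant $c_0$, that $G\in\mathcal G$, that $J$ and $G$ obey Assumption 1, and that moreover $E(\beta(\boldsymbol{\delta}))<\boldsymbol{\delta}$ (Assumption 2). Then $\beta(\boldsymbol{\delta})=\beta_c$, so $\beta_c<\infty$, and for every $\beta\in[0,\beta_c]$ and every $x\in\mathbb Z^d$, $$G_\beta(x)\le \delta_0(x)+\frac{\mathbf{C}}{\sigma_J^d}\left(\frac{\sigma_J}{\sigma_J\vee|x|}\right)^{d-2-\varepsilon}\exp\left(-\mathbf{c}\,\frac{|x|}{\xi(\beta)}\right).$$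
   Context: Notation: $|x|_2$ is the Euclidean norm and $|x|=\max_i|x_i|$; $a\vee b=\max(a,b)$; $\delta_0$ is the Kronecker delta at $0\in\mathbb Z^d$; $(f*g)(x)=\sum_{y\in\mathbb Z^d}f(y)g(x-y)$; $\|f\|_1=\sum_x f(x)$ and $\||x|_2^2\cdot f\|_1=\sum_x|x|_2^2f(x)$ for $f\ge0$. A function on $\mathbb Z^d$ is $\mathbb Z^d$-symmetric if it is invariant under permutations of coordinates and sign changes of coordinates. Admissible kernel with constant $c_0\in(0,1]$: a function $J:\mathbb Z^d\to[0,\infty)$ with $J_0=0$, $\sum_xJ_x=1$, $\mathbb Z^d$-symmetric, with finite range $R_J=\max\{|x|:J_x>0\}\in[1,\infty)$, and, with $\sigma_J^2=\sum_x|x|_2^2J_x$, satisfying $c_0R_J\le\sigma_J$ and $J_x\le c_0^{-1}R_J^{-d}$ for all $x$. Class $\mathcal G$: families of functions $G_\beta:\mathbb Z^d\to[0,\infty]$ indexed by $\beta\in[0,\beta_c]$, for some $\beta_c\in[0,\infty]$, such that: (i) $G_0=\delta_0$; (ii) for every $x$, $\beta\mapsto G_\beta(x)$ is non-decreasing and differentiable on $[0,\beta_c)$; (iii) each $G_\beta$ is $\mathbb Z^d$-symmetric; (iv) for each $\beta\in[0,\beta_c)$, $G_\beta(x)$ decays exponentially in $x$; (v) if $\beta_c<\infty$, $\lim_{\beta\uparrow\beta_c}G_\beta(x)=G_{\beta_c}(x)$ for every $x$ (possibly infinite). Assumption 1 (on an admissible kernel $J$ and $G\in\mathcal G$): (i)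 for all $0\le\beta'\le\beta<\beta_c$, $G_\beta\le G_{\beta'}+(\beta-\beta')(G_{\beta'}*J*G_\beta)$ pointwise; (ii) for every $\beta<\beta_c$ there is $H_\beta:\mathbb Z^d\to[0,\infty)$ (which may depend on $J,G$) with $\partial_\beta G_\beta\ge G_\beta*(J-H_\beta)*G_\beta$ pointwise, where, for all $x$, $H_0(x)=0$, $H_\beta(x)=H_\beta(-x)$, $\beta\mapsto H_\beta(x)$ is continuous on $[0,\beta_c)$, and $H_\beta(x)$ decays exponentially in $x$ for each fixed $\beta$. Set $F_\beta=J*G_\beta$ and, for $\beta<\beta_c$, $\chi(\beta)=\|G_\beta\|_1=\|F_\beta\|_1$, $\xi(\beta)^2=\||x|_2^2\cdot F_\beta\|_1/\chi(\beta)$, $E(\beta)=\sup_{0\le t\le\beta}\left(\|H_t\|_1+\||x|_2^2\cdot H_t\|_1/\xi(t)^2\right)$; also $E(\beta_c)$ denotes the same supremum over $0\le t<\beta_c$. For $\delta>0$, $\beta(\delta)=\sup\{\beta\in[0,\beta_c):E(\beta)<\delta\}$. At $\beta=\beta_c$ one takes $\xi(\beta_c)=\lim_{\beta\uparrow\beta_c}\xi(\beta)\in(0,\infty]$, and the exponential factor is $1$ if $\xi(\beta_c)=\infty$.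
   Formalization: Added to Assumption 1: the norms ‖H_β‖_1 and ‖|x|_2^2·H_β‖_1 are continuous in β on [0,β_c); with only pointwise continuity of H_β(x), mass can enter from infinity so that E jumps just after β(δ), and β(δ)=β_c can fail. *)

theory Defs
  imports "HOL-Analysis.Analysis"
begin

type_synonym 'd lattice = "int ^ 'd"

definition supnorm :: "('d::finite) lattice \<Rightarrow> real" where
  "supnorm x = Max (range (\<lambda>i. \<bar>real_of_int (x $ i)\<bar>))"

definition norm2 :: "('d::finite) lattice \<Rightarrow> real" where
  "norm2 x = sqrt (\<Sum>i\<in>UNIV. (real_of_int (x $ i))\<^sup>2)"

definition delta0 :: "('d::finite) lattice \<Rightarrow> ennreal" where
  "delta0 x = (if x = 0 then 1 else 0)"

text \<open>
  Used with values in \<^typ>\<open>ennreal\<close> (where the sum always exists) and, for signed functions, in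
  \<^typ>\<open>real\<close>, where it is only applied to exponentially decaying functions.
\<close>
definition conv ::
  "(('d::finite) lattice \<Rightarrow> 'a::{comm_semiring_1, t2_space}) \<Rightarrow> ('d lattice \<Rightarrow> 'a) \<Rightarrow> 'd lattice \<Rightarrow> 'a"
  where "conv f g x = (\<Sum>\<^sub>\<infinity>y\<in>UNIV. f y * g (x - y))"

definition l1 :: "(('d::finite) lattice \<Rightarrow> ennreal) \<Rightarrow> ennreal" where
  "l1 f = (\<Sum>\<^sub>\<infinity>x\<in>UNIV. f x)"

definition second_moment :: "(('d::finite) lattice \<Rightarrow> ennreal) \<Rightarrow> ennreal" where
  "second_moment f = l1 (\<lambda>x. ennreal ((norm2 x)\<^sup>2) * f x)"

definition lattice_symmetric :: "(('d::finite) lattice \<Rightarrow> 'a) \<Rightarrow> bool" where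
  "lattice_symmetric f \<longleftrightarrow>
     (\<forall>p x. p permutes UNIV \<longrightarrow> f (\<chi> i. x $ p i) = f x) \<and>
     (\<forall>s x. (\<forall>i. s i \<in> {-1, 1}) \<longrightarrow> f (\<chi> i. s i * x $ i) = f x)"

definition exp_decay :: "(('d::finite) lattice \<Rightarrow> ennreal) \<Rightarrow> bool" where
  "exp_decay f \<longleftrightarrow> (\<exists>A a. a > 0 \<and> (\<forall>x. f x \<le> ennreal (A * exp (- a * supnorm x))))"

definition kernel_range :: "(('d::finite) lattice \<Rightarrow> real) \<Rightarrow> real" where
  "kernel_range J = Max (supnorm ` {x. J x > 0})"

definition kernel_sigma :: "(('d::finite) lattice \<Rightarrow> real) \<Rightarrow> real" where
  "kernel_sigma J = sqrt (\<Sum>\<^sub>\<infinity>x\<in>UNIV. (norm2 x)\<^sup>2 * J x)"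

definition admissible :: "real \<Rightarrow> (('d::finite) lattice \<Rightarrow> real) \<Rightarrow> bool" where
  "admissible c0 J \<longleftrightarrow>
     (\<forall>x. J x \<ge> 0) \<and> J 0 = 0 \<and> (J has_sum 1) UNIV \<and> lattice_symmetric J \<and>
     finite {x. J x > 0} \<and> kernel_range J \<ge> 1 \<and>
     c0 * kernel_range J \<le> kernel_sigma J \<and>
     (\<forall>x. J x \<le> inverse c0 * inverse (kernel_range J ^ CARD('d)))"

text \<open>
  The parameter \<open>\<beta>\<close> ranges over \<^typ>\<open>ennreal\<close>, so that \<open>\<beta> \<le> \<beta>\<^sub>c\<close> is the index set \<open>[0,\<beta>\<^sub>c]\<close> also
  when \<open>\<beta>\<^sub>c = \<infinity>\<close>. Derivatives in \<open>\<beta>\<close> are those of the real function below, taken within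
  \<open>[0,\<beta>\<^sub>c)\<close>, i.e. one-sided at \<open>0\<close>; on \<open>[0,\<beta>\<^sub>c)\<close> the values of \<open>G\<close> are finite by exponential decay.
\<close>
definition subcritical :: "ennreal \<Rightarrow> real set" where
  "subcritical \<beta>c = {b. 0 \<le> b \<and> ennreal b < \<beta>c}"

definition real_G :: "(ennreal \<Rightarrow> ('d::finite) lattice \<Rightarrow> ennreal) \<Rightarrow> 'd lattice \<Rightarrow> real \<Rightarrow> real" where
  "real_G G x b = enn2real (G (ennreal b) x)"

definition beta_deriv ::
  "(ennreal \<Rightarrow> ('d::finite) lattice \<Rightarrow> ennreal) \<Rightarrow> ennreal \<Rightarrow> ennreal \<Rightarrow> 'd lattice \<Rightarrow> real" where
  "beta_deriv G \<beta>c \<beta> x =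
     vector_derivative (real_G G x) (at (enn2real \<beta>) within subcritical \<beta>c)"

text \<open>For \<open>\<beta>\<^sub>c = 0\<close> the filter \<^term>\<open>at_left \<beta>c\<close> on \<^typ>\<open>ennreal\<close> is trivial, so the last clause is void.\<close>
definition class_G :: "ennreal \<Rightarrow> (ennreal \<Rightarrow> ('d::finite) lattice \<Rightarrow> ennreal) \<Rightarrow> bool" where
  "class_G \<beta>c G \<longleftrightarrow>
     G 0 = delta0 \<and>
     (\<forall>x. mono_on {..<\<beta>c} (\<lambda>\<beta>. G \<beta> x) \<and> real_G G x differentiable_on subcritical \<beta>c) \<and>
     (\<forall>\<beta>\<le>\<beta>c. lattice_symmetric (G \<beta>)) \<and>
     (\<forall>\<beta><\<beta>c. exp_decay (G \<beta>)) \<and>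
     (\<beta>c < \<infinity> \<longrightarrow> (\<forall>x. ((\<lambda>\<beta>. G \<beta> x) \<longlongrightarrow> G \<beta>c x) (at_left \<beta>c)))"

definition assumption1_i ::
  "(('d::finite) lattice \<Rightarrow> real) \<Rightarrow> ennreal \<Rightarrow> (ennreal \<Rightarrow> 'd lattice \<Rightarrow> ennreal) \<Rightarrow> bool" where
  "assumption1_i J \<beta>c G \<longleftrightarrow>
     (\<forall>\<beta>' \<beta> x. \<beta>' \<le> \<beta> \<and> \<beta> < \<beta>c \<longrightarrow>
        G \<beta> x \<le> G \<beta>' x + (\<beta> - \<beta>') * conv (conv (G \<beta>') (\<lambda>z. ennreal (J z))) (G \<beta>) x)"

text \<open>
  The existentially quantified family of the differential inequality is kept as a parameter \<open>H\<close>,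
  because the error \<open>E\<close> below is built from it.
\<close>
definition assumption1_ii ::
  "(('d::finite) lattice \<Rightarrow> real) \<Rightarrow> ennreal \<Rightarrow> (ennreal \<Rightarrow> 'd lattice \<Rightarrow> ennreal) \<Rightarrow>
   (ennreal \<Rightarrow> 'd lattice \<Rightarrow> real) \<Rightarrow> bool" where
  "assumption1_ii J \<beta>c G H \<longleftrightarrow>
     (\<forall>\<beta><\<beta>c. \<forall>x. H \<beta> x \<ge> 0) \<and>
     (\<forall>\<beta><\<beta>c. \<forall>x. beta_deriv G \<beta>c \<beta> x \<ge>
        conv (conv (\<lambda>z. enn2real (G \<beta> z)) (\<lambda>z. J z - H \<beta> z)) (\<lambda>z. enn2real (G \<beta> z)) x) \<and>
     (\<forall>x. H 0 x = 0) \<and>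
     (\<forall>\<beta><\<beta>c. \<forall>x. H \<beta> x = H \<beta> (- x)) \<and>
     (\<forall>x. continuous_on {..<\<beta>c} (\<lambda>\<beta>. H \<beta> x)) \<and>
     (\<forall>\<beta><\<beta>c. exp_decay (\<lambda>x. ennreal (H \<beta> x)))"

definition assumption1 ::
  "(('d::finite) lattice \<Rightarrow> real) \<Rightarrow> ennreal \<Rightarrow> (ennreal \<Rightarrow> 'd lattice \<Rightarrow> ennreal) \<Rightarrow>
   (ennreal \<Rightarrow> 'd lattice \<Rightarrow> real) \<Rightarrow> bool" where
  "assumption1 J \<beta>c G H \<longleftrightarrow> assumption1_i J \<beta>c G \<and> assumption1_ii J \<beta>c G H"

text \<open>
  Pointwise continuity of \<open>\<beta> \<mapsto> H \<beta> x\<close> does not prevent mass of \<open>H \<beta>\<close> from coming in from infinity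
  at some \<open>\<beta>\<close>, which makes the error \<open>E\<close> jump immediately after \<open>\<beta>(\<delta>)\<close> although
  \<open>E (\<beta>(\<delta>)) < \<delta>\<close>; then \<open>\<beta>(\<delta>) = \<beta>\<^sub>c\<close> fails. Together with pointwise continuity, the following
  says that \<open>\<beta> \<mapsto> H \<beta>\<close> is continuous in the weighted \<open>\<ell>\<^sup>1\<close> norm that enters \<open>E\<close>. By dominated
  convergence it holds whenever the exponential decay of \<open>H\<close> is locally uniform in \<open>\<beta>\<close>.
\<close>
definition norm_continuous :: "ennreal \<Rightarrow> (ennreal \<Rightarrow> ('d::finite) lattice \<Rightarrow> real) \<Rightarrow> bool" where
  "norm_continuous \<beta>c H \<longleftrightarrow>
     continuous_on {..<\<beta>c} (\<lambda>\<beta>. l1 (\<lambda>x. ennreal (H \<beta> x))) \<and>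
     continuous_on {..<\<beta>c} (\<lambda>\<beta>. second_moment (\<lambda>x. ennreal (H \<beta> x)))"

definition F_conv ::
  "(('d::finite) lattice \<Rightarrow> real) \<Rightarrow> (ennreal \<Rightarrow> 'd lattice \<Rightarrow> ennreal) \<Rightarrow> ennreal \<Rightarrow> 'd lattice \<Rightarrow> ennreal"
  where "F_conv J G \<beta> = conv (\<lambda>z. ennreal (J z)) (G \<beta>)"

definition chi :: "(ennreal \<Rightarrow> ('d::finite) lattice \<Rightarrow> ennreal) \<Rightarrow> ennreal \<Rightarrow> ennreal" where
  "chi G \<beta> = l1 (G \<beta>)"

definition esqrt :: "ennreal \<Rightarrow> ennreal" where
  "esqrt t = (if t = \<infinity> then \<infinity> else ennreal (sqrt (enn2real t)))"

definition xi_below ::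
  "(('d::finite) lattice \<Rightarrow> real) \<Rightarrow> (ennreal \<Rightarrow> 'd lattice \<Rightarrow> ennreal) \<Rightarrow> ennreal \<Rightarrow> ennreal" where
  "xi_below J G \<beta> = esqrt (second_moment (F_conv J G \<beta>) / chi G \<beta>)"

definition xi ::
  "(('d::finite) lattice \<Rightarrow> real) \<Rightarrow> ennreal \<Rightarrow> (ennreal \<Rightarrow> 'd lattice \<Rightarrow> ennreal) \<Rightarrow> ennreal \<Rightarrow> ennreal"
  where
  "xi J \<beta>c G \<beta> = (if \<beta> < \<beta>c then xi_below J G \<beta> else Lim (at_left \<beta>c) (xi_below J G))"

text \<open>The index set is \<open>[0,\<beta>]\<close> for \<open>\<beta> < \<beta>\<^sub>c\<close> and \<open>[0,\<beta>\<^sub>c)\<close> for \<open>\<beta> = \<beta>\<^sub>c\<close>.\<close>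
definition E_err ::
  "(('d::finite) lattice \<Rightarrow> real) \<Rightarrow> ennreal \<Rightarrow> (ennreal \<Rightarrow> 'd lattice \<Rightarrow> ennreal) \<Rightarrow>
   (ennreal \<Rightarrow> 'd lattice \<Rightarrow> real) \<Rightarrow> ennreal \<Rightarrow> ennreal" where
  "E_err J \<beta>c G H \<beta> =
     (SUP t\<in>{t. t \<le> \<beta> \<and> t < \<beta>c}.
        l1 (\<lambda>x. ennreal (H t x)) + second_moment (\<lambda>x. ennreal (H t x)) / (xi J \<beta>c G t)\<^sup>2)"

definition beta_thr ::
  "(('d::finite) lattice \<Rightarrow> real) \<Rightarrow> ennreal \<Rightarrow> (ennreal \<Rightarrow> 'd lattice \<Rightarrow> ennreal) \<Rightarrow>
   (ennreal \<Rightarrow> 'd lattice \<Rightarrow> real) \<Rightarrow> real \<Rightarrow> ennreal" where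
  "beta_thr J \<beta>c G H \<delta> = Sup {\<beta>. \<beta> < \<beta>c \<and> E_err J \<beta>c G H \<beta> < ennreal \<delta>}"

definition exp_factor :: "real \<Rightarrow> real \<Rightarrow> ennreal \<Rightarrow> real" where
  "exp_factor c r \<xi> = (if \<xi> = \<infinity> then 1 else exp (- c * (r / enn2real \<xi>)))"

end

theory Submission
  imports Defs
begin

text \<open>Write \<open>X\<close> for the mass and \<open>V\<close> for the second moment of \<open>F\<^bsub>\<beta>\<^esub>\<close>. As long as the error is below \<open>\<delta>\<close>, the
  differential inequalities force \<open>1 / X\<close> to decrease at a rate between \<open>1 - \<delta>\<close> and \<open>1\<close> and \<open>V / X\<close> to
  be comparable to \<open>\<sigma>\<^sup>2 X\<close> up to factors \<open>X\<^bsup>O(\<delta>)\<^esup>\<close>. Assumption 1 (i) iterates to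
  \<open>F\<^bsub>\<beta>\<^esub> \<le> \<Sum>j. (\<beta> - \<beta>')\<^sup>j F\<^bsub>\<beta>'\<^esub>\<^sup>*\<^sup>j\<^sup>+\<^sup>1\<close>, a random walk with step law \<open>F\<^bsub>\<beta>'\<^esub> / X\<close> and a geometric number
  of steps. Hence second moments control exponential moments at the scale \<open>\<xi>\<close>, the step law is
  sub-Gaussian, and a Fourier estimate makes its \<open>d\<close>-fold convolution bounded by \<open>\<xi>\<^sup>-\<^sup>d\<close>, at the price of a
  constant factor each time the mass grows by a large factor \<open>M\<close>, that is, of a small power of \<open>X\<close>.
  Fewer than \<open>d\<close> convolutions need not be that regular, so \<open>F\<^bsub>\<beta>\<^esub>\<close> is Taylor expanded to order \<open>d\<close>
  in \<open>\<beta>\<close> along a sequence of dyadic masses; the terms sum to the stated bound because \<open>d > 2\<close>.\<close>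

section \<open>Sums and convolutions with values in the extended nonnegative reals\<close>

text \<open>The order of choices keeps the total loss below a power \<epsilon>. Smoothing across a
  mass ratio \<Lambda> yields \<Lambda>^(-d) from d normalisations and \<Lambda>^(d/2) from summing
  over the number of steps; the net \<Lambda>^(-d/2) matches the d-th power of the ratio of the two
  values of \<xi>, so the loss \<open>D1\<close> depends on d and c0 alone. Next M is chosen with
  \<open>D1\<close> at most a small power of M, and only then \<delta> with \<delta> M small, so
  that within one step mass and \<xi>^2 grow alike up to a factor 2. The order d of the power has
  this reason: in the power of order j, walks of n steps carry the weight n^(j-1) n^(-d/2). For
  small j short walks dominate, and their law need not spread beyond the scale of J; for j = d the
  weight n^(d/2-1) increases and long walks dominate. In the Taylor expansion each order gains
  2^(-l) at mass 2^l. The d-fold power has sup norm of order 2^(l d/2) in units of \<sigma>^(-d), up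
  to small powers, and d - 1 orders reduce this to 2^(l (1 - d/2)).\<close>

lemma infinite_lattice: "infinite (UNIV :: ('d::finite) lattice set)"
proof
  assume "finite (UNIV :: ('d::finite) lattice set)"
  then have "finite (range (\<lambda>n::int. (\<chi> i. n) :: 'd lattice))" by (rule finite_subset[rotated]) auto
  moreover have "inj (\<lambda>n::int. (\<chi> i. n) :: 'd lattice)" by (auto simp: inj_def vec_eq_iff)
  ultimately show False using finite_imageD infinite_UNIV_int by blast
qed

text \<open>Both sides are suprema of finite sums: \<open>infsum\<close> over all finite subsets,
  the integral along an enumeration of the lattice. In integral form, Tonelli and monotone
  convergence apply to every \<open>ennreal\<close> function without summability conditions.\<close>

lemma l1_eq_nn_integral:
  fixes f :: "('d::finite) lattice \<Rightarrow> ennreal"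
  shows "l1 f = (\<integral>\<^sup>+x. f x \<partial>count_space UNIV)"
proof (rule antisym)
  have eq: "l1 f = (SUP F\<in>{F. finite F \<and> F \<subseteq> UNIV}. sum f F)"
    unfolding l1_def by (rule nonneg_infsum_complete) simp
  show "l1 f \<le> (\<integral>\<^sup>+x. f x \<partial>count_space UNIV)"
    unfolding eq
  proof (rule SUP_least, clarify)
    fix F :: "'d lattice set" assume "finite F"
    then have "sum f F = (\<integral>\<^sup>+x. f x * indicator F x \<partial>count_space UNIV)"
      by (simp add: nn_integral_count_space_finite flip: nn_integral_count_space_indicator)
    also have "\<dots> \<le> (\<integral>\<^sup>+x. f x \<partial>count_space UNIV)"
      by (intro nn_integral_mono) (auto split: split_indicator)
    finally show "sum f F \<le> (\<integral>\<^sup>+x. f x \<partial>count_space UNIV)" .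
  qed
  define e :: "nat \<Rightarrow> 'd lattice" where "e = from_nat_into UNIV"
  have e: "bij_betw e UNIV UNIV"
    unfolding e_def by (rule bij_betw_from_nat_into) (auto simp: infinite_lattice)
  have "(\<integral>\<^sup>+x. f x \<partial>count_space UNIV) = (\<Sum>n. f (e n))"
    by (simp add: nn_integral_bij_count_space[symmetric, OF e] nn_integral_count_space_nat)
  also have "\<dots> = (SUP n. \<Sum>i<n. f (e i))"
    by (rule suminf_eq_SUP)
  also have "\<dots> \<le> l1 f"
    unfolding eq
  proof (rule SUP_mono)
    fix n
    have "inj_on e {..<n}" using e by (auto simp: bij_betw_def intro: inj_on_subset)
    then have "(\<Sum>i<n. f (e i)) = sum f (e ` {..<n})"
      by (simp add: sum.reindex)
    then show "\<exists>F\<in>{F. finite F \<and> F \<subseteq> UNIV}. (\<Sum>i<n. f (e i)) \<le> sum f F"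
      by (intro bexI[of _ "e ` {..<n}"]) auto
  qed
  finally show "(\<integral>\<^sup>+x. f x \<partial>count_space UNIV) \<le> l1 f" .
qed

lemma l1_mono: "(\<And>x. f x \<le> g x) \<Longrightarrow> l1 f \<le> l1 g"
  by (simp add: l1_eq_nn_integral nn_integral_mono)

lemma l1_add: "l1 (\<lambda>x. f x + g x) = l1 f + l1 g"
  by (simp add: l1_eq_nn_integral nn_integral_add)

lemma l1_cmult: "l1 (\<lambda>x. c * f x) = c * l1 f"
  by (simp add: l1_eq_nn_integral nn_integral_cmult)

lemma l1_multc: "l1 (\<lambda>x. f x * c) = l1 f * c"
  by (simp add: l1_eq_nn_integral nn_integral_multc)

lemma l1_sum: "l1 (\<lambda>x. \<Sum>i\<in>A. f i x) = (\<Sum>i\<in>A. l1 (f i))"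
  by (simp add: l1_eq_nn_integral nn_integral_sum)

lemma l1_suminf: "l1 (\<lambda>x. \<Sum>i. f i x) = (\<Sum>i. l1 (f i))"
  by (simp add: l1_eq_nn_integral nn_integral_suminf)

lemma l1_swap: "l1 (\<lambda>x. l1 (\<lambda>y. f x y)) = l1 (\<lambda>y. l1 (\<lambda>x. f x y))"
  unfolding l1_eq_nn_integral
  by (rule nn_integral_count_space_nn_integral) auto

lemma l1_bij: "bij h \<Longrightarrow> l1 (\<lambda>x. f (h x)) = l1 f"
  unfolding l1_eq_nn_integral by (rule nn_integral_bij_count_space)

lemma l1_shift: "l1 (\<lambda>x. f (x - a)) = l1 f"
  by (rule l1_bij) (rule bij_betw_byWitness[of _ "\<lambda>x. x + a"], auto)

lemma l1_uminus: "l1 (\<lambda>x. f (- x)) = l1 f"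
  by (rule l1_bij) (rule bij_uminus)

lemma l1_reflect: "l1 (\<lambda>x. f (a - x)) = l1 f"
  by (rule l1_bij) (rule bij_betw_byWitness[of _ "\<lambda>x. a - x"], auto)

lemma l1_single: "l1 (\<lambda>x. if x = a then f x else 0) = f a"
proof -
  have "l1 (\<lambda>x. if x = a then f x else 0) = (\<integral>\<^sup>+x. f a * indicator {a} x \<partial>count_space UNIV)"
    unfolding l1_eq_nn_integral by (intro nn_integral_cong) auto
  then show ?thesis by simp
qed

lemma l1_ge: "f x \<le> l1 f"
proof -
  have "l1 (\<lambda>y. if y = x then f y else 0) \<le> l1 f" by (rule l1_mono) auto
  then show ?thesis by (simp only: l1_single)
qed

lemma l1_ge_sum: "finite A \<Longrightarrow> (\<Sum>x\<in>A. f x) \<le> l1 f"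
  unfolding l1_def infsum_finite[symmetric]
  by (rule infsum_mono_neutral) (auto intro!: nonneg_summable_on_complete)

lemma l1_zero [simp]: "l1 (\<lambda>x. 0) = 0"
  by (simp add: l1_eq_nn_integral)

lemma conv_eq: "conv f g x = l1 (\<lambda>y. f y * g (x - y))"
  by (simp add: conv_def l1_def)

lemma conv_commute:
  fixes f g :: "('d::finite) lattice \<Rightarrow> ennreal"
  shows "conv f g = conv g f"
proof
  fix x
  have "conv f g x = l1 (\<lambda>y. (\<lambda>z. f z * g (x - z)) (x - y))"
    unfolding conv_eq by (rule l1_reflect[symmetric])
  then show "conv f g x = conv g f x"
    by (simp add: conv_eq mult.commute)
qed

lemma conv_assoc:
  fixes f g h :: "('d::finite) lattice \<Rightarrow> ennreal"
  shows "conv (conv f g) h = conv f (conv g h)"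
proof
  fix x
  have "conv (conv f g) h x = l1 (\<lambda>y. l1 (\<lambda>z. f z * g (y - z) * h (x - y)))"
    by (simp add: conv_eq l1_multc)
  also have "\<dots> = l1 (\<lambda>z. l1 (\<lambda>y. f z * g (y - z) * h (x - y)))"
    by (rule l1_swap)
  also have "\<dots> = l1 (\<lambda>z. f z * l1 (\<lambda>y. g (y - z) * h (x - y)))"
    by (simp add: mult.assoc l1_cmult)
  also have "\<dots> = conv f (conv g h) x"
  proof -
    have "l1 (\<lambda>y. g (y - z) * h (x - y)) = conv g h (x - z)" for z
      using l1_shift[of "\<lambda>w. g w * h ((x - z) - w)" z] by (simp add: conv_eq)
    then show ?thesis by (simp add: conv_eq)
  qed
  finally show "conv (conv f g) h x = conv f (conv g h) x" .
qed

lemma conv_mono: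
  fixes f g :: "('d::finite) lattice \<Rightarrow> ennreal"
  shows "(\<And>x. f x \<le> f' x) \<Longrightarrow> (\<And>x. g x \<le> g' x) \<Longrightarrow> conv f g x \<le> conv f' g' x"
  by (simp add: conv_eq l1_mono mult_mono)

lemma conv_add_right:
  fixes f g :: "('d::finite) lattice \<Rightarrow> ennreal"
  shows "conv f (\<lambda>x. g x + h x) x = conv f g x + conv f h x"
  by (simp add: conv_eq distrib_left l1_add)

lemma conv_add_left:
  fixes f g :: "('d::finite) lattice \<Rightarrow> ennreal"
  shows "conv (\<lambda>x. f x + g x) h x = conv f h x + conv g h x"
  by (simp add: conv_eq distrib_right l1_add)

lemma conv_cmult_right:
  fixes f g :: "('d::finite) lattice \<Rightarrow> ennreal"
  shows "conv f (\<lambda>x. c * g x) x = c * conv f g x"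
  by (simp add: conv_eq mult.left_commute l1_cmult)

lemma conv_cmult_left:
  fixes f g :: "('d::finite) lattice \<Rightarrow> ennreal"
  shows "conv (\<lambda>x. c * f x) g x = c * conv f g x"
  by (simp add: conv_eq mult.assoc l1_cmult)

lemma conv_suminf_right:
  fixes f :: "('d::finite) lattice \<Rightarrow> ennreal"
  shows "conv f (\<lambda>x. \<Sum>n. g n x) x = (\<Sum>n. conv f (g n) x)"
  by (simp add: conv_eq l1_suminf flip: ennreal_suminf_cmult)

lemma conv_suminf_left:
  fixes f :: "('d::finite) lattice \<Rightarrow> ennreal"
  shows "conv (\<lambda>x. \<Sum>n. g n x) f x = (\<Sum>n. conv (g n) f x)"
  using conv_suminf_right[of f g x] by (simp add: conv_commute)

lemma conv_delta0_left [simp]: "conv delta0 f = f"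
proof
  fix x
  have "conv delta0 f x = l1 (\<lambda>y. if y = 0 then f (x - y) else 0)"
    unfolding conv_eq delta0_def by (intro arg_cong[of _ _ l1] ext) auto
  then show "conv delta0 f x = f x" by (simp add: l1_single)
qed

lemma conv_delta0_right [simp]: "conv f delta0 = f"
  by (metis conv_commute conv_delta0_left)

lemma l1_conv: "l1 (conv f g) = l1 f * l1 g"
proof -
  have "l1 (conv f g) = l1 (\<lambda>y. l1 (\<lambda>x. f y * g (x - y)))"
    unfolding conv_eq by (rule l1_swap)
  also have "\<dots> = l1 f * l1 g"
    by (simp add: l1_cmult l1_shift l1_multc)
  finally show ?thesis .
qed

lemma conv_le_sup:
  fixes f g :: "('d::finite) lattice \<Rightarrow> ennreal"
  assumes "\<And>x. g x \<le> c"
  shows "conv f g x \<le> l1 f * c"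
  unfolding conv_eq l1_multc[symmetric] using assms by (intro l1_mono mult_left_mono) auto

lemma l1_delta0: "l1 delta0 = 1"
  unfolding delta0_def by (simp add: l1_single)

text \<open>Test functions \<open>w\<close> that satisfy the parallelogram identity see no cross term.\<close>

lemma l1_conv_parallelogram:
  fixes f g w :: "('d::finite) lattice \<Rightarrow> ennreal"
  assumes par: "\<And>y z. w (y + z) + w (y - z) = 2 * w y + 2 * w z"
    and even: "\<And>z. g (- z) = g z"
  shows "l1 (\<lambda>x. w x * conv f g x) = l1 (\<lambda>x. w x * f x) * l1 g + l1 f * l1 (\<lambda>x. w x * g x)"
proof -
  let ?A = "l1 (\<lambda>x. w x * conv f g x)"
  have "?A = l1 (\<lambda>x. l1 (\<lambda>y. w x * (f y * g (x - y))))"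
    by (simp add: conv_eq l1_cmult)
  also have "\<dots> = l1 (\<lambda>y. l1 (\<lambda>x. w x * (f y * g (x - y))))"
    by (rule l1_swap)
  also have "\<dots> = l1 (\<lambda>y. l1 (\<lambda>z. w (y + z) * (f y * g z)))"
  proof -
    have "l1 (\<lambda>x. w x * (f y * g (x - y))) = l1 (\<lambda>z. w (y + z) * (f y * g z))" for y
      using l1_shift[of "\<lambda>z. w (y + z) * (f y * g z)" y] by simp
    then show ?thesis by simp
  qed
  finally have 1: "?A = l1 (\<lambda>y. l1 (\<lambda>z. w (y + z) * (f y * g z)))" .
  also have "\<dots> = l1 (\<lambda>y. l1 (\<lambda>z. w (y - z) * (f y * g z)))"
  proof -
    have "l1 (\<lambda>z. w (y + z) * (f y * g z)) = l1 (\<lambda>z. w (y - z) * (f y * g z))" for y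
      using l1_uminus[of "\<lambda>z. w (y + z) * (f y * g z)"] by (simp add: even)
    then show ?thesis by simp
  qed
  finally have 2: "?A = l1 (\<lambda>y. l1 (\<lambda>z. w (y - z) * (f y * g z)))" .
  have "2 * ?A = ?A + ?A" by (rule mult_2)
  also have "?A + ?A = l1 (\<lambda>y. l1 (\<lambda>z. w (y + z) * (f y * g z))) + l1 (\<lambda>y. l1 (\<lambda>z. w (y - z) * (f y * g z)))"
    by (rule arg_cong2[of _ _ _ _ "(+)"]) (rule 1, rule 2)
  also have "\<dots> = l1 (\<lambda>y. l1 (\<lambda>z. (w (y + z) + w (y - z)) * (f y * g z)))"
    by (simp add: l1_add distrib_right)
  also have "\<dots> = l1 (\<lambda>y. l1 (\<lambda>z. 2 * (w y * f y) * g z + 2 * f y * (w z * g z)))"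
    unfolding par by (simp add: algebra_simps)
  also have "\<dots> = l1 (\<lambda>y. 2 * (w y * f y) * l1 g + 2 * f y * l1 (\<lambda>z. w z * g z))"
    by (simp only: l1_add l1_cmult)
  also have "\<dots> = 2 * (l1 (\<lambda>x. w x * f x) * l1 g + l1 f * l1 (\<lambda>x. w x * g x))"
    by (simp only: l1_add l1_cmult l1_multc) (simp add: algebra_simps)
  finally have "2 * ?A = 2 * (l1 (\<lambda>x. w x * f x) * l1 g + l1 f * l1 (\<lambda>x. w x * g x))" .
  then show ?thesis
    by (subst (asm) ennreal_mult_cancel_left) auto
qed

subsection \<open>Convolution powers and exponential tilts\<close>

primrec cpow :: "(('d::finite) lattice \<Rightarrow> ennreal) \<Rightarrow> nat \<Rightarrow> 'd lattice \<Rightarrow> ennreal" where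
  "cpow f 0 = delta0"
| "cpow f (Suc n) = conv f (cpow f n)"

lemma cpow_add: "cpow f (m + n) = conv (cpow f m) (cpow f n)"
  by (induction m) (simp_all add: conv_assoc)

lemma l1_cpow: "l1 (cpow f n) = l1 f ^ n"
  by (induction n) (simp_all add: l1_delta0 l1_conv)

lemma cpow_mono: "(\<And>x. f x \<le> g x) \<Longrightarrow> cpow f n x \<le> cpow g n x"
proof (induction n arbitrary: x)
  case (Suc n) then show ?case by (simp add: conv_mono)
qed simp

lemma cpow_cmult: "cpow (\<lambda>x. c * f x) n x = c ^ n * cpow f n x"
proof (induction n arbitrary: x)
  case (Suc n)
  then have "cpow (\<lambda>x. c * f x) n = (\<lambda>x. c ^ n * cpow f n x)" by (intro ext)
  then show ?case by (simp add: conv_cmult_left conv_cmult_right mult.assoc)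
qed simp

text \<open>An exponential change of measure. The weight is multiplicative along convolutions, so
  exponential moments of \<open>cpow\<close> are plain powers and pointwise decay reduces to bounds
  on tilted laws. One coordinate suffices, as \<open>supnorm\<close> is attained at one.\<close>

definition tilt :: "'d \<Rightarrow> real \<Rightarrow> (('d::finite) lattice \<Rightarrow> ennreal) \<Rightarrow> 'd lattice \<Rightarrow> ennreal" where
  "tilt i \<mu> f x = ennreal (exp (\<mu> * real_of_int (x $ i))) * f x"

lemma tilt_conv: "tilt i \<mu> (conv f g) x = conv (tilt i \<mu> f) (tilt i \<mu> g) x"
proof -
  have "ennreal (exp (\<mu> * real_of_int (x $ i))) * (f y * g (x - y)) =
      (ennreal (exp (\<mu> * real_of_int (y $ i))) * f y) *
      (ennreal (exp (\<mu> * real_of_int ((x - y) $ i))) * g (x - y))" for y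
  proof -
    have "exp (\<mu> * real_of_int (x $ i)) = exp (\<mu> * real_of_int (y $ i)) * exp (\<mu> * real_of_int ((x - y) $ i))"
      by (simp add: algebra_simps flip: exp_add)
    then have "ennreal (exp (\<mu> * real_of_int (x $ i))) =
       ennreal (exp (\<mu> * real_of_int (y $ i))) * ennreal (exp (\<mu> * real_of_int ((x - y) $ i)))"
      by (simp add: ennreal_mult)
    then show ?thesis by (simp add: mult_ac)
  qed
  then show ?thesis
    by (simp add: tilt_def conv_eq flip: l1_cmult)
qed

lemma tilt_delta0 [simp]: "tilt i \<mu> delta0 = delta0"
  by (auto simp: tilt_def delta0_def)

lemma tilt_cpow: "tilt i \<mu> (cpow f n) = cpow (tilt i \<mu> f) n"
proof (induction n)
  case (Suc n)
  have "tilt i \<mu> (conv f (cpow f n)) = conv (tilt i \<mu> f) (tilt i \<mu> (cpow f n))"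
    by (rule ext) (rule tilt_conv)
  with Suc show ?case by simp
qed simp

lemma tilt_mono: "f x \<le> g x \<Longrightarrow> tilt i \<mu> f x \<le> tilt i \<mu> g x"
  by (simp add: tilt_def mult_left_mono)

lemma l1_tilt_cpow: "l1 (tilt i \<mu> (cpow f n)) = l1 (tilt i \<mu> f) ^ n"
  by (simp add: tilt_cpow l1_cpow)

text \<open>Iterating \<open>F \<le> F' + h F' * F\<close> gives a geometric series, since the remainder
  \<open>h\<^sup>n F'\<^sup>n * F\<close> has total mass tending to \<open>0\<close>.\<close>

lemma renewal_le_geometric:
  fixes F F' :: "('d::finite) lattice \<Rightarrow> ennreal"
  assumes le: "\<And>x. F x \<le> F' x + h * conv F' F x"
    and small: "h * l1 F' < 1" and fin: "l1 F < \<infinity>"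
  shows "F x \<le> (\<Sum>j. h ^ j * cpow F' (Suc j) x)"
proof -
  have it: "F x \<le> (\<Sum>j<n. h ^ j * cpow F' (Suc j) x) + h ^ n * conv (cpow F' n) F x" for n x
  proof (induction n)
    case 0 then show ?case by simp
  next
    case (Suc n)
    have "conv (cpow F' n) F x \<le> conv (cpow F' n) (\<lambda>x. F' x + h * conv F' F x) x"
      by (rule conv_mono) (auto intro: le)
    also have "\<dots> = cpow F' (Suc n) x + h * conv (cpow F' (Suc n)) F x"
    proof -
      have "conv (cpow F' n) F' = cpow F' (Suc n)" by (simp add: conv_commute)
      moreover have "conv (cpow F' n) (conv F' F) = conv (cpow F' (Suc n)) F"
        using conv_assoc[of "cpow F' n" F' F] \<open>conv (cpow F' n) F' = cpow F' (Suc n)\<close> by simp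
      ultimately show ?thesis by (simp only: conv_add_right conv_cmult_right)
    qed
    finally have "h ^ n * conv (cpow F' n) F x \<le>
        h ^ n * (cpow F' (Suc n) x + h * conv (cpow F' (Suc n)) F x)"
      by (rule mult_left_mono) simp
    with Suc have "F x \<le> (\<Sum>j<n. h ^ j * cpow F' (Suc j) x) +
        h ^ n * (cpow F' (Suc n) x + h * conv (cpow F' (Suc n)) F x)"
      by (meson add_left_mono order_trans)
    then show ?case by (simp add: algebra_simps)
  qed
  define a where "a = h * l1 F'"
  have rem: "h ^ n * conv (cpow F' n) F x \<le> a ^ n * l1 F" for n
  proof -
    have "conv (cpow F' n) F x \<le> l1 F' ^ n * l1 F"
      using conv_le_sup[of F "l1 F" "cpow F' n" x] by (simp add: l1_ge l1_cpow)
    then have "h ^ n * conv (cpow F' n) F x \<le> h ^ n * (l1 F' ^ n * l1 F)"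
      by (rule mult_left_mono) simp
    then show ?thesis by (simp add: a_def power_mult_distrib mult.assoc)
  qed
  obtain r where r: "a = ennreal r" "0 \<le> r" "r < 1"
    using small unfolding a_def[symmetric] by (cases a) (auto simp: ennreal_less_one_iff)
  have "(\<lambda>n. ennreal (r ^ n * enn2real (l1 F))) \<longlonglongrightarrow> ennreal (0 * enn2real (l1 F))"
    by (intro tendsto_ennrealI tendsto_mult_right LIMSEQ_realpow_zero r)
  moreover have "ennreal (r ^ n * enn2real (l1 F)) = a ^ n * l1 F" for n
    using r fin by (simp add: ennreal_mult ennreal_power)
  ultimately have lim0: "(\<lambda>n. a ^ n * l1 F) \<longlonglongrightarrow> 0" by simp
  have "F x \<le> (\<Sum>j. h ^ j * cpow F' (Suc j) x) + a ^ n * l1 F" for n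
  proof -
    have "(\<Sum>j<n. h ^ j * cpow F' (Suc j) x) \<le> (\<Sum>j. h ^ j * cpow F' (Suc j) x)"
      by (rule sum_le_suminf) auto
    then show ?thesis using it[of x n] rem[of n] by (meson add_mono order_trans)
  qed
  moreover have "(\<lambda>n. (\<Sum>j. h ^ j * cpow F' (Suc j) x) + a ^ n * l1 F) \<longlonglongrightarrow>
      (\<Sum>j. h ^ j * cpow F' (Suc j) x) + 0"
    by (intro tendsto_add tendsto_const lim0)
  ultimately show ?thesis
    by (intro LIMSEQ_le_const[where X = "\<lambda>n. (\<Sum>j. h ^ j * cpow F' (Suc j) x) + a ^ n * l1 F"]) auto
qed

text \<open>The integrated form of the rule that F' \<le> F * F implies (F^j)' \<le> j F^(j+1) for
  convolution powers. By monotonicity the remainder may be evaluated at the larger function. This is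
  the Taylor step of \<open>taylor\<close>.\<close>

lemma cpow_diff_le:
  fixes F F' :: "('d::finite) lattice \<Rightarrow> ennreal"
  assumes le: "\<And>x. F x \<le> F' x + h * conv F' F x" and mono: "\<And>x. F' x \<le> F x"
  shows "cpow F (Suc j) x \<le> cpow F' (Suc j) x + of_nat (Suc j) * h * cpow F (Suc (Suc j)) x"
proof (induction j arbitrary: x)
  case 0
  have "conv F' F x \<le> conv F F x" by (rule conv_mono) (auto intro: mono)
  with le[of x] show ?case by simp (meson add_left_mono mult_left_mono order_trans zero_le)
next
  case (Suc j)
  let ?P = "cpow F (Suc j)" and ?P' = "cpow F' (Suc j)"
  let ?c = "of_nat (Suc j) * h" and ?R = "cpow F (Suc (Suc (Suc j))) x"
  have comm: "conv (cpow f n) f = cpow f (Suc n)" for f :: "'d lattice \<Rightarrow> ennreal" and n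
    by (simp add: conv_commute)
  have "cpow F (Suc (Suc j)) x = conv ?P F x"
    by (simp only: comm)
  also have "\<dots> \<le> conv ?P (\<lambda>x. F' x + h * conv F' F x) x"
    by (rule conv_mono) (auto intro: le)
  also have "\<dots> = conv ?P F' x + h * conv ?P (conv F' F) x"
    by (simp only: conv_add_right conv_cmult_right)
  finally have 1: "cpow F (Suc (Suc j)) x \<le> conv ?P F' x + h * conv ?P (conv F' F) x" .
  have "conv ?P (conv F' F) x \<le> conv ?P (conv F F) x"
    by (intro conv_mono) (auto intro: mono)
  also have "conv ?P (conv F F) x = ?R"
    by (simp only: comm conv_assoc[symmetric])
  finally have 2: "h * conv ?P (conv F' F) x \<le> h * ?R"
    by (rule mult_left_mono) simp
  have "conv ?P F' x \<le> conv (\<lambda>x. ?P' x + ?c * cpow F (Suc (Suc j)) x) F' x"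
    by (rule conv_mono) (use Suc in auto)
  also have "\<dots> = cpow F' (Suc (Suc j)) x + ?c * conv (cpow F (Suc (Suc j))) F' x"
    by (simp only: conv_add_left conv_cmult_left comm)
  finally have 3: "conv ?P F' x \<le> cpow F' (Suc (Suc j)) x + ?c * conv (cpow F (Suc (Suc j))) F' x" .
  have "conv (cpow F (Suc (Suc j))) F' x \<le> conv (cpow F (Suc (Suc j))) F x"
    by (rule conv_mono) (auto intro: mono)
  also have "\<dots> = ?R"
    by (simp only: comm)
  finally have 4: "?c * conv (cpow F (Suc (Suc j))) F' x \<le> ?c * ?R"
    by (rule mult_left_mono) simp
  have "cpow F (Suc (Suc j)) x \<le> conv ?P F' x + h * ?R"
    using 1 2 by (meson add_left_mono order_trans)
  also have "\<dots> \<le> (cpow F' (Suc (Suc j)) x + ?c * conv (cpow F (Suc (Suc j))) F' x) + h * ?R"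
    by (rule add_right_mono[OF 3])
  also have "\<dots> \<le> (cpow F' (Suc (Suc j)) x + ?c * ?R) + h * ?R"
    by (intro add_right_mono add_left_mono 4)
  also have "\<dots> = cpow F' (Suc (Suc j)) x + of_nat (Suc (Suc j)) * h * ?R"
    by (simp add: algebra_simps del: cpow.simps)
  finally show ?case .
qed

section \<open>Exponential decay and summability\<close>

lemma supnorm_ge: "\<bar>real_of_int (x $ i)\<bar> \<le> supnorm x"
  unfolding supnorm_def by (rule Max_ge) auto

lemma supnorm_le_iff: "supnorm x \<le> r \<longleftrightarrow> (\<forall>i. \<bar>real_of_int (x $ i)\<bar> \<le> r)"
  unfolding supnorm_def by (subst Max_le_iff) auto

lemma supnorm_attained: "\<exists>i. supnorm x = \<bar>real_of_int (x $ i)\<bar>"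
proof -
  have "supnorm x \<in> range (\<lambda>i. \<bar>real_of_int (x $ i)\<bar>)"
    unfolding supnorm_def by (rule Max_in) auto
  then show ?thesis by auto
qed

lemma supnorm_nonneg: "0 \<le> supnorm x"
  using supnorm_attained[of x] by auto

lemma supnorm_triangle: "supnorm (x + y) \<le> supnorm x + supnorm y"
  unfolding supnorm_le_iff
proof
  fix i
  show "\<bar>real_of_int ((x + y) $ i)\<bar> \<le> supnorm x + supnorm y"
    using supnorm_ge[of x i] supnorm_ge[of y i] by auto
qed

lemma norm2_sq: "(norm2 x)\<^sup>2 = (\<Sum>i\<in>UNIV. (real_of_int (x $ i))\<^sup>2)"
  by (simp add: norm2_def sum_nonneg)

lemma norm2_sq_le: "(norm2 (x :: ('d::finite) lattice))\<^sup>2 \<le> real CARD('d) * (supnorm x)\<^sup>2"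
proof -
  have "(\<Sum>i\<in>UNIV. (real_of_int (x $ i))\<^sup>2) \<le> (\<Sum>i\<in>(UNIV::'d set). (supnorm x)\<^sup>2)"
    by (intro sum_mono) (metis abs_le_square_iff abs_of_nonneg supnorm_ge supnorm_nonneg)
  then show ?thesis by (simp add: norm2_sq)
qed

lemma finite_supnorm_ball: "finite {x :: ('d::finite) lattice. supnorm x \<le> real m}"
  and card_supnorm_ball: "card {x :: ('d::finite) lattice. supnorm x \<le> real m} \<le> (2 * m + 1) ^ CARD('d)"
proof -
  let ?P = "PiE UNIV (\<lambda>_::'d. {- int m..int m})"
  have sub: "{x :: 'd lattice. supnorm x \<le> real m} \<subseteq> vec_lambda ` ?P"
  proof
    fix x :: "'d lattice" assume "x \<in> {x. supnorm x \<le> real m}"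
    then have "\<bar>x $ i\<bar> \<le> int m" for i
      by (simp add: supnorm_le_iff) (metis of_int_abs of_int_le_iff of_int_of_nat_eq)
    then have "vec_nth x \<in> ?P" by (auto simp: abs_le_iff minus_le_iff)
    then show "x \<in> vec_lambda ` ?P" by (intro image_eqI[of _ _ "vec_nth x"]) auto
  qed
  have fin: "finite ?P" by (intro finite_PiE) auto
  then show "finite {x :: 'd lattice. supnorm x \<le> real m}"
    using finite_subset[OF sub] by blast
  have "card {x :: 'd lattice. supnorm x \<le> real m} \<le> card (vec_lambda ` ?P)"
    by (intro card_mono finite_imageI fin sub)
  also have "\<dots> \<le> card ?P" by (rule card_image_le[OF fin])
  also have "\<dots> = (2 * m + 1) ^ CARD('d)"
    by (simp add: card_PiE nat_add_distrib nat_mult_distrib)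
  finally show "card {x :: 'd lattice. supnorm x \<le> real m} \<le> (2 * m + 1) ^ CARD('d)" .
qed

lemma summable_poly_exp:
  fixes a :: real assumes "a > 0"
  shows "summable (\<lambda>m. real ((2 * m + 1) ^ k) * exp (- a * real m))"
proof (rule summable_comparison_test_ev)
  have "((\<lambda>m. real ((2 * m + 1) ^ k) * exp (- (a / 2) * real m)) \<longlongrightarrow> 0) sequentially"
    using assms by real_asymp
  then have "eventually (\<lambda>m. real ((2 * m + 1) ^ k) * exp (- (a / 2) * real m) < 1) sequentially"
    by (rule order_tendstoD) simp
  then show "eventually (\<lambda>m. norm (real ((2 * m + 1) ^ k) * exp (- a * real m)) \<le> exp (- (a / 2)) ^ m) sequentially"
  proof eventually_elim
    case (elim m)
    have "exp (- a * real m) = exp (- (a / 2) * real m) * exp (- (a / 2) * real m)"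
      by (simp flip: exp_add)
    moreover have "exp (- (a / 2) * real m) = exp (- (a / 2)) ^ m"
      by (simp add: exp_of_nat_mult[symmetric] mult.commute)
    ultimately show ?case using elim
      by (simp add: abs_mult mult.assoc[symmetric] mult_le_one)
  qed
  show "summable (\<lambda>m. exp (- (a / 2)) ^ m)"
    using assms by (intro summable_geometric) auto
qed

lemma l1_exp_finite:
  fixes a :: real assumes "a > 0"
  shows "l1 (\<lambda>x::('d::finite) lattice. ennreal (exp (- a * supnorm x))) < \<infinity>"
proof -
  let ?B = "\<lambda>m. {x::'d lattice. supnorm x \<le> real m}"
  \<comment> \<open>Each point is charged to the ball whose radius is its norm rounded up. Rounding
    costs the factor exp a, and the balls have polynomially many points.\<close>
  define N where "N x = nat \<lceil>supnorm x\<rceil>" for x :: "'d lattice"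
  have N: "supnorm x \<le> real (N x)" "real (N x) \<le> supnorm x + 1" for x
    using supnorm_nonneg[of x] unfolding N_def by linarith+
  let ?e = "\<lambda>m. ennreal (exp a * exp (- a * real m))"
  have "ennreal (exp (- a * supnorm x)) \<le> (\<Sum>m. ?e m * indicator (?B m) x)" for x
  proof -
    have "exp (- a * supnorm x) \<le> exp a * exp (- a * real (N x))"
      using mult_left_mono[OF N(2)[of x], of a] assms by (simp add: algebra_simps flip: exp_add)
    then have "ennreal (exp (- a * supnorm x)) \<le> ?e (N x) * indicator (?B (N x)) x"
      using N(1)[of x] by (simp add: ennreal_leI)
    also have "\<dots> = (\<Sum>m\<in>{N x}. ?e m * indicator (?B m) x)"
      by (simp only: sum.insert finite.emptyI sum.empty empty_iff not_False_eq_True add_0_right)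
    also have "\<dots> \<le> (\<Sum>m. ?e m * indicator (?B m) x)"
      by (rule sum_le_suminf) auto
    finally show ?thesis .
  qed
  then have "l1 (\<lambda>x::'d lattice. ennreal (exp (- a * supnorm x))) \<le>
      l1 (\<lambda>x::'d lattice. \<Sum>m. ?e m * indicator (?B m) x)"
    by (rule l1_mono)
  also have "\<dots> = (\<Sum>m. ?e m * of_nat (card (?B m)))"
    by (simp add: l1_suminf l1_cmult) (simp add: l1_eq_nn_integral finite_supnorm_ball)
  also have "\<dots> \<le> (\<Sum>m. ennreal (exp a * (real ((2 * m + 1) ^ CARD('d)) * exp (- a * real m))))"
  proof (rule suminf_le)
    fix m
    have "?e m * of_nat (card (?B m)) \<le> ?e m * of_nat ((2 * m + 1) ^ CARD('d))"
      using card_supnorm_ball[of m] by (intro mult_left_mono) (auto simp del: of_nat_power)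
    also have "\<dots> = ennreal (exp a * (real ((2 * m + 1) ^ CARD('d)) * exp (- a * real m)))"
      by (simp add: ennreal_of_nat_eq_real_of_nat ennreal_mult[symmetric] mult_ac del: of_nat_power)
    finally show "?e m * of_nat (card (?B m)) \<le> ennreal (exp a * (real ((2 * m + 1) ^ CARD('d)) * exp (- a * real m)))" .
  qed auto
  also have "\<dots> = ennreal (\<Sum>m. exp a * (real ((2 * m + 1) ^ CARD('d)) * exp (- a * real m)))"
    using summable_mult[OF summable_poly_exp[OF assms, of "CARD('d)"], of "exp a"]
    by (intro suminf_ennreal2) auto
  also have "\<dots> < \<infinity>" by simp
  finally show ?thesis .
qed

section \<open>Concentration of convolution powers\<close>

definition dot :: "('d \<Rightarrow> real) \<Rightarrow> ('d::finite) lattice \<Rightarrow> real" where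
  "dot \<theta> x = (\<Sum>k\<in>UNIV. \<theta> k * real_of_int (x $ k))"

lemma dot_add: "dot \<theta> (x + y) = dot \<theta> x + dot \<theta> y"
  by (simp add: dot_def distrib_left sum.distrib)

lemma dot_uminus: "dot \<theta> (- x) = - dot \<theta> x"
  by (simp add: dot_def sum_negf)

lemma dot_diff: "dot \<theta> (x - y) = dot \<theta> x - dot \<theta> y"
  using dot_add[of \<theta> x "- y"] by (simp add: dot_uminus)

abbreviation lat :: "('d::finite) lattice measure" where
  "lat \<equiv> count_space UNIV"

lemma integrable_enn2real:
  assumes "l1 f < \<infinity>" shows "integrable lat (\<lambda>x. enn2real (f x))"
proof -
  have "f x < \<infinity>" for x using assms l1_ge[of f x] by (simp add: order_le_less_trans)
  then have "ennreal (enn2real (f x)) = f x" for x by simp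
  then show ?thesis using assms
    by (simp add: integrable_iff_bounded l1_eq_nn_integral)
qed

lemma integral_enn2real:
  assumes "l1 f < \<infinity>" shows "(\<integral>x. enn2real (f x) \<partial>lat) = enn2real (l1 f)"
proof -
  have "f x < \<infinity>" for x using assms l1_ge[of f x] by (simp add: order_le_less_trans)
  then have "ennreal (enn2real (f x)) = f x" for x by simp
  then show ?thesis
    by (subst integral_eq_nn_integral) (auto simp: l1_eq_nn_integral)
qed

text \<open>The characteristic function of \<open>f\<close> with unnormalised mass. Since
  \<open>enn2real\<close> sends \<infinity> to 0, this reading is correct when \<open>l1 f\<close>
  is finite.\<close>

definition ft :: "(('d::finite) lattice \<Rightarrow> ennreal) \<Rightarrow> ('d \<Rightarrow> real) \<Rightarrow> complex" where
  "ft f \<theta> = (\<integral>x. enn2real (f x) *\<^sub>R cis (dot \<theta> x) \<partial>lat)"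

lemma integrable_ft:
  assumes "l1 f < \<infinity>" shows "integrable lat (\<lambda>x. enn2real (f x) *\<^sub>R cis (dot \<theta> x))"
  by (rule Bochner_Integration.integrable_bound[OF integrable_enn2real[OF assms]]) auto

lemma ft_conv:
  fixes f g :: "('d::finite) lattice \<Rightarrow> ennreal"
  assumes f: "l1 f < \<infinity>" and g: "l1 g < \<infinity>"
  shows "ft (conv f g) \<theta> = ft f \<theta> * ft g \<theta>"
proof -
  interpret pair_sigma_finite "lat :: 'd lattice measure" "lat :: 'd lattice measure"
    by (intro pair_sigma_finite.intro sigma_finite_measure_count_space)
  have finf: "f x < \<infinity>" and fing: "g x < \<infinity>" for x :: "'d lattice"
    using f g l1_ge[of f x] l1_ge[of g x] by (simp_all add: order_le_less_trans)
  have pm: "lat \<Otimes>\<^sub>M lat = (count_space UNIV :: ('d lattice \<times> 'd lattice) measure)"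
    by (subst pair_measure_countable) auto
  let ?h = "\<lambda>(y::'d lattice) x. (enn2real (f y) * enn2real (g (x - y))) *\<^sub>R cis (dot \<theta> x)"
  have fin: "l1 (\<lambda>y. f y * g (x - y)) < \<infinity>" for x :: "'d lattice"
  proof -
    have "conv f g x \<le> l1 f * l1 g" by (rule conv_le_sup) (rule l1_ge)
    also have "\<dots> < \<infinity>" using f g by (simp add: ennreal_mult_less_top)
    finally show ?thesis by (simp add: conv_eq)
  qed
  have int: "integrable (lat \<Otimes>\<^sub>M lat) (\<lambda>(y, x). ?h y x)"
    unfolding integrable_iff_bounded
  proof
    have "(\<integral>\<^sup>+z. ennreal (norm (case z of (y, x) \<Rightarrow> ?h y x)) \<partial>(lat \<Otimes>\<^sub>M lat)) =
        (\<integral>\<^sup>+z. (\<lambda>(y, x). f y * g (x - y)) z \<partial>count_space UNIV)"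
      unfolding pm using finf fing
      by (intro nn_integral_cong) (auto simp: ennreal_mult abs_mult)
    also have "\<dots> = l1 (\<lambda>y. l1 (\<lambda>x. f y * g (x - y)))"
      unfolding l1_eq_nn_integral by (subst nn_integral_fst_count_space[symmetric]) simp
    also have "\<dots> = l1 f * l1 g" by (simp add: l1_cmult l1_shift l1_multc)
    also have "\<dots> < \<infinity>" using f g by (simp add: ennreal_mult_less_top)
    finally show "(\<integral>\<^sup>+z. ennreal (norm (case z of (y, x) \<Rightarrow> ?h y x)) \<partial>(lat \<Otimes>\<^sub>M lat)) < \<infinity>" .
  qed (simp add: pm)
  have "ft (conv f g) \<theta> = (\<integral>x. (\<integral>y. ?h y x \<partial>lat) \<partial>lat)"
    unfolding ft_def
  proof (intro Bochner_Integration.integral_cong refl)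
    fix x
    have "enn2real (conv f g x) = (\<integral>y. enn2real (f y * g (x - y)) \<partial>lat)"
      unfolding conv_eq using integral_enn2real[OF fin] by simp
    moreover have "integrable lat (\<lambda>y. enn2real (f y * g (x - y)))"
      by (rule integrable_enn2real[OF fin])
    ultimately show "enn2real (conv f g x) *\<^sub>R cis (dot \<theta> x) = (\<integral>y. ?h y x \<partial>lat)"
      by (simp add: enn2real_mult)
  qed
  also have "\<dots> = (\<integral>y. (\<integral>x. ?h y x \<partial>lat) \<partial>lat)"
    by (rule Fubini_integral[OF int])
  also have "\<dots> = (\<integral>y. (enn2real (f y) *\<^sub>R cis (dot \<theta> y)) * ft g \<theta> \<partial>lat)"
  proof (intro Bochner_Integration.integral_cong refl)
    fix y :: "'d lattice"
    have "bij (\<lambda>z. z + y)" by (rule bij_betw_byWitness[of _ "\<lambda>x. x - y"]) auto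
    then have "(\<integral>x. ?h y x \<partial>lat) = (\<integral>z. ?h y (z + y) \<partial>lat)"
      by (rule integral_bij_count_space[symmetric])
    also have "\<dots> = (\<integral>z. (enn2real (f y) *\<^sub>R cis (dot \<theta> y)) * (enn2real (g z) *\<^sub>R cis (dot \<theta> z)) \<partial>lat)"
      by (intro Bochner_Integration.integral_cong refl) (simp add: dot_add cis_mult add.commute)
    also have "\<dots> = (enn2real (f y) *\<^sub>R cis (dot \<theta> y)) * ft g \<theta>"
      unfolding ft_def by (rule integral_mult_right_zero)
    finally show "(\<integral>x. ?h y x \<partial>lat) = (enn2real (f y) *\<^sub>R cis (dot \<theta> y)) * ft g \<theta>" .
  qed
  also have "\<dots> = ft f \<theta> * ft g \<theta>"
    unfolding ft_def[of f] by (rule integral_mult_left_zero)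
  finally show ?thesis .
qed

lemma ft_delta0: "ft (delta0 :: 'a::finite lattice \<Rightarrow> ennreal) \<theta> = 1"
proof -
  have "ft delta0 \<theta> = (\<integral>x. indicator {0::'a lattice} x *\<^sub>R (1::complex) \<partial>lat)"
    unfolding ft_def by (intro Bochner_Integration.integral_cong) (auto simp: delta0_def dot_def)
  also have "\<dots> = 1" by simp
  finally show ?thesis .
qed

lemma ft_cpow:
  assumes "l1 f < \<infinity>" shows "ft (cpow f n) \<theta> = ft f \<theta> ^ n"
proof (induction n)
  case (Suc n)
  have "l1 (cpow f n) < \<infinity>" using assms by (simp add: l1_cpow power_less_top_ennreal)
  with Suc assms show ?case by (simp add: ft_conv)
qed (simp add: ft_delta0)

text \<open>The length scale is \<open>sqrt v\<close>, and \<open>\<kappa>\<close> is dimensionless: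
  tilts of size up to \<open>\<kappa>\<close> in units of \<open>1 / sqrt v\<close> are controlled.
  The constants derived below depend on d and \<open>\<kappa>\<close> only, which makes them uniform
  over all scales of the flow.\<close>

locale subgaussian =
  fixes p :: "('d::finite) lattice \<Rightarrow> ennreal" and v \<kappa> :: real
  assumes mass: "l1 p = 1" and sym: "lattice_symmetric p"
    and v: "0 < v" and \<kappa>: "0 < \<kappa>" "\<kappa> \<le> 1"
    and second: "\<And>k. l1 (\<lambda>x. ennreal ((real_of_int (x $ k))\<^sup>2) * p x) = ennreal v"
    and mgf: "\<And>k \<mu>. \<mu>\<^sup>2 * v \<le> \<kappa>\<^sup>2 \<Longrightarrow> l1 (tilt k \<mu> p) \<le> ennreal (1 + \<mu>\<^sup>2 * v)"
begin

abbreviation r :: "'d lattice \<Rightarrow> real" where "r x \<equiv> enn2real (p x)"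

lemma integrable_r: "integrable lat r"
  using mass by (intro integrable_enn2real) simp

lemma integral_r: "(\<integral>x. r x \<partial>lat) = 1"
  using mass by (subst integral_enn2real) simp_all

lemma integrable_weight:
  assumes "l1 (\<lambda>x. ennreal (w x) * p x) < \<infinity>" "\<And>x. 0 \<le> w x"
  shows "integrable lat (\<lambda>x. w x * r x)"
    and "(\<integral>x. w x * r x \<partial>lat) = enn2real (l1 (\<lambda>x. ennreal (w x) * p x))"
  using integrable_enn2real[OF assms(1)] integral_enn2real[OF assms(1)] assms(2)
  by (simp_all add: enn2real_mult)

lemma flip_sym: "(\<And>k. s k \<in> {-1, 1}) \<Longrightarrow> r (\<chi> k. s k * x $ k) = r x"
  using sym unfolding lattice_symmetric_def by auto

lemma r_uminus: "r (- x) = r x"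
proof -
  have "- x = (\<chi> k. (\<lambda>_. - 1) k * x $ k)" by (simp add: vec_eq_iff)
  then show ?thesis using flip_sym[of "\<lambda>_. - 1" x] by simp
qed

lemma integral_uminus:
  fixes f :: "'d lattice \<Rightarrow> 'b::{banach, second_countable_topology}"
  shows "(\<integral>x. f (- x) \<partial>lat) = (\<integral>x. f x \<partial>lat)"
  by (rule integral_bij_count_space) (rule bij_uminus)

lemma second_int: "integrable lat (\<lambda>x. (real_of_int (x $ k))\<^sup>2 * r x)"
  "(\<integral>x. (real_of_int (x $ k))\<^sup>2 * r x \<partial>lat) = v"
  using integrable_weight[of "\<lambda>x. (real_of_int (x $ k))\<^sup>2"] second[of k] v by simp_all

lemma exp_int:
  assumes "\<mu>\<^sup>2 * v \<le> \<kappa>\<^sup>2"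
  shows "integrable lat (\<lambda>x. exp (\<mu> * real_of_int (x $ k)) * r x)"
    and "(\<integral>x. exp (\<mu> * real_of_int (x $ k)) * r x \<partial>lat) \<le> 1 + \<mu>\<^sup>2 * v"
proof -
  have le: "l1 (\<lambda>x. ennreal (exp (\<mu> * real_of_int (x $ k))) * p x) \<le> ennreal (1 + \<mu>\<^sup>2 * v)"
    using mgf[OF assms, of k] by (simp add: tilt_def[abs_def])
  then have fin: "l1 (\<lambda>x. ennreal (exp (\<mu> * real_of_int (x $ k))) * p x) < \<infinity>"
    by (rule order_le_less_trans) simp
  show "integrable lat (\<lambda>x. exp (\<mu> * real_of_int (x $ k)) * r x)"
    by (rule integrable_weight(1)[OF fin]) simp
  have "0 \<le> 1 + \<mu>\<^sup>2 * v" using v by (simp add: add_nonneg_nonneg)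
  then show "(\<integral>x. exp (\<mu> * real_of_int (x $ k)) * r x \<partial>lat) \<le> 1 + \<mu>\<^sup>2 * v"
    using le by (subst integrable_weight(2)[OF fin]) (auto simp: enn2real_leI)
qed

lemma cosh_int:
  assumes "\<mu>\<^sup>2 * v \<le> \<kappa>\<^sup>2"
  shows "integrable lat (\<lambda>x. cosh (\<mu> * real_of_int (x $ k)) * r x)"
    and "(\<integral>x. cosh (\<mu> * real_of_int (x $ k)) * r x \<partial>lat) \<le> 1 + \<mu>\<^sup>2 * v"
proof -
  have eq: "cosh (\<mu> * real_of_int (x $ k)) * r x =
      (exp (\<mu> * real_of_int (x $ k)) * r x + exp ((- \<mu>) * real_of_int (x $ k)) * r x) / 2" for x
    by (simp add: cosh_def field_simps)
  have neg: "(- \<mu>)\<^sup>2 * v \<le> \<kappa>\<^sup>2" using assms by simp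
  show "integrable lat (\<lambda>x. cosh (\<mu> * real_of_int (x $ k)) * r x)"
    unfolding eq
    by (intro integrable_divide Bochner_Integration.integrable_add exp_int(1)[OF assms] exp_int(1)[OF neg])
  show "(\<integral>x. cosh (\<mu> * real_of_int (x $ k)) * r x \<partial>lat) \<le> 1 + \<mu>\<^sup>2 * v"
    unfolding eq using exp_int(2)[OF assms, of k] exp_int(2)[OF neg, of k]
    by (subst integral_divide_zero, subst Bochner_Integration.integral_add)
       (use exp_int(1)[OF assms] exp_int(1)[OF neg] in auto)
qed

lemma cosh_ge4: "1 + u ^ 4 / 24 \<le> cosh (u::real)"
proof -
  have "(\<lambda>n. if even n then u ^ n /\<^sub>R fact n else 0) sums cosh u"
    by (rule cosh_converges)
  moreover have "(\<Sum>n<5. if even n then u ^ n /\<^sub>R fact n else 0) = 1 + u\<^sup>2 / 2 + u ^ 4 / 24"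
  proof -
    have "{..<5::nat} = {0, 1, 2, 3, 4}" by auto
    then show ?thesis by (simp add: fact_numeral)
  qed
  moreover have "(\<Sum>n<5. if even n then u ^ n /\<^sub>R fact n else 0) \<le>
      (\<Sum>n. if even n then u ^ n /\<^sub>R fact n else 0)"
    by (rule sum_le_suminf) (use calculation in \<open>auto simp: sums_iff zero_le_even_power\<close>)
  ultimately have "1 + u\<^sup>2 / 2 + u ^ 4 / 24 \<le> cosh u"
    by (simp add: sums_iff)
  then show ?thesis by (smt (verit) zero_le_power2 divide_nonneg_nonneg)
qed

text \<open>The largest admissible tilt, with \<mu>^2 v = \<kappa>^2, gives the strongest moment
  bound: u^4 / 24 \<le> cosh u - 1, whose mean at u = \<mu> x_k is at most \<kappa>^2.\<close>

lemma fourth_int: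
  "integrable lat (\<lambda>x. (real_of_int (x $ k)) ^ 4 * r x)"
  "(\<integral>x. (real_of_int (x $ k)) ^ 4 * r x \<partial>lat) \<le> 24 * v\<^sup>2 / \<kappa>\<^sup>2"
proof -
  define \<mu> where "\<mu> = \<kappa> / sqrt v"
  have \<mu>: "\<mu>\<^sup>2 * v = \<kappa>\<^sup>2" "0 < \<mu>" using v \<kappa> by (simp_all add: \<mu>_def power_divide)
  have \<mu>4: "\<mu> ^ 4 = \<kappa> ^ 4 / v\<^sup>2" using v by (simp add: \<mu>_def power_divide eval_nat_numeral)
  have b: "(\<mu> * real_of_int (x $ k)) ^ 4 / 24 * r x \<le> cosh (\<mu> * real_of_int (x $ k)) * r x - r x" for x
    using mult_right_mono[OF cosh_ge4[of "\<mu> * real_of_int (x $ k)"], of "r x"]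
    by (simp add: algebra_simps)
  have ic: "integrable lat (\<lambda>x. cosh (\<mu> * real_of_int (x $ k)) * r x - r x)"
    using \<mu> by (intro Bochner_Integration.integrable_diff cosh_int(1) integrable_r) simp
  have i4: "integrable lat (\<lambda>x. (\<mu> * real_of_int (x $ k)) ^ 4 / 24 * r x)"
    by (rule Bochner_Integration.integrable_bound[OF ic]) (use order_trans[OF b abs_ge_self] in \<open>simp_all add: abs_mult\<close>)
  have eq: "(real_of_int (x $ k)) ^ 4 * r x = (24 / \<mu> ^ 4) * ((\<mu> * real_of_int (x $ k)) ^ 4 / 24 * r x)" for x
    using \<mu> by (simp add: power_mult_distrib)
  show "integrable lat (\<lambda>x. (real_of_int (x $ k)) ^ 4 * r x)"
    unfolding eq using i4 by (rule integrable_mult_right)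
  have "(\<integral>x. (\<mu> * real_of_int (x $ k)) ^ 4 / 24 * r x \<partial>lat) \<le> (\<integral>x. cosh (\<mu> * real_of_int (x $ k)) * r x - r x \<partial>lat)"
    by (rule integral_mono[OF i4 ic b])
  also have "\<dots> \<le> \<kappa>\<^sup>2"
    using cosh_int[of \<mu> k] \<mu> integrable_r
    by (subst Bochner_Integration.integral_diff) (auto simp: integral_r)
  finally have "(24 / \<mu> ^ 4) * (\<integral>x. (\<mu> * real_of_int (x $ k)) ^ 4 / 24 * r x \<partial>lat) \<le> (24 / \<mu> ^ 4) * \<kappa>\<^sup>2"
    using \<mu> by (intro mult_left_mono) auto
  also have "\<dots> = 24 * v\<^sup>2 / \<kappa>\<^sup>2"
    unfolding \<mu>4 using \<kappa> v by (simp add: field_simps eval_nat_numeral)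
  finally show "(\<integral>x. (real_of_int (x $ k)) ^ 4 * r x \<partial>lat) \<le> 24 * v\<^sup>2 / \<kappa>\<^sup>2"
    unfolding eq by (subst integral_mult_right_zero)
qed

text \<open>Cauchy-Schwarz twice. It separates the coordinates, whose individual fourth moments are
  known.\<close>

lemma dot4_le:
  fixes x :: "'d lattice"
  shows "(dot \<theta> x) ^ 4 \<le> real CARD('d) ^ 3 * (\<Sum>k\<in>UNIV. \<theta> k ^ 4 * real_of_int (x $ k) ^ 4)"
proof -
  let ?a = "\<lambda>k. \<theta> k * real_of_int (x $ k)"
  have cs: "(\<Sum>k\<in>UNIV. f k)\<^sup>2 \<le> real CARD('d) * (\<Sum>k\<in>UNIV. (f k)\<^sup>2)" for f :: "'d \<Rightarrow> real"
    using Cauchy_Schwarz_ineq_sum[of "\<lambda>_. 1" f UNIV] by simp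
  have "(dot \<theta> x) ^ 4 = ((\<Sum>k\<in>UNIV. ?a k)\<^sup>2)\<^sup>2" by (simp add: dot_def)
  also have "\<dots> \<le> (real CARD('d) * (\<Sum>k\<in>UNIV. (?a k)\<^sup>2))\<^sup>2"
    using cs[of ?a] by (rule power_mono) simp
  also have "\<dots> = (real CARD('d))\<^sup>2 * (\<Sum>k\<in>UNIV. (?a k)\<^sup>2)\<^sup>2"
    by (rule power_mult_distrib)
  also have "\<dots> \<le> (real CARD('d))\<^sup>2 * (real CARD('d) * (\<Sum>k\<in>UNIV. ((?a k)\<^sup>2)\<^sup>2))"
    by (intro mult_left_mono cs) auto
  also have "\<dots> = real CARD('d) ^ 3 * (\<Sum>k\<in>UNIV. \<theta> k ^ 4 * real_of_int (x $ k) ^ 4)"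
  proof -
    have "((?a k)\<^sup>2)\<^sup>2 = \<theta> k ^ 4 * real_of_int (x $ k) ^ 4" for k
      by (simp add: power_mult_distrib flip: power_mult)
    then show ?thesis by (simp add: power3_eq_cube power2_eq_square)
  qed
  finally show ?thesis .
qed

text \<open>Flipping the sign of coordinate \<open>k\<close> preserves the law and negates the
  integrand.\<close>

lemma cross_int:
  assumes "k \<noteq> l"
  shows "(\<integral>x. real_of_int (x $ k) * real_of_int (x $ l) * r x \<partial>lat) = 0"
proof -
  define s where "s = (\<lambda>m. if m = k then - 1 else (1::int))"
  let ?f = "\<lambda>x::'d lattice. real_of_int (x $ k) * real_of_int (x $ l) * r x"
  define h where "h x = (\<chi> m. s m * x $ m)" for x :: "'d lattice"
  have "h (h x) = x" for x by (auto simp: h_def s_def vec_eq_iff)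
  then have "bij h" by (intro bij_betw_byWitness[of _ h]) auto
  then have "(\<integral>x. ?f x \<partial>lat) = (\<integral>x. ?f (h x) \<partial>lat)"
    by (rule integral_bij_count_space[symmetric])
  also have "\<dots> = (\<integral>x. - ?f x \<partial>lat)"
  proof (intro Bochner_Integration.integral_cong refl)
    fix x
    have "r (h x) = r x" unfolding h_def by (rule flip_sym) (auto simp: s_def)
    then show "?f (h x) = - ?f x" using assms by (simp add: h_def s_def)
  qed
  finally show ?thesis by simp
qed

lemma cross_integrable: "integrable lat (\<lambda>x. real_of_int (x $ k) * real_of_int (x $ l) * r x)"
proof (rule Bochner_Integration.integrable_bound)
  show "integrable lat (\<lambda>x. (real_of_int (x $ k))\<^sup>2 * r x + (real_of_int (x $ l))\<^sup>2 * r x)"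
    by (intro Bochner_Integration.integrable_add second_int)
  have "\<bar>a * b\<bar> \<le> a\<^sup>2 + b\<^sup>2" for a b :: real
  proof -
    have "0 \<le> (\<bar>a\<bar> - \<bar>b\<bar>)\<^sup>2" by simp
    then have "2 * (\<bar>a\<bar> * \<bar>b\<bar>) \<le> a\<^sup>2 + b\<^sup>2" by (simp add: power2_diff)
    moreover have "0 \<le> \<bar>a\<bar> * \<bar>b\<bar>" by simp
    ultimately show ?thesis unfolding abs_mult by linarith
  qed
  then show "AE x in lat. norm (real_of_int (x $ k) * real_of_int (x $ l) * r x) \<le>
      norm ((real_of_int (x $ k))\<^sup>2 * r x + (real_of_int (x $ l))\<^sup>2 * r x)"
    by (auto simp: abs_mult distrib_right[symmetric] intro!: mult_right_mono)
qed simp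

lemma dot2_int:
  "integrable lat (\<lambda>x. (dot \<theta> x)\<^sup>2 * r x)"
  "(\<integral>x. (dot \<theta> x)\<^sup>2 * r x \<partial>lat) = (\<Sum>k\<in>UNIV. (\<theta> k)\<^sup>2) * v"
proof -
  have eq: "(dot \<theta> x)\<^sup>2 * r x =
      (\<Sum>k\<in>UNIV. \<Sum>l\<in>UNIV. (\<theta> k * \<theta> l) * (real_of_int (x $ k) * real_of_int (x $ l) * r x))" for x
    unfolding dot_def power2_eq_square sum_product by (simp add: sum_distrib_left sum_distrib_right mult_ac)
  show "integrable lat (\<lambda>x. (dot \<theta> x)\<^sup>2 * r x)"
    unfolding eq by (intro Bochner_Integration.integrable_sum integrable_mult_right cross_integrable)
  have c: "(\<integral>x. real_of_int (x $ k) * real_of_int (x $ l) * r x \<partial>lat) = (if k = l then v else 0)" for k l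
    using cross_int[of k l] second_int(2)[of k] by (auto simp: power2_eq_square)
  have "(\<integral>x. (dot \<theta> x)\<^sup>2 * r x \<partial>lat) = (\<Sum>k\<in>UNIV. \<Sum>l\<in>UNIV. (\<theta> k * \<theta> l) * (if k = l then v else 0))"
    unfolding eq by (simp only: Bochner_Integration.integral_sum integrable_mult_right cross_integrable
      Bochner_Integration.integrable_sum integral_mult_right_zero c)
  also have "\<dots> = (\<Sum>k\<in>UNIV. (\<theta> k)\<^sup>2 * v)"
    by (intro sum.cong refl) (simp add: power2_eq_square if_distrib cong: if_cong)
  finally show "(\<integral>x. (dot \<theta> x)\<^sup>2 * r x \<partial>lat) = (\<Sum>k\<in>UNIV. (\<theta> k)\<^sup>2) * v"
    by (simp add: sum_distrib_right)
qed

text \<open>\<open>t\<^sup>2 v\<close> is small enough for the fourth moments to be dominated by the second ones in the Taylor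
  expansion of the characteristic function on the box of radius \<open>t\<close>.\<close>

definition t :: real where "t = \<kappa> / (2 * real CARD('d) ^ 2 * sqrt v)"

end

lemma cos_le_quartic: "cos w \<le> 1 - w\<^sup>2 / 2 + w ^ 4 / 24" for w :: real
proof -
  obtain u where u: "cos w = (\<Sum>m<4. cos_coeff m * w ^ m) + cos (u + 1 / 2 * real 4 * pi) / fact 4 * w ^ 4"
    using Maclaurin_cos_expansion[of w 4] by auto
  have "{..<4::nat} = {0, 1, 2, 3}" by auto
  then have "(\<Sum>m<4. cos_coeff m * w ^ m) = 1 - w\<^sup>2 / 2"
    by (simp add: cos_coeff_def fact_numeral)
  moreover have "cos (u + 1 / 2 * real 4 * pi) / fact 4 * w ^ 4 \<le> 1 / 24 * w ^ 4"
    by (intro mult_right_mono) (auto simp: fact_numeral)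
  ultimately show ?thesis using u by simp
qed

lemma cos_ge_quadratic: "1 - w\<^sup>2 / 2 \<le> cos w" for w :: real
proof -
  have "1 - cos w = 2 * (sin (w / 2))\<^sup>2"
    using cos_double_sin[of "w / 2"] by simp
  also have "(sin (w / 2))\<^sup>2 \<le> (w / 2)\<^sup>2"
    using abs_sin_x_le_abs_x[of "w / 2"] by (rule abs_le_square_iff[THEN iffD1])
  finally show ?thesis by (simp add: power_divide)
qed

context subgaussian
begin

lemma t_pos: "0 < t"
  using v \<kappa> by (simp add: t_def)

lemma t_sq: "t\<^sup>2 * v = \<kappa>\<^sup>2 / (4 * real CARD('d) ^ 4)"
  using v by (simp add: t_def power_divide power_mult_distrib flip: power_mult)

lemma integrable_bounded_r:
  assumes "\<And>x. \<bar>f x\<bar> \<le> 1" shows "integrable lat (\<lambda>x. f x * r x)"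
  by (rule Bochner_Integration.integrable_bound[OF integrable_r])
     (use assms in \<open>auto simp: abs_mult intro!: mult_left_le_one_le\<close>)

text \<open>The upper bound comes from the quartic Taylor polynomial of cos, the bound on the
  negative from the quadratic one. Off-diagonal second moments vanish, so the quadratic term is
  exactly \<Theta> v / 2.\<close>

lemma cos_dot_int:
  assumes \<theta>: "\<And>k. \<bar>\<theta> k\<bar> \<le> t"
  defines "\<Theta> \<equiv> \<Sum>k\<in>UNIV. (\<theta> k)\<^sup>2"
  shows "\<bar>\<integral>x. cos (dot \<theta> x) * r x \<partial>lat\<bar> \<le> 1 - \<Theta> * v / 4"
proof (rule abs_leI)
  let ?d = "real CARD('d)"
  have d1: "1 \<le> ?d" by (simp add: Suc_leI)
  have d34: "?d ^ 3 \<le> ?d ^ 4" using d1 by (intro power_increasing) auto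
  have \<Theta>0: "0 \<le> \<Theta>" unfolding \<Theta>_def by (intro sum_nonneg) auto
  have i0: "integrable lat (\<lambda>x. cos (dot \<theta> x) * r x)"
    by (rule integrable_bounded_r) auto
  have i4: "integrable lat (\<lambda>x. (?d ^ 3 * (\<Sum>k\<in>UNIV. \<theta> k ^ 4 * real_of_int (x $ k) ^ 4)) * r x)"
    unfolding sum_distrib_right mult.assoc
    by (intro integrable_mult_right Bochner_Integration.integrable_sum fourth_int(1))
  \<comment> \<open>The constant in \<open>t\<close> is spent here: t^2 v = \<kappa>^2 / (4 d^4)
    turns 24 d^3 into at most 6. Divided by 24 this is \<Theta> v / 4, half of the quadratic
    term.\<close>
  have b4: "(\<integral>x. (?d ^ 3 * (\<Sum>k\<in>UNIV. \<theta> k ^ 4 * real_of_int (x $ k) ^ 4)) * r x \<partial>lat) \<le> 6 * \<Theta> * v"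
  proof -
    have "(\<integral>x. (?d ^ 3 * (\<Sum>k\<in>UNIV. \<theta> k ^ 4 * real_of_int (x $ k) ^ 4)) * r x \<partial>lat) =
        ?d ^ 3 * (\<Sum>k\<in>UNIV. \<theta> k ^ 4 * (\<integral>x. real_of_int (x $ k) ^ 4 * r x \<partial>lat))"
      unfolding sum_distrib_right mult.assoc
      by (simp add: Bochner_Integration.integral_sum fourth_int(1))
    also have "\<dots> \<le> ?d ^ 3 * (\<Sum>k\<in>UNIV. (\<theta> k)\<^sup>2 * (t\<^sup>2 * (24 * v\<^sup>2 / \<kappa>\<^sup>2)))"
    proof (intro mult_left_mono sum_mono)
      fix k
      have "(\<theta> k)\<^sup>2 \<le> t\<^sup>2" using \<theta>[of k] t_pos by (simp add: abs_le_square_iff[symmetric])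
      then have "\<theta> k ^ 4 \<le> (\<theta> k)\<^sup>2 * t\<^sup>2"
        using mult_left_mono[of "(\<theta> k)\<^sup>2" "t\<^sup>2" "(\<theta> k)\<^sup>2"] by (simp flip: power_add)
      then show "\<theta> k ^ 4 * (\<integral>x. real_of_int (x $ k) ^ 4 * r x \<partial>lat) \<le> (\<theta> k)\<^sup>2 * (t\<^sup>2 * (24 * v\<^sup>2 / \<kappa>\<^sup>2))"
        unfolding mult.assoc[symmetric]
        using mult_mono[OF _ fourth_int(2)[of k], of "\<theta> k ^ 4" "(\<theta> k)\<^sup>2 * t\<^sup>2"]
        by (simp add: integral_nonneg_AE)
    qed auto
    also have "\<dots> = \<Theta> * ((t\<^sup>2 * v) * v * 24 * ?d ^ 3 / \<kappa>\<^sup>2)"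
      by (simp add: \<Theta>_def sum_distrib_right sum_distrib_left power2_eq_square mult_ac divide_inverse)
    also have "(t\<^sup>2 * v) * v * 24 * ?d ^ 3 / \<kappa>\<^sup>2 = 6 * v * (?d ^ 3 / ?d ^ 4)"
      unfolding t_sq using \<kappa> by (simp add: field_simps)
    also have "\<Theta> * (6 * v * (?d ^ 3 / ?d ^ 4)) \<le> \<Theta> * (6 * v * 1)"
      using \<Theta>0 v d34 by (intro mult_left_mono) (auto simp: divide_le_eq)
    finally show ?thesis by simp
  qed
  have "(\<integral>x. cos (dot \<theta> x) * r x \<partial>lat) \<le>
      (\<integral>x. r x - (dot \<theta> x)\<^sup>2 * r x / 2 + (?d ^ 3 * (\<Sum>k\<in>UNIV. \<theta> k ^ 4 * real_of_int (x $ k) ^ 4)) * r x / 24 \<partial>lat)"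
  proof (rule integral_mono[OF i0])
    show "integrable lat (\<lambda>x. r x - (dot \<theta> x)\<^sup>2 * r x / 2 + (?d ^ 3 * (\<Sum>k\<in>UNIV. \<theta> k ^ 4 * real_of_int (x $ k) ^ 4)) * r x / 24)"
      by (intro Bochner_Integration.integrable_add Bochner_Integration.integrable_diff integrable_divide
          integrable_r dot2_int i4)
    fix x
    have "cos (dot \<theta> x) \<le> 1 - (dot \<theta> x)\<^sup>2 / 2 + (?d ^ 3 * (\<Sum>k\<in>UNIV. \<theta> k ^ 4 * real_of_int (x $ k) ^ 4)) / 24"
      using cos_le_quartic[of "dot \<theta> x"] dot4_le[of \<theta> x] by simp
    from mult_right_mono[OF this, of "r x"]
    show "cos (dot \<theta> x) * r x \<le> r x - (dot \<theta> x)\<^sup>2 * r x / 2 +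
        (?d ^ 3 * (\<Sum>k\<in>UNIV. \<theta> k ^ 4 * real_of_int (x $ k) ^ 4)) * r x / 24"
      by (simp add: algebra_simps)
  qed
  also have "\<dots> = 1 - \<Theta> * v / 2 + (\<integral>x. (?d ^ 3 * (\<Sum>k\<in>UNIV. \<theta> k ^ 4 * real_of_int (x $ k) ^ 4)) * r x \<partial>lat) / 24"
    by (simp only: Bochner_Integration.integral_add Bochner_Integration.integral_diff integral_divide_zero
        Bochner_Integration.integrable_diff integrable_divide integrable_r dot2_int i4 integral_r \<Theta>_def)
  also have "\<dots> \<le> 1 - \<Theta> * v / 2 + 6 * \<Theta> * v / 24"
    using b4 by simp
  finally show "(\<integral>x. cos (dot \<theta> x) * r x \<partial>lat) \<le> 1 - \<Theta> * v / 4" by simp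
  have "1 - \<Theta> * v / 2 = (\<integral>x. r x - (dot \<theta> x)\<^sup>2 * r x / 2 \<partial>lat)"
    by (simp only: Bochner_Integration.integral_diff integral_divide_zero
        integrable_divide integrable_r dot2_int integral_r \<Theta>_def)
  also have "\<dots> \<le> (\<integral>x. cos (dot \<theta> x) * r x \<partial>lat)"
  proof (rule integral_mono[OF _ i0])
    show "integrable lat (\<lambda>x. r x - (dot \<theta> x)\<^sup>2 * r x / 2)"
      by (intro Bochner_Integration.integrable_diff integrable_divide integrable_r dot2_int)
    fix x
    from mult_right_mono[OF cos_ge_quadratic[of "dot \<theta> x"], of "r x"]
    show "r x - (dot \<theta> x)\<^sup>2 * r x / 2 \<le> cos (dot \<theta> x) * r x" by (simp add: algebra_simps)
  qed
  finally have low: "1 - \<Theta> * v / 2 \<le> (\<integral>x. cos (dot \<theta> x) * r x \<partial>lat)" .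
  \<comment> \<open>On the box of radius \<open>t\<close> one has \<Theta> v \<le> 1, so the
    integral stays far from -1 and the absolute value costs nothing.\<close>
  have "\<Theta> \<le> (\<Sum>k\<in>(UNIV::'d set). t\<^sup>2)"
    unfolding \<Theta>_def using \<theta> t_pos by (intro sum_mono) (auto simp: abs_le_square_iff[symmetric])
  then have "\<Theta> * v \<le> ?d * (t\<^sup>2 * v)"
    using mult_right_mono[of \<Theta> "?d * t\<^sup>2" v] v by (simp add: mult.assoc)
  also have "\<dots> \<le> ?d ^ 4 * (t\<^sup>2 * v)"
    using d1 v self_le_power[of ?d 4] by (intro mult_right_mono) auto
  also have "\<dots> \<le> 1" unfolding t_sq using \<kappa> power_le_one[of \<kappa> 2] by simp
  finally show "- (\<integral>x. cos (dot \<theta> x) * r x \<partial>lat) \<le> 1 - \<Theta> * v / 4"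
    using low by linarith
qed

text \<open>Pairing x with -x turns the real part into the mean of cosh times cos, within \<mu>^2 v
  of the untilted value, and the imaginary part into the mean of sinh times sin. The latter is split
  by the arithmetic-geometric inequality so that it uses only half of the gain \<Theta> v /
  4.\<close>

lemma ft_tilt_bound:
  assumes \<theta>: "\<And>k. \<bar>\<theta> k\<bar> \<le> t" and \<mu>: "4 * (\<mu>\<^sup>2 * v) \<le> \<kappa>\<^sup>2"
  defines "\<Theta> \<equiv> \<Sum>k\<in>UNIV. (\<theta> k)\<^sup>2"
  shows "norm (ft (tilt i \<mu> p) \<theta>) \<le> exp (- \<Theta> * v / 8 + 5 * (\<mu>\<^sup>2 * v))"
proof -
  let ?m = "\<lambda>x::'d lattice. \<mu> * real_of_int (x $ i)"
  have \<mu>1: "\<mu>\<^sup>2 * v \<le> \<kappa>\<^sup>2" using \<mu> v by (smt (verit) mult_nonneg_nonneg zero_le_power2)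
  have \<mu>2: "(2 * \<mu>)\<^sup>2 * v \<le> \<kappa>\<^sup>2" using \<mu> by (simp add: power_mult_distrib)
  let ?g = "\<lambda>x. exp (?m x) * r x"
  have ig: "integrable lat ?g" by (rule exp_int(1)[OF \<mu>1])
  have icos: "integrable lat (\<lambda>x. ?g x * cos (dot \<theta> x))" and isin: "integrable lat (\<lambda>x. ?g x * sin (dot \<theta> x))"
    by (rule Bochner_Integration.integrable_bound[OF ig]; auto simp: abs_mult intro!: mult_right_le_one_le)+
  have tilt: "enn2real (tilt i \<mu> p x) = ?g x" for x
    by (simp add: tilt_def enn2real_mult)
  have l1t: "l1 (tilt i \<mu> p) < \<infinity>"
    using mgf[OF \<mu>1, of i] by (rule order_le_less_trans) simp
  have re: "Re (ft (tilt i \<mu> p) \<theta>) = (\<integral>x. ?g x * cos (dot \<theta> x) \<partial>lat)"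
    unfolding ft_def integral_Re[OF integrable_ft[OF l1t], symmetric] by (simp add: tilt)
  have im: "Im (ft (tilt i \<mu> p) \<theta>) = (\<integral>x. ?g x * sin (dot \<theta> x) \<partial>lat)"
    unfolding ft_def integral_Im[OF integrable_ft[OF l1t], symmetric] by (simp add: tilt)
  have gneg: "?g (- x) = exp (- ?m x) * r x" for x by (simp add: r_uminus)
  have ic1: "integrable lat (\<lambda>x. (cosh (?m x) * r x - r x) * cos (dot \<theta> x))"
    by (rule Bochner_Integration.integrable_bound[OF Bochner_Integration.integrable_diff[OF cosh_int(1)[OF \<mu>1, of i] integrable_r]])
       (auto simp: abs_mult intro!: mult_right_le_one_le)
  have ic0: "integrable lat (\<lambda>x. cos (dot \<theta> x) * r x)"
    by (rule integrable_bounded_r) auto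
  have "2 * Re (ft (tilt i \<mu> p) \<theta>) = (\<integral>x. ?g x * cos (dot \<theta> x) \<partial>lat) + (\<integral>x. ?g (- x) * cos (dot \<theta> (- x)) \<partial>lat)"
    unfolding re using integral_uminus[of "\<lambda>x. ?g x * cos (dot \<theta> x)"] by simp
  also have "\<dots> = (\<integral>x. ?g x * cos (dot \<theta> x) + ?g (- x) * cos (dot \<theta> (- x)) \<partial>lat)"
  proof (rule Bochner_Integration.integral_add[symmetric, OF icos])
    show "integrable lat (\<lambda>x. ?g (- x) * cos (dot \<theta> (- x)))"
      using integrable_bij_count_space[OF bij_uminus, of "\<lambda>x. ?g x * cos (dot \<theta> x)"] icos by simp
  qed
  also have "\<dots> = (\<integral>x. 2 * (cos (dot \<theta> x) * r x + (cosh (?m x) * r x - r x) * cos (dot \<theta> x)) \<partial>lat)"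
    unfolding gneg by (intro Bochner_Integration.integral_cong refl) (simp add: dot_uminus cosh_def algebra_simps)
  also have "\<dots> = 2 * ((\<integral>x. cos (dot \<theta> x) * r x \<partial>lat) + (\<integral>x. (cosh (?m x) * r x - r x) * cos (dot \<theta> x) \<partial>lat))"
    by (simp only: integral_mult_right_zero Bochner_Integration.integral_add[OF ic0 ic1])
  finally have re2: "Re (ft (tilt i \<mu> p) \<theta>) =
      (\<integral>x. cos (dot \<theta> x) * r x \<partial>lat) + (\<integral>x. (cosh (?m x) * r x - r x) * cos (dot \<theta> x) \<partial>lat)"
    by simp
  have "\<bar>\<integral>x. (cosh (?m x) * r x - r x) * cos (dot \<theta> x) \<partial>lat\<bar> \<le> (\<integral>x. cosh (?m x) * r x - r x \<partial>lat)"
  proof -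
    have nn: "0 \<le> cosh (?m x) * r x - r x" for x
      using mult_right_mono[OF cosh_real_ge_1[of "?m x"], of "r x"] by simp
    have "\<bar>\<integral>x. (cosh (?m x) * r x - r x) * cos (dot \<theta> x) \<partial>lat\<bar> \<le>
        (\<integral>x. \<bar>(cosh (?m x) * r x - r x) * cos (dot \<theta> x)\<bar> \<partial>lat)"
      by (rule integral_abs_bound)
    also have "\<dots> \<le> (\<integral>x. cosh (?m x) * r x - r x \<partial>lat)"
      using ic1 nn by (intro integral_mono integrable_abs Bochner_Integration.integrable_diff cosh_int(1)[OF \<mu>1] integrable_r)
        (auto simp: abs_mult intro!: mult_right_le_one_le)
    finally show ?thesis .
  qed
  also have "\<dots> \<le> \<mu>\<^sup>2 * v"
    using cosh_int[OF \<mu>1, of i] integrable_r integral_r by (subst Bochner_Integration.integral_diff) auto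
  finally have R: "\<bar>Re (ft (tilt i \<mu> p) \<theta>)\<bar> \<le> 1 - \<Theta> * v / 4 + \<mu>\<^sup>2 * v"
    unfolding re2 using cos_dot_int[of \<theta>, OF \<theta>] unfolding \<Theta>_def by linarith
  have "2 * Im (ft (tilt i \<mu> p) \<theta>) = (\<integral>x. ?g x * sin (dot \<theta> x) \<partial>lat) + (\<integral>x. ?g (- x) * sin (dot \<theta> (- x)) \<partial>lat)"
    unfolding im using integral_uminus[of "\<lambda>x. ?g x * sin (dot \<theta> x)"] by simp
  also have "\<dots> = (\<integral>x. ?g x * sin (dot \<theta> x) + ?g (- x) * sin (dot \<theta> (- x)) \<partial>lat)"
  proof (rule Bochner_Integration.integral_add[symmetric, OF isin])
    show "integrable lat (\<lambda>x. ?g (- x) * sin (dot \<theta> (- x)))"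
      using integrable_bij_count_space[OF bij_uminus, of "\<lambda>x. ?g x * sin (dot \<theta> x)"] isin by simp
  qed
  also have "\<dots> = (\<integral>x. 2 * (sinh (?m x) * sin (dot \<theta> x) * r x) \<partial>lat)"
    unfolding gneg by (intro Bochner_Integration.integral_cong refl) (simp add: dot_uminus sinh_def algebra_simps)
  finally have im2: "Im (ft (tilt i \<mu> p) \<theta>) = (\<integral>x. sinh (?m x) * sin (dot \<theta> x) * r x \<partial>lat)"
    by simp
  let ?b = "\<lambda>x. (dot \<theta> x)\<^sup>2 * r x / 8 + (cosh (2 * \<mu> * real_of_int (x $ i)) * r x - r x)"
  have bnd: "\<bar>sinh (?m x) * sin (dot \<theta> x) * r x\<bar> \<le> ?b x" for x
  proof -
    have "\<bar>sinh (?m x) * sin (dot \<theta> x)\<bar> \<le> \<bar>sinh (?m x)\<bar> * \<bar>dot \<theta> x\<bar>"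
      unfolding abs_mult by (intro mult_left_mono abs_sin_x_le_abs_x) auto
    also have "\<dots> \<le> (dot \<theta> x)\<^sup>2 / 8 + 2 * (sinh (?m x))\<^sup>2"
    proof -
      have "0 \<le> (\<bar>dot \<theta> x\<bar> / 4 - \<bar>sinh (?m x)\<bar>)\<^sup>2" by simp
      then show ?thesis by (simp add: power2_diff power_divide mult.commute)
    qed
    \<comment> \<open>The double angle formula produces a tilt of size 2 \<mu>; the hypothesis
      bounds 4 \<mu>^2 v for this reason.\<close>
    also have "2 * (sinh (?m x))\<^sup>2 = cosh (2 * \<mu> * real_of_int (x $ i)) - 1"
      using cosh_add[of "?m x" "?m x"] hyperbolic_pythagoras[of "?m x"]
      by (simp add: power2_eq_square mult.assoc flip: mult_2)
    finally have "\<bar>sinh (?m x) * sin (dot \<theta> x)\<bar> \<le> (dot \<theta> x)\<^sup>2 / 8 + (cosh (2 * \<mu> * real_of_int (x $ i)) - 1)" .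
    from mult_right_mono[OF this, of "r x"] show ?thesis
      by (simp add: abs_mult algebra_simps)
  qed
  have ib: "integrable lat ?b"
    by (intro Bochner_Integration.integrable_add Bochner_Integration.integrable_diff integrable_divide
        dot2_int cosh_int(1)[OF \<mu>2] integrable_r)
  have "\<bar>Im (ft (tilt i \<mu> p) \<theta>)\<bar> \<le> (\<integral>x. \<bar>sinh (?m x) * sin (dot \<theta> x) * r x\<bar> \<partial>lat)"
    unfolding im2 by (rule integral_abs_bound)
  also have "\<dots> \<le> (\<integral>x. ?b x \<partial>lat)"
  proof (rule integral_mono)
    show "integrable lat (\<lambda>x. \<bar>sinh (?m x) * sin (dot \<theta> x) * r x\<bar>)"
      by (rule Bochner_Integration.integrable_bound[OF ib]) (use order_trans[OF bnd abs_ge_self] in \<open>simp_all add: abs_mult\<close>)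
  qed (use ib bnd in auto)
  also have "\<dots> = \<Theta> * v / 8 + ((\<integral>x. cosh (2 * \<mu> * real_of_int (x $ i)) * r x \<partial>lat) - 1)"
    by (simp only: Bochner_Integration.integral_add Bochner_Integration.integral_diff integral_divide_zero
        Bochner_Integration.integrable_diff integrable_divide integrable_r dot2_int cosh_int(1)[OF \<mu>2] integral_r \<Theta>_def)
  also have "\<dots> \<le> \<Theta> * v / 8 + 4 * (\<mu>\<^sup>2 * v)"
    using cosh_int(2)[OF \<mu>2, of i] by (simp add: power_mult_distrib)
  finally have I: "\<bar>Im (ft (tilt i \<mu> p) \<theta>)\<bar> \<le> \<Theta> * v / 8 + 4 * (\<mu>\<^sup>2 * v)" .
  have "norm (ft (tilt i \<mu> p) \<theta>) \<le> 1 + (- \<Theta> * v / 8 + 5 * (\<mu>\<^sup>2 * v))"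
    using R I cmod_le[of "ft (tilt i \<mu> p) \<theta>"] by linarith
  also have "\<dots> \<le> exp (- \<Theta> * v / 8 + 5 * (\<mu>\<^sup>2 * v))"
    by (rule exp_ge_add_one_self)
  finally show ?thesis .
qed

end

section \<open>Small-ball estimates from products of unnormalised Fejer kernels\<close>

definition box_kernel :: "real \<Rightarrow> nat \<Rightarrow> ('d::finite) lattice \<Rightarrow> real" where
  "box_kernel s n z = (\<Prod>k\<in>UNIV. (norm (\<Sum>l<n. cis (s * real l * real_of_int (z $ k))))\<^sup>2)"

lemma box_kernel_nonneg: "0 \<le> box_kernel s n z"
  unfolding box_kernel_def by (intro prod_nonneg) auto

text \<open>Squaring a sum of n characters gives one pair of indices per coordinate, and only their
  difference enters the frequency. The kernel is thus a finite sum of characters, and the mass of a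
  box is compared with finitely many values of the characteristic function instead of an integral
  over the torus.\<close>

definition freqs :: "nat \<Rightarrow> ('d::finite \<Rightarrow> nat \<times> nat) set" where
  "freqs n = PiE UNIV (\<lambda>_. {..<n} \<times> {..<n})"

definition freq :: "real \<Rightarrow> ('d::finite \<Rightarrow> nat \<times> nat) \<Rightarrow> 'd \<Rightarrow> real" where
  "freq s g k = s * (real (fst (g k)) - real (snd (g k)))"

lemma cis_sum: "finite A \<Longrightarrow> cis (\<Sum>k\<in>A. f k) = (\<Prod>k\<in>A. cis (f k))"
  by (induction A rule: finite_induct) (simp_all flip: cis_mult)

lemma box_kernel_expand:
  "complex_of_real (box_kernel s n z) = (\<Sum>g\<in>freqs n. cis (dot (freq s g) (z :: ('d::finite) lattice)))"
proof -
  let ?c = "\<lambda>l k. cis (s * real l * real_of_int (z $ k))"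
  have one: "complex_of_real ((norm (\<Sum>l<n. ?c l k))\<^sup>2) =
      (\<Sum>ab\<in>{..<n} \<times> {..<n}. cis (s * (real (fst ab) - real (snd ab)) * real_of_int (z $ k)))" for k
  proof -
    have "complex_of_real ((norm (\<Sum>l<n. ?c l k))\<^sup>2) = (\<Sum>l<n. ?c l k) * cnj (\<Sum>l<n. ?c l k)"
      by (rule complex_norm_square)
    also have "\<dots> = (\<Sum>a<n. \<Sum>b<n. ?c a k * cis (- (s * real b * real_of_int (z $ k))))"
      by (simp add: sum_product cis_cnj)
    also have "\<dots> = (\<Sum>a<n. \<Sum>b<n. cis (s * (real a - real b) * real_of_int (z $ k)))"
      by (simp add: cis_mult algebra_simps)
    finally show ?thesis by (simp add: sum.cartesian_product case_prod_unfold)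
  qed
  have "complex_of_real (box_kernel s n z) =
      (\<Prod>k\<in>UNIV. \<Sum>ab\<in>{..<n} \<times> {..<n}. cis (s * (real (fst ab) - real (snd ab)) * real_of_int (z $ k)))"
    unfolding box_kernel_def of_real_prod one ..
  also have "\<dots> = (\<Sum>g\<in>freqs n. \<Prod>k\<in>UNIV. cis (s * (real (fst (g k)) - real (snd (g k))) * real_of_int (z $ k)))"
    unfolding freqs_def by (rule prod_sum_PiE) auto
  finally show ?thesis by (simp add: dot_def freq_def cis_sum)
qed

lemma cos_1_ge: "1 / 2 \<le> cos (1::real)"
  using cos_monotone_0_pi_le[of 1 "pi / 3"] pi_gt3 by (simp add: cos_60)

text \<open>Inside the box all phases have absolute value at most 1, where cos is at least 1/2, so
  the characters cannot cancel.\<close>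

lemma box_kernel_ge:
  fixes z :: "('d::finite) lattice"
  assumes n: "0 < n" and s: "0 \<le> s" and z: "\<And>k. s * real n * \<bar>real_of_int (z $ k)\<bar> \<le> 1"
  shows "((real n)\<^sup>2 / 4) ^ CARD('d) \<le> box_kernel s n z"
proof -
  have "(real n)\<^sup>2 / 4 \<le> (norm (\<Sum>l<n. cis (s * real l * real_of_int (z $ k))))\<^sup>2" for k
  proof -
    have "real n / 2 = (\<Sum>l<n. 1 / 2)" by simp
    also have "\<dots> \<le> (\<Sum>l<n. cos (s * real l * real_of_int (z $ k)))"
    proof (rule sum_mono)
      fix l assume "l \<in> {..<n}"
      then have "s * real l * \<bar>real_of_int (z $ k)\<bar> \<le> s * real n * \<bar>real_of_int (z $ k)\<bar>"
        using s by (intro mult_right_mono mult_left_mono) auto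
      then have "\<bar>s * real l * real_of_int (z $ k)\<bar> \<le> 1"
        using z[of k] s by (simp add: abs_mult)
      then have "cos 1 \<le> cos \<bar>s * real l * real_of_int (z $ k)\<bar>"
        using pi_gt3 by (intro cos_monotone_0_pi_le) auto
      then show "1 / 2 \<le> cos (s * real l * real_of_int (z $ k))"
        using cos_1_ge by simp
    qed
    also have "\<dots> = Re (\<Sum>l<n. cis (s * real l * real_of_int (z $ k)))" by simp
    also have "\<dots> \<le> norm (\<Sum>l<n. cis (s * real l * real_of_int (z $ k)))"
      by (rule complex_Re_le_cmod)
    finally have "(real n / 2)\<^sup>2 \<le> (norm (\<Sum>l<n. cis (s * real l * real_of_int (z $ k))))\<^sup>2"
      by (rule power_mono) simp
    then show ?thesis by (simp add: power_divide)
  qed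
  then have "(\<Prod>k\<in>(UNIV::'d set). (real n)\<^sup>2 / 4) \<le> box_kernel s n z"
    unfolding box_kernel_def by (intro prod_mono) auto
  then show ?thesis by simp
qed

text \<open>For integers m \<le> m^2, so the Gaussian is dominated by a geometric series in the
  index difference. The total is of order n rather than n^2; against the kernel size n^2 this leaves
  the factor 1 / n per coordinate.\<close>

lemma gaussian_pair_sum:
  assumes c: "0 < c"
  shows "(\<Sum>ab\<in>{..<n} \<times> {..<n}. exp (- c * (real (fst ab) - real (snd ab))\<^sup>2)) \<le> real n * (2 / (1 - exp (- c)))"
proof -
  define q where "q = exp (- c)"
  have q: "0 < q" "q < 1" using c by (simp_all add: q_def)
  have geo: "(\<Sum>b\<in>B. q ^ b) \<le> 1 / (1 - q)" if "finite B" for B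
  proof -
    have "(\<Sum>b\<in>B. q ^ b) \<le> (\<Sum>b. q ^ b)"
      using q that by (intro sum_le_suminf summable_geometric) auto
    then show ?thesis using q by (simp add: suminf_geometric)
  qed
  have le: "exp (- c * (real a - real b)\<^sup>2) \<le> (if a \<le> b then q ^ (b - a) else q ^ (a - b))" for a b
  proof -
    define m where "m = (if a \<le> b then b - a else a - b)"
    have m: "(real a - real b)\<^sup>2 = (real m)\<^sup>2"
      by (auto simp: m_def of_nat_diff power2_commute)
    have "real m \<le> (real m)\<^sup>2" by (metis le_square of_nat_le_iff of_nat_mult power2_eq_square)
    then have "exp (- c * (real a - real b)\<^sup>2) \<le> exp (real m * - c)"
      unfolding m using c by simp
    also have "\<dots> = q ^ m" unfolding q_def by (rule exp_of_nat_mult)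
    finally show ?thesis by (auto simp: m_def)
  qed
  have row: "(\<Sum>b<n. exp (- c * (real a - real b)\<^sup>2)) \<le> 2 / (1 - q)" if "a < n" for a
  proof -
    have "(\<Sum>b<n. exp (- c * (real a - real b)\<^sup>2)) \<le> (\<Sum>b<n. if a \<le> b then q ^ (b - a) else q ^ (a - b))"
      by (intro sum_mono le)
    also have "\<dots> = (\<Sum>b\<in>{b. b < n \<and> a \<le> b}. q ^ (b - a)) + (\<Sum>b\<in>{b. b < n \<and> \<not> a \<le> b}. q ^ (a - b))"
      by (subst sum.If_cases) (auto intro!: arg_cong2[of _ _ _ _ "(+)"] sum.cong)
    also have "(\<Sum>b\<in>{b. b < n \<and> a \<le> b}. q ^ (b - a)) = (\<Sum>m\<in>(\<lambda>b. b - a) ` {b. b < n \<and> a \<le> b}. q ^ m)"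
      by (subst sum.reindex) (auto simp: inj_on_def)
    also have "\<dots> \<le> 1 / (1 - q)" by (rule geo) auto
    also have "(\<Sum>b\<in>{b. b < n \<and> \<not> a \<le> b}. q ^ (a - b)) = (\<Sum>m\<in>(\<lambda>b. a - b) ` {b. b < n \<and> \<not> a \<le> b}. q ^ m)"
      by (subst sum.reindex) (auto simp: inj_on_def)
    also have "\<dots> \<le> 1 / (1 - q)" by (rule geo) auto
    finally show ?thesis by simp
  qed
  have "(\<Sum>ab\<in>{..<n} \<times> {..<n}. exp (- c * (real (fst ab) - real (snd ab))\<^sup>2)) =
      (\<Sum>a<n. \<Sum>b<n. exp (- c * (real a - real b)\<^sup>2))"
    by (simp add: sum.cartesian_product case_prod_unfold)
  also have "\<dots> \<le> (\<Sum>a<n. 2 / (1 - q))" by (intro sum_mono row) auto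
  finally show ?thesis by (simp add: q_def)
qed

context subgaussian
begin

text \<open>The 8 is the 2 of \<open>gaussian_pair_sum\<close> times the 4 of
  \<open>box_kernel_ge\<close>. The exponent is t^2 v / 32, in which \<open>v\<close>
  cancels.\<close>

definition box_const :: real where
  "box_const = (8 / (1 - exp (- (\<kappa>\<^sup>2 / (128 * real CARD('d) ^ 4))))) ^ CARD('d)"

lemma box_const_pos: "0 < box_const"
proof -
  have "0 < \<kappa>\<^sup>2 / (128 * real CARD('d) ^ 4)" using \<kappa> by simp
  then show ?thesis unfolding box_const_def by (intro zero_less_power divide_pos_pos) auto
qed

text \<open>The Fejer kernel majorises the indicator of the box up to a constant and only tests
  frequencies of size at most \<open>t\<close>, where \<open>ft_tilt_bound\<close> makes the j-th
  power of the characteristic function Gaussian. The point \<open>y0\<close> enters as a phase only,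
  so the bound is uniform in the position of the box.\<close>

lemma concentration_box:
  assumes j: "1 \<le> j" and \<mu>: "4 * (\<mu>\<^sup>2 * v) \<le> \<kappa>\<^sup>2"
    and B: "\<And>y k. y \<in> B \<Longrightarrow> \<bar>real_of_int ((y - y0) $ k)\<bar> \<le> 1 / t"
  shows "l1 (\<lambda>y. tilt i \<mu> (cpow p j) y * indicator B y) \<le>
    ennreal (box_const * exp (5 * (\<mu>\<^sup>2 * v) * real j) / sqrt (real j) ^ CARD('d))"
proof -
  let ?d = "CARD('d)"
  \<comment> \<open>With n close to sqrt j, frequencies are spaced by t / n, so j steps damp the
    index difference m by exp (- c m^2) with c independent of j.\<close>
  define n where "n = nat \<lceil>sqrt (real j)\<rceil>"
  have sj: "1 \<le> sqrt (real j)" using j by simp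
  have n: "sqrt (real j) \<le> real n" "0 < n" "real n \<le> 2 * sqrt (real j)"
    unfolding n_def using sj by linarith+
  have n2: "(real n)\<^sup>2 \<le> 4 * real j"
    using power_mono[OF n(3), of 2] by (simp add: power_mult_distrib)
  define s where "s = t / real n"
  have s: "0 < s" "s * real n = t" using t_pos n by (simp_all add: s_def)
  define \<kappa>' where "\<kappa>' = \<kappa>\<^sup>2 / (128 * real ?d ^ 4)"
  have \<kappa>': "0 < \<kappa>'" using \<kappa> by (simp add: \<kappa>'_def)
  have sk: "\<kappa>' \<le> real j * (s\<^sup>2 * v) / 8"
  proof -
    have "\<kappa>' = t\<^sup>2 * v / 32" unfolding t_sq \<kappa>'_def by simp
    also have "\<dots> = (s\<^sup>2 * v) * (real n)\<^sup>2 / 32" unfolding s(2)[symmetric] by (simp add: power_mult_distrib)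
    also have "\<dots> \<le> (s\<^sup>2 * v) * (4 * real j) / 32"
      using n2 v by (intro divide_right_mono mult_left_mono) auto
    finally show ?thesis by (simp add: mult_ac)
  qed
  have \<mu>1: "\<mu>\<^sup>2 * v \<le> \<kappa>\<^sup>2" using \<mu> v by (smt (verit) mult_nonneg_nonneg zero_le_power2)
  let ?f = "tilt i \<mu> p" and ?q = "tilt i \<mu> (cpow p j)"
  have l1f: "l1 ?f < \<infinity>"
    using mgf[OF \<mu>1, of i] by (rule order_le_less_trans) simp
  then have l1q: "l1 ?q < \<infinity>" by (simp add: l1_tilt_cpow power_less_top_ennreal)
  let ?r = "\<lambda>y. enn2real (?q y)"
  let ?K = "\<lambda>y. box_kernel s n (y - y0)"
  have Kbound: "integrable lat (\<lambda>y. ?r y *\<^sub>R complex_of_real (?K y))" and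
    Kval: "(\<integral>y. ?r y *\<^sub>R complex_of_real (?K y) \<partial>lat) =
      (\<Sum>g\<in>freqs n. cis (- dot (freq s g) y0) * ft ?q (freq s g))"
  proof -
    have eq: "?r y *\<^sub>R complex_of_real (?K y) =
        (\<Sum>g\<in>freqs n. cis (- dot (freq s g) y0) * (?r y *\<^sub>R cis (dot (freq s g) y)))" for y
      unfolding box_kernel_expand scaleR_sum_right dot_diff
      by (intro sum.cong refl) (simp add: cis_mult add.commute)
    have i: "integrable lat (\<lambda>y. ?r y *\<^sub>R cis (dot (freq s g) y))" for g
      by (rule integrable_ft[OF l1q])
    show "integrable lat (\<lambda>y. ?r y *\<^sub>R complex_of_real (?K y))"
      unfolding eq using i by (intro Bochner_Integration.integrable_sum integrable_mult_right)
    show "(\<integral>y. ?r y *\<^sub>R complex_of_real (?K y) \<partial>lat) =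
      (\<Sum>g\<in>freqs n. cis (- dot (freq s g) y0) * ft ?q (freq s g))"
      unfolding eq ft_def
      by (simp only: Bochner_Integration.integral_sum integrable_mult_right i integral_mult_right_zero)
  qed
  have iK: "integrable lat (\<lambda>y. ?r y * ?K y)"
    using integrable_Re[OF Kbound] by simp
  have "(\<integral>y. ?r y * ?K y \<partial>lat) = Re (\<integral>y. ?r y *\<^sub>R complex_of_real (?K y) \<partial>lat)"
    using integral_Re[OF Kbound] by simp
  also have "\<dots> \<le> norm (\<integral>y. ?r y *\<^sub>R complex_of_real (?K y) \<partial>lat)"
    by (rule complex_Re_le_cmod)
  also have "\<dots> \<le> (\<Sum>g\<in>freqs n. norm (ft ?q (freq s g)))"
    unfolding Kval by (rule order_trans[OF norm_sum]) (simp add: norm_mult)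
  also have "\<dots> \<le> (\<Sum>g\<in>(freqs n :: ('d \<Rightarrow> nat \<times> nat) set). exp (5 * (\<mu>\<^sup>2 * v) * real j) *
      (\<Prod>k\<in>UNIV. exp (- \<kappa>' * (real (fst (g k)) - real (snd (g k)))\<^sup>2)))"
  proof (rule sum_mono)
    fix g :: "'d \<Rightarrow> nat \<times> nat" assume "g \<in> freqs n"
    then have gk: "fst (g k) < n \<and> snd (g k) < n" for k
      unfolding freqs_def by (auto simp: PiE_def Pi_def mem_Times_iff)
    have "\<bar>freq s g k\<bar> \<le> t" for k
    proof -
      have "\<bar>real (fst (g k)) - real (snd (g k))\<bar> \<le> real n" using gk[of k] by auto
      then have "s * \<bar>real (fst (g k)) - real (snd (g k))\<bar> \<le> s * real n"
        using s by (intro mult_left_mono) auto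
      then show ?thesis using s by (simp add: freq_def abs_mult)
    qed
    then have "norm (ft ?f (freq s g)) \<le>
        exp (- (\<Sum>k\<in>UNIV. (freq s g k)\<^sup>2) * v / 8 + 5 * (\<mu>\<^sup>2 * v))"
      by (intro ft_tilt_bound \<mu>)
    then have "norm (ft ?f (freq s g)) ^ j \<le>
        exp (- (\<Sum>k\<in>UNIV. (freq s g k)\<^sup>2) * v / 8 + 5 * (\<mu>\<^sup>2 * v)) ^ j"
      by (rule power_mono) simp
    also have "\<dots> = exp (real j * (- (\<Sum>k\<in>UNIV. (freq s g k)\<^sup>2) * v / 8 + 5 * (\<mu>\<^sup>2 * v)))"
      by (rule exp_of_nat_mult[symmetric])
    also have "\<dots> = exp (5 * (\<mu>\<^sup>2 * v) * real j) * exp (\<Sum>k\<in>UNIV. - (real j * (s\<^sup>2 * v) / 8) * (real (fst (g k)) - real (snd (g k)))\<^sup>2)"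
      unfolding exp_add[symmetric] freq_def power_mult_distrib sum_distrib_left[symmetric]
      by (rule arg_cong[of _ _ exp]) (simp add: field_simps)
    also have "\<dots> \<le> exp (5 * (\<mu>\<^sup>2 * v) * real j) * exp (\<Sum>k\<in>UNIV. - \<kappa>' * (real (fst (g k)) - real (snd (g k)))\<^sup>2)"
      using sk by (intro mult_left_mono exp_le_cancel_iff[THEN iffD2] sum_mono mult_right_mono) auto
    also have "\<dots> = exp (5 * (\<mu>\<^sup>2 * v) * real j) * (\<Prod>k\<in>UNIV. exp (- \<kappa>' * (real (fst (g k)) - real (snd (g k)))\<^sup>2))"
      by (subst exp_sum) auto
    finally show "norm (ft ?q (freq s g)) \<le> exp (5 * (\<mu>\<^sup>2 * v) * real j) *
        (\<Prod>k\<in>UNIV. exp (- \<kappa>' * (real (fst (g k)) - real (snd (g k)))\<^sup>2))"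
      by (simp add: tilt_cpow ft_cpow[OF l1f] norm_power)
  qed
  also have "\<dots> = exp (5 * (\<mu>\<^sup>2 * v) * real j) *
      (\<Prod>k\<in>(UNIV::'d set). \<Sum>ab\<in>{..<n} \<times> {..<n}. exp (- \<kappa>' * (real (fst ab) - real (snd ab))\<^sup>2))"
    unfolding sum_distrib_left[symmetric] freqs_def by (subst prod_sum_PiE) auto
  also have "\<dots> \<le> exp (5 * (\<mu>\<^sup>2 * v) * real j) * (\<Prod>k\<in>(UNIV::'d set). real n * (2 / (1 - exp (- \<kappa>'))))"
    by (intro mult_left_mono prod_mono conjI gaussian_pair_sum \<kappa>' sum_nonneg) auto
  finally have up: "(\<integral>y. ?r y * ?K y \<partial>lat) \<le> exp (5 * (\<mu>\<^sup>2 * v) * real j) * (real n * (2 / (1 - exp (- \<kappa>')))) ^ ?d"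
    by simp
  have iB: "integrable lat (\<lambda>y. ?r y * indicator B y)"
    by (rule Bochner_Integration.integrable_bound[OF integrable_enn2real[OF l1q]]) (auto split: split_indicator)
  have "((real n)\<^sup>2 / 4) ^ ?d * (\<integral>y. ?r y * indicator B y \<partial>lat) = (\<integral>y. ((real n)\<^sup>2 / 4) ^ ?d * (?r y * indicator B y) \<partial>lat)"
    by simp
  also have "\<dots> \<le> (\<integral>y. ?r y * ?K y \<partial>lat)"
  proof (rule integral_mono)
    show "integrable lat (\<lambda>y. ((real n)\<^sup>2 / 4) ^ ?d * (?r y * indicator B y))"
      using iB by (rule integrable_mult_right)
    show "integrable lat (\<lambda>y. ?r y * ?K y)" by (rule iK)
    fix y
    show "((real n)\<^sup>2 / 4) ^ ?d * (?r y * indicator B y) \<le> ?r y * ?K y"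
    proof (cases "y \<in> B")
      case True
      have "((real n)\<^sup>2 / 4) ^ ?d \<le> ?K y"
      proof (rule box_kernel_ge)
        fix k
        show "s * real n * \<bar>real_of_int ((y - y0) $ k)\<bar> \<le> 1"
          using mult_left_mono[OF B[OF True, of k], of t] t_pos unfolding s(2) by simp
      qed (use n s in auto)
      then have "?r y * ((real n)\<^sup>2 / 4) ^ ?d \<le> ?r y * ?K y" by (rule mult_left_mono) simp
      then show ?thesis using True by (simp add: mult.commute)
    qed (simp add: box_kernel_nonneg)
  qed
  finally have "((real n)\<^sup>2 / 4) ^ ?d * (\<integral>y. ?r y * indicator B y \<partial>lat) \<le>
      exp (5 * (\<mu>\<^sup>2 * v) * real j) * (real n * (2 / (1 - exp (- \<kappa>')))) ^ ?d"
    using up by linarith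
  then have "(\<integral>y. ?r y * indicator B y \<partial>lat) \<le>
      exp (5 * (\<mu>\<^sup>2 * v) * real j) * (real n * (2 / (1 - exp (- \<kappa>')))) ^ ?d / ((real n)\<^sup>2 / 4) ^ ?d"
    using n by (subst pos_le_divide_eq) (auto simp: mult.commute)
  also have "\<dots> = exp (5 * (\<mu>\<^sup>2 * v) * real j) * ((8 / (1 - exp (- \<kappa>'))) / real n) ^ ?d"
  proof -
    have "real n * (2 / w) / ((real n)\<^sup>2 / 4) = (8 / w) / real n" for w
      using n by (simp add: power2_eq_square)
    then show ?thesis by (simp only: times_divide_eq_right[symmetric] power_divide[symmetric])
  qed
  also have "\<dots> = box_const * exp (5 * (\<mu>\<^sup>2 * v) * real j) / real n ^ ?d"
    by (simp add: box_const_def \<kappa>'_def power_divide power_mult_distrib mult.commute)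
  also have "\<dots> \<le> box_const * exp (5 * (\<mu>\<^sup>2 * v) * real j) / sqrt (real j) ^ ?d"
  proof -
    have "0 < real n" "0 < real j" using n j by simp_all
    then show ?thesis
      using n(1) box_const_pos by (intro divide_left_mono power_mono mult_pos_pos zero_less_power mult_nonneg_nonneg) auto
  qed
  finally have fin: "(\<integral>y. ?r y * indicator B y \<partial>lat) \<le> box_const * exp (5 * (\<mu>\<^sup>2 * v) * real j) / sqrt (real j) ^ ?d" .
  have qf: "?q y < \<infinity>" for y using l1q l1_ge[of ?q y] by (simp add: order_le_less_trans)
  have "l1 (\<lambda>y. ?q y * indicator B y) = (\<integral>\<^sup>+y. ennreal (?r y * indicator B y) \<partial>lat)"
    unfolding l1_eq_nn_integral using qf by (intro nn_integral_cong) (auto split: split_indicator)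
  also have "\<dots> = ennreal (\<integral>y. ?r y * indicator B y \<partial>lat)"
    by (rule nn_integral_eq_integral[OF iB]) auto
  finally show ?thesis using fin by (simp add: ennreal_leI)
qed

text \<open>The summand 1 covers \<open>j = 0\<close>, and 2^d is the price of replacing sqrt j by
  sqrt (1 + j). The rate is b / sqrt v per unit length times the cell side 1 / t, in which
  \<open>v\<close> has cancelled.\<close>

definition conc_const :: "real \<Rightarrow> real" where
  "conc_const b = 1 + 2 ^ CARD('d) * box_const *
     enn2real (l1 (\<lambda>u::'d lattice. ennreal (exp (2 * b * real CARD('d) ^ 2 / \<kappa>) *
       exp (- (2 * b * real CARD('d) ^ 2 / \<kappa>) * supnorm u))))"

lemma conc_const_ge: "1 \<le> conc_const b"
  unfolding conc_const_def using box_const_pos by simp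

text \<open>The exponential weight decays from cell to cell at a fixed rate, so summing the box
  bound over all cells costs a constant. The outcome is a local-limit-type bound for a law that is
  only tested after averaging over the scale \<open>sqrt v\<close>.\<close>

lemma concentration:
  assumes b: "0 < b" and \<mu>: "4 * (\<mu>\<^sup>2 * v) \<le> \<kappa>\<^sup>2"
  shows "l1 (\<lambda>y. tilt i \<mu> (cpow p j) y * ennreal (exp (- b * supnorm (x - y) / sqrt v))) \<le>
    ennreal (conc_const b * exp (5 * (\<mu>\<^sup>2 * v) * real j) / sqrt (1 + real j) ^ CARD('d))"
proof (cases "j = 0")
  case True
  have "l1 (\<lambda>y. tilt i \<mu> (cpow p j) y * ennreal (exp (- b * supnorm (x - y) / sqrt v))) \<le> l1 (delta0 :: 'd lattice \<Rightarrow> ennreal)"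
    using True b v supnorm_nonneg by (intro l1_mono) (auto simp: delta0_def intro!: divide_nonneg_pos mult_nonneg_nonneg)
  also have "\<dots> = ennreal 1" by (simp add: l1_delta0)
  also have "\<dots> \<le> ennreal (conc_const b * exp (5 * (\<mu>\<^sup>2 * v) * real j) / sqrt (1 + real j) ^ CARD('d))"
    using True conc_const_ge by (intro ennreal_leI) simp
  finally show ?thesis .
next
  case False
  then have j: "1 \<le> j" by simp
  let ?d = "CARD('d)"
  define \<tau> where "\<tau> = 2 * b * real ?d ^ 2 / \<kappa>"
  define \<l> where "\<l> = 1 / t"
  have \<l>: "0 < \<l>" using t_pos by (simp add: \<l>_def)
  have \<tau>: "0 < \<tau>" using b \<kappa> by (simp add: \<tau>_def)
  have \<l>\<tau>: "b * \<l> / sqrt v = \<tau>"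
    using v \<kappa> by (simp add: \<l>_def \<tau>_def t_def)
  \<comment> \<open>Cells have side 1 / t, the size that \<open>concentration_box\<close> admits,
    and \<open>\<tau>\<close> is the decay of the weight per cell. Rounding to cell indices costs
    the factor exp \<tau> in \<open>W\<close>.\<close>
  define cell where "cell y = (\<chi> k. \<lfloor>real_of_int ((x - y) $ k) / \<l>\<rfloor>)" for y :: "'d lattice"
  define W where "W u = ennreal (exp \<tau> * exp (- \<tau> * supnorm u))" for u :: "'d lattice"
  let ?q = "tilt i \<mu> (cpow p j)"
  let ?Q = "box_const * exp (5 * (\<mu>\<^sup>2 * v) * real j) / sqrt (real j) ^ ?d"
  have Wfin: "l1 W < \<infinity>"
  proof -
    have "l1 W = ennreal (exp \<tau>) * l1 (\<lambda>u::'d lattice. ennreal (exp (- \<tau> * supnorm u)))"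
      unfolding W_def[abs_def] by (simp add: ennreal_mult l1_cmult)
    also have "\<dots> < \<infinity>" using l1_exp_finite[where 'd = 'd, OF \<tau>] by (simp add: ennreal_mult_less_top)
    finally show ?thesis .
  qed
  have weight: "ennreal (exp (- b * supnorm (x - y) / sqrt v)) \<le> W (cell y)" for y
  proof -
    have "supnorm (cell y) \<le> supnorm (x - y) / \<l> + 1"
      unfolding supnorm_le_iff
    proof
      fix k
      have "\<bar>real_of_int ((x - y) $ k)\<bar> / \<l> \<le> supnorm (x - y) / \<l>"
        using \<l> by (intro divide_right_mono supnorm_ge) auto
      then have "\<bar>real_of_int ((x - y) $ k) / \<l>\<bar> \<le> supnorm (x - y) / \<l>"
        using \<l> by (simp add: abs_divide)
      moreover have "cell y $ k = \<lfloor>real_of_int ((x - y) $ k) / \<l>\<rfloor>" by (simp add: cell_def)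
      ultimately show "\<bar>real_of_int (cell y $ k)\<bar> \<le> supnorm (x - y) / \<l> + 1" by linarith
    qed
    then have "\<tau> * supnorm (cell y) \<le> \<tau> * (supnorm (x - y) / \<l> + 1)"
      using \<tau> by (intro mult_left_mono) auto
    also have "\<dots> = b * supnorm (x - y) / sqrt v + \<tau>"
      using \<l> by (simp add: \<l>\<tau>[symmetric] algebra_simps)
    finally have "- b * supnorm (x - y) / sqrt v \<le> \<tau> + (- \<tau> * supnorm (cell y))" by simp
    then show ?thesis unfolding W_def exp_add[symmetric] by (intro ennreal_leI) simp
  qed
  have part: "l1 (\<lambda>y. ?q y * indicator {y. cell y = u} y) \<le> ennreal ?Q" for u
  proof (cases "\<exists>y0. cell y0 = u")
    case False
    then have "(\<lambda>y. ?q y * indicator {y. cell y = u} y) = (\<lambda>y. 0)" by (auto simp: fun_eq_iff)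
    then show ?thesis by simp
  next
    case True
    then obtain y0 where y0: "cell y0 = u" by blast
    show ?thesis
    proof (rule concentration_box[OF j \<mu>])
      fix y k assume "y \<in> {y. cell y = u}"
      then have "cell y $ k = cell y0 $ k" using y0 by simp
      then have "\<bar>real_of_int ((x - y) $ k) / \<l> - real_of_int ((x - y0) $ k) / \<l>\<bar> \<le> 1"
        by (simp add: cell_def) linarith
      then have "\<bar>(real_of_int ((x - y) $ k) - real_of_int ((x - y0) $ k)) / \<l>\<bar> \<le> 1"
        by (simp add: diff_divide_distrib)
      then have "\<bar>real_of_int ((x - y) $ k) - real_of_int ((x - y0) $ k)\<bar> \<le> \<l>"
        using \<l> by (simp add: abs_divide)
      then show "\<bar>real_of_int ((y - y0) $ k)\<bar> \<le> 1 / t"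
        by (simp add: \<l>_def abs_minus_commute)
    qed
  qed
  have "l1 (\<lambda>y. ?q y * ennreal (exp (- b * supnorm (x - y) / sqrt v))) \<le> l1 (\<lambda>y. ?q y * W (cell y))"
    by (intro l1_mono mult_left_mono weight) auto
  also have "\<dots> = l1 (\<lambda>y. l1 (\<lambda>u. if u = cell y then ?q y * W u else 0))"
    by (simp only: l1_single)
  also have "\<dots> = l1 (\<lambda>u. l1 (\<lambda>y. if u = cell y then ?q y * W u else 0))"
    by (rule l1_swap)
  also have "\<dots> = l1 (\<lambda>u. W u * l1 (\<lambda>y. ?q y * indicator {y. cell y = u} y))"
    unfolding l1_cmult[symmetric] by (intro arg_cong[of _ _ l1] ext) (auto split: split_indicator simp: mult.commute)
  also have "\<dots> \<le> l1 (\<lambda>u. W u * ennreal ?Q)"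
    by (intro l1_mono mult_left_mono part) auto
  also have "\<dots> = l1 W * ennreal ?Q" by (rule l1_multc)
  also have "\<dots> = ennreal (enn2real (l1 W) * ?Q)"
  proof -
    have W: "l1 W = ennreal (enn2real (l1 W))" using Wfin by simp
    have "0 \<le> ?Q" using box_const_pos by simp
    then show ?thesis by (subst W) (rule ennreal_mult[symmetric], auto)
  qed
  also have "\<dots> \<le> ennreal (conc_const b * exp (5 * (\<mu>\<^sup>2 * v) * real j) / sqrt (1 + real j) ^ ?d)"
  proof (rule ennreal_leI)
    have "sqrt (1 + real j) \<le> sqrt (4 * real j)" using j by (intro real_sqrt_le_mono) auto
    then have sq: "sqrt (1 + real j) \<le> 2 * sqrt (real j)" by (simp add: real_sqrt_mult)
    have "1 / sqrt (real j) ^ ?d \<le> 2 ^ ?d / sqrt (1 + real j) ^ ?d"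
    proof -
      have "sqrt (1 + real j) ^ ?d \<le> (2 * sqrt (real j)) ^ ?d" using sq by (intro power_mono) auto
      then show ?thesis using j by (simp add: power_mult_distrib field_simps)
    qed
    then have "(enn2real (l1 W) * box_const * exp (5 * (\<mu>\<^sup>2 * v) * real j)) * (1 / sqrt (real j) ^ ?d) \<le>
        (enn2real (l1 W) * box_const * exp (5 * (\<mu>\<^sup>2 * v) * real j)) * (2 ^ ?d / sqrt (1 + real j) ^ ?d)"
      using box_const_pos by (intro mult_left_mono) auto
    also have "\<dots> = (conc_const b - 1) * exp (5 * (\<mu>\<^sup>2 * v) * real j) / sqrt (1 + real j) ^ ?d"
      by (simp add: conc_const_def W_def[abs_def] \<tau>_def)
    also have "\<dots> \<le> conc_const b * exp (5 * (\<mu>\<^sup>2 * v) * real j) / sqrt (1 + real j) ^ ?d"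
      by (intro divide_right_mono mult_right_mono) auto
    finally show "enn2real (l1 W) * ?Q \<le> conc_const b * exp (5 * (\<mu>\<^sup>2 * v) * real j) / sqrt (1 + real j) ^ ?d"
      by simp
  qed
  finally show ?thesis .
qed

end

section \<open>Moments of symmetric functions\<close>

lemma lattice_symmetric_uminus:
  assumes "lattice_symmetric f" shows "f (- x) = f x"
proof -
  have "- x = (\<chi> k. (\<lambda>_. - 1) k * x $ k)" by (simp add: vec_eq_iff)
  moreover from assms have "\<forall>s x. (\<forall>i. s i \<in> {-1, 1}) \<longrightarrow> f (\<chi> i. s i * x $ i) = f x"
    unfolding lattice_symmetric_def by blast
  from this[rule_format, of "\<lambda>_. - 1" x] have "f (\<chi> k. (\<lambda>_. - 1) k * x $ k) = f x" by simp
  ultimately show ?thesis by simp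
qed

lemma lattice_symmetric_cmult:
  "lattice_symmetric f \<Longrightarrow> lattice_symmetric (\<lambda>x. (c::ennreal) * f x)"
  by (simp add: lattice_symmetric_def)

lemma conv_symmetric_bij:
  fixes f g :: "('d::finite) lattice \<Rightarrow> ennreal"
  assumes "bij h" "\<And>x y. h (x - y) = h x - h y" "\<And>x. f (h x) = f x" "\<And>x. g (h x) = g x"
  shows "conv f g (h x) = conv f g x"
proof -
  have "conv f g (h x) = l1 (\<lambda>y. f (h y) * g (h x - h y))"
    unfolding conv_eq by (rule l1_bij[OF assms(1), symmetric])
  then show ?thesis by (simp add: conv_eq assms(3,4) flip: assms(2))
qed

lemma lattice_symmetric_conv:
  fixes f g :: "('d::finite) lattice \<Rightarrow> ennreal"
  assumes f: "lattice_symmetric f" and g: "lattice_symmetric g"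
  shows "lattice_symmetric (conv f g)"
  unfolding lattice_symmetric_def
proof (intro conjI allI impI)
  fix p :: "'d \<Rightarrow> 'd" and x :: "'d lattice" assume p: "p permutes UNIV"
  show "conv f g (\<chi> i. x $ p i) = conv f g x"
  proof (rule conv_symmetric_bij[where h = "\<lambda>x. \<chi> i. x $ p i"])
    show "bij (\<lambda>x::'d lattice. \<chi> i. x $ p i)"
      by (rule bij_betw_byWitness[of _ "\<lambda>x. \<chi> i. x $ inv p i"]) (auto simp: vec_eq_iff permutes_inverses[OF p])
  qed (use f g p in \<open>auto simp: lattice_symmetric_def vec_eq_iff\<close>)
next
  fix s :: "'d \<Rightarrow> int" and x :: "'d lattice" assume s: "\<forall>i. s i \<in> {-1, 1}"
  show "conv f g (\<chi> i. s i * x $ i) = conv f g x"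
  proof (rule conv_symmetric_bij[where h = "\<lambda>x. \<chi> i. s i * x $ i"])
    have ss: "s i * (s i * z) = z" for i z using s[rule_format, of i] by auto
    show "bij (\<lambda>x::'d lattice. \<chi> i. s i * x $ i)"
      by (rule bij_betw_byWitness[of _ "\<lambda>x. \<chi> i. s i * x $ i"]) (auto simp: vec_eq_iff ss)
  qed (use f g s in \<open>auto simp: lattice_symmetric_def vec_eq_iff algebra_simps\<close>)
qed

lemma second_moment_coordinate:
  fixes f :: "('d::finite) lattice \<Rightarrow> ennreal"
  assumes "lattice_symmetric f"
  shows "second_moment f = of_nat CARD('d) * l1 (\<lambda>x. ennreal ((real_of_int (x $ i))\<^sup>2) * f x)"
proof -
  have eq: "l1 (\<lambda>x. ennreal ((real_of_int (x $ k))\<^sup>2) * f x) = l1 (\<lambda>x. ennreal ((real_of_int (x $ i))\<^sup>2) * f x)" for k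
  proof -
    let ?p = "Transposition.transpose i k"
    have p: "?p permutes UNIV" by (rule permutes_swap_id) auto
    have "bij (\<lambda>x::'d lattice. \<chi> m. x $ ?p m)"
      by (rule bij_betw_byWitness[of _ "\<lambda>x. \<chi> m. x $ ?p m"]) (auto simp: vec_eq_iff)
    then have "l1 (\<lambda>x. ennreal ((real_of_int (x $ i))\<^sup>2) * f x) =
        l1 (\<lambda>x. ennreal ((real_of_int ((\<chi> m. x $ ?p m) $ i))\<^sup>2) * f (\<chi> m. x $ ?p m))"
      by (rule l1_bij[symmetric])
    also have "\<dots> = l1 (\<lambda>x. ennreal ((real_of_int (x $ k))\<^sup>2) * f x)"
      using assms p unfolding lattice_symmetric_def by simp
    finally show ?thesis ..
  qed
  have "second_moment f = l1 (\<lambda>x. \<Sum>k\<in>UNIV. ennreal ((real_of_int (x $ k))\<^sup>2) * f x)"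
    unfolding second_moment_def norm2_sq by (simp add: sum_distrib_right flip: sum_ennreal)
  also have "\<dots> = (\<Sum>k\<in>(UNIV::'d set). l1 (\<lambda>x. ennreal ((real_of_int (x $ i))\<^sup>2) * f x))"
    unfolding l1_sum by (intro sum.cong refl eq)
  finally show ?thesis by simp
qed

lemma coordinate_parallelogram:
  "ennreal ((real_of_int ((y + z) $ i))\<^sup>2) + ennreal ((real_of_int ((y - z) $ i))\<^sup>2) =
    2 * ennreal ((real_of_int (y $ i))\<^sup>2) + 2 * ennreal ((real_of_int (z $ i))\<^sup>2)"
proof -
  have "(real_of_int ((y + z) $ i))\<^sup>2 + (real_of_int ((y - z) $ i))\<^sup>2 =
      2 * (real_of_int (y $ i))\<^sup>2 + 2 * (real_of_int (z $ i))\<^sup>2"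
    by (simp add: power2_eq_square algebra_simps)
  then show ?thesis
    by (metis (no_types, lifting) ennreal_mult' ennreal_numeral ennreal_plus mult_nonneg_nonneg zero_le_numeral zero_le_power2)
qed

definition hcosh :: "real \<Rightarrow> real" where "hcosh u = cosh u - 1 - u\<^sup>2 / 2"

lemma hcosh_nonneg: "0 \<le> hcosh u"
  and hcosh_le: "\<bar>u\<bar> \<le> 1 \<Longrightarrow> hcosh u \<le> u ^ 4"
proof -
  have S: "(\<lambda>n. if even n then u ^ n /\<^sub>R fact n else 0) sums cosh u"
    by (rule cosh_converges)
  have e3: "{..<3::nat} = {0, 1, 2}" by auto
  have s3: "(\<Sum>n<3. if even n then u ^ n /\<^sub>R fact n else 0) = 1 + u\<^sup>2 / 2"
    unfolding e3 by (simp add: fact_numeral)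
  have "(\<Sum>n<3. if even n then u ^ n /\<^sub>R fact n else 0) \<le> (\<Sum>n. if even n then u ^ n /\<^sub>R fact n else 0)"
    by (rule sum_le_suminf) (use S in \<open>auto simp: sums_iff zero_le_even_power\<close>)
  then show "0 \<le> hcosh u" unfolding s3 hcosh_def using S by (simp add: sums_iff)
  assume u: "\<bar>u\<bar> \<le> 1"
  obtain z where z: "\<bar>z\<bar> \<le> \<bar>u\<bar>"
    and z2: "cosh u = (\<Sum>m<4. (if even m then 1 else 0) / fact m * u ^ m) + cosh z / fact 4 * u ^ 4"
  proof -
    let ?diff = "\<lambda>m::nat. if even m then (cosh :: real \<Rightarrow> real) else sinh"
    have d: "\<forall>m z. DERIV (?diff m) z :> ?diff (Suc m) z"
      by (auto intro!: derivative_eq_intros)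
    have "\<exists>t. \<bar>t\<bar> \<le> \<bar>u\<bar> \<and> cosh u = (\<Sum>m<4. ?diff m 0 / fact m * u ^ m) + ?diff 4 t / fact 4 * u ^ 4"
      by (rule Maclaurin_all_le) (use d in auto)
    moreover have "?diff m 0 = (if even m then 1 else 0)" for m by simp
    ultimately show ?thesis using that by auto
  qed
  have e4: "{..<4::nat} = {0, 1, 2, 3}" by auto
  have "cosh z \<le> 24"
  proof -
    have "cosh z = cosh \<bar>z\<bar>" by simp
    also have "\<dots> \<le> exp \<bar>z\<bar>" by (simp add: cosh_def)
    also have "\<dots> \<le> exp 1" using z u by simp
    also have "\<dots> \<le> 3" by (rule exp_le)
    finally show ?thesis by simp
  qed
  then have "cosh z / 24 * u ^ 4 \<le> 1 * u ^ 4"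
    by (intro mult_right_mono) (auto simp: zero_le_even_power)
  then show "hcosh u \<le> u ^ 4"
    using z2 unfolding e4 hcosh_def by (simp add: fact_numeral)
qed

text \<open>Evenness replaces exp by cosh. Along the flow the mass and the variance are known
  exactly, so all uncertainty about exponential moments sits in the \<open>hcosh\<close>
  remainder.\<close>

lemma tilt_even:
  assumes even: "\<And>x. f (- x) = f x"
  shows "l1 (tilt i \<mu> f) = l1 f + ennreal (\<mu>\<^sup>2 / 2) * l1 (\<lambda>x. ennreal ((real_of_int (x $ i))\<^sup>2) * f x) +
     l1 (\<lambda>x. ennreal (hcosh (\<mu> * real_of_int (x $ i))) * f x)"
proof -
  let ?m = "\<lambda>x::'a lattice. \<mu> * real_of_int (x $ i)"
  have "2 * l1 (tilt i \<mu> f) = l1 (tilt i \<mu> f) + l1 (\<lambda>x. tilt i \<mu> f (- x))"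
    by (simp only: l1_uminus mult_2)
  also have "\<dots> = l1 (\<lambda>x. ennreal (exp (?m x)) * f x + ennreal (exp (- ?m x)) * f x)"
    unfolding l1_add by (simp add: tilt_def[abs_def] even)
  also have "\<dots> = l1 (\<lambda>x. 2 * (f x + ennreal (\<mu>\<^sup>2 / 2) * (ennreal ((real_of_int (x $ i))\<^sup>2) * f x) +
      ennreal (hcosh (?m x)) * f x))"
  proof (intro arg_cong[of _ _ l1] ext)
    fix x :: "'a lattice"
    have "exp (?m x) + exp (- ?m x) = 2 * (1 + \<mu>\<^sup>2 / 2 * (real_of_int (x $ i))\<^sup>2 + hcosh (?m x))"
      by (simp add: hcosh_def cosh_def power_mult_distrib)
    then have "ennreal (exp (?m x)) + ennreal (exp (- ?m x)) =
        ennreal (2 * (1 + \<mu>\<^sup>2 / 2 * (real_of_int (x $ i))\<^sup>2 + hcosh (?m x)))"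
      by (subst ennreal_plus[symmetric]) auto
    also have "\<dots> = ennreal 2 * (ennreal 1 + ennreal (\<mu>\<^sup>2 / 2) * ennreal ((real_of_int (x $ i))\<^sup>2) + ennreal (hcosh (?m x)))"
      by (simp only: ennreal_mult' ennreal_plus hcosh_nonneg ennreal_mult zero_le_power2 zero_le_numeral
        divide_nonneg_nonneg mult_nonneg_nonneg zero_le_one add_nonneg_nonneg)
    finally have "ennreal (exp (?m x)) + ennreal (exp (- ?m x)) =
       2 * (1 + ennreal (\<mu>\<^sup>2 / 2) * ennreal ((real_of_int (x $ i))\<^sup>2) + ennreal (hcosh (?m x)))"
      by simp
    then show "ennreal (exp (?m x)) * f x + ennreal (exp (- ?m x)) * f x =
      2 * (f x + ennreal (\<mu>\<^sup>2 / 2) * (ennreal ((real_of_int (x $ i))\<^sup>2) * f x) + ennreal (hcosh (?m x)) * f x)"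
      by (simp add: distrib_right[symmetric] mult.assoc[symmetric])
  qed
  also have "\<dots> = 2 * (l1 f + ennreal (\<mu>\<^sup>2 / 2) * l1 (\<lambda>x. ennreal ((real_of_int (x $ i))\<^sup>2) * f x) +
     l1 (\<lambda>x. ennreal (hcosh (?m x)) * f x))"
    by (simp only: l1_cmult l1_add)
  finally show ?thesis by (subst (asm) ennreal_mult_cancel_left) auto
qed

text \<open>The growth of the variance over one doubling of the mass, as used in
  \<open>H4_bound\<close>.\<close>

lemma two_powr_ge: "(19 / 10 :: real) \<le> 2 powr (1 - 2 * \<delta>)" if "0 \<le> \<delta>" "\<delta> \<le> 1 / 100" for \<delta> :: real
proof -
  have "(2::real) powr (1 - 2 * \<delta>) = 2 * exp (- 2 * \<delta> * ln 2)"
    by (simp add: powr_diff powr_def exp_minus field_simps flip: exp_add)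
  moreover have "1 - 1 / 50 \<le> 1 + (- 2 * \<delta> * ln 2)"
    using that ln_2_less_1 mult_mono[of \<delta> "1/100" "ln 2" 1] by simp
  moreover have "1 + (- 2 * \<delta> * ln 2) \<le> exp (- 2 * \<delta> * ln 2)" by (rule exp_ge_add_one_self)
  ultimately show ?thesis by linarith
qed

section \<open>The abstract renewal flow\<close>

text \<open>The interface between the differential inequalities and the random-walk argument: F is J
  convolved with G, X its mass and V its second moment. The two exponents express that log V grows
  between 2 (1 - \<delta>) and 2 / (1 - \<delta>) times as fast as log X.\<close>

locale flow =
  fixes F :: "real \<Rightarrow> ('d::finite) lattice \<Rightarrow> ennreal" and I :: "real set" and X V :: "real \<Rightarrow> real"
    and c0 \<sigma> \<delta> :: real
  assumes c0: "0 < c0" "c0 \<le> 1" and \<sigma>: "0 < \<sigma>" and \<delta>: "0 \<le> \<delta>" "\<delta> \<le> 1 / 100"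
    and I0: "0 \<in> I" and I_nonneg: "\<And>b. b \<in> I \<Longrightarrow> 0 \<le> b"
    and I_down: "\<And>a b. b \<in> I \<Longrightarrow> 0 \<le> a \<Longrightarrow> a \<le> b \<Longrightarrow> a \<in> I"
    and renewal: "\<And>a b x. b \<in> I \<Longrightarrow> 0 \<le> a \<Longrightarrow> a \<le> b \<Longrightarrow> F b x \<le> F a x + ennreal (b - a) * conv (F a) (F b) x"
    and F_mono: "\<And>a b x. b \<in> I \<Longrightarrow> 0 \<le> a \<Longrightarrow> a \<le> b \<Longrightarrow> F a x \<le> F b x"
    and sym: "\<And>b. b \<in> I \<Longrightarrow> lattice_symmetric (F b)"
    and mass: "\<And>b. b \<in> I \<Longrightarrow> l1 (F b) = ennreal (X b)"
    and second: "\<And>b. b \<in> I \<Longrightarrow> second_moment (F b) = ennreal (V b)"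
    and X0: "X 0 = 1" and V0: "V 0 = \<sigma>\<^sup>2"
    and X_pos: "\<And>b. b \<in> I \<Longrightarrow> 0 < X b" and V_pos: "\<And>b. b \<in> I \<Longrightarrow> 0 < V b"
    and X_cont: "continuous_on I X"
    and inv_lower: "\<And>a b. b \<in> I \<Longrightarrow> 0 \<le> a \<Longrightarrow> a \<le> b \<Longrightarrow> (1 - \<delta>) * (b - a) \<le> 1 / X a - 1 / X b"
    and xi_lower: "\<And>a b. b \<in> I \<Longrightarrow> 0 \<le> a \<Longrightarrow> a \<le> b \<Longrightarrow>
      V a / X a * (X b / X a) powr (1 - 2 * \<delta>) \<le> V b / X b"
    and xi_upper: "\<And>a b. b \<in> I \<Longrightarrow> 0 \<le> a \<Longrightarrow> a \<le> b \<Longrightarrow>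
      V b / X b \<le> V a / X a * (X b / X a) powr ((1 + \<delta>) / (1 - \<delta>))"
    and F0_bound: "\<And>x. F 0 x \<le> ennreal (real CARD('d) ^ CARD('d) / c0 / \<sigma> ^ CARD('d))"
    and F0_range: "\<And>x. F 0 x \<noteq> 0 \<Longrightarrow> supnorm x \<le> \<sigma> / c0"
begin

definition xi2 :: "real \<Rightarrow> real" where "xi2 b = V b / X b"

definition var :: "real \<Rightarrow> real" where "var b = xi2 b / real CARD('d)"

lemma xi2_pos: "b \<in> I \<Longrightarrow> 0 < xi2 b"
  using X_pos[of b] V_pos[of b] by (simp add: xi2_def)

lemma var_pos: "b \<in> I \<Longrightarrow> 0 < var b"
  using xi2_pos[of b] by (simp add: var_def)

lemma X_mono: "b \<in> I \<Longrightarrow> 0 \<le> a \<Longrightarrow> a \<le> b \<Longrightarrow> X a \<le> X b"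
proof -
  assume *: "b \<in> I" "0 \<le> a" "a \<le> b"
  have "0 \<le> (1 - \<delta>) * (b - a)" using * \<delta> by simp
  then have "1 / X b \<le> 1 / X a" using inv_lower[OF *] by simp
  then show ?thesis using X_pos[OF *(1)] X_pos[OF I_down[OF *]] by (simp add: field_simps)
qed

lemma X_ge_1: "b \<in> I \<Longrightarrow> 1 \<le> X b"
  using X_mono[of b 0] X0 I_nonneg[of b] by simp

lemma X_ratio:
  assumes "b \<in> I" "0 \<le> a" "a \<le> b" shows "1 \<le> X b / X a"
  using X_mono[OF assms] X_pos[OF I_down[OF assms]] by simp

text \<open>\<open>(b - a) * X a\<close> is the ratio of the series in \<open>geometric\<close>: the
  continuation probability of the walk whose steps are distributed as F at \<open>a\<close>.\<close>

lemma step_le: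
  assumes "b \<in> I" "0 \<le> a" "a \<le> b"
  shows "(b - a) * X a \<le> (1 - X a / X b) / (1 - \<delta>)"
proof -
  have Xa: "0 < X a" using X_pos[OF I_down[OF assms]] .
  have "(1 - \<delta>) * (b - a) * X a \<le> (1 / X a - 1 / X b) * X a"
    using inv_lower[OF assms] Xa by (intro mult_right_mono) auto
  also have "\<dots> = 1 - X a / X b" using Xa by (simp add: field_simps)
  finally show ?thesis using \<delta> by (simp add: field_simps)
qed

lemma coordinate_second:
  assumes "b \<in> I"
  shows "l1 (\<lambda>x. ennreal ((real_of_int (x $ i))\<^sup>2) * F b x) = ennreal (var b * X b)"
proof -
  have "of_nat CARD('d) * l1 (\<lambda>x. ennreal ((real_of_int (x $ i))\<^sup>2) * F b x) = ennreal (V b)"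
    using second_moment_coordinate[OF sym[OF assms], of i] second[OF assms] by simp
  also have "V b = real CARD('d) * (var b * X b)"
    using X_pos[OF assms] by (simp add: var_def xi2_def)
  also have "ennreal \<dots> = of_nat CARD('d) * ennreal (var b * X b)"
    by (simp add: ennreal_mult' ennreal_of_nat_eq_real_of_nat)
  finally show ?thesis by (subst (asm) ennreal_mult_cancel_left) auto
qed

lemma F_even: "b \<in> I \<Longrightarrow> F b (- x) = F b x"
  by (rule lattice_symmetric_uminus[OF sym])

abbreviation H4 :: "'d \<Rightarrow> real \<Rightarrow> ('d lattice \<Rightarrow> ennreal) \<Rightarrow> ennreal" where
  "H4 i \<mu> f \<equiv> l1 (\<lambda>x. ennreal (hcosh (\<mu> * real_of_int (x $ i))) * f x)"

lemma tilt_F: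
  assumes "b \<in> I"
  shows "l1 (tilt i \<mu> (F b)) = ennreal (X b * (1 + \<mu>\<^sup>2 * var b / 2)) + H4 i \<mu> (F b)"
proof -
  have "l1 (F b) + ennreal (\<mu>\<^sup>2 / 2) * ennreal (var b * X b) = ennreal (X b + \<mu>\<^sup>2 / 2 * (var b * X b))"
    unfolding mass[OF assms] using X_pos[OF assms] var_pos[OF assms]
    by (subst ennreal_plus) (auto simp flip: ennreal_mult')
  moreover have "X b + \<mu>\<^sup>2 / 2 * (var b * X b) = X b * (1 + \<mu>\<^sup>2 * var b / 2)" by (simp add: algebra_simps)
  ultimately show ?thesis
    using tilt_even[of "F b", OF F_even[OF assms], of i \<mu>] coordinate_second[OF assms, of i] by simp
qed

lemma geometric:
  assumes "b \<in> I" "0 \<le> a" "a \<le> b" and "(b - a) * X a < 1"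
  shows "F b x \<le> (\<Sum>j. ennreal (b - a) ^ j * cpow (F a) (Suc j) x)"
proof (rule renewal_le_geometric)
  show "F b x \<le> F a x + ennreal (b - a) * conv (F a) (F b) x" for x
    by (rule renewal[OF assms(1-3)])
  show "ennreal (b - a) * l1 (F a) < 1"
    using assms X_pos[OF I_down[OF assms(1-3)]] mass[OF I_down[OF assms(1-3)]]
    by (simp add: ennreal_less_one_iff flip: ennreal_mult)
  show "l1 (F b) < \<infinity>" using mass[OF assms(1)] by simp
qed

text \<open>One step of the recursion for the exponential moments. The quadratic term of \<open>cosh\<close> is split
  off, because it is the only part whose growth is known exactly; the remainder \<open>H4\<close> grows only
  linearly with the mass, up to quadratic errors, so it stays of order \<open>(\<mu>\<^sup>2 var)\<^sup>2\<close>.\<close>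

lemma H4_step:
  assumes ab: "b \<in> I" "0 \<le> a" "a \<le> b" and \<Lambda>: "X b \<le> 2 * X a"
    and w: "\<mu>\<^sup>2 * var a \<le> \<mu>\<^sup>2 * var b" "\<mu>\<^sup>2 * var a \<le> 1 / 100"
    and Na: "H4 i \<mu> (F a) \<le> ennreal (K * (\<mu>\<^sup>2 * var a)\<^sup>2 * X a)"
    and K: "0 \<le> K" "K * (\<mu>\<^sup>2 * var a) \<le> 1 / 2"
  shows "H4 i \<mu> (F b) \<le> ennreal ((43 / 10 * K * (\<mu>\<^sup>2 * var a)\<^sup>2) * X a + 6 / 10 * (\<mu>\<^sup>2 * var a) * (\<mu>\<^sup>2 * var b) * X b)"
proof -
  have aI: "a \<in> I" by (rule I_down[OF ab])
  define h where "h = b - a"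
  have h0: "0 \<le> h" using ab by (simp add: h_def)
  note pos = X_pos[OF aI] X_pos[OF ab(1)] var_pos[OF aI] var_pos[OF ab(1)]
  define wa where "wa = \<mu>\<^sup>2 * var a"
  define wb where "wb = \<mu>\<^sup>2 * var b"
  have wa0: "0 \<le> wa" and wb0: "0 \<le> wb" using pos by (simp_all add: wa_def wb_def)
  \<comment> \<open>Over at most one doubling the ratio is at most (1/2) / (99/100), safely below
    51/100. The room left under 1 absorbs the unknown \<open>nb\<close> at the end.\<close>
  have hXa: "h * X a \<le> 51 / 100"
  proof -
    have "1 / 2 \<le> X a / X b" using \<Lambda> pos by (simp add: field_simps)
    then have "1 - X a / X b \<le> 1 / 2" by linarith
    also have "\<dots> \<le> 51 / 100 * (1 - \<delta>)" using \<delta> by simp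
    finally have "(1 - X a / X b) / (1 - \<delta>) \<le> 51 / 100" using \<delta> by (simp add: divide_le_eq)
    with step_le[OF ab] show ?thesis unfolding h_def by (rule order_trans)
  qed
  have hXb: "h * X b \<le> 102 / 100"
    using hXa mult_left_mono[OF \<Lambda> h0] by simp
  define na where "na = enn2real (H4 i \<mu> (F a))"
  have na: "H4 i \<mu> (F a) = ennreal na" "0 \<le> na" "na \<le> K * wa\<^sup>2 * X a"
    using Na K pos unfolding na_def wa_def[symmetric]
    by (auto simp: enn2real_leI ennreal_enn2real_if top_unique intro!: mult_nonneg_nonneg)
  have na2: "na \<le> wa / 2 * X a"
  proof -
    have "K * wa\<^sup>2 * X a = (K * wa) * (wa * X a)" by (simp add: power2_eq_square)
    also have "\<dots> \<le> 1 / 2 * (wa * X a)"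
      using K wa0 pos unfolding wa_def by (intro mult_right_mono) auto
    finally show ?thesis using na by simp
  qed
  define Ma where "Ma = X a * (1 + wa / 2) + na"
  have Ma: "l1 (tilt i \<mu> (F a)) = ennreal Ma" "0 \<le> Ma"
    using tilt_F[OF aI, of i \<mu>] na wa0 pos unfolding Ma_def wa_def by (auto simp flip: ennreal_plus)
  have MaX: "Ma \<le> X a * (1 + wa)" using na2 by (simp add: Ma_def algebra_simps)
  have hMa: "h * Ma < 1"
  proof -
    have "h * Ma \<le> (h * X a) * (1 + wa)" using mult_left_mono[OF MaX h0] by simp
    also have "\<dots> \<le> 51 / 100 * (1 + 1 / 100)"
      using hXa w(2) wa0 h0 pos unfolding wa_def by (intro mult_mono) auto
    finally show ?thesis by simp
  qed
  \<comment> \<open>Finiteness must be known beforehand, because \<open>nb\<close> is later moved to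
    the left-hand side. It follows from the geometric series, whose tilted ratio
    \<open>h * Ma\<close> is still below 1.\<close>
  have Mb_fin: "l1 (tilt i \<mu> (F b)) < \<infinity>"
  proof -
    have "l1 (tilt i \<mu> (F b)) \<le> l1 (tilt i \<mu> (\<lambda>x. \<Sum>j. ennreal h ^ j * cpow (F a) (Suc j) x))"
      unfolding h_def using hXa by (intro l1_mono tilt_mono geometric[OF ab]) (auto simp: h_def)
    also have "\<dots> = (\<Sum>j. ennreal h ^ j * l1 (tilt i \<mu> (cpow (F a) (Suc j))))"
      unfolding tilt_def[abs_def]
      by (simp only: ennreal_suminf_cmult[symmetric] l1_suminf mult.left_commute[of "ennreal (exp _)"] l1_cmult)
    also have "\<dots> = (\<Sum>j. ennreal (Ma * (h * Ma) ^ j))"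
      unfolding l1_tilt_cpow Ma(1) using h0 Ma(2)
      by (simp add: ennreal_power ennreal_mult[symmetric] power_mult_distrib mult_ac)
    also have "\<dots> = ennreal (\<Sum>j. Ma * (h * Ma) ^ j)"
      using Ma h0 hMa by (intro suminf_ennreal2 summable_mult summable_geometric) auto
    finally show ?thesis by (simp add: order_le_less_trans)
  qed
  define nb where "nb = enn2real (H4 i \<mu> (F b))"
  have nb: "H4 i \<mu> (F b) = ennreal nb" "0 \<le> nb"
    using Mb_fin unfolding tilt_F[OF ab(1)] nb_def by (auto simp: ennreal_enn2real_if)
  define Mb where "Mb = X b * (1 + wb / 2) + nb"
  have Mb: "l1 (tilt i \<mu> (F b)) = ennreal Mb" "0 \<le> Mb"
    using tilt_F[OF ab(1), of i \<mu>] nb wb0 pos unfolding Mb_def wb_def by (auto simp flip: ennreal_plus)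
  let ?c = "conv (F a) (F b)"
  have c_even: "?c (- x) = ?c x" for x
    by (rule lattice_symmetric_uminus[OF lattice_symmetric_conv[OF sym[OF aI] sym[OF ab(1)]]])
  have c_tilt: "l1 (tilt i \<mu> ?c) = ennreal (Ma * Mb)"
  proof -
    have "tilt i \<mu> ?c = conv (tilt i \<mu> (F a)) (tilt i \<mu> (F b))" by (intro ext tilt_conv)
    then show ?thesis using Ma Mb by (simp add: l1_conv ennreal_mult)
  qed
  have c_second: "l1 (\<lambda>x. ennreal ((real_of_int (x $ i))\<^sup>2) * ?c x) = ennreal (var a * X a * X b + X a * (var b * X b))"
  proof -
    have "l1 (\<lambda>x. ennreal ((real_of_int (x $ i))\<^sup>2) * ?c x) =
       ennreal (var a * X a) * l1 (F b) + l1 (F a) * ennreal (var b * X b)"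
      unfolding coordinate_second[OF aI, of i, symmetric] coordinate_second[OF ab(1), of i, symmetric]
      by (rule l1_conv_parallelogram[where w = "\<lambda>x. ennreal ((real_of_int (x $ i))\<^sup>2)"])
         (rule coordinate_parallelogram, rule F_even[OF ab(1)])
    then show ?thesis using pos unfolding mass[OF aI] mass[OF ab(1)]
      by (subst ennreal_plus) (auto simp add: ennreal_mult)
  qed
  have split: "ennreal (Ma * Mb) = ennreal (X a * X b + \<mu>\<^sup>2 / 2 * (var a * X a * X b + X a * (var b * X b))) + H4 i \<mu> ?c"
  proof -
    have "l1 ?c + ennreal (\<mu>\<^sup>2 / 2) * ennreal (var a * X a * X b + X a * (var b * X b)) =
       ennreal (X a * X b + \<mu>\<^sup>2 / 2 * (var a * X a * X b + X a * (var b * X b)))"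
    proof -
      define c where "c = var a * X a * X b + X a * (var b * X b)"
      have c: "0 \<le> c" using pos by (simp add: c_def)
      have "ennreal (\<mu>\<^sup>2 / 2) * ennreal c = ennreal (\<mu>\<^sup>2 / 2 * c)"
        by (rule ennreal_mult'[symmetric]) simp
      moreover have "l1 ?c = ennreal (X a * X b)"
        unfolding l1_conv mass[OF aI] mass[OF ab(1)] using pos by (simp add: ennreal_mult)
      moreover have "ennreal (X a * X b) + ennreal (\<mu>\<^sup>2 / 2 * c) = ennreal (X a * X b + \<mu>\<^sup>2 / 2 * c)"
        by (rule ennreal_plus[symmetric]) (use pos c in auto)
      ultimately show ?thesis unfolding c_def by simp
    qed
    then show ?thesis
      using tilt_even[of ?c, OF c_even, of i \<mu>] unfolding c_tilt c_second by simp
  qed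
  define nc where "nc = enn2real (H4 i \<mu> ?c)"
  have nc: "H4 i \<mu> ?c = ennreal nc" "0 \<le> nc"
    using split unfolding nc_def by (auto simp: ennreal_enn2real_if add_top)
  have MM: "Ma * Mb = X a * X b + \<mu>\<^sup>2 / 2 * (var a * X a * X b + X a * (var b * X b)) + nc"
  proof -
    define A where "A = X a * X b + \<mu>\<^sup>2 / 2 * (var a * X a * X b + X a * (var b * X b))"
    have A: "0 \<le> A" using pos by (simp add: A_def)
    have "ennreal (Ma * Mb) = ennreal (A + nc)"
      using split unfolding nc(1) A_def[symmetric] ennreal_plus[OF A nc(2)] .
    then show ?thesis unfolding A_def[symmetric] using A nc(2) Ma(2) Mb(2) by (subst (asm) ennreal_inj) auto
  qed
  \<comment> \<open>Subtracting the exact mass and variance of the convolution cancels the constant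
    and quadratic parts of \<open>Ma * Mb\<close>. What survives is linear in \<open>na\<close> and
    \<open>nb\<close>, up to one product of small quantities.\<close>
  have nc_eq: "nc = na * X b + X a * nb + (X a * wa / 2 + na) * (X b * wb / 2 + nb)"
    using MM unfolding Ma_def Mb_def wa_def wb_def by (simp add: algebra_simps)
  have "H4 i \<mu> (F b) \<le> l1 (\<lambda>x. ennreal (hcosh (\<mu> * real_of_int (x $ i))) * F a x +
      ennreal h * (ennreal (hcosh (\<mu> * real_of_int (x $ i))) * ?c x))"
  proof (rule l1_mono)
    fix x
    have "F b x \<le> F a x + ennreal h * ?c x" using renewal[OF ab] by (simp add: h_def)
    then have "ennreal (hcosh (\<mu> * real_of_int (x $ i))) * F b x \<le>
        ennreal (hcosh (\<mu> * real_of_int (x $ i))) * (F a x + ennreal h * ?c x)"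
      by (rule mult_left_mono) simp
    then show "ennreal (hcosh (\<mu> * real_of_int (x $ i))) * F b x \<le> ennreal (hcosh (\<mu> * real_of_int (x $ i))) * F a x +
      ennreal h * (ennreal (hcosh (\<mu> * real_of_int (x $ i))) * ?c x)"
      by (simp add: distrib_left mult.left_commute)
  qed
  also have "\<dots> = ennreal (na + h * nc)"
    unfolding l1_add l1_cmult na(1) nc(1) using na nc h0 by (simp add: ennreal_mult)
  finally have "nb \<le> na + h * nc"
    unfolding nb(1) using na nc h0 by (subst (asm) ennreal_le_iff) auto
  define s where "s = X a * wa / 2 + na"
    have s: "0 \<le> s" "s \<le> X a * wa" using na na2 wa0 pos by (simp_all add: s_def mult.commute)
  have hs: "h * s \<le> 51 / 100 * wa"
    using mult_left_mono[OF s(2) h0] mult_right_mono[OF hXa wa0] by simp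
  have hs2: "h * s \<le> 51 / 10000" using hs w(2) by (simp add: wa_def)
  have "nb \<le> na + (h * X b) * na + (h * X a) * nb + (h * s) * (X b * wb / 2) + (h * s) * nb"
    using \<open>nb \<le> na + h * nc\<close> unfolding nc_eq s_def[symmetric] by (simp add: algebra_simps)
  moreover have "(h * X b) * na \<le> 102 / 100 * na" using hXb na by (intro mult_right_mono) auto
  moreover have "(h * X a) * nb \<le> 51 / 100 * nb" using hXa nb by (intro mult_right_mono) auto
  moreover have "(h * s) * nb \<le> 51 / 10000 * nb" using hs2 nb by (intro mult_right_mono) auto
  moreover have "(h * s) * (X b * wb / 2) \<le> 51 / 200 * (wa * wb * X b)"
  proof -
    have "(h * s) * (X b * wb / 2) \<le> 51 / 100 * wa * (X b * wb / 2)"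
      using hs pos wb0 by (intro mult_right_mono) auto
    also have "\<dots> = 51 / 200 * (wa * wb * X b)" by simp
    finally show ?thesis .
  qed
  \<comment> \<open>The terms in \<open>nb\<close> on the right have total coefficient below 52/100
    and are absorbed. Dividing by 48/100 gives the rounded constants 43/10 and 6/10.\<close>
  ultimately have "48 / 100 * nb \<le> 202 / 100 * na + 51 / 200 * (wa * wb * X b)"
    using nb(2) by linarith
  then have "nb \<le> 43 / 10 * na + 6 / 10 * (wa * wb * X b)"
    using na(2) wa0 wb0 pos mult_nonneg_nonneg[OF mult_nonneg_nonneg[OF wa0 wb0], of "X b"] by linarith
  also have "\<dots> \<le> 43 / 10 * (K * wa\<^sup>2 * X a) + 6 / 10 * (wa * wb * X b)"
    using na by simp
  finally show ?thesis unfolding nb(1) wa_def wb_def by (intro ennreal_leI) (simp add: mult_ac)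
qed

lemma xi2_mono:
  assumes "b \<in> I" "0 \<le> a" "a \<le> b" shows "xi2 a \<le> xi2 b"
proof -
  have "1 \<le> (X b / X a) powr (1 - 2 * \<delta>)"
    using X_ratio[OF assms] \<delta> by (intro ge_one_powr_ge_zero) auto
  then have "xi2 a * 1 \<le> xi2 a * (X b / X a) powr (1 - 2 * \<delta>)"
    using xi2_pos[OF I_down[OF assms]] by (intro mult_left_mono) auto
  then show ?thesis using xi_lower[OF assms] by (simp add: xi2_def)
qed

lemma X_intermediate:
  assumes "b \<in> I" "1 \<le> y" "y \<le> X b"
  obtains a where "0 \<le> a" "a \<le> b" "X a = y"
proof -
  have "{0..b} \<subseteq> I" using I_down[OF assms(1)] by auto
  then have "continuous_on {0..b} X" using X_cont continuous_on_subset by blast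
  then obtain a where "0 \<le> a" "a \<le> b" "X a = y"
    using IVT'[of X 0 y b] assms X0 I_nonneg[OF assms(1)] by auto
  then show ?thesis using that by blast
qed

text \<open>\<open>Y0\<close> comes from the kernel itself: on the support of F at 0 coordinates are
  at most \<sigma> / c0 while the variance is \<sigma>^2 / d, so (\<mu> x_i)^2 is at most Y0 times
  \<mu>^2 times the variance. \<open>Y1\<close> exceeds 43/10 Y0 + 6/10, the output of one
  \<open>H4_step\<close>, and \<open>w0\<close> restricts the tilt until the quartic remainder is
  negligible against the quadratic term.\<close>

definition Y0 :: real where "Y0 = real CARD('d) / c0\<^sup>2"
definition Y1 :: real where "Y1 = 43 / 10 * Y0 + 2"
definition w0 :: real where "w0 = 1 / (100 * Y1)"

lemma Y_bounds: "0 < Y0" "2 \<le> Y1" "0 < w0" "w0 \<le> 1 / 200" "Y1 * w0 = 1 / 100" "Y0 * w0 \<le> 1 / 100"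
proof -
  show Y0: "0 < Y0" using c0 by (simp add: Y0_def)
  then show Y1: "2 \<le> Y1" by (simp add: Y1_def)
  then show w: "0 < w0" "w0 \<le> 1 / 200" "Y1 * w0 = 1 / 100" by (simp_all add: w0_def field_simps)
  have "Y0 \<le> Y1" using Y0 by (simp add: Y1_def)
  then have "Y0 * w0 \<le> Y1 * w0" using w by (intro mult_right_mono) auto
  then show "Y0 * w0 \<le> 1 / 100" using w by simp
qed

lemma H4_zero:
  assumes w: "\<mu>\<^sup>2 * var 0 \<le> w0"
  shows "H4 i \<mu> (F 0) \<le> ennreal (Y0 * (\<mu>\<^sup>2 * var 0)\<^sup>2 * X 0)"
proof -
  define w where "w = \<mu>\<^sup>2 * var 0"
  have v0: "var 0 = \<sigma>\<^sup>2 / real CARD('d)" by (simp add: var_def xi2_def X0 V0)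
  have w_nonneg: "0 \<le> w" using var_pos[OF I0] by (simp add: w_def)
  have "H4 i \<mu> (F 0) \<le> l1 (\<lambda>x. ennreal (w * Y0 * \<mu>\<^sup>2) * (ennreal ((real_of_int (x $ i))\<^sup>2) * F 0 x))"
  proof (rule l1_mono)
    fix x
    show "ennreal (hcosh (\<mu> * real_of_int (x $ i))) * F 0 x \<le>
       ennreal (w * Y0 * \<mu>\<^sup>2) * (ennreal ((real_of_int (x $ i))\<^sup>2) * F 0 x)"
    proof (cases "F 0 x = 0")
      case False
      define u where "u = \<mu> * real_of_int (x $ i)"
      have "\<bar>real_of_int (x $ i)\<bar> \<le> \<sigma> / c0" using F0_range[OF False] supnorm_ge[of x i] by simp
      then have "(real_of_int (x $ i))\<^sup>2 \<le> (\<sigma> / c0)\<^sup>2"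
        by (metis abs_ge_zero power2_abs power_mono)
      then have "\<mu>\<^sup>2 * (real_of_int (x $ i))\<^sup>2 \<le> \<mu>\<^sup>2 * (\<sigma> / c0)\<^sup>2" by (rule mult_left_mono) simp
      also have "\<dots> = w * Y0" using c0 by (simp add: w_def v0 Y0_def power_divide)
      finally have u2: "u\<^sup>2 \<le> w * Y0" by (simp add: u_def power_mult_distrib)
      also have "\<dots> \<le> 1"
      proof -
        have "w * Y0 \<le> w0 * Y0" using assms Y_bounds(1) unfolding w_def by (intro mult_right_mono) auto
        also have "\<dots> \<le> 1" using Y_bounds(6) by (simp add: mult.commute)
        finally show ?thesis .
      qed
      finally have "\<bar>u\<bar> \<le> 1" by (simp add: abs_square_le_1)
      then have "hcosh u \<le> u ^ 4" by (rule hcosh_le)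
      also have "\<dots> = u\<^sup>2 * u\<^sup>2" by (simp flip: power_add)
      also have "\<dots> \<le> w * Y0 * u\<^sup>2" using u2 by (intro mult_right_mono) auto
      finally have "hcosh u \<le> (w * Y0 * \<mu>\<^sup>2) * (real_of_int (x $ i))\<^sup>2"
        by (simp add: u_def power_mult_distrib)
      then have "ennreal (hcosh u) \<le> ennreal (w * Y0 * \<mu>\<^sup>2) * ennreal ((real_of_int (x $ i))\<^sup>2)"
        by (subst ennreal_mult[symmetric]) (use w_nonneg Y_bounds(1) in \<open>auto intro!: ennreal_leI mult_nonneg_nonneg\<close>)
      then show ?thesis unfolding u_def mult.assoc[symmetric] by (rule mult_right_mono) simp
    qed simp
  qed
  also have "\<dots> = ennreal (w * Y0 * \<mu>\<^sup>2) * ennreal (var 0 * X 0)"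
    unfolding l1_cmult coordinate_second[OF I0] ..
  also have "\<dots> = ennreal (Y0 * w\<^sup>2 * X 0)"
  proof -
    have "0 \<le> w * Y0 * \<mu>\<^sup>2" using w_nonneg Y_bounds(1) by simp
    then have "ennreal (w * Y0 * \<mu>\<^sup>2) * ennreal (var 0 * X 0) = ennreal ((w * Y0 * \<mu>\<^sup>2) * (var 0 * X 0))"
      by (rule ennreal_mult'[symmetric])
    also have "(w * Y0 * \<mu>\<^sup>2) * (var 0 * X 0) = Y0 * w\<^sup>2 * X 0"
      by (simp add: w_def power2_eq_square)
    finally show ?thesis .
  qed
  finally show ?thesis by (simp add: w_def)
qed

lemma var_mono: "b \<in> I \<Longrightarrow> 0 \<le> a \<Longrightarrow> a \<le> b \<Longrightarrow> var a \<le> var b"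
  using xi2_mono[of b a] by (simp add: var_def divide_right_mono)

text \<open>Masses in [1, 2] are reached from parameter 0 in a single step. They form the base case
  because X starts at 1, so smaller masses cannot be halved; only here does the constant worsen from
  \<open>Y0\<close> to \<open>Y1\<close>.\<close>

lemma H4_bound_2:
  assumes b: "b \<in> I" and X2: "X b \<le> 2" and wb: "\<mu>\<^sup>2 * var b \<le> w0"
  shows "H4 i \<mu> (F b) \<le> ennreal (Y1 * (\<mu>\<^sup>2 * var b)\<^sup>2 * X b)"
proof -
  have b0: "0 \<le> b" using I_nonneg[OF b] .
  have wab: "\<mu>\<^sup>2 * var 0 \<le> \<mu>\<^sup>2 * var b" using var_mono[OF b _ b0] by (intro mult_left_mono) auto
  have wa: "\<mu>\<^sup>2 * var 0 \<le> w0" using wab wb by simp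
  have wa0: "0 \<le> \<mu>\<^sup>2 * var 0" using var_pos[OF I0] by simp
  have "Y0 * (\<mu>\<^sup>2 * var 0) \<le> Y0 * w0" using wa Y_bounds(1) by (intro mult_left_mono) auto
  then have K: "Y0 * (\<mu>\<^sup>2 * var 0) \<le> 1 / 2" using Y_bounds(6) by linarith
  have "H4 i \<mu> (F b) \<le> ennreal ((43 / 10 * Y0 * (\<mu>\<^sup>2 * var 0)\<^sup>2) * X 0 + 6 / 10 * (\<mu>\<^sup>2 * var 0) * (\<mu>\<^sup>2 * var b) * X b)"
    by (rule H4_step[OF b _ b0 _ wab _ H4_zero[OF wa] _ K]) (use X0 X2 wa Y_bounds in auto)
  also have "\<dots> \<le> ennreal (Y1 * (\<mu>\<^sup>2 * var b)\<^sup>2 * X b)"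
  proof (rule ennreal_leI)
    have sq: "(\<mu>\<^sup>2 * var 0)\<^sup>2 \<le> (\<mu>\<^sup>2 * var b)\<^sup>2" using wab wa0 by (rule power_mono)
    have "43 / 10 * Y0 * (\<mu>\<^sup>2 * var 0)\<^sup>2 * X 0 \<le> 43 / 10 * Y0 * (\<mu>\<^sup>2 * var b)\<^sup>2 * X b"
      using sq Y_bounds(1) X0 X_ge_1[OF b] by (intro mult_mono) auto
    moreover have "6 / 10 * (\<mu>\<^sup>2 * var 0) * (\<mu>\<^sup>2 * var b) * X b \<le> 6 / 10 * (\<mu>\<^sup>2 * var b) * (\<mu>\<^sup>2 * var b) * X b"

    proof -
      have "(\<mu>\<^sup>2 * var 0) * (\<mu>\<^sup>2 * var b * X b) \<le> (\<mu>\<^sup>2 * var b) * (\<mu>\<^sup>2 * var b * X b)"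
        using wab by (rule mult_right_mono) (use X_pos[OF b] var_pos[OF b] in simp)
      then have "6 / 10 * ((\<mu>\<^sup>2 * var 0) * (\<mu>\<^sup>2 * var b * X b)) \<le> 6 / 10 * ((\<mu>\<^sup>2 * var b) * (\<mu>\<^sup>2 * var b * X b))"
        by linarith
      then show ?thesis by (simp only: mult.assoc)
    qed
    moreover have "0 \<le> (\<mu>\<^sup>2 * var b)\<^sup>2 * X b" using X_pos[OF b] by simp
    ultimately show "43 / 10 * Y0 * (\<mu>\<^sup>2 * var 0)\<^sup>2 * X 0 + 6 / 10 * (\<mu>\<^sup>2 * var 0) * (\<mu>\<^sup>2 * var b) * X b \<le>
        Y1 * (\<mu>\<^sup>2 * var b)\<^sup>2 * X b"
      unfolding Y1_def by (simp add: algebra_simps power2_eq_square)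
  qed
  finally show ?thesis .
qed

text \<open>Over one doubling the variance grows by 19/10 at least. Relative to the squared variance
  and the mass, the factor 43/10 of \<open>H4_step\<close> becomes 43/20 (10/19)^2 < 3/5 and the
  source 6/10 becomes 6/19, so any constant of at least 2 that has been reached reproduces itself
  through all \<open>k\<close> doublings.\<close>

lemma H4_bound:
  assumes "b \<in> I" "X b \<le> 2 ^ k" "\<mu>\<^sup>2 * var b \<le> w0"
  shows "H4 i \<mu> (F b) \<le> ennreal (Y1 * (\<mu>\<^sup>2 * var b)\<^sup>2 * X b)"
  using assms
proof (induction k arbitrary: b)
  case (0 b)
  then show ?case by (intro H4_bound_2) auto
next
  case (Suc k b)
  show ?case
  proof (cases "X b \<le> 2")
    case True
    then show ?thesis using Suc by (intro H4_bound_2) auto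
  next
    case False
    then obtain a where a: "0 \<le> a" "a \<le> b" "X a = X b / 2"
      using X_intermediate[OF Suc.prems(1), of "X b / 2"] by auto
    note ab = Suc.prems(1) a(1,2)
    have aI: "a \<in> I" by (rule I_down[OF ab])
    have wab: "\<mu>\<^sup>2 * var a \<le> \<mu>\<^sup>2 * var b" using var_mono[OF ab] by (intro mult_left_mono) auto
    have wa: "\<mu>\<^sup>2 * var a \<le> w0" using wab Suc.prems(3) by simp
    have wa0: "0 \<le> \<mu>\<^sup>2 * var a" using var_pos[OF aI] by simp
    have Na: "H4 i \<mu> (F a) \<le> ennreal (Y1 * (\<mu>\<^sup>2 * var a)\<^sup>2 * X a)"
      by (rule Suc.IH[OF aI _ wa]) (use a Suc.prems in auto)
    have "Y1 * (\<mu>\<^sup>2 * var a) \<le> Y1 * w0" using wa Y_bounds(2) by (intro mult_left_mono) auto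
    then have K: "Y1 * (\<mu>\<^sup>2 * var a) \<le> 1 / 2" using Y_bounds(5) by linarith
    have "H4 i \<mu> (F b) \<le> ennreal ((43 / 10 * Y1 * (\<mu>\<^sup>2 * var a)\<^sup>2) * X a + 6 / 10 * (\<mu>\<^sup>2 * var a) * (\<mu>\<^sup>2 * var b) * X b)"
      by (rule H4_step[OF ab _ wab _ Na _ K]) (use a wa Y_bounds in auto)
    also have "\<dots> \<le> ennreal (Y1 * (\<mu>\<^sup>2 * var b)\<^sup>2 * X b)"
    proof (rule ennreal_leI)
      have "xi2 a * (19 / 10) \<le> xi2 a * 2 powr (1 - 2 * \<delta>)"
        using two_powr_ge[OF \<delta>] xi2_pos[OF aI] by (intro mult_left_mono) auto
      also have "\<dots> \<le> xi2 b"
      proof -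
        have "X b / X a = 2" using a(3) X_pos[OF ab(1)] by (simp add: field_simps)
        then show ?thesis using xi_lower[OF ab] unfolding xi2_def by metis
      qed
      finally have "19 / 10 * var a \<le> var b" by (simp add: var_def field_simps)
      then have "\<mu>\<^sup>2 * (19 / 10 * var a) \<le> \<mu>\<^sup>2 * var b" by (rule mult_left_mono) simp
      then have r: "19 / 10 * (\<mu>\<^sup>2 * var a) \<le> \<mu>\<^sup>2 * var b" by simp
      define p q where "p = \<mu>\<^sup>2 * var a" and "q = \<mu>\<^sup>2 * var b"
      have pq: "0 \<le> p" "p \<le> 10 / 19 * q" using r wa0 by (auto simp: p_def q_def)
      have q0: "0 \<le> q" using pq by simp
      have "p\<^sup>2 \<le> (10 / 19 * q)\<^sup>2" using pq(2,1) by (rule power_mono)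
      then have p2: "p\<^sup>2 \<le> 100 / 361 * q\<^sup>2" by (simp add: power_divide power_mult_distrib)
      have pq2: "p * q \<le> 10 / 19 * q\<^sup>2" using mult_right_mono[OF pq(2) q0] by (simp add: power2_eq_square)
      have "43 / 20 * Y1 * p\<^sup>2 + 6 / 10 * (p * q) \<le> 43 / 20 * Y1 * (100 / 361 * q\<^sup>2) + 6 / 10 * (10 / 19 * q\<^sup>2)"
        using p2 pq2 Y_bounds(2) by (intro add_mono mult_left_mono) auto
      also have "\<dots> = (4300 / 7220 * Y1 + 6 / 19) * q\<^sup>2" by (simp add: algebra_simps)
      also have "\<dots> \<le> Y1 * q\<^sup>2" using Y_bounds(2) by (intro mult_right_mono) auto
      finally have "(43 / 20 * Y1 * p\<^sup>2 + 6 / 10 * (p * q)) * X b \<le> Y1 * q\<^sup>2 * X b"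
        using X_pos[OF ab(1)] by (intro mult_right_mono) auto
      then show "43 / 10 * Y1 * (\<mu>\<^sup>2 * var a)\<^sup>2 * X a + 6 / 10 * (\<mu>\<^sup>2 * var a) * (\<mu>\<^sup>2 * var b) * X b \<le>
          Y1 * (\<mu>\<^sup>2 * var b)\<^sup>2 * X b"
        unfolding a(3) p_def q_def by (simp add: algebra_simps)
    qed
    finally show ?thesis .
  qed
qed

definition p :: "real \<Rightarrow> 'd lattice \<Rightarrow> ennreal" where
  "p b x = ennreal (1 / X b) * F b x"

lemma F_eq_p: "b \<in> I \<Longrightarrow> F b x = ennreal (X b) * p b x"
  using X_pos[of b] by (simp add: p_def mult.assoc[symmetric] ennreal_mult[symmetric])

text \<open>The exact quadratic coefficient is 1/2. Since Y1 w0 = 1/100, the quartic remainder fits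
  into the other half.\<close>

lemma tilt_p:
  assumes "b \<in> I" "\<mu>\<^sup>2 * var b \<le> w0"
  shows "l1 (tilt i \<mu> (p b)) \<le> ennreal (1 + \<mu>\<^sup>2 * var b)"
proof -
  define w where "w = \<mu>\<^sup>2 * var b"
  have w_nonneg: "0 \<le> w" using var_pos[OF assms(1)] by (simp add: w_def)
  have "X b \<le> real (nat \<lceil>X b\<rceil>)" by linarith
  also have "\<dots> < 2 ^ nat \<lceil>X b\<rceil>" by (rule of_nat_less_two_power)
  finally have "X b < 2 ^ nat \<lceil>X b\<rceil>" .
  then have N: "H4 i \<mu> (F b) \<le> ennreal (Y1 * w\<^sup>2 * X b)"
    unfolding w_def by (intro H4_bound[OF assms(1) less_imp_le assms(2)])
  have "l1 (tilt i \<mu> (F b)) \<le> ennreal (X b * (1 + w / 2)) + ennreal (Y1 * w\<^sup>2 * X b)"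
    unfolding tilt_F[OF assms(1)] using N by (simp add: w_def add_left_mono)
  also have "\<dots> = ennreal (X b * (1 + w / 2 + Y1 * w\<^sup>2))"
    using w_nonneg X_pos[OF assms(1)] Y_bounds(2)
    by (subst ennreal_plus[symmetric]) (auto simp: algebra_simps)
  also have "\<dots> \<le> ennreal (X b * (1 + w))"
  proof (intro ennreal_leI mult_left_mono)
    have "Y1 * w\<^sup>2 = (Y1 * w) * w" by (simp add: power2_eq_square)
    also have "\<dots> \<le> (Y1 * w0) * w"
      using assms(2) w_nonneg Y_bounds(2) unfolding w_def by (intro mult_right_mono mult_left_mono) auto
    also have "\<dots> \<le> w / 2" unfolding Y_bounds(5) using w_nonneg by simp
    finally show "1 + w / 2 + Y1 * w\<^sup>2 \<le> 1 + w" by simp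
  qed (use X_pos[OF assms(1)] in auto)
  finally have "l1 (tilt i \<mu> (F b)) \<le> ennreal (X b * (1 + w))" .
  then have "ennreal (1 / X b) * l1 (tilt i \<mu> (F b)) \<le> ennreal (1 / X b) * ennreal (X b * (1 + w))"
    by (rule mult_left_mono) simp
  also have "\<dots> = ennreal (1 + w)"
    using X_pos[OF assms(1)] w_nonneg by (subst ennreal_mult[symmetric]) auto
  finally show ?thesis
    by (simp add: p_def[abs_def] tilt_def[abs_def] mult.left_commute l1_cmult w_def)
qed

definition \<kappa> :: real where "\<kappa> = sqrt w0"

text \<open>\<open>\<kappa>\<close> is a function of d and c0, so every estimate of
  \<open>subgaussian\<close> holds uniformly in \<open>b\<close> once lengths are measured in units
  of \<open>sqrt (var b)\<close>.\<close>

lemma subgaussian_p: "b \<in> I \<Longrightarrow> subgaussian (p b) (var b) \<kappa>"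
proof
  assume b: "b \<in> I"
  note pos = X_pos[OF b] var_pos[OF b]
  show "l1 (p b) = 1"
    using pos by (simp add: p_def[abs_def] l1_cmult mass[OF b] ennreal_mult[symmetric])
  show "lattice_symmetric (p b)"
    unfolding p_def[abs_def] by (rule lattice_symmetric_cmult[OF sym[OF b]])
  show "0 < var b" by (rule pos)
  show "0 < \<kappa>" "\<kappa> \<le> 1" using Y_bounds by (simp_all add: \<kappa>_def)
  show "l1 (\<lambda>x. ennreal ((real_of_int (x $ k))\<^sup>2) * p b x) = ennreal (var b)" for k
    using pos coordinate_second[OF b, of k]
    by (simp add: p_def mult.left_commute l1_cmult ennreal_mult[symmetric])
  show "l1 (tilt k \<mu> (p b)) \<le> ennreal (1 + \<mu>\<^sup>2 * var b)" if "\<mu>\<^sup>2 * var b \<le> \<kappa>\<^sup>2" for k \<mu>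
    using that Y_bounds by (intro tilt_p[OF b]) (simp add: \<kappa>_def)
qed

end

section \<open>Powers of a geometric series\<close>

lemma ennreal_suminf_swap:
  fixes g :: "nat \<Rightarrow> nat \<Rightarrow> ennreal"
  shows "(\<Sum>l. \<Sum>n. g l n) = (\<Sum>n. \<Sum>l. g l n)"
  unfolding nn_integral_count_space_nat[symmetric]
  by (rule nn_integral_count_space_nn_integral) auto

lemma ennreal_suminf_shift:
  fixes H :: "nat \<Rightarrow> ennreal"
  shows "(\<Sum>j. H j) = (\<Sum>n. if l \<le> n then H (n - l) else 0)"
proof -
  have "(\<Sum>n. if l \<le> n then H (n - l) else 0) =
      (\<Sum>n. if l \<le> n + l then H (n + l - l) else 0) + (\<Sum>n<l. if l \<le> n then H (n - l) else 0)"
    by (rule suminf_offset) auto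
  also have "(\<Sum>n<l. if l \<le> n then H (n - l) else 0) = 0" by (intro sum.neutral) auto
  finally show ?thesis by simp
qed

lemma ennreal_suminf_triangle:
  fixes G :: "nat \<Rightarrow> nat \<Rightarrow> ennreal"
  shows "(\<Sum>l. \<Sum>j. G l j) = (\<Sum>n. \<Sum>l\<le>n. G l (n - l))"
proof -
  have "(\<Sum>l. \<Sum>j. G l j) = (\<Sum>l. \<Sum>n. if l \<le> n then G l (n - l) else 0)"
    by (intro suminf_cong ennreal_suminf_shift)
  also have "\<dots> = (\<Sum>n. \<Sum>l. if l \<le> n then G l (n - l) else 0)"
    by (rule ennreal_suminf_swap)
  also have "\<dots> = (\<Sum>n. \<Sum>l\<le>n. G l (n - l))"
  proof (intro suminf_cong)
    fix n
    have "(\<Sum>l. if l \<le> n then G l (n - l) else 0) = (\<Sum>l\<in>{..n}. if l \<le> n then G l (n - l) else 0)"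
      by (rule suminf_finite) auto
    then show "(\<Sum>l. if l \<le> n then G l (n - l) else 0) = (\<Sum>l\<le>n. G l (n - l))" by simp
  qed
  finally show ?thesis .
qed

text \<open>The exact coefficient counts the ways to write \<open>j\<close> as an ordered sum of
  \<open>Suc r\<close> nonnegative terms, a binomial coefficient. \<open>Suc j ^ r\<close> is a
  crude bound for it of the right polynomial order.\<close>

lemma cpow_geometric_le:
  fixes f :: "('d::finite) lattice \<Rightarrow> ennreal"
  shows "cpow (\<lambda>x. \<Sum>j. \<alpha> ^ j * cpow f (Suc j) x) (Suc r) x \<le>
    (\<Sum>j. of_nat (Suc j) ^ r * \<alpha> ^ j * cpow f (Suc r + j) x)"
proof (induction r arbitrary: x)
  case 0
  show ?case by simp
next
  case (Suc r)
  let ?g = "\<lambda>x. \<Sum>j. \<alpha> ^ j * cpow f (Suc j) x"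
  have "cpow ?g (Suc (Suc r)) x = conv ?g (cpow ?g (Suc r)) x" by (rule fun_cong[OF cpow.simps(2)])
  also have "\<dots> \<le> conv ?g (\<lambda>x. \<Sum>j. of_nat (Suc j) ^ r * \<alpha> ^ j * cpow f (Suc r + j) x) x"
    by (rule conv_mono) (use Suc in auto)
  also have "\<dots> = (\<Sum>l. \<Sum>j. \<alpha> ^ l * (of_nat (Suc j) ^ r * \<alpha> ^ j * cpow f (Suc l + (Suc r + j)) x))"
    unfolding conv_suminf_left conv_suminf_right conv_cmult_left conv_cmult_right cpow_add
    by (simp only: ennreal_suminf_cmult)
  also have "\<dots> = (\<Sum>n. \<Sum>l\<le>n. \<alpha> ^ l * (of_nat (Suc (n - l)) ^ r * \<alpha> ^ (n - l) * cpow f (Suc l + (Suc r + (n - l))) x))"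
    by (rule ennreal_suminf_triangle)
  also have "\<dots> \<le> (\<Sum>n. of_nat (Suc n) ^ Suc r * \<alpha> ^ n * cpow f (Suc (Suc r) + n) x)"
  proof (intro suminf_le)
    fix n
    have "(\<Sum>l\<le>n. \<alpha> ^ l * (of_nat (Suc (n - l)) ^ r * \<alpha> ^ (n - l) * cpow f (Suc l + (Suc r + (n - l))) x)) \<le>
      (\<Sum>l\<le>n. of_nat (Suc n) ^ r * \<alpha> ^ n * cpow f (Suc (Suc r) + n) x)"
    proof (rule sum_mono)
      fix l assume "l \<in> {..n}"
      then have l: "l \<le> n" by simp
      have e: "\<alpha> ^ l * \<alpha> ^ (n - l) = \<alpha> ^ n" using l by (simp flip: power_add)
      have i: "Suc l + (Suc r + (n - l)) = Suc (Suc r) + n" using l by simp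
      have "(of_nat (Suc (n - l)) :: ennreal) ^ r \<le> of_nat (Suc n) ^ r" by (intro power_mono of_nat_mono) auto
      then have "of_nat (Suc (n - l)) ^ r * (\<alpha> ^ n * cpow f (Suc (Suc r) + n) x) \<le>
          of_nat (Suc n) ^ r * (\<alpha> ^ n * cpow f (Suc (Suc r) + n) x)"
        by (rule mult_right_mono) simp
      then show "\<alpha> ^ l * (of_nat (Suc (n - l)) ^ r * \<alpha> ^ (n - l) * cpow f (Suc l + (Suc r + (n - l))) x) \<le>
          of_nat (Suc n) ^ r * \<alpha> ^ n * cpow f (Suc (Suc r) + n) x"
        unfolding i e[symmetric] by (simp only: mult_ac)
    qed
    also have "\<dots> = of_nat (Suc n) ^ Suc r * \<alpha> ^ n * cpow f (Suc (Suc r) + n) x"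
      by (simp del: cpow.simps of_nat_Suc add: mult.assoc)
    finally show "(\<Sum>l\<le>n. \<alpha> ^ l * (of_nat (Suc (n - l)) ^ r * \<alpha> ^ (n - l) * cpow f (Suc l + (Suc r + (n - l))) x)) \<le>
      of_nat (Suc n) ^ Suc r * \<alpha> ^ n * cpow f (Suc (Suc r) + n) x" .
  qed auto
  finally show ?case .
qed

lemma cpow_le_sup:
  fixes f :: "('d::finite) lattice \<Rightarrow> ennreal"
  assumes "\<And>x. f x \<le> c" and "l1 f = 1"
  shows "cpow f (Suc n) x \<le> c"
proof -
  have "cpow f (Suc n) x = conv (cpow f n) f x" by (simp add: conv_commute)
  also have "\<dots> \<le> l1 (cpow f n) * c" by (rule conv_le_sup) (rule assms)
  finally show ?thesis by (simp add: l1_cpow assms)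
qed

lemma cpow_range:
  fixes f :: "('d::finite) lattice \<Rightarrow> ennreal"
  assumes "\<And>x. f x \<noteq> 0 \<Longrightarrow> supnorm x \<le> R"
  shows "cpow f n x \<noteq> 0 \<Longrightarrow> supnorm x \<le> real n * R"
proof (induction n arbitrary: x)
  case 0
  then show ?case using supnorm_le_iff[of x 0] by (auto simp: delta0_def split: if_splits)
next
  case (Suc n)
  have "\<exists>y. f y * cpow f n (x - y) \<noteq> 0"
  proof (rule ccontr)
    assume "\<not> ?thesis"
    then have "(\<lambda>y. f y * cpow f n (x - y)) = (\<lambda>_. 0)" by auto
    then have "conv f (cpow f n) x = 0" by (simp add: conv_eq)
    with Suc.prems show False by simp
  qed
  then obtain y where "f y \<noteq> 0" "cpow f n (x - y) \<noteq> 0" by auto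
  then have "supnorm y \<le> R" "supnorm (x - y) \<le> real n * R" using assms Suc.IH by auto
  then show ?case using supnorm_triangle[of y "x - y"] by (simp add: algebra_simps)
qed

text \<open>The summand is (1 + j)^(d/2 - 1) times an exponential cutoff at j of order \<Lambda>, so
  the sum is of order \<Lambda>^(d/2). The first factor is the number of compositions against the
  concentration bound.\<close>

lemma weighted_geometric_sum:
  fixes \<Lambda> :: real
  assumes \<Lambda>: "1 \<le> \<Lambda>" and d: "2 \<le> d"
  shows "(\<Sum>j. ennreal (real (Suc j) ^ (d - 1) / sqrt (1 + real j) ^ d * exp (- real j / (4 * \<Lambda>)))) \<le>
    ennreal (27 * (1 + fact (d - 2)) * sqrt 8 ^ (d - 2) * sqrt \<Lambda> ^ d)"
proof -
  define k where "k = d - 2"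
  have dk: "d = k + 2" using d by (simp add: k_def)
  define B where "B = 3 * (1 + fact k) * (sqrt 8 * sqrt \<Lambda>) ^ k"
  have B0: "0 \<le> B" using \<Lambda> by (simp add: B_def)
  define q where "q = exp (- 1 / (8 * \<Lambda>))"
  have q: "0 < q" "q < 1" using \<Lambda> by (simp_all add: q_def)
  have term_le: "real (Suc j) ^ (d - 1) / sqrt (1 + real j) ^ d * exp (- real j / (4 * \<Lambda>)) \<le> B * q ^ j" for j
  proof -
    define n where "n = 1 + real j"
    have n: "1 \<le> n" by (simp add: n_def)
    have "real (Suc j) ^ (d - 1) / sqrt (1 + real j) ^ d = sqrt n ^ k"
    proof -
      define s where "s = sqrt n"
      have "real (Suc j) = s * s" using n by (simp add: s_def n_def)
      then have "real (Suc j) ^ (d - 1) = (s * s) ^ (k + 1)" by (simp add: dk)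
      also have "\<dots> = s ^ (k + 1) * s ^ (k + 1)" by (rule power_mult_distrib)
      also have "\<dots> = s ^ k * s ^ d" unfolding dk by (simp flip: power_add)
      finally have "real (Suc j) ^ (d - 1) = sqrt n ^ k * sqrt n ^ d" unfolding s_def .
      then show ?thesis using n unfolding n_def[symmetric] by simp
    qed
    moreover have "sqrt n ^ k * exp (- real j / (4 * \<Lambda>)) \<le> B * q ^ j"
    proof -
      \<comment> \<open>Half of the exponential rate: exp u pays for the power of \<open>n\<close>,
        and the other half remains as the geometric series in \<open>q\<close>.\<close>
      define u where "u = n / (8 * \<Lambda>)"
      have u: "0 \<le> u" using n \<Lambda> by (simp add: u_def)
      have "sqrt u ^ k \<le> 1 + u ^ k"
      proof (cases "u \<le> 1")
        case True
        then have "sqrt u ^ k \<le> 1" using u by (intro power_le_one) auto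
        then show ?thesis using u by (smt (verit) zero_le_power)
      next
        case False
        then have "sqrt u \<le> u" by (simp add: real_le_lsqrt sqrt_le_D power2_eq_square real_sqrt_le_iff real_less_lsqrt less_imp_le)
        then have "sqrt u ^ k \<le> u ^ k" using u by (intro power_mono) auto
        then show ?thesis by simp
      qed
      also have "u ^ k \<le> fact k * exp u"
      proof -
        have "u ^ k /\<^sub>R fact k \<le> exp u"
          using sum_le_suminf[OF summable_exp_generic[of u], of "{k}"] u by (simp add: exp_def)
        then show ?thesis by (simp add: field_simps)
      qed
      also have "1 + fact k * exp u \<le> (1 + fact k) * exp u" using u by (simp add: distrib_right)
      finally have su: "sqrt u ^ k \<le> (1 + fact k) * exp u" by simp
      have "sqrt n = (sqrt 8 * sqrt \<Lambda>) * sqrt u"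
        using \<Lambda> n by (simp add: u_def real_sqrt_mult real_sqrt_divide)
      then have "sqrt n ^ k = (sqrt 8 * sqrt \<Lambda>) ^ k * sqrt u ^ k" by (simp add: power_mult_distrib)
      also have "\<dots> \<le> (sqrt 8 * sqrt \<Lambda>) ^ k * ((1 + fact k) * exp u)"
        using su \<Lambda> by (intro mult_left_mono) auto
      also have "\<dots> = (B / 3) * exp u" by (simp add: B_def)
      finally have 1: "sqrt n ^ k \<le> (B / 3) * exp u" .
      have "exp u * exp (- real j / (4 * \<Lambda>)) = exp (1 / (8 * \<Lambda>)) * exp (real j * (- 1 / (8 * \<Lambda>)))"
        unfolding exp_add[symmetric] using \<Lambda> by (simp add: u_def n_def field_simps)
      also have "exp (real j * (- 1 / (8 * \<Lambda>))) = q ^ j" unfolding q_def by (rule exp_of_nat_mult)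
      also have "exp (1 / (8 * \<Lambda>)) \<le> 3"
      proof -
        have "exp (1 / (8 * \<Lambda>)) \<le> exp 1" using \<Lambda> by simp
        then show ?thesis using exp_le by linarith
      qed
      finally have 2: "exp u * exp (- real j / (4 * \<Lambda>)) \<le> 3 * q ^ j" using q by simp
      have "sqrt n ^ k * exp (- real j / (4 * \<Lambda>)) \<le> (B / 3) * (exp u * exp (- real j / (4 * \<Lambda>)))"
        using mult_right_mono[OF 1, of "exp (- real j / (4 * \<Lambda>))"] by simp
      also have "\<dots> \<le> (B / 3) * (3 * q ^ j)" using 2 B0 by (intro mult_left_mono) auto
      finally show ?thesis by simp
    qed
    ultimately show ?thesis by simp
  qed
  have "(\<Sum>j. ennreal (real (Suc j) ^ (d - 1) / sqrt (1 + real j) ^ d * exp (- real j / (4 * \<Lambda>)))) \<le> (\<Sum>j. ennreal (B * q ^ j))"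
    by (intro suminf_le ennreal_leI term_le) auto
  also have "\<dots> = ennreal (\<Sum>j. B * q ^ j)"
    using q B0 by (intro suminf_ennreal2 summable_mult summable_geometric) auto
  also have "(\<Sum>j. B * q ^ j) = B * (1 / (1 - q))"
    using q by (subst suminf_mult) (auto simp: suminf_geometric intro!: summable_geometric)
  also have "ennreal \<dots> \<le> ennreal (B * (9 * \<Lambda>))"
  proof (intro ennreal_leI mult_left_mono B0)
    define s where "s = 1 / (8 * \<Lambda>)"
    have s: "0 < s" "s \<le> 1 / 8" using \<Lambda> by (simp_all add: s_def)
    have "1 + s \<le> exp s" by (rule exp_ge_add_one_self)
    then have "inverse (exp s) \<le> inverse (1 + s)" using s by (intro le_imp_inverse_le) auto
    then have "q \<le> 1 / (1 + s)" by (simp add: q_def s_def inverse_eq_divide exp_minus)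
    then have "s / (1 + s) \<le> 1 - q" using s by (simp add: field_simps)
    moreover have "1 / (9 * \<Lambda>) \<le> s / (1 + s)"
    proof -
      have "s / (1 + s) = 1 / (8 * \<Lambda> + 1)" using \<Lambda> by (simp add: s_def field_simps)
      moreover have "1 / (9 * \<Lambda>) \<le> 1 / (8 * \<Lambda> + 1)" using \<Lambda> by (intro divide_left_mono) auto
      ultimately show ?thesis by simp
    qed
    ultimately have "1 / (9 * \<Lambda>) \<le> 1 - q" by linarith
    then show "1 / (1 - q) \<le> 9 * \<Lambda>" using q \<Lambda> by (simp add: field_simps)
  qed
  also have "B * (9 * \<Lambda>) = 27 * (1 + fact (d - 2)) * sqrt 8 ^ (d - 2) * sqrt \<Lambda> ^ d"
    using \<Lambda> by (simp add: B_def dk power_add power_mult_distrib)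
  finally show ?thesis .
qed

section \<open>Smoothing across scales\<close>

context flow
begin

definition xi :: "real \<Rightarrow> real" where "xi b = sqrt (xi2 b)"

lemma xi_pos: "b \<in> I \<Longrightarrow> 0 < xi b"
  using xi2_pos[of b] by (simp add: xi_def)

lemma xi_sq: "b \<in> I \<Longrightarrow> (xi b)\<^sup>2 = xi2 b"
  using xi2_pos[of b] by (simp add: xi_def)

lemma xi_zero: "xi 0 = \<sigma>"
  using \<sigma> by (simp add: xi_def xi2_def X0 V0)

lemma xi_mono: "b \<in> I \<Longrightarrow> 0 \<le> a \<Longrightarrow> a \<le> b \<Longrightarrow> xi a \<le> xi b"
  using xi2_mono by (simp add: xi_def)

lemma xi_eq_var: "xi b = sqrt (real CARD('d)) * sqrt (var b)"
  by (simp add: xi_def var_def real_sqrt_divide)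

text \<open>The 1/7 is dictated by \<open>p_step\<close>, where the tilt satisfies \<mu>^2 var a
  \<le> 2 ct^2 / \<Lambda>, and both 8 ct^2 \<le> \<kappa>^2 and 10 ct^2 \<le> 1/4 are
  required.\<close>

definition ct :: real where "ct = \<kappa> / 7"

lemma ct_pos: "0 < ct" "ct \<le> 1" "ct \<le> \<kappa> / 7" "0 < \<kappa>" "\<kappa> \<le> 1"
proof -
  show \<kappa>: "0 < \<kappa>" "\<kappa> \<le> 1" using Y_bounds by (simp_all add: \<kappa>_def)
  then show "0 < ct" "ct \<le> 1" "ct \<le> \<kappa> / 7" by (simp_all add: ct_def)
qed

definition Cc :: real where
  "Cc = subgaussian.conc_const TYPE('d) \<kappa> (ct / (2 * sqrt (real CARD('d))))"

text \<open>The factors stem from \<open>concentration\<close>, from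
  \<open>weighted_geometric_sum\<close>, and from the 2 in the hypothesis
  \<open>xi2 b \<le> 2 * \<Lambda> * xi2 a\<close> of \<open>p_step\<close>. No mass ratio
  enters.\<close>

definition D1 :: real where
  "D1 = Cc * (27 * (1 + fact (CARD('d) - 2)) * sqrt 8 ^ (CARD('d) - 2)) * sqrt 2 ^ CARD('d)"

text \<open>The law at \<open>b\<close> is that of a walk with steps from \<open>p a\<close> and a
  geometric number of steps of mean order \<Lambda>, so its d-th power contains at least d steps. Of
  these, d steps provide the sup bound of \<open>IH\<close>, and the other j steps the factor
  j^(-d/2) of \<open>concentration\<close>. The two decay rates in \<open>IH\<close> have separate
  uses: ct / xi b cancels the tilt on the d steps, and (ct / 2) / xi a is the localising weight for
  \<open>concentration\<close>.\<close>

lemma p_step: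
  assumes d2: "2 \<le> CARD('d)" and ab: "b \<in> I" "0 \<le> a" "a \<le> b"
    and \<Lambda>_def: "\<Lambda> = X b / X a" and \<delta>\<Lambda>: "\<delta> * \<Lambda> \<le> 1 / 2"
    and up: "xi2 b \<le> 2 * \<Lambda> * xi2 a" and low: "\<Lambda> * xi2 a \<le> 2 * xi2 b"
    and A: "0 \<le> A"
    and IH: "\<And>z. cpow (p a) CARD('d) z \<le>
      ennreal (A / xi a ^ CARD('d) * exp (- (ct / 2) * supnorm z / xi a - ct * supnorm z / xi b))"
  shows "cpow (p b) CARD('d) x \<le> ennreal (D1 * A / xi b ^ CARD('d) * exp (- ct * supnorm x / xi b))"
proof -
  let ?d = "CARD('d)"
  have aI: "a \<in> I" by (rule I_down[OF ab])
  note pos = X_pos[OF aI] X_pos[OF ab(1)] var_pos[OF aI] var_pos[OF ab(1)] xi_pos[OF aI] xi_pos[OF ab(1)]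
  interpret sg: subgaussian "p a" "var a" \<kappa> by (rule subgaussian_p[OF aI])
  have \<Lambda>1: "1 \<le> \<Lambda>" unfolding \<Lambda>_def by (rule X_ratio[OF ab])
  define \<alpha> where "\<alpha> = (b - a) * X a"
  have \<alpha>0: "0 \<le> \<alpha>" using ab pos by (simp add: \<alpha>_def)
  \<comment> \<open>\<open>inv_lower\<close> gives the continuation probability up to a factor 1 -
    \<delta>; \<delta> \<Lambda> \<le> 1/2 keeps the error within half of the gap 1 / \<Lambda>, so
    the walk still stops after order \<Lambda> steps.\<close>
  have \<alpha>_le: "\<alpha> \<le> 1 - 1 / (2 * \<Lambda>)"
  proof -
    have "\<alpha> \<le> (1 - 1 / \<Lambda>) / (1 - \<delta>)"
      using step_le[OF ab] pos by (simp add: \<alpha>_def \<Lambda>_def)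
    also have "\<dots> \<le> 1 - 1 / (2 * \<Lambda>)"
    proof -
      define z where "z = 1 / (2 * \<Lambda>)"
      have "\<delta> \<le> z" using \<delta>\<Lambda> \<Lambda>1 by (simp add: field_simps z_def)
      moreover have "0 \<le> \<delta> * z" using \<delta> \<Lambda>1 by (simp add: z_def)
      moreover have "1 / \<Lambda> = 2 * z" by (simp add: z_def)
      ultimately have "1 - 1 / \<Lambda> \<le> (1 - \<delta>) * (1 - z)"
        by (simp add: algebra_simps)
      then show ?thesis using \<delta> by (simp add: divide_le_eq mult.commute z_def)
    qed
    finally show ?thesis .
  qed
  have \<alpha>1: "\<alpha> < 1"
    using \<alpha>_le \<Lambda>1 by (smt (verit) divide_pos_pos)
  have \<alpha>_exp: "\<alpha> ^ j \<le> exp (- real j / (2 * \<Lambda>))" for j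
  proof -
    have "\<alpha> \<le> exp (- 1 / (2 * \<Lambda>))"
      using \<alpha>_le exp_ge_add_one_self[of "- 1 / (2 * \<Lambda>)"] by simp
    then have "\<alpha> ^ j \<le> exp (- 1 / (2 * \<Lambda>)) ^ j" using \<alpha>0 by (rule power_mono)
    also have "\<dots> = exp (real j * (- 1 / (2 * \<Lambda>)))" by (rule exp_of_nat_mult[symmetric])
    finally show ?thesis by simp
  qed
  have pb: "p b y \<le> ennreal (1 / \<Lambda>) * (\<Sum>j. ennreal \<alpha> ^ j * cpow (p a) (Suc j) y)" for y
  proof -
    have "F a = (\<lambda>x. ennreal (X a) * p a x)" using F_eq_p[OF aI] by (intro ext)
    then have c: "cpow (F a) (Suc j) y = ennreal (X a) ^ Suc j * cpow (p a) (Suc j) y" for j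
      by (simp only: cpow_cmult)
    have "F b y \<le> (\<Sum>j. ennreal (b - a) ^ j * cpow (F a) (Suc j) y)"
      using \<alpha>1 by (intro geometric[OF ab]) (simp add: \<alpha>_def)
    also have "\<dots> = (\<Sum>j. ennreal (X a) * (ennreal \<alpha> ^ j * cpow (p a) (Suc j) y))"
      unfolding c \<alpha>_def using ab pos
      by (intro suminf_cong) (simp add: ennreal_mult power_mult_distrib mult_ac del: cpow.simps)
    also have "\<dots> = ennreal (X a) * (\<Sum>j. ennreal \<alpha> ^ j * cpow (p a) (Suc j) y)"
      by (rule ennreal_suminf_cmult)
    finally have "ennreal (1 / X b) * F b y \<le> ennreal (1 / X b) * (ennreal (X a) * (\<Sum>j. ennreal \<alpha> ^ j * cpow (p a) (Suc j) y))"
      by (rule mult_left_mono) simp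
    moreover have "ennreal (1 / X b) * ennreal (X a) = ennreal (1 / \<Lambda>)"
      using pos by (simp add: \<Lambda>_def flip: ennreal_mult)
    ultimately show ?thesis by (simp add: p_def[of b] mult.assoc[symmetric])
  qed
  have dS: "Suc (?d - 1) = ?d" using d2 by simp
  have "cpow (p b) ?d x \<le> cpow (\<lambda>y. ennreal (1 / \<Lambda>) * (\<Sum>j. ennreal \<alpha> ^ j * cpow (p a) (Suc j) y)) ?d x"
    by (rule cpow_mono) (rule pb)
  also have "\<dots> = ennreal (1 / \<Lambda>) ^ ?d * cpow (\<lambda>y. \<Sum>j. ennreal \<alpha> ^ j * cpow (p a) (Suc j) y) ?d x"
    by (rule cpow_cmult)
  also have "\<dots> \<le> ennreal (1 / \<Lambda>) ^ ?d * (\<Sum>j. of_nat (Suc j) ^ (?d - 1) * ennreal \<alpha> ^ j * cpow (p a) (?d + j) x)"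
    using cpow_geometric_le[of "ennreal \<alpha>" "p a" "?d - 1" x] unfolding dS by (rule mult_left_mono) simp
  finally have main: "cpow (p b) ?d x \<le>
      ennreal (1 / \<Lambda>) ^ ?d * (\<Sum>j. of_nat (Suc j) ^ (?d - 1) * ennreal \<alpha> ^ j * cpow (p a) (?d + j) x)" .
  obtain i where i: "supnorm x = \<bar>real_of_int (x $ i)\<bar>" using supnorm_attained by blast
  \<comment> \<open>Coordinate and sign are chosen so that the weight at \<open>x\<close> equals exp
    (ct * supnorm x / xi b). Dividing it out at the end produces the claimed decay.\<close>
  define \<mu> where "\<mu> = (if 0 \<le> x $ i then 1 else - 1) * (ct / xi b)"
  have \<mu>x: "\<mu> * real_of_int (x $ i) = ct * supnorm x / xi b"
    by (auto simp: \<mu>_def i)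
  have \<mu>abs: "\<bar>\<mu>\<bar> = ct / xi b" using ct_pos pos by (auto simp: \<mu>_def)
  have \<mu>v: "\<mu>\<^sup>2 * var a \<le> 2 * ct\<^sup>2 / \<Lambda>"
  proof -
    have "\<mu>\<^sup>2 = ct\<^sup>2 / xi2 b"
      using \<mu>abs xi_sq[OF ab(1)] by (metis power2_abs power_divide)
    then have "\<mu>\<^sup>2 * var a = ct\<^sup>2 * (xi2 a / xi2 b) / real ?d" by (simp add: var_def)
    also have "\<dots> \<le> ct\<^sup>2 * (xi2 a / xi2 b) / 1"
      using xi2_pos[OF aI] xi2_pos[OF ab(1)] by (intro divide_left_mono) (auto simp: Suc_leI)
    also have "\<dots> \<le> ct\<^sup>2 * (2 / \<Lambda>) / 1"
      using low xi2_pos[OF ab(1)] \<Lambda>1 by (intro divide_right_mono mult_left_mono) (simp_all add: field_simps)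
    finally show ?thesis by (simp add: mult.commute)
  qed
  have ct2: "ct\<^sup>2 \<le> \<kappa>\<^sup>2 / 49" "\<kappa>\<^sup>2 \<le> 1"
    using power_mono[OF ct_pos(3), of 2] ct_pos power_mono[of \<kappa> 1 2] by (simp_all add: power_divide)
  have \<mu>1: "4 * (\<mu>\<^sup>2 * var a) \<le> \<kappa>\<^sup>2"
  proof -
    have "2 * ct\<^sup>2 / \<Lambda> \<le> 2 * ct\<^sup>2 / 1" using \<Lambda>1 by (intro divide_left_mono) auto
    then have "4 * (\<mu>\<^sup>2 * var a) \<le> 8 * ct\<^sup>2" using \<mu>v by linarith
    also have "\<dots> \<le> \<kappa>\<^sup>2" using ct2(1) zero_le_power2[of ct] by linarith
    finally show ?thesis .
  qed
  \<comment> \<open>The tilt costs exp (5 \<mu>^2 var a j) in \<open>concentration\<close>. This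
    uses up half of the decay exp (- j / (2 \<Lambda>)) of \<alpha>^j.\<close>
  have \<mu>2: "5 * (\<mu>\<^sup>2 * var a) \<le> 1 / (4 * \<Lambda>)"
  proof -
    have "5 * (\<mu>\<^sup>2 * var a) \<le> 5 * (2 * ct\<^sup>2 / \<Lambda>)" using \<mu>v by linarith
    also have "\<dots> = 10 * ct\<^sup>2 / \<Lambda>" by simp
    also have "\<dots> \<le> (1 / 4) / \<Lambda>" using ct2 \<Lambda>1 by (intro divide_right_mono) auto
    finally show ?thesis by simp
  qed
  let ?e = "exp (ct * supnorm x / xi b)"
  define b0 where "b0 = ct / (2 * sqrt (real ?d))"
  have b0: "0 < b0" using ct_pos by (simp add: b0_def)
  have each: "ennreal ?e * cpow (p a) (?d + j) x \<le>
      ennreal (A / xi a ^ ?d) * ennreal (Cc * exp (5 * (\<mu>\<^sup>2 * var a) * real j) / sqrt (1 + real j) ^ ?d)" for j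
  proof -
    have "ennreal ?e * cpow (p a) (?d + j) x = tilt i \<mu> (conv (cpow (p a) j) (cpow (p a) ?d)) x"
      unfolding tilt_def \<mu>x by (simp add: cpow_add conv_commute)
    also have "\<dots> = l1 (\<lambda>y. tilt i \<mu> (cpow (p a) j) y * tilt i \<mu> (cpow (p a) ?d) (x - y))"
      unfolding tilt_conv conv_eq ..
    also have "\<dots> \<le> l1 (\<lambda>y. ennreal (A / xi a ^ ?d) *
        (tilt i \<mu> (cpow (p a) j) y * ennreal (exp (- b0 * supnorm (x - y) / sqrt (var a)))))"
    proof (rule l1_mono)
      fix y
      let ?z = "x - y"
      have "tilt i \<mu> (cpow (p a) ?d) ?z \<le> ennreal (exp (\<mu> * real_of_int (?z $ i))) *
          ennreal (A / xi a ^ ?d * exp (- (ct / 2) * supnorm ?z / xi a - ct * supnorm ?z / xi b))"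
        unfolding tilt_def using IH[of ?z] by (rule mult_left_mono) simp
      also have "\<dots> = ennreal (A / xi a ^ ?d * exp (\<mu> * real_of_int (?z $ i) - (ct / 2) * supnorm ?z / xi a - ct * supnorm ?z / xi b))"
      proof -
        have "exp m * (B * exp (- u - w)) = B * exp (m - u - w)" for m B u w :: real
          by (simp add: mult.left_commute[of "exp m"] flip: exp_add)
        moreover have "ennreal (exp m) * ennreal y = ennreal (exp m * y)" for m y :: real
          by (rule ennreal_mult'[symmetric]) simp
        ultimately have e: "ennreal (exp m) * ennreal (B * exp (- u - w)) = ennreal (B * exp (m - u - w))" for m B u w :: real
          by (simp only:)
        have n: "- (ct / 2) * supnorm ?z / xi a = - ((ct / 2) * supnorm ?z / xi a)" by simp
        show ?thesis unfolding n by (rule e)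
      qed
      also have "\<dots> \<le> ennreal (A / xi a ^ ?d * exp (- b0 * supnorm ?z / sqrt (var a)))"
      proof (intro ennreal_leI mult_left_mono exp_le_cancel_iff[THEN iffD2])
        have "\<mu> * real_of_int (?z $ i) \<le> \<bar>\<mu>\<bar> * \<bar>real_of_int (?z $ i)\<bar>"
          by (metis abs_ge_self abs_mult)
        also have "\<dots> \<le> \<bar>\<mu>\<bar> * supnorm ?z" by (intro mult_left_mono supnorm_ge) auto
        finally have "\<mu> * real_of_int (?z $ i) \<le> ct * supnorm ?z / xi b" unfolding \<mu>abs by simp
        moreover have "(ct / 2) * supnorm ?z / xi a = b0 * supnorm ?z / sqrt (var a)"
          by (simp add: b0_def xi_eq_var)
        ultimately show "\<mu> * real_of_int (?z $ i) - (ct / 2) * supnorm ?z / xi a - ct * supnorm ?z / xi b \<le>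
            - b0 * supnorm ?z / sqrt (var a)" by simp
      qed (use A pos in auto)
      also have "\<dots> = ennreal (A / xi a ^ ?d) * ennreal (exp (- b0 * supnorm ?z / sqrt (var a)))"
        using A pos by (intro ennreal_mult) auto
      finally have "tilt i \<mu> (cpow (p a) j) y * tilt i \<mu> (cpow (p a) ?d) ?z \<le>
          tilt i \<mu> (cpow (p a) j) y * (ennreal (A / xi a ^ ?d) * ennreal (exp (- b0 * supnorm ?z / sqrt (var a))))"
        by (rule mult_left_mono) simp
      then show "tilt i \<mu> (cpow (p a) j) y * tilt i \<mu> (cpow (p a) ?d) ?z \<le> ennreal (A / xi a ^ ?d) *
        (tilt i \<mu> (cpow (p a) j) y * ennreal (exp (- b0 * supnorm ?z / sqrt (var a))))"
        by (simp only: mult.left_commute)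
    qed
    also have "\<dots> \<le> ennreal (A / xi a ^ ?d) * ennreal (Cc * exp (5 * (\<mu>\<^sup>2 * var a) * real j) / sqrt (1 + real j) ^ ?d)"
      unfolding l1_cmult Cc_def b0_def[symmetric]
      by (intro mult_left_mono sg.concentration[OF b0 \<mu>1]) auto
    finally show ?thesis .
  qed
  have Cc1: "1 \<le> Cc" unfolding Cc_def by (rule sg.conc_const_ge)
  define S where "S = 27 * (1 + fact (?d - 2)) * sqrt 8 ^ (?d - 2) * sqrt \<Lambda> ^ ?d"
  have S0: "0 \<le> S" using \<Lambda>1 by (simp add: S_def)
  have "ennreal ?e * cpow (p b) ?d x \<le>
      ennreal (1 / \<Lambda>) ^ ?d * (\<Sum>j. of_nat (Suc j) ^ (?d - 1) * ennreal \<alpha> ^ j * (ennreal ?e * cpow (p a) (?d + j) x))"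
  proof -
    have "ennreal ?e * cpow (p b) ?d x \<le> ennreal ?e * (ennreal (1 / \<Lambda>) ^ ?d *
        (\<Sum>j. of_nat (Suc j) ^ (?d - 1) * ennreal \<alpha> ^ j * cpow (p a) (?d + j) x))"
      by (rule mult_left_mono[OF main]) simp
    also have "\<dots> = ennreal (1 / \<Lambda>) ^ ?d * (\<Sum>j. ennreal ?e * (of_nat (Suc j) ^ (?d - 1) * ennreal \<alpha> ^ j * cpow (p a) (?d + j) x))"
      by (simp only: ennreal_suminf_cmult mult.left_commute)
    finally show ?thesis by (simp only: mult.left_commute[of "ennreal ?e"])
  qed
  also have "\<dots> \<le> ennreal (1 / \<Lambda>) ^ ?d * (\<Sum>j. ennreal (A / xi a ^ ?d * Cc) *
      ennreal (real (Suc j) ^ (?d - 1) / sqrt (1 + real j) ^ ?d * exp (- real j / (4 * \<Lambda>))))"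
  proof (intro mult_left_mono suminf_le)
    fix j
    have "of_nat (Suc j) ^ (?d - 1) * ennreal \<alpha> ^ j * (ennreal ?e * cpow (p a) (?d + j) x) \<le>
        of_nat (Suc j) ^ (?d - 1) * ennreal \<alpha> ^ j *
        (ennreal (A / xi a ^ ?d) * ennreal (Cc * exp (5 * (\<mu>\<^sup>2 * var a) * real j) / sqrt (1 + real j) ^ ?d))"
      by (rule mult_left_mono[OF each]) simp
    also have "\<dots> = ennreal (real (Suc j) ^ (?d - 1) * \<alpha> ^ j *
        (A / xi a ^ ?d * (Cc * exp (5 * (\<mu>\<^sup>2 * var a) * real j) / sqrt (1 + real j) ^ ?d)))"
      using A pos \<alpha>0 Cc1
      by (simp add: ennreal_of_nat_eq_real_of_nat ennreal_power ennreal_mult[symmetric] del: of_nat_Suc of_nat_power)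
    also have "\<dots> \<le> ennreal ((A / xi a ^ ?d * Cc) *
       (real (Suc j) ^ (?d - 1) / sqrt (1 + real j) ^ ?d * exp (- real j / (4 * \<Lambda>))))"
    proof (rule ennreal_leI)
      have "\<alpha> ^ j * exp (5 * (\<mu>\<^sup>2 * var a) * real j) \<le> exp (- real j / (2 * \<Lambda>)) * exp (1 / (4 * \<Lambda>) * real j)"
        using \<alpha>_exp[of j] \<mu>2 \<alpha>0 by (intro mult_mono exp_le_cancel_iff[THEN iffD2] mult_right_mono) auto
      also have "\<dots> = exp (- real j / (4 * \<Lambda>))"
        unfolding exp_add[symmetric] using \<Lambda>1 by (simp add: field_simps)
      finally have "(A / xi a ^ ?d * Cc) * (real (Suc j) ^ (?d - 1) / sqrt (1 + real j) ^ ?d) *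
          (\<alpha> ^ j * exp (5 * (\<mu>\<^sup>2 * var a) * real j)) \<le>
          (A / xi a ^ ?d * Cc) * (real (Suc j) ^ (?d - 1) / sqrt (1 + real j) ^ ?d) * exp (- real j / (4 * \<Lambda>))"
        using A pos Cc1 by (intro mult_left_mono) auto
      then show "real (Suc j) ^ (?d - 1) * \<alpha> ^ j *
        (A / xi a ^ ?d * (Cc * exp (5 * (\<mu>\<^sup>2 * var a) * real j) / sqrt (1 + real j) ^ ?d)) \<le>
        (A / xi a ^ ?d * Cc) * (real (Suc j) ^ (?d - 1) / sqrt (1 + real j) ^ ?d * exp (- real j / (4 * \<Lambda>)))"
        by (simp add: mult_ac)
    qed
    also have "\<dots> = ennreal (A / xi a ^ ?d * Cc) *
      ennreal (real (Suc j) ^ (?d - 1) / sqrt (1 + real j) ^ ?d * exp (- real j / (4 * \<Lambda>)))"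
      using A pos Cc1 by (intro ennreal_mult) auto
    finally show "of_nat (Suc j) ^ (?d - 1) * ennreal \<alpha> ^ j * (ennreal ?e * cpow (p a) (?d + j) x) \<le> \<dots>" .
  qed auto
  also have "\<dots> \<le> ennreal (1 / \<Lambda>) ^ ?d * (ennreal (A / xi a ^ ?d * Cc) * ennreal S)"
    unfolding ennreal_suminf_cmult S_def by (intro mult_left_mono weighted_geometric_sum[OF \<Lambda>1 d2]) auto
  also have "\<dots> = ennreal ((1 / \<Lambda>) ^ ?d * (A / xi a ^ ?d * Cc * S))"
    using A pos Cc1 S0 \<Lambda>1 by (simp add: ennreal_power ennreal_mult[symmetric])
  also have "\<dots> \<le> ennreal (D1 * A / xi b ^ ?d)"
  proof (rule ennreal_leI)
    define s where "s = sqrt \<Lambda>"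
    have s: "1 \<le> s" "\<Lambda> = s * s" using \<Lambda>1 by (simp_all add: s_def)
    have "xi b \<le> sqrt (2 * \<Lambda> * xi2 a)" unfolding xi_def by (rule real_sqrt_le_mono[OF up])
    also have "\<dots> = sqrt 2 * s * xi a" by (simp add: real_sqrt_mult s_def xi_def)
    finally have "xi b ^ ?d \<le> (sqrt 2 * s * xi a) ^ ?d" using pos by (intro power_mono) auto
    then have xib: "1 / (s ^ ?d * xi a ^ ?d) \<le> sqrt 2 ^ ?d / xi b ^ ?d"
      using s pos by (simp add: power_mult_distrib field_simps)
    define W where "W = A * Cc * (27 * (1 + fact (?d - 2)) * sqrt 8 ^ (?d - 2))"
    have W: "0 \<le> W" using A Cc1 by (simp add: W_def)
    have "(1 / \<Lambda>) ^ ?d * (A / xi a ^ ?d * Cc * S) = W * ((1 / \<Lambda>) ^ ?d * s ^ ?d / xi a ^ ?d)"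
      by (simp add: W_def S_def s_def[symmetric])
    also have "(1 / \<Lambda>) ^ ?d * s ^ ?d / xi a ^ ?d = 1 / (s ^ ?d * xi a ^ ?d)"
      using s by (simp add: power_mult_distrib power_divide)
    also have "W * \<dots> \<le> W * (sqrt 2 ^ ?d / xi b ^ ?d)" by (rule mult_left_mono[OF xib W])
    also have "\<dots> = D1 * A / xi b ^ ?d" by (simp add: D1_def W_def)
    finally show "(1 / \<Lambda>) ^ ?d * (A / xi a ^ ?d * Cc * S) \<le> D1 * A / xi b ^ ?d" .
  qed
  finally have fin: "ennreal ?e * cpow (p b) ?d x \<le> ennreal (D1 * A / xi b ^ ?d)" .
  have "cpow (p b) ?d x = ennreal (1 / ?e) * (ennreal ?e * cpow (p b) ?d x)"
    by (simp add: mult.assoc[symmetric] ennreal_mult[symmetric])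
  also have "\<dots> \<le> ennreal (1 / ?e) * ennreal (D1 * A / xi b ^ ?d)"
    by (rule mult_left_mono[OF fin]) simp
  also have "\<dots> = ennreal (1 / ?e * (D1 * A / xi b ^ ?d))"
    by (rule ennreal_mult'[symmetric]) simp
  also have "1 / ?e * (D1 * A / xi b ^ ?d) = D1 * A / xi b ^ ?d * exp (- ct * supnorm x / xi b)"
    by (simp add: exp_minus field_simps)
  finally show ?thesis .
qed

end

section \<open>Elementary estimates for sums over dyadic scales\<close>

lemma powr_three_delta_le:
  assumes M: "16 \<le> M" and \<delta>: "0 \<le> \<delta>" "\<delta> * M \<le> 1 / 4"
  shows "M powr (3 * \<delta>) \<le> (2::real)"
proof -
  have "ln M = 2 * ln (sqrt M)" using M by (simp add: ln_sqrt)
  also have "\<dots> \<le> 2 * (sqrt M - 1)" using M by (intro mult_left_mono ln_le_minus_one) auto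
  also have "\<dots> \<le> 2 * sqrt M" by simp
  also have "\<dots> \<le> M / 2"
  proof -
    have "4 \<le> sqrt M" using M real_sqrt_le_mono[of 16 M] by simp
    then have "4 * sqrt M \<le> sqrt M * sqrt M" using M by (intro mult_right_mono) auto
    then show ?thesis using M by simp
  qed
  finally have "3 * \<delta> * ln M \<le> 3 * \<delta> * (M / 2)" using \<delta> by (intro mult_left_mono) auto
  also have "\<dots> \<le> 3 / 8" using \<delta>(2) by (simp add: mult.commute)
  finally have e: "3 * \<delta> * ln M \<le> 3 / 8" .
  have "exp (3 / 8 :: real) \<le> 1 + 3 / 8 + (3 / 8)\<^sup>2" by (rule exp_bound) auto
  then have "exp (3 / 8 :: real) \<le> 2" by (simp add: power2_eq_square)
  moreover have "M powr (3 * \<delta>) = exp (3 * \<delta> * ln M)" using M by (simp add: powr_def)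
  moreover have "exp (3 * \<delta> * ln M) \<le> exp (3 / 8)" using e by simp
  ultimately show ?thesis by linarith
qed

text \<open>Exchanging the sums leaves geometric tails, each at most twice its first term. It
  flattens the nested sums that arise when the telescoping in \<open>taylor\<close> is
  repeated.\<close>

lemma ennreal_sum_dyadic:
  fixes f :: "nat \<Rightarrow> ennreal"
  shows "(\<Sum>l\<in>{1..k}. ennreal ((1/2) ^ l) * (q + (\<Sum>i\<in>{1..l}. f i))) \<le> q + 2 * (\<Sum>i\<in>{1..k}. ennreal ((1/2) ^ i) * f i)"
proof -
  have geo: "(\<Sum>l\<in>{i..k}. (1/2::real) ^ l) \<le> 2 * (1/2) ^ i" for i
    by (cases "i \<le> k") (auto simp: sum_gp)
  have tail: "(\<Sum>l\<in>{i..k}. ennreal ((1/2) ^ l)) \<le> 2 * ennreal ((1/2) ^ i)" for i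
  proof -
    have "(\<Sum>l\<in>{i..k}. ennreal ((1/2) ^ l)) = ennreal (\<Sum>l\<in>{i..k}. (1/2::real) ^ l)" by (rule sum_ennreal) simp
    also have "\<dots> \<le> ennreal (2 * (1/2) ^ i)" by (rule ennreal_leI[OF geo])
    also have "\<dots> = 2 * ennreal ((1/2) ^ i)" by (subst ennreal_mult) auto
    finally show ?thesis .
  qed
  have tail1: "(\<Sum>l\<in>{1..k}. ennreal ((1/2) ^ l)) \<le> 1"
  proof -
    have "(\<Sum>l\<in>{1..k}. ennreal ((1/2) ^ l)) = ennreal (\<Sum>l\<in>{1..k}. (1/2::real) ^ l)" by (rule sum_ennreal) simp
    also have "\<dots> \<le> ennreal 1" by (rule ennreal_leI) (use geo[of 1] in simp)
    finally show ?thesis by simp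
  qed
  have "(\<Sum>l\<in>{1..k}. \<Sum>i\<in>{1..l}. ennreal ((1/2) ^ l) * f i) =
      (\<Sum>l\<in>{1..k}. \<Sum>i\<in>{1..k}. if i \<le> l then ennreal ((1/2) ^ l) * f i else 0)"
    by (intro sum.cong refl sum.mono_neutral_cong_left) auto
  also have "\<dots> = (\<Sum>i\<in>{1..k}. \<Sum>l\<in>{1..k}. if i \<le> l then ennreal ((1/2) ^ l) * f i else 0)"
    by (rule sum.swap)
  also have "\<dots> = (\<Sum>i\<in>{1..k}. \<Sum>l\<in>{i..k}. ennreal ((1/2) ^ l) * f i)"
    by (intro sum.cong refl sum.mono_neutral_cong_right) auto
  also have "\<dots> \<le> (\<Sum>i\<in>{1..k}. 2 * ennreal ((1/2) ^ i) * f i)"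
    unfolding sum_distrib_right[symmetric] by (intro sum_mono mult_right_mono tail) auto
  finally have 1: "(\<Sum>l\<in>{1..k}. \<Sum>i\<in>{1..l}. ennreal ((1/2) ^ l) * f i) \<le> 2 * (\<Sum>i\<in>{1..k}. ennreal ((1/2) ^ i) * f i)"
    by (simp add: sum_distrib_left mult.assoc)
  have "(\<Sum>l\<in>{1..k}. ennreal ((1/2) ^ l) * (q + (\<Sum>i\<in>{1..l}. f i))) =
      (\<Sum>l\<in>{1..k}. ennreal ((1/2) ^ l)) * q + (\<Sum>l\<in>{1..k}. \<Sum>i\<in>{1..l}. ennreal ((1/2) ^ l) * f i)"
    unfolding distrib_left sum.distrib sum_distrib_left sum_distrib_right ..
  also have "\<dots> \<le> 1 * q + 2 * (\<Sum>i\<in>{1..k}. ennreal ((1/2) ^ i) * f i)"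
    by (intro add_mono mult_right_mono tail1 1) auto
  finally show ?thesis by simp
qed

lemma geometric_subset_sum:
  fixes q :: real and S :: "nat set"
  assumes "0 < q" "q < 1" "finite S" "inj_on h S"
  shows "(\<Sum>l\<in>S. q ^ h l) \<le> 1 / (1 - q)"
proof -
  have "(\<Sum>l\<in>S. q ^ h l) = (\<Sum>m\<in>h ` S. q ^ m)" using assms by (simp add: sum.reindex)
  also have "\<dots> \<le> (\<Sum>m. q ^ m)" using assms by (intro sum_le_suminf summable_geometric) auto
  finally show ?thesis using assms by (simp add: suminf_geometric)
qed

text \<open>The numbers 2^(l/2) / B form a geometric progression. On either side of the place where
  it crosses 1, the terms fall at least like powers of 2^(-1/4), so the bound depends neither on
  \<open>B\<close> nor on \<open>S\<close>.\<close>

lemma bump_sum: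
  fixes B :: real and S :: "nat set"
  assumes B: "0 < B" and S: "finite S"
  shows "(\<Sum>l\<in>S. if B \<le> 2 powr (real l / 2) then (2 powr (real l / 2) / B) powr (- 1 / 2)
      else (2 powr (real l / 2) / B) powr (1 / 2)) \<le> 2 / (1 - 2 powr (- 1 / 4))"
proof -
  define q :: real where "q = 2 powr (- 1 / 4)"
  have q: "0 < q" "q < 1" unfolding q_def using powr_less_mono[of "-1/4" 0 "2::real"] by auto
  define y where "y l = 2 powr (real l / 2) / B" for l :: nat
  have y: "0 < y l" for l using B by (simp add: y_def)
  have ratio: "y l = y m * 2 powr ((real l - real m) / 2)" for l m
    by (simp add: y_def powr_add[symmetric] algebra_simps flip: add_divide_distrib)
  have qp: "q ^ n = 2 powr (- real n / 4)" for n
    unfolding q_def by (simp add: powr_powr flip: powr_realpow)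
  define S1 where "S1 = {l\<in>S. B \<le> 2 powr (real l / 2)}"
  define S2 where "S2 = {l\<in>S. \<not> B \<le> 2 powr (real l / 2)}"
  have fin: "finite S1" "finite S2" using S by (simp_all add: S1_def S2_def)
  have 1: "(\<Sum>l\<in>S1. y l powr (- 1 / 2)) \<le> 1 / (1 - q)"
  proof (cases "S1 = {}")
    case False
    define m where "m = Min S1"
    have m: "m \<in> S1" "\<And>l. l \<in> S1 \<Longrightarrow> m \<le> l" using fin False by (simp_all add: m_def)
    have "y l powr (- 1 / 2) \<le> q ^ (l - m)" if "l \<in> S1" for l
    proof -
      have "1 \<le> y m" using m(1) B by (simp add: S1_def y_def)
      then have "2 powr ((real l - real m) / 2) \<le> y l" unfolding ratio[of l m] by simp
      then have "y l powr (- 1 / 2) \<le> (2 powr ((real l - real m) / 2)) powr (- 1 / 2)"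
        by (intro powr_mono2') auto
      also have "\<dots> = q ^ (l - m)"
      proof -
        have "(real l - real m) / 2 * (- 1 / 2) = - real (l - m) / 4"
          unfolding of_nat_diff[OF m(2)[OF that]] by linarith
        then show ?thesis unfolding qp powr_powr by (simp only:)
      qed
      finally show ?thesis .
    qed
    then have "(\<Sum>l\<in>S1. y l powr (- 1 / 2)) \<le> (\<Sum>l\<in>S1. q ^ (l - m))" by (rule sum_mono)
    also have "\<dots> \<le> 1 / (1 - q)"
    proof (rule geometric_subset_sum[OF q fin(1)], rule inj_onI)
      fix l l' assume "l \<in> S1" "l' \<in> S1" "l - m = l' - m"
      then show "l = l'" using m(2)[of l] m(2)[of l'] by arith
    qed
    finally show ?thesis .
  qed (use q in auto)
  have 2: "(\<Sum>l\<in>S2. y l powr (1 / 2)) \<le> 1 / (1 - q)"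
  proof (cases "S2 = {}")
    case False
    define m where "m = Max S2"
    have m: "m \<in> S2" "\<And>l. l \<in> S2 \<Longrightarrow> l \<le> m" using fin False by (simp_all add: m_def)
    have "y l powr (1 / 2) \<le> q ^ (m - l)" if "l \<in> S2" for l
    proof -
      have "y m \<le> 1" using m(1) B by (simp add: S2_def y_def)
      then have "y l \<le> 2 powr ((real l - real m) / 2)" unfolding ratio[of l m]
        using mult_right_mono[of "y m" 1 "2 powr ((real l - real m) / 2)"] by simp
      then have "y l powr (1 / 2) \<le> (2 powr ((real l - real m) / 2)) powr (1 / 2)"
        using y[of l] by (intro powr_mono2) auto
      also have "\<dots> = q ^ (m - l)"
      proof -
        have "(real l - real m) / 2 * (1 / 2) = - real (m - l) / 4"
          unfolding of_nat_diff[OF m(2)[OF that]] by (simp add: field_simps)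
        then show ?thesis unfolding qp powr_powr by (simp only:)
      qed
      finally show ?thesis .
    qed
    then have "(\<Sum>l\<in>S2. y l powr (1 / 2)) \<le> (\<Sum>l\<in>S2. q ^ (m - l))" by (rule sum_mono)
    also have "\<dots> \<le> 1 / (1 - q)"
    proof (rule geometric_subset_sum[OF q fin(2)], rule inj_onI)
      fix l l' assume "l \<in> S2" "l' \<in> S2" "m - l = m - l'"
      then show "l = l'" using m(2)[of l] m(2)[of l'] by arith
    qed
    finally show ?thesis .
  qed (use q in auto)
  have "(\<Sum>l\<in>S. if B \<le> 2 powr (real l / 2) then y l powr (- 1 / 2) else y l powr (1 / 2)) =
      (\<Sum>l\<in>S1. y l powr (- 1 / 2)) + (\<Sum>l\<in>S2. y l powr (1 / 2))"
    unfolding S1_def S2_def using S by (subst sum.If_cases) (auto simp: Int_def intro!: arg_cong2[of _ _ _ _ "(+)"] sum.cong)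
  also have "\<dots> \<le> 2 / (1 - q)" using 1 2 by simp
  finally show ?thesis unfolding y_def q_def .
qed

lemma exp_minus_le_power: "0 < u \<Longrightarrow> exp (- u) \<le> fact d / u ^ d" for u :: real
proof -
  assume u: "0 < u"
  have "u ^ d /\<^sub>R fact d \<le> exp u"
    using sum_le_suminf[OF summable_exp_generic[of u], of "{d}"] u by (simp add: exp_def)
  then have "u ^ d \<le> fact d * exp u" by (simp add: field_simps)
  then show ?thesis using u by (simp add: exp_minus field_simps)
qed

text \<open>The scale 2^(l/2) is compared with B = max 1 A. Above B the prefactor alone decays,
  since 2 - d + 2 \<eta> \<le> -1/2; below B the exponential, bounded by d! / u^d, outweighs the
  growth of the prefactor. Both regimes peak near B, which yields B^(2-d) up to the small
  exponents.\<close>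

lemma dyadic_sum:
  fixes g A \<epsilon> \<eta> \<delta> :: real
  assumes g: "0 < g" and A: "0 \<le> A" and d: "3 \<le> d" and \<eta>: "0 \<le> \<eta>" "\<eta> \<le> 1 / 4" and \<delta>: "0 \<le> \<delta>"
    and \<epsilon>: "2 * \<eta> + 3 * \<delta> * real d \<le> \<epsilon>"
  shows "(\<Sum>l\<in>{1..K}. 2 powr (real l * (1 - real d / 2 + \<eta>)) * exp (- g * A / 2 powr (real l * (1 + 3 * \<delta>) / 2)))
    \<le> (1 + fact d / g ^ d) * (2 / (1 - 2 powr (- 1 / 4))) * max 1 A powr (2 - real d + \<epsilon>)"
proof -
  define B where "B = max 1 A"
  have B: "1 \<le> B" by (simp add: B_def)
  define m where "m l = (if B \<le> 2 powr (real l / 2) then (2 powr (real l / 2) / B) powr (- 1 / 2)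
      else (2 powr (real l / 2) / B) powr (1 / 2))" for l :: nat
  have "2 powr (real l * (1 - real d / 2 + \<eta>)) * exp (- g * A / 2 powr (real l * (1 + 3 * \<delta>) / 2)) \<le>
      (1 + fact d / g ^ d) * B powr (2 - real d + \<epsilon>) * m l" for l
  proof -
    define y where "y = 2 powr (real l / 2) / B"
    have y: "0 < y" using B by (simp add: y_def)
    have By: "B * y = 2 powr (real l / 2)" using B by (simp add: y_def)
    have t1: "2 powr (real l * (1 - real d / 2 + \<eta>)) = (B * y) powr (2 - real d + 2 * \<eta>)"
      unfolding By powr_powr by (simp add: algebra_simps)
    show ?thesis
    proof (cases "1 \<le> y")
      case True
      then have my: "m l = y powr (- 1 / 2)" using B by (simp add: m_def y_def)
      have "2 powr (real l * (1 - real d / 2 + \<eta>)) * exp (- g * A / 2 powr (real l * (1 + 3 * \<delta>) / 2)) \<le>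
          2 powr (real l * (1 - real d / 2 + \<eta>)) * 1"
        using g A by (intro mult_left_mono) auto
      also have "\<dots> = B powr (2 - real d + 2 * \<eta>) * y powr (2 - real d + 2 * \<eta>)"
        unfolding t1 using B y by (simp add: powr_mult)
      also have "\<dots> \<le> B powr (2 - real d + \<epsilon>) * y powr (- 1 / 2)"
      proof (intro mult_mono powr_mono)
        have "0 \<le> 3 * \<delta> * real d" using \<delta> by simp
        then show "2 - real d + 2 * \<eta> \<le> 2 - real d + \<epsilon>" using \<epsilon> by linarith
        show "2 - real d + 2 * \<eta> \<le> - 1 / 2" using d \<eta> by simp
      qed (use B True in auto)
      also have "\<dots> \<le> (1 + fact d / g ^ d) * (B powr (2 - real d + \<epsilon>) * y powr (- 1 / 2))"
      proof -
        have "1 \<le> 1 + fact d / g ^ d" using g by simp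
        from mult_right_mono[OF this, of "B powr (2 - real d + \<epsilon>) * y powr (- 1 / 2)"] show ?thesis by simp
      qed
      finally show ?thesis by (simp add: my mult.assoc)
    next
      case False
      then have y1: "y < 1" by simp
      then have my: "m l = y powr (1 / 2)" using B by (simp add: m_def y_def)
      \<comment> \<open>As 2^(l/2) is at least 1, the case y < 1 forces B > 1 and hence B = A, so
        the exponential really involves B.\<close>
      have "1 \<le> 2 powr (real l / 2)" by (intro ge_one_powr_ge_zero) auto
      moreover have "2 powr (real l / 2) < B" using y1 B by (simp add: y_def)
      ultimately have AB: "A = B" unfolding B_def by linarith
      define u where "u = g * B / (B * y) powr (1 + 3 * \<delta>)"
      have u: "0 < u" using g B y by (simp add: u_def)
      have "2 powr (real l * (1 + 3 * \<delta>) / 2) = (B * y) powr (1 + 3 * \<delta>)"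
      proof -
        have "real l * (1 + 3 * \<delta>) / 2 = real l / 2 * (1 + 3 * \<delta>)" by simp
        then show ?thesis unfolding By powr_powr by simp
      qed
      then have "exp (- g * A / 2 powr (real l * (1 + 3 * \<delta>) / 2)) = exp (- u)" by (simp add: AB u_def)
      also have "\<dots> \<le> fact d / u ^ d" by (rule exp_minus_le_power[OF u])
      also have "\<dots> = (fact d / g ^ d) * (((B * y) powr (1 + 3 * \<delta>)) ^ d / B ^ d)"
        by (simp add: u_def power_divide power_mult_distrib)
      also have "((B * y) powr (1 + 3 * \<delta>)) ^ d = (B * y) powr (real d + 3 * \<delta> * real d)"
        using B y by (simp add: powr_powr algebra_simps flip: powr_realpow)
      finally have e: "exp (- g * A / 2 powr (real l * (1 + 3 * \<delta>) / 2)) \<le>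
          (fact d / g ^ d) * ((B * y) powr (real d + 3 * \<delta> * real d) / B ^ d)" .
      have "2 powr (real l * (1 - real d / 2 + \<eta>)) * exp (- g * A / 2 powr (real l * (1 + 3 * \<delta>) / 2)) \<le>
        (B * y) powr (2 - real d + 2 * \<eta>) * ((fact d / g ^ d) * ((B * y) powr (real d + 3 * \<delta> * real d) / B ^ d))"
        unfolding t1 using e by (intro mult_left_mono) auto
      also have "\<dots> = (fact d / g ^ d) * ((B * y) powr (2 + 2 * \<eta> + 3 * \<delta> * real d) / B powr real d)"
        using B y by (simp add: powr_realpow powr_add[symmetric] algebra_simps)
      also have "(B * y) powr (2 + 2 * \<eta> + 3 * \<delta> * real d) / B powr real d =
          B powr (2 - real d + (2 * \<eta> + 3 * \<delta> * real d)) * y powr (2 + 2 * \<eta> + 3 * \<delta> * real d)"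
      proof -
        have "2 - real d + (2 * \<eta> + 3 * \<delta> * real d) = (2 + 2 * \<eta> + 3 * \<delta> * real d) - real d" by simp
        then show ?thesis using B y by (simp only: powr_diff) (simp add: powr_mult)
      qed
      also have "(fact d / g ^ d) * \<dots> \<le> (1 + fact d / g ^ d) * (B powr (2 - real d + \<epsilon>) * y powr (1 / 2))"
      proof (intro mult_mono)
        show "B powr (2 - real d + (2 * \<eta> + 3 * \<delta> * real d)) \<le> B powr (2 - real d + \<epsilon>)"
          using B \<epsilon> by (intro powr_mono) auto
        have "0 \<le> 3 * \<delta> * real d" using \<delta> by simp
        then show "y powr (2 + 2 * \<eta> + 3 * \<delta> * real d) \<le> y powr (1 / 2)"
          using y y1 \<eta> by (intro powr_mono') auto
      qed (use g in auto)
      finally show ?thesis by (simp add: my mult.assoc)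
    qed
  qed
  then have "(\<Sum>l\<in>{1..K}. 2 powr (real l * (1 - real d / 2 + \<eta>)) * exp (- g * A / 2 powr (real l * (1 + 3 * \<delta>) / 2))) \<le>
      (\<Sum>l\<in>{1..K}. (1 + fact d / g ^ d) * B powr (2 - real d + \<epsilon>) * m l)" by (rule sum_mono)
  also have "\<dots> = (1 + fact d / g ^ d) * B powr (2 - real d + \<epsilon>) * (\<Sum>l\<in>{1..K}. m l)"
    by (simp add: sum_distrib_left)
  also have "\<dots> \<le> (1 + fact d / g ^ d) * B powr (2 - real d + \<epsilon>) * (2 / (1 - 2 powr (- 1 / 4)))"
    unfolding m_def using g B by (intro mult_left_mono bump_sum) auto
  finally show ?thesis unfolding B_def by (simp only: mult_ac)
qed

section \<open>Chaining smoothing steps of large mass ratio\<close>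

context flow
begin

definition A1 :: real where "A1 = real CARD('d) ^ CARD('d) / c0"
text \<open>The exponential compensates the decay factors demanded by \<open>p_step\<close> in the
  base case of \<open>smooth_bound\<close>: the d-fold power of F at 0 has support of radius d
  \<sigma> / c0, where those factors are bounded below.\<close>

definition A0 :: real where "A0 = A1 * exp (2 * ct * real CARD('d) / c0)"

lemma A_pos: "0 < A1" "0 < A0"
  using c0 by (simp_all add: A1_def A0_def)

lemma p_zero: "p 0 = F 0"
  by (simp add: p_def[abs_def] X0)

lemma cpow_F0_le: "1 \<le> j \<Longrightarrow> cpow (F 0) j x \<le> ennreal (A1 / \<sigma> ^ CARD('d))"
  using cpow_le_sup[of "F 0" _ "j - 1" x, OF F0_bound] mass[OF I0] by (cases j) (auto simp: X0 A1_def)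

lemma cpow_F0_range: "cpow (F 0) j x \<noteq> 0 \<Longrightarrow> supnorm x \<le> real j * (\<sigma> / c0)"
  by (rule cpow_range) (rule F0_range)

lemma D1_ge_1: "1 \<le> D1"
proof -
  interpret sg: subgaussian "p 0" "var 0" \<kappa> by (rule subgaussian_p[OF I0])
  have "1 \<le> Cc" unfolding Cc_def by (rule sg.conc_const_ge)
  moreover have "1 \<le> (27 * (1 + fact (CARD('d) - 2)) * sqrt 8 ^ (CARD('d) - 2) :: real)"
  proof -
    have "1 * 1 \<le> (27 * (1 + fact (CARD('d) - 2)) :: real) * sqrt 8 ^ (CARD('d) - 2)"
      by (intro mult_mono one_le_power) (auto intro: order_trans[of _ "27 * (1 + 0)"])
    then show ?thesis by simp
  qed
  moreover have "1 \<le> sqrt 2 ^ CARD('d)" by (intro one_le_power) simp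
  ultimately have "1 * 1 * 1 \<le> Cc * (27 * (1 + fact (CARD('d) - 2)) * sqrt 8 ^ (CARD('d) - 2)) * sqrt 2 ^ CARD('d)"
    by (intro mult_mono) auto
  then show ?thesis by (simp add: D1_def)
qed

text \<open>Both exponents in \<open>xi_lower\<close> and \<open>xi_upper\<close> differ from 1 by
  at most 3 \<delta>, and \<open>powr_three_delta_le\<close> bounds the resulting deviation by 2 for
  all mass ratios up to M. So one step is diffusive up to a constant that does not depend on
  M.\<close>

lemma xi2_ratio:
  assumes ab: "b \<in> I" "0 \<le> a" "a \<le> b"
    and M: "16 \<le> M" "\<delta> * M \<le> 1 / 4" and \<Lambda>: "X b / X a \<le> M"
  shows "xi2 b \<le> 2 * (X b / X a) * xi2 a" "(X b / X a) * xi2 a \<le> 2 * xi2 b"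
proof -
  define \<Lambda> where "\<Lambda> = X b / X a"
  have \<Lambda>1: "1 \<le> \<Lambda>" unfolding \<Lambda>_def by (rule X_ratio[OF ab])
  have aI: "a \<in> I" by (rule I_down[OF ab])
  have "\<Lambda> powr (3 * \<delta>) \<le> M powr (3 * \<delta>)"
    using \<Lambda> \<Lambda>1 \<delta> unfolding \<Lambda>_def[symmetric] by (intro powr_mono2) auto
  also have "\<dots> \<le> 2" using M \<delta> by (intro powr_three_delta_le) auto
  finally have two: "\<Lambda> powr (3 * \<delta>) \<le> 2" .
  have ex: "(1 + \<delta>) / (1 - \<delta>) \<le> 1 + 3 * \<delta>"
  proof -
    have "3 * (\<delta> * \<delta>) \<le> \<delta>" using \<delta> mult_left_mono[of \<delta> "1/100" \<delta>] by simp
    then show ?thesis using \<delta> by (simp add: divide_le_eq algebra_simps)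
  qed
  have "xi2 b \<le> xi2 a * \<Lambda> powr ((1 + \<delta>) / (1 - \<delta>))"
    using xi_upper[OF ab] by (simp add: xi2_def \<Lambda>_def)
  also have "\<dots> \<le> xi2 a * \<Lambda> powr (1 + 3 * \<delta>)"
    using ex \<Lambda>1 xi2_pos[OF aI] by (intro mult_left_mono powr_mono) auto
  also have "\<Lambda> powr (1 + 3 * \<delta>) = \<Lambda> * \<Lambda> powr (3 * \<delta>)" using \<Lambda>1 by (simp add: powr_add)
  also have "xi2 a * (\<Lambda> * \<Lambda> powr (3 * \<delta>)) \<le> xi2 a * (\<Lambda> * 2)"
    using two \<Lambda>1 xi2_pos[OF aI] by (intro mult_left_mono) auto
  finally show "xi2 b \<le> 2 * (X b / X a) * xi2 a" by (simp add: \<Lambda>_def mult_ac)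
  have "\<Lambda> = \<Lambda> powr (1 - 2 * \<delta>) * \<Lambda> powr (2 * \<delta>)" using \<Lambda>1 by (simp flip: powr_add)
  also have "\<dots> \<le> \<Lambda> powr (1 - 2 * \<delta>) * \<Lambda> powr (3 * \<delta>)"
    using \<Lambda>1 \<delta> by (intro mult_left_mono powr_mono) auto
  also have "\<dots> \<le> \<Lambda> powr (1 - 2 * \<delta>) * 2" using two by (intro mult_left_mono) auto
  finally have "xi2 a * \<Lambda> \<le> xi2 a * (\<Lambda> powr (1 - 2 * \<delta>) * 2)"
    using xi2_pos[OF aI] by (intro mult_left_mono) auto
  also have "\<dots> \<le> 2 * xi2 b"
  proof -
    have "xi2 a * \<Lambda> powr (1 - 2 * \<delta>) \<le> xi2 b" using xi_lower[OF ab] by (simp add: xi2_def \<Lambda>_def)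
    then show ?thesis by linarith
  qed
  finally show "(X b / X a) * xi2 a \<le> 2 * xi2 b" by (simp add: \<Lambda>_def mult.commute)
qed

text \<open>Each factor \<open>M\<close> in the mass costs one factor of \<open>D1\<close>; since \<open>D1\<close> does not depend on \<open>M\<close>, this
  amounts to a factor \<open>X b powr \<theta>\<close> with \<open>\<theta>\<close> as small as desired.\<close>

lemma smooth_bound:
  assumes d2: "2 \<le> CARD('d)" and M: "16 \<le> M" "\<delta> * M \<le> 1 / 4"
    and \<theta>: "0 \<le> \<theta>" "D1 \<le> M powr \<theta>"
    and b: "b \<in> I" "X b \<le> M ^ Suc k"
  shows "cpow (p b) CARD('d) x \<le>
    ennreal (A0 * D1 * X b powr \<theta> / xi b ^ CARD('d) * exp (- ct * supnorm x / xi b))"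
  using b
proof (induction k arbitrary: b x)
  case (0 b x)
  have bI: "b \<in> I" and XM: "X b \<le> M" using 0 by auto
  note ab = bI order_refl[of 0] I_nonneg[OF bI]
  have r: "X b / X 0 \<le> M" using XM X0 by simp
  have "cpow (p b) CARD('d) x \<le> ennreal (D1 * A0 / xi b ^ CARD('d) * exp (- ct * supnorm x / xi b))"
  proof (rule p_step[OF d2 ab refl _ xi2_ratio[OF ab M r]])
    have "\<delta> * (X b / X 0) \<le> \<delta> * M" using r \<delta> by (intro mult_left_mono) auto
    then show "\<delta> * (X b / X 0) \<le> 1 / 2" using M by simp
    show "0 \<le> A0" using A_pos by simp
    fix z
    show "cpow (p 0) CARD('d) z \<le> ennreal (A0 / xi 0 ^ CARD('d) *
        exp (- (ct / 2) * supnorm z / xi 0 - ct * supnorm z / xi b))"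
    proof (cases "cpow (F 0) CARD('d) z = 0")
      case True
      then show ?thesis by (simp add: p_zero)
    next
      case False
      have z: "supnorm z / \<sigma> \<le> real CARD('d) / c0"
        using cpow_F0_range[OF False] \<sigma> by (simp add: divide_le_eq)
      have "supnorm z / xi b \<le> supnorm z / \<sigma>"
        using xi_mono[OF ab] \<sigma> supnorm_nonneg[of z] unfolding xi_zero by (intro divide_left_mono) auto
      then have "ct * (supnorm z / xi b) \<le> ct * (real CARD('d) / c0)"
        using z ct_pos by (intro mult_left_mono) auto
      moreover have "ct * (supnorm z / \<sigma>) \<le> ct * (real CARD('d) / c0)"
        using z ct_pos by (intro mult_left_mono) auto
      moreover have "0 \<le> ct * (real CARD('d) / c0)" using ct_pos c0 by simp
      ultimately have "0 \<le> 2 * ct * real CARD('d) / c0 + (- (ct / 2) * supnorm z / \<sigma> - ct * supnorm z / xi b)"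
        by simp
      then have "1 \<le> exp (2 * ct * real CARD('d) / c0) * exp (- (ct / 2) * supnorm z / \<sigma> - ct * supnorm z / xi b)"
        unfolding exp_add[symmetric] by simp
      then have "A1 / \<sigma> ^ CARD('d) * 1 \<le> A1 / \<sigma> ^ CARD('d) *
          (exp (2 * ct * real CARD('d) / c0) * exp (- (ct / 2) * supnorm z / \<sigma> - ct * supnorm z / xi b))"
        using A_pos \<sigma> by (intro mult_left_mono) auto
      then have "ennreal (A1 / \<sigma> ^ CARD('d)) \<le> ennreal (A0 / xi 0 ^ CARD('d) *
        exp (- (ct / 2) * supnorm z / xi 0 - ct * supnorm z / xi b))"
        unfolding xi_zero A0_def by (intro ennreal_leI) simp
      with cpow_F0_le[of "CARD('d)" z] show ?thesis unfolding p_zero using d2 by (auto intro: order_trans)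
    qed
  qed
  also have "\<dots> \<le> ennreal (A0 * D1 * X b powr \<theta> / xi b ^ CARD('d) * exp (- ct * supnorm x / xi b))"
  proof (intro ennreal_leI mult_right_mono divide_right_mono)
    have "1 \<le> X b powr \<theta>" using X_ge_1[OF bI] \<theta> by (intro ge_one_powr_ge_zero) auto
    then have "A0 * D1 * 1 \<le> A0 * D1 * X b powr \<theta>" using A_pos D1_ge_1 by (intro mult_left_mono) auto
    then show "D1 * A0 \<le> A0 * D1 * X b powr \<theta>" by (simp add: mult.commute)
  qed (use xi_pos[OF bI] in auto)
  finally show ?case .
next
  case (Suc k b x)
  have bI: "b \<in> I" and XM: "X b \<le> M ^ Suc (Suc k)" using Suc.prems by auto
  show ?case
  proof (cases "X b \<le> M")
    case True
    have "M ^ 1 \<le> M ^ Suc k" using M by (intro power_increasing) auto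
    then show ?thesis using True by (intro Suc.IH bI) simp
  next
    case False
    \<comment> \<open>A mass ratio of exactly M makes X grow by M, so the gain M^\<theta> pays for
      the whole factor \<open>D1\<close> of this step.\<close>
    obtain a where a: "0 \<le> a" "a \<le> b" "X a = X b / M"
      using X_intermediate[OF bI, of "X b / M"] False M by (auto simp: field_simps)
    note ab = bI a(1,2)
    have aI: "a \<in> I" by (rule I_down[OF ab])
    have r: "X b / X a = M" using a(3) M X_pos[OF aI] by (simp add: field_simps)
    note ratio = xi2_ratio[OF ab M, unfolded r, OF order_refl]
    \<comment> \<open>M \<ge> 16 separates the two scales: half of the rate ct / xi a already covers
      ct / xi b, and the other half is the localisation that \<open>p_step\<close> asks for.\<close>
    have half: "2 * xi a \<le> xi b"
    proof -
      have "16 * xi2 a \<le> M * xi2 a" using M xi2_pos[OF aI] by (intro mult_right_mono) auto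
      then have "4 * xi2 a \<le> xi2 b" using ratio(2) xi2_pos[OF aI] by linarith
      then have "sqrt (4 * xi2 a) \<le> sqrt (xi2 b)" by (rule real_sqrt_le_mono)
      then show ?thesis by (simp add: xi_def real_sqrt_mult)
    qed
    have "cpow (p b) CARD('d) x \<le> ennreal (D1 * (A0 * D1 * X a powr \<theta>) / xi b ^ CARD('d) * exp (- ct * supnorm x / xi b))"
    proof (rule p_step[OF d2 ab r[symmetric] _ ratio])
      show "\<delta> * M \<le> 1 / 2" using M by simp
      show "0 \<le> A0 * D1 * X a powr \<theta>" using A_pos D1_ge_1 by simp
      fix z
      have "cpow (p a) CARD('d) z \<le> ennreal (A0 * D1 * X a powr \<theta> / xi a ^ CARD('d) * exp (- ct * supnorm z / xi a))"
      proof (rule Suc.IH[OF aI])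
        have "M * X a \<le> M * M ^ Suc k" using a(3) XM M by simp
        then show "X a \<le> M ^ Suc k" using M by (subst (asm) mult_le_cancel_left_pos) auto
      qed
      also have "\<dots> \<le> ennreal (A0 * D1 * X a powr \<theta> / xi a ^ CARD('d) *
          exp (- (ct / 2) * supnorm z / xi a - ct * supnorm z / xi b))"
      proof (intro ennreal_leI mult_left_mono exp_le_cancel_iff[THEN iffD2])
        have "ct * supnorm z / xi b \<le> ct * supnorm z / (2 * xi a)"
          using half xi_pos[OF aI] xi_pos[OF bI] ct_pos supnorm_nonneg[of z] by (intro divide_left_mono) auto
        then show "- ct * supnorm z / xi a \<le> - (ct / 2) * supnorm z / xi a - ct * supnorm z / xi b"
          by simp
      qed (use A_pos D1_ge_1 xi_pos[OF aI] in auto)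
      finally show "cpow (p a) CARD('d) z \<le> \<dots>" .
    qed
    also have "\<dots> \<le> ennreal (A0 * D1 * X b powr \<theta> / xi b ^ CARD('d) * exp (- ct * supnorm x / xi b))"
    proof (intro ennreal_leI mult_right_mono divide_right_mono)
      have "X b = M * X a" using a(3) M by simp
      then have "X b powr \<theta> = M powr \<theta> * X a powr \<theta>" using M X_pos[OF aI] by (simp add: powr_mult)
      then have "D1 * X a powr \<theta> \<le> X b powr \<theta>" using \<theta> by (simp add: mult_right_mono)
      then have "A0 * D1 * (D1 * X a powr \<theta>) \<le> A0 * D1 * X b powr \<theta>" using A_pos D1_ge_1 by (intro mult_left_mono) auto
      then show "D1 * (A0 * D1 * X a powr \<theta>) \<le> A0 * D1 * X b powr \<theta>" by (simp add: mult_ac)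
    qed (use xi_pos[OF bI] in auto)
    finally show ?thesis .
  qed
qed

section \<open>Taylor expansion in the parameter along dyadic masses\<close>

lemma strict_X: "b \<in> I \<Longrightarrow> 0 \<le> a \<Longrightarrow> a < b \<Longrightarrow> X a < X b"
proof -
  assume *: "b \<in> I" "0 \<le> a" "a < b"
  have "0 < (1 - \<delta>) * (b - a)" using * \<delta> by simp
  then have "1 / X b < 1 / X a" using inv_lower[of b a] * by simp
  then show ?thesis using X_pos[OF *(1)] X_pos[OF I_down[of b a]] * by (simp add: field_simps)
qed

text \<open>The 8 d is 4 d, from a power of order at most d and steps of length at most 2 * 2^(-l) =
  4 * 2^(-(l+1)), times the 2 of \<open>ennreal_sum_dyadic\<close>. The 1 accounts for the boundary
  term \<open>Q\<close>.\<close>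

primrec taylor_const :: "nat \<Rightarrow> real" where
  "taylor_const 0 = 1"
| "taylor_const (Suc m) = 1 + 8 * real CARD('d) * taylor_const m"

lemma taylor_const_ge_1: "1 \<le> taylor_const m"
  by (induction m) auto

definition Q :: "'d lattice \<Rightarrow> ennreal" where
  "Q x = (\<Sum>j\<in>{1..CARD('d)}. cpow (F 0) j x)"

text \<open>Telescoping along \<open>pt\<close> with \<open>cpow_diff_le\<close> raises the order of
  the convolution power by one and gains the step length, of order 2^(-l). After \<open>m\<close>
  rounds only d-fold powers remain, weighted by 2^(-l m), and the values at parameter 0 collect in
  \<open>Q\<close>. F itself is the case m = d - 1.\<close>

lemma taylor:
  assumes pt0: "pt 0 = 0" and ptI: "\<And>l. pt l \<in> I" and pt_mono: "\<And>l. pt l \<le> pt (Suc l)"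
    and pt_step: "\<And>l. pt (Suc l) - pt l \<le> 2 * (1/2) ^ l"
    and m: "m < CARD('d)"
  shows "cpow (F (pt k)) (CARD('d) - m) x \<le> ennreal (taylor_const m) *
    (Q x + (\<Sum>l\<in>{1..k}. ennreal ((1/2) ^ l) ^ m * cpow (F (pt l)) CARD('d) x))"
  using m
proof (induction m arbitrary: k)
  case 0
  have "cpow (F (pt k)) CARD('d) x \<le> Q x + (\<Sum>l\<in>{1..k}. cpow (F (pt l)) CARD('d) x)"
  proof (cases k)
    case 0
    have "cpow (F 0) CARD('d) x \<le> Q x"
      unfolding Q_def by (rule member_le_sum) auto
    then show ?thesis using 0 pt0 by simp
  next
    case (Suc k')
    have "cpow (F (pt k)) CARD('d) x \<le> (\<Sum>l\<in>{1..k}. cpow (F (pt l)) CARD('d) x)"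
      by (rule member_le_sum) (use Suc in auto)
    then show ?thesis by (simp add: add_increasing)
  qed
  then show ?case by simp
next
  case (Suc m)
  define j where "j = CARD('d) - Suc m"
  have j: "1 \<le> j" "CARD('d) - m = Suc j" "j \<le> CARD('d)" using Suc.prems by (simp_all add: j_def)
  let ?T = "\<lambda>l. cpow (F (pt l)) (Suc j) x"
  let ?c = "ennreal (4 * real CARD('d))"
  have pt_nonneg: "0 \<le> pt l" for l using I_nonneg[OF ptI] .
  have incr: "cpow (F (pt (Suc l))) j x \<le> cpow (F (pt l)) j x + ?c * (ennreal ((1/2) ^ Suc l) * ?T (Suc l))" for l
  proof -
    obtain j' where j': "j = Suc j'" using j(1) by (cases j) auto
    have "cpow (F (pt (Suc l))) j x \<le> cpow (F (pt l)) j x + of_nat j * ennreal (pt (Suc l) - pt l) * ?T (Suc l)"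
      unfolding j'
    proof (rule cpow_diff_le)
      show "F (pt (Suc l)) x \<le> F (pt l) x + ennreal (pt (Suc l) - pt l) * conv (F (pt l)) (F (pt (Suc l))) x" for x
        by (rule renewal[OF ptI pt_nonneg pt_mono])
      show "F (pt l) x \<le> F (pt (Suc l)) x" for x
        by (rule F_mono[OF ptI pt_nonneg pt_mono])
    qed
    also have "of_nat j * ennreal (pt (Suc l) - pt l) \<le> ?c * ennreal ((1/2) ^ Suc l)"
    proof -
      have "real j * (pt (Suc l) - pt l) \<le> real CARD('d) * (2 * (1/2) ^ l)"
        using j(3) pt_mono pt_step by (intro mult_mono) auto
      then have "ennreal (real j * (pt (Suc l) - pt l)) \<le> ennreal (4 * real CARD('d) * (1/2) ^ Suc l)"
        by (intro ennreal_leI) simp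
      then show ?thesis using pt_mono[of l]
        by (simp add: ennreal_of_nat_eq_real_of_nat ennreal_mult[symmetric] del: power_Suc)
    qed
    finally show ?thesis by (simp only: mult.assoc add_left_mono mult_right_mono zero_le)
  qed
  have tel: "cpow (F (pt k)) j x \<le> Q x + ?c * (\<Sum>l\<in>{1..k}. ennreal ((1/2) ^ l) * ?T l)" for k
  proof (induction k)
    case 0
    have "cpow (F 0) j x \<le> Q x"
      unfolding Q_def by (rule member_le_sum) (use j in auto)
    then show ?case by (simp add: pt0)
  next
    case (Suc k)
    have "cpow (F (pt (Suc k))) j x \<le> cpow (F (pt k)) j x + ?c * (ennreal ((1/2) ^ Suc k) * ?T (Suc k))"
      by (rule incr)
    also have "\<dots> \<le> (Q x + ?c * (\<Sum>l\<in>{1..k}. ennreal ((1/2) ^ l) * ?T l)) + ?c * (ennreal ((1/2) ^ Suc k) * ?T (Suc k))"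
      by (rule add_right_mono[OF Suc])
    also have "\<dots> = Q x + ?c * (\<Sum>l\<in>{1..Suc k}. ennreal ((1/2) ^ l) * ?T l)"
      by (simp add: distrib_left add.assoc del: power_Suc cpow.simps)
    finally show ?case .
  qed
  let ?f = "\<lambda>l. ennreal ((1/2) ^ l) ^ m * cpow (F (pt l)) CARD('d) x"
  let ?tc = "ennreal (taylor_const m)"
  have IH: "?T l \<le> ?tc * (Q x + (\<Sum>i\<in>{1..l}. ?f i))" for l
    using Suc.IH[of l] Suc.prems unfolding j(2) by simp
  have "cpow (F (pt k)) j x \<le> Q x + ?c * (\<Sum>l\<in>{1..k}. ennreal ((1/2) ^ l) * (?tc * (Q x + (\<Sum>i\<in>{1..l}. ?f i))))"
    by (rule order_trans[OF tel]) (intro add_left_mono mult_left_mono sum_mono IH, auto)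
  also have "\<dots> = Q x + ?c * ?tc * (\<Sum>l\<in>{1..k}. ennreal ((1/2) ^ l) * (Q x + (\<Sum>i\<in>{1..l}. ?f i)))"
    by (simp only: mult.left_commute[of _ ?tc] sum_distrib_left[symmetric] mult.assoc)
  also have "\<dots> \<le> Q x + ?c * ?tc * (Q x + 2 * (\<Sum>i\<in>{1..k}. ennreal ((1/2) ^ i) * ?f i))"
    by (intro add_left_mono mult_left_mono ennreal_sum_dyadic) auto
  also have "\<dots> \<le> Q x + ?c * ?tc * (2 * (Q x + (\<Sum>i\<in>{1..k}. ennreal ((1/2) ^ i) * ?f i)))"
    by (intro add_left_mono mult_left_mono) (auto simp: distrib_left mult_2 intro: add_right_mono add_increasing2)
  also have "\<dots> \<le> (Q x + (\<Sum>i\<in>{1..k}. ennreal ((1/2) ^ i) * ?f i)) + ?c * ?tc * (2 * (Q x + (\<Sum>i\<in>{1..k}. ennreal ((1/2) ^ i) * ?f i)))"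
    by (intro add_right_mono) (simp add: add_increasing2)
  also have "\<dots> = (1 + ?c * ?tc * 2) * (Q x + (\<Sum>i\<in>{1..k}. ennreal ((1/2) ^ i) * ?f i))"
    by (simp only: distrib_right mult_1 mult.assoc)
  also have "1 + ?c * ?tc * 2 = ennreal (taylor_const (Suc m))"
  proof -
    have "?c * ?tc = ennreal (4 * real CARD('d) * taylor_const m)"
      by (rule ennreal_mult'[symmetric]) simp
    moreover have "ennreal (4 * real CARD('d) * taylor_const m) * ennreal 2 = ennreal (4 * real CARD('d) * taylor_const m * 2)"
      by (rule ennreal_mult''[symmetric]) simp
    ultimately have "1 + ?c * ?tc * 2 = ennreal 1 + ennreal (4 * real CARD('d) * taylor_const m * 2)"
      by simp
    also have "\<dots> = ennreal (1 + 4 * real CARD('d) * taylor_const m * 2)"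
      using taylor_const_ge_1[of m] by (intro ennreal_plus[symmetric]) auto
    finally show ?thesis by (simp add: mult_ac)
  qed
  also have "(\<Sum>i\<in>{1..k}. ennreal ((1/2) ^ i) * ?f i) = (\<Sum>l\<in>{1..k}. ennreal ((1/2) ^ l) ^ Suc m * cpow (F (pt l)) CARD('d) x)"
    by (simp add: mult.assoc)
  finally show ?case unfolding j_def .
qed

text \<open>The points solve X (pt l) = min (2^l) (X b). Between consecutive ones 1 / X falls by at
  most 2^(-l), and it falls at rate at least 1 - \<delta> \<ge> 1/2, which bounds the step
  length.\<close>

lemma dyadic_points:
  assumes b: "b \<in> I" and K: "X b \<le> 2 ^ K"
  obtains pt where "pt 0 = 0" "\<And>l. pt l \<in> I" "\<And>l. pt l \<le> pt (Suc l)" "\<And>l. pt l \<le> b"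
    "\<And>l. pt (Suc l) - pt l \<le> 2 * (1/2) ^ l" "\<And>l. X (pt l) \<le> 2 ^ l" "pt K = b"
proof -
  have "\<exists>a. 0 \<le> a \<and> a \<le> b \<and> X a = min (2 ^ l) (X b)" for l
    using X_intermediate[OF b, of "min (2 ^ l) (X b)"] X_ge_1[OF b] by (metis min.bounded_iff min.cobounded2 one_le_numeral one_le_power)
  then obtain pt where pt: "\<And>l. 0 \<le> pt l" "\<And>l. pt l \<le> b" "\<And>l. X (pt l) = min (2 ^ l) (X b)" by metis
  have ptI: "pt l \<in> I" for l by (rule I_down[OF b pt(1,2)])
  have inj: "s \<le> t" if "X s \<le> X t" "s \<in> I" "t \<in> I" for s t
  proof (rule ccontr)
    assume "\<not> s \<le> t"
    then have "X t < X s" using that I_nonneg[of t] by (intro strict_X) auto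
    then show False using that by simp
  qed
  show ?thesis
  proof (rule that)
    have "X (pt 0) \<le> X 0" using pt(3)[of 0] X0 by simp
    then have "pt 0 \<le> 0" using ptI I0 inj by blast
    then show "pt 0 = 0" using pt(1)[of 0] by simp
    show mono: "pt l \<le> pt (Suc l)" for l
    proof (rule inj[OF _ ptI ptI])
      have "(2::real) ^ l \<le> 2 ^ Suc l" by simp
      then show "X (pt l) \<le> X (pt (Suc l))" unfolding pt(3) by linarith
    qed
    show "X (pt l) \<le> 2 ^ l" for l using pt(3)[of l] by simp
    have "b \<le> pt K" by (rule inj[OF _ b ptI]) (use pt(3)[of K] K in simp)
    then show "pt K = b" using pt(2)[of K] by simp
    show "pt (Suc l) - pt l \<le> 2 * (1/2) ^ l" for l
    proof (cases "2 ^ l \<le> X b")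
      case True
      then have Xl: "X (pt l) = 2 ^ l" using pt(3)[of l] by simp
      have "(1 - \<delta>) * (pt (Suc l) - pt l) \<le> 1 / X (pt l) - 1 / X (pt (Suc l))"
        by (rule inv_lower[OF ptI pt(1) mono])
      also have "\<dots> \<le> 1 / 2 ^ l" using X_pos[OF ptI[of "Suc l"]] Xl by simp
      finally have "(1 - \<delta>) * (pt (Suc l) - pt l) \<le> (1/2) ^ l" by (simp add: power_one_over)
      moreover have "1 / 2 * (pt (Suc l) - pt l) \<le> (1 - \<delta>) * (pt (Suc l) - pt l)"
        using \<delta> mono[of l] by (intro mult_right_mono) auto
      ultimately show ?thesis by simp
    next
      \<comment> \<open>Once 2^l exceeds X b the sequence rests at \<open>b\<close>, so this step
        has length 0.\<close>
      case False
      then have "X (pt (Suc l)) \<le> X (pt l)" using pt(3)[of l] pt(3)[of "Suc l"] by simp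
      then have "pt (Suc l) \<le> pt l" using inj[OF _ ptI ptI] by blast
      then show ?thesis by (smt (verit) zero_le_power divide_nonneg_nonneg)
    qed
  qed (use ptI pt in auto)
qed

end

section \<open>The pointwise bound for the flow\<close>

context flow
begin

text \<open>The first summand is the constant of \<open>Q_bound\<close>, the second that of
  \<open>dyadic_sum\<close> with rate ct / 2.\<close>

definition final_const :: real where
  "final_const = taylor_const (CARD('d) - 1) *
     (real CARD('d) * A1 * (real CARD('d) / c0) ^ CARD('d) * exp (ct * real CARD('d) / c0) +
      A0 * D1 * ((1 + fact CARD('d) / (ct / 2) ^ CARD('d)) * (2 / (1 - 2 powr (- 1 / 4)))))"

lemma xi_bounds:
  assumes b: "b \<in> I"
  shows "\<sigma> * X b powr ((1 - 2 * \<delta>) / 2) \<le> xi b" "xi b \<le> \<sigma> * X b powr ((1 + 3 * \<delta>) / 2)"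
proof -
  note zb = b order_refl[of 0] I_nonneg[OF b]
  have X1: "1 \<le> X b" by (rule X_ge_1[OF b])
  have s: "sqrt (\<sigma>\<^sup>2 * X b powr e) = \<sigma> * X b powr (e / 2)" for e
    using \<sigma> X1 by (simp add: real_sqrt_mult powr_half_sqrt[symmetric] powr_powr)
  have "\<sigma>\<^sup>2 * X b powr (1 - 2 * \<delta>) \<le> xi2 b"
    using xi_lower[OF zb] by (simp add: xi2_def X0 V0)
  then have "sqrt (\<sigma>\<^sup>2 * X b powr (1 - 2 * \<delta>)) \<le> xi b" unfolding xi_def by (rule real_sqrt_le_mono)
  then show "\<sigma> * X b powr ((1 - 2 * \<delta>) / 2) \<le> xi b" unfolding s .
  have ex: "(1 + \<delta>) / (1 - \<delta>) \<le> 1 + 3 * \<delta>"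
  proof -
    have "3 * (\<delta> * \<delta>) \<le> \<delta>" using \<delta> mult_left_mono[of \<delta> "1/100" \<delta>] by simp
    then show ?thesis using \<delta> by (simp add: divide_le_eq algebra_simps)
  qed
  have "xi2 b \<le> \<sigma>\<^sup>2 * X b powr ((1 + \<delta>) / (1 - \<delta>))"
    using xi_upper[OF zb] by (simp add: xi2_def X0 V0)
  also have "\<dots> \<le> \<sigma>\<^sup>2 * X b powr (1 + 3 * \<delta>)"
    using ex X1 by (intro mult_left_mono powr_mono) auto
  finally have "xi b \<le> sqrt (\<sigma>\<^sup>2 * X b powr (1 + 3 * \<delta>))" unfolding xi_def by (rule real_sqrt_le_mono)
  then show "xi b \<le> \<sigma> * X b powr ((1 + 3 * \<delta>) / 2)" unfolding s .
qed

text \<open>\<open>Q\<close> lives in the ball of radius d \<sigma> / c0, where both the power and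
  the exponential on the right are bounded below in terms of d and c0.\<close>

lemma Q_bound:
  assumes b: "b \<in> I" and e: "0 \<le> e" "e \<le> real CARD('d)" "1 \<le> CARD('d)"
  shows "Q x \<le> ennreal (real CARD('d) * A1 * (real CARD('d) / c0) ^ CARD('d) * exp (ct * real CARD('d) / c0) /
    \<sigma> ^ CARD('d) * (\<sigma> / max \<sigma> (supnorm x)) powr e * exp (- (ct / 2) * supnorm x / xi b))"
proof -
  let ?d = "real CARD('d)"
  have d1: "1 \<le> ?d" using e by simp
  define z where "z = ?d / c0"
  have z1: "1 \<le> z" using order_trans[OF c0(2) d1] c0 by (simp add: z_def)
  show ?thesis
  proof (cases "supnorm x \<le> z * \<sigma>")
    case False
    have "cpow (F 0) j x = 0" if "j \<in> {1..CARD('d)}" for j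
    proof (rule ccontr)
      assume "cpow (F 0) j x \<noteq> 0"
      then have "supnorm x \<le> real j * (\<sigma> / c0)" by (rule cpow_F0_range)
      also have "\<dots> \<le> ?d * (\<sigma> / c0)" using that \<sigma> c0 by (intro mult_right_mono) auto
      finally show False using False by (simp add: z_def)
    qed
    then have "Q x = 0" unfolding Q_def by (intro sum.neutral) auto
    then show ?thesis by simp
  next
    case True
    have "Q x \<le> (\<Sum>j\<in>{1..CARD('d)}. ennreal (A1 / \<sigma> ^ CARD('d)))"
      unfolding Q_def by (intro sum_mono cpow_F0_le) auto
    also have "\<dots> = ennreal (?d * (A1 / \<sigma> ^ CARD('d)))"
      by (simp only: sum_constant card_atLeastAtMost diff_Suc_1 add_diff_cancel_right' Suc_eq_plus1[symmetric]
          ennreal_of_nat_eq_real_of_nat ennreal_mult'[OF of_nat_0_le_iff])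
    also have "\<dots> \<le> ennreal (?d * A1 * z ^ CARD('d) * exp (ct * z) / \<sigma> ^ CARD('d) *
        (\<sigma> / max \<sigma> (supnorm x)) powr e * exp (- (ct / 2) * supnorm x / xi b))"
    proof (rule ennreal_leI)
      have "max \<sigma> (supnorm x) \<le> z * \<sigma>" using True z1 \<sigma> by auto
      then have "1 / z \<le> \<sigma> / max \<sigma> (supnorm x)"
        using \<sigma> z1 by (simp add: field_simps max_def split: if_splits)
      then have "(1 / z) powr e \<le> (\<sigma> / max \<sigma> (supnorm x)) powr e" using e z1 by (intro powr_mono2) auto
      moreover have "(1 / z) powr ?d \<le> (1 / z) powr e" using e z1 by (intro powr_mono') auto
      moreover have "(1 / z) powr ?d = (1 / z) ^ CARD('d)" using z1 by (simp add: powr_realpow)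
      ultimately have "(1 / z) ^ CARD('d) \<le> (\<sigma> / max \<sigma> (supnorm x)) powr e" by linarith
      then have "z ^ CARD('d) * (1 / z) ^ CARD('d) \<le> z ^ CARD('d) * (\<sigma> / max \<sigma> (supnorm x)) powr e"
        using z1 by (intro mult_left_mono) auto
      then have p: "1 \<le> z ^ CARD('d) * (\<sigma> / max \<sigma> (supnorm x)) powr e"
        using z1 by (simp add: power_mult_distrib[symmetric])
      have "supnorm x / xi b \<le> supnorm x / \<sigma>"
        using xi_mono[OF b order_refl I_nonneg[OF b]] \<sigma> supnorm_nonneg[of x] unfolding xi_zero
        by (intro divide_left_mono) auto
      also have "\<dots> \<le> z" using True \<sigma> by (simp add: divide_le_eq)
      finally have "ct * (supnorm x / xi b) \<le> ct * z" using ct_pos by (intro mult_left_mono) auto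
      moreover have "0 \<le> ct * (supnorm x / xi b)"
        using ct_pos xi_pos[OF b] supnorm_nonneg[of x] by simp
      ultimately have "0 \<le> ct * z + - (ct / 2) * supnorm x / xi b" by simp
      then have q: "1 \<le> exp (ct * z) * exp (- (ct / 2) * supnorm x / xi b)"
        unfolding exp_add[symmetric] by simp
      have "1 * 1 \<le> (z ^ CARD('d) * (\<sigma> / max \<sigma> (supnorm x)) powr e) * (exp (ct * z) * exp (- (ct / 2) * supnorm x / xi b))"
        using p q by (intro mult_mono) auto
      then have "?d * (A1 / \<sigma> ^ CARD('d)) * 1 \<le> ?d * (A1 / \<sigma> ^ CARD('d)) *
          ((z ^ CARD('d) * (\<sigma> / max \<sigma> (supnorm x)) powr e) * (exp (ct * z) * exp (- (ct / 2) * supnorm x / xi b)))"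
        using A_pos \<sigma> by (intro mult_left_mono) auto
      then show "?d * (A1 / \<sigma> ^ CARD('d)) \<le> ?d * A1 * z ^ CARD('d) * exp (ct * z) / \<sigma> ^ CARD('d) *
        (\<sigma> / max \<sigma> (supnorm x)) powr e * exp (- (ct / 2) * supnorm x / xi b)"
        by (simp add: mult_ac)
    qed
    finally show ?thesis by (simp add: z_def)
  qed
qed

text \<open>The budget of exponents: \<open>smooth_bound\<close> loses \<theta> = \<epsilon> / 8,
  and comparing \<xi> with the square root of the mass loses multiples of d \<delta> \<le>
  \<epsilon> / 20, so 2 \<eta> + 3 \<delta> d \<le> \<epsilon> / 2. The choice M^\<theta> = 16 D1
  meets both \<open>D1 \<le> M powr \<theta>\<close> and \<open>16 \<le> M\<close>.\<close>

theorem flow_bound: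
  assumes d3: "3 \<le> CARD('d)" and \<epsilon>: "0 < \<epsilon>" "\<epsilon> < 1"
    and \<delta>\<epsilon>: "\<delta> \<le> \<epsilon> / (20 * real CARD('d))" and \<delta>M: "\<delta> * (16 * D1) powr (8 / \<epsilon>) \<le> 1 / 4"
    and b: "b \<in> I"
  shows "F b x \<le> ennreal (final_const / \<sigma> ^ CARD('d) *
    (\<sigma> / max \<sigma> (supnorm x)) powr (real CARD('d) - 2 - \<epsilon>) * exp (- (ct / 2) * supnorm x / xi b))"
proof -
  let ?d = "real CARD('d)"
  define \<theta> where "\<theta> = \<epsilon> / 8"
  define M where "M = (16 * D1) powr (8 / \<epsilon>)"
  have D16: "16 \<le> 16 * D1" using D1_ge_1 by simp
  have M\<theta>: "M powr \<theta> = 16 * D1" unfolding M_def \<theta>_def powr_powr using \<epsilon> D16 by simp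
  have M16: "16 \<le> M"
  proof -
    have "(16 * D1) powr 1 \<le> M" unfolding M_def using \<epsilon> D16 by (intro powr_mono) auto
    then show ?thesis using D16 by simp
  qed
  have \<theta>0: "0 \<le> \<theta>" "\<theta> \<le> 1 / 8" using \<epsilon> by (simp_all add: \<theta>_def)
  have d\<delta>: "?d * \<delta> \<le> \<epsilon> / 20" using \<delta>\<epsilon> d3 by (simp add: field_simps)
  define \<eta> where "\<eta> = \<theta> + ?d * \<delta>"
  have \<eta>: "0 \<le> \<eta>" "\<eta> \<le> 1 / 4" "2 * \<eta> + 3 * \<delta> * ?d \<le> \<epsilon>"
  proof -
    have "0 \<le> ?d * \<delta>" using \<delta> by simp
    then show "0 \<le> \<eta>" "\<eta> \<le> 1 / 4" using \<theta>0 d\<delta> \<epsilon> by (simp_all add: \<eta>_def)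
    have "2 * \<eta> + 3 * \<delta> * ?d = \<epsilon> / 4 + 5 * (?d * \<delta>)" by (simp add: \<eta>_def \<theta>_def)
    then show "2 * \<eta> + 3 * \<delta> * ?d \<le> \<epsilon>" using d\<delta> \<epsilon> by linarith
  qed
  obtain K :: nat where K: "X b < 2 ^ K" using real_arch_pow[of 2 "X b"] by auto
  obtain pt where pt: "pt 0 = 0" "\<And>l. pt l \<in> I" "\<And>l. pt l \<le> pt (Suc l)" "\<And>l. pt l \<le> b"
    "\<And>l. pt (Suc l) - pt l \<le> 2 * (1/2) ^ l" "\<And>l. X (pt l) \<le> 2 ^ l" "pt K = b"
    using dyadic_points[OF b less_imp_le[OF K]] by blast
  define g where "g = ct / 2"
  have g: "0 < g" using ct_pos by (simp add: g_def)
  define A where "A = supnorm x / \<sigma>"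
  have A: "0 \<le> A" using \<sigma> supnorm_nonneg[of x] by (simp add: A_def)
  \<comment> \<open>The rate \<open>ct\<close> at scale xi a is halved. One half, weakened to the
    larger scale xi b, is factored out as \<open>e\<close> and becomes the final exponential; the
    other half stays in \<open>tm\<close> and turns the sum over scales into a power of the
    distance.\<close>
  define e where "e = exp (- g * supnorm x / xi b)"
  have e: "0 < e" by (simp add: e_def)
  \<comment> \<open>At mass 2^l the Taylor weight 2^(-l (d-1)) meets the d-th power of the mass
    times its \<theta>-power over xi^d, of order 2^(l (d/2 + \<eta>)) in units of \<sigma>^(-d). The
    argument of exp uses the largest \<xi> possible at that mass.\<close>
  define tm where "tm l = 2 powr (real l * (1 - ?d / 2 + \<eta>)) * exp (- g * A / 2 powr (real l * (1 + 3 * \<delta>) / 2))" for l :: nat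
  have tm0: "0 \<le> tm l" for l by (simp add: tm_def)
  have W: "0 \<le> A0 * D1 / \<sigma> ^ CARD('d) * e" using A_pos D1_ge_1 \<sigma> e by simp
  have term_le: "ennreal ((1/2) ^ l) ^ (CARD('d) - 1) * cpow (F (pt l)) CARD('d) x \<le>
      ennreal (A0 * D1 / \<sigma> ^ CARD('d) * e * tm l)" for l
  proof -
    define a where "a = pt l"
    have aI: "a \<in> I" and ab: "a \<le> b" and Xa: "X a \<le> 2 ^ l" using pt by (simp_all add: a_def)
    have a0: "0 \<le> a" by (rule I_nonneg[OF aI])
    have X1: "1 \<le> X a" by (rule X_ge_1[OF aI])
    have "X a \<le> M ^ Suc l"
    proof -
      have "(2::real) ^ l \<le> M ^ l" using M16 by (intro power_mono) auto
      also have "\<dots> \<le> M ^ Suc l" using M16 by (intro power_increasing) auto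
      finally show ?thesis using Xa by simp
    qed
    then have pa: "cpow (p a) CARD('d) x \<le> ennreal (A0 * D1 * X a powr \<theta> / xi a ^ CARD('d) * exp (- ct * supnorm x / xi a))"
      using d3 M16 \<delta>M M\<theta> D1_ge_1 aI \<theta>0 unfolding M_def[symmetric] by (intro smooth_bound[of M \<theta> a l]) auto
    have "F a = (\<lambda>x. ennreal (X a) * p a x)" using F_eq_p[OF aI] by (intro ext)
    then have "cpow (F a) CARD('d) x = ennreal (X a) ^ CARD('d) * cpow (p a) CARD('d) x"
      by (simp only: cpow_cmult)
    also have "\<dots> \<le> ennreal (X a) ^ CARD('d) * ennreal (A0 * D1 * X a powr \<theta> / xi a ^ CARD('d) * exp (- ct * supnorm x / xi a))"
      by (rule mult_left_mono[OF pa]) simp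
    also have "\<dots> = ennreal (X a ^ CARD('d) * (A0 * D1 * X a powr \<theta> / xi a ^ CARD('d) * exp (- ct * supnorm x / xi a)))"
    proof -
      have "ennreal (X a) ^ CARD('d) = ennreal (X a ^ CARD('d))" using X1 by (intro ennreal_power) simp
      moreover have "0 \<le> X a ^ CARD('d)" using X1 by simp
      ultimately show ?thesis by (simp only: ennreal_mult')
    qed
    also have "\<dots> \<le> ennreal ((A0 * D1 / \<sigma> ^ CARD('d) * e) * (2 powr (real l * (?d / 2 + \<eta>)) * exp (- g * A / 2 powr (real l * (1 + 3 * \<delta>) / 2))))"
    proof (rule ennreal_leI)
      have xa: "0 < xi a" by (rule xi_pos[OF aI])
      have "(\<sigma> * X a powr ((1 - 2 * \<delta>) / 2)) ^ CARD('d) \<le> xi a ^ CARD('d)"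
        using xi_bounds(1)[OF aI] \<sigma> by (intro power_mono) auto
      moreover have "(\<sigma> * X a powr ((1 - 2 * \<delta>) / 2)) ^ CARD('d) = \<sigma> ^ CARD('d) * X a powr (?d * ((1 - 2 * \<delta>) / 2))"
        using X1 by (simp add: power_mult_distrib powr_powr mult.commute flip: powr_realpow)
      ultimately have xid: "\<sigma> ^ CARD('d) * X a powr (?d * ((1 - 2 * \<delta>) / 2)) \<le> xi a ^ CARD('d)" by simp
      have "X a ^ CARD('d) * X a powr \<theta> / xi a ^ CARD('d) \<le>
          X a ^ CARD('d) * X a powr \<theta> / (\<sigma> ^ CARD('d) * X a powr (?d * ((1 - 2 * \<delta>) / 2)))"
        using xid X1 \<sigma> xa by (intro divide_left_mono) auto
      also have "\<dots> = (1 / \<sigma> ^ CARD('d)) * (X a powr ?d * X a powr \<theta> / X a powr (?d * ((1 - 2 * \<delta>) / 2)))"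
        using X1 by (simp add: powr_realpow)
      also have "X a powr ?d * X a powr \<theta> / X a powr (?d * ((1 - 2 * \<delta>) / 2)) = X a powr (?d / 2 + \<eta>)"
        using X1 by (simp add: powr_add[symmetric] powr_diff[symmetric] \<eta>_def field_simps)
      also have "(1 / \<sigma> ^ CARD('d)) * X a powr (?d / 2 + \<eta>) \<le> (1 / \<sigma> ^ CARD('d)) * (2 ^ l) powr (?d / 2 + \<eta>)"
        using Xa X1 \<sigma> \<eta> by (intro mult_left_mono powr_mono2) auto
      also have "((2::real) ^ l) powr (?d / 2 + \<eta>) = 2 powr (real l * (?d / 2 + \<eta>))"
        by (simp add: powr_powr flip: powr_realpow)
      finally have f1: "X a ^ CARD('d) * X a powr \<theta> / xi a ^ CARD('d) \<le> (1 / \<sigma> ^ CARD('d)) * 2 powr (real l * (?d / 2 + \<eta>))" .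
      have f2: "exp (- ct * supnorm x / xi a) \<le> e * exp (- g * A / 2 powr (real l * (1 + 3 * \<delta>) / 2))"
      proof -
        have "supnorm x / xi b \<le> supnorm x / xi a"
          using xi_mono[OF b a0 ab] xa supnorm_nonneg[of x] by (intro divide_left_mono) auto
        then have h1: "g * (supnorm x / xi b) \<le> g * (supnorm x / xi a)" using g by (intro mult_left_mono) auto
        have "xi a \<le> \<sigma> * (2 ^ l) powr ((1 + 3 * \<delta>) / 2)"
          using xi_bounds(2)[OF aI] Xa X1 \<delta> \<sigma> by (elim order_trans) (intro mult_left_mono powr_mono2, auto)
        also have "((2::real) ^ l) powr ((1 + 3 * \<delta>) / 2) = 2 powr (real l * (1 + 3 * \<delta>) / 2)"
          by (simp add: powr_powr flip: powr_realpow)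
        finally have "supnorm x / (\<sigma> * 2 powr (real l * (1 + 3 * \<delta>) / 2)) \<le> supnorm x / xi a"
          using xa supnorm_nonneg[of x] \<sigma> by (intro divide_left_mono) auto
        then have "g * (A / 2 powr (real l * (1 + 3 * \<delta>) / 2)) \<le> g * (supnorm x / xi a)"
          using g by (intro mult_left_mono) (auto simp: A_def)
        then have "- ct * supnorm x / xi a \<le> - g * supnorm x / xi b + - g * A / 2 powr (real l * (1 + 3 * \<delta>) / 2)"
          using h1 by (simp add: g_def)
        then show ?thesis unfolding e_def exp_add[symmetric] by simp
      qed
      have "(X a ^ CARD('d) * X a powr \<theta> / xi a ^ CARD('d)) * exp (- ct * supnorm x / xi a) \<le>
          ((1 / \<sigma> ^ CARD('d)) * 2 powr (real l * (?d / 2 + \<eta>))) * (e * exp (- g * A / 2 powr (real l * (1 + 3 * \<delta>) / 2)))"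
        using f1 f2 \<sigma> by (intro mult_mono) auto
      then have "A0 * D1 * ((X a ^ CARD('d) * X a powr \<theta> / xi a ^ CARD('d)) * exp (- ct * supnorm x / xi a)) \<le>
          A0 * D1 * (((1 / \<sigma> ^ CARD('d)) * 2 powr (real l * (?d / 2 + \<eta>))) * (e * exp (- g * A / 2 powr (real l * (1 + 3 * \<delta>) / 2))))"
        using A_pos D1_ge_1 by (intro mult_left_mono) auto
      then show "X a ^ CARD('d) * (A0 * D1 * X a powr \<theta> / xi a ^ CARD('d) * exp (- ct * supnorm x / xi a)) \<le>
          (A0 * D1 / \<sigma> ^ CARD('d) * e) * (2 powr (real l * (?d / 2 + \<eta>)) * exp (- g * A / 2 powr (real l * (1 + 3 * \<delta>) / 2)))"
        by (simp add: mult_ac)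
    qed
    finally have T: "cpow (F a) CARD('d) x \<le> ennreal ((A0 * D1 / \<sigma> ^ CARD('d) * e) *
        (2 powr (real l * (?d / 2 + \<eta>)) * exp (- g * A / 2 powr (real l * (1 + 3 * \<delta>) / 2))))" .
    have "ennreal ((1/2) ^ l) ^ (CARD('d) - 1) = ennreal (2 powr (- (real l * (?d - 1))))"
    proof -
      have "((1/2::real) ^ l) ^ (CARD('d) - 1) = 2 powr (- (real l * (?d - 1)))"
      proof -
        have "2 powr (real l * (?d - 1)) = (2::real) powr real (l * (CARD('d) - 1))"
          using d3 by (simp add: of_nat_diff)
        also have "\<dots> = 2 ^ (l * (CARD('d) - 1))" by (rule powr_realpow) simp
        finally show ?thesis by (simp add: powr_minus power_one_over inverse_eq_divide power_mult)
      qed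
      then show ?thesis by (simp add: ennreal_power)
    qed
    then have "ennreal ((1/2) ^ l) ^ (CARD('d) - 1) * cpow (F a) CARD('d) x \<le>
       ennreal (2 powr (- (real l * (?d - 1)))) * ennreal ((A0 * D1 / \<sigma> ^ CARD('d) * e) *
        (2 powr (real l * (?d / 2 + \<eta>)) * exp (- g * A / 2 powr (real l * (1 + 3 * \<delta>) / 2))))"
      using mult_left_mono[OF T] by simp
    also have "\<dots> = ennreal (2 powr (- (real l * (?d - 1))) * ((A0 * D1 / \<sigma> ^ CARD('d) * e) *
        (2 powr (real l * (?d / 2 + \<eta>)) * exp (- g * A / 2 powr (real l * (1 + 3 * \<delta>) / 2)))))"
      by (rule ennreal_mult'[symmetric]) simp
    also have "2 powr (- (real l * (?d - 1))) * ((A0 * D1 / \<sigma> ^ CARD('d) * e) *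
        (2 powr (real l * (?d / 2 + \<eta>)) * exp (- g * A / 2 powr (real l * (1 + 3 * \<delta>) / 2)))) =
        (A0 * D1 / \<sigma> ^ CARD('d) * e) * ((2 powr (- (real l * (?d - 1))) * 2 powr (real l * (?d / 2 + \<eta>))) *
          exp (- g * A / 2 powr (real l * (1 + 3 * \<delta>) / 2)))" by (simp only: mult_ac)
    also have "2 powr (- (real l * (?d - 1))) * 2 powr (real l * (?d / 2 + \<eta>)) = 2 powr (real l * (1 - ?d / 2 + \<eta>))"
      by (simp add: powr_add[symmetric] algebra_simps)
    finally show ?thesis unfolding a_def tm_def .
  qed
  define E where "E = (1 + fact CARD('d) / g ^ CARD('d)) * (2 / (1 - 2 powr (- 1 / 4)))"
  define u where "u = (\<sigma> / max \<sigma> (supnorm x)) powr (?d - 2 - \<epsilon>)"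
  have u0: "0 \<le> u" by (simp add: u_def)
  have uA: "max 1 A powr (2 - ?d + \<epsilon>) = u"
  proof -
    have "\<sigma> / max \<sigma> (supnorm x) = 1 / max 1 A"
      using \<sigma> by (auto simp: A_def max_def field_simps)
    moreover have "(1 / max 1 A) powr (?d - 2 - \<epsilon>) = max 1 A powr (- (?d - 2 - \<epsilon>))"
      unfolding powr_minus_divide by (simp add: powr_divide)
    moreover have "- (?d - 2 - \<epsilon>) = 2 - ?d + \<epsilon>" by simp
    ultimately show ?thesis unfolding u_def by metis
  qed
  have sum_le: "(\<Sum>l\<in>{1..K}. ennreal ((1/2) ^ l) ^ (CARD('d) - 1) * cpow (F (pt l)) CARD('d) x) \<le>
      ennreal (A0 * D1 / \<sigma> ^ CARD('d) * e * (E * u))"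
  proof -
    have "(\<Sum>l\<in>{1..K}. ennreal ((1/2) ^ l) ^ (CARD('d) - 1) * cpow (F (pt l)) CARD('d) x) \<le>
        (\<Sum>l\<in>{1..K}. ennreal (A0 * D1 / \<sigma> ^ CARD('d) * e * tm l))"
      by (rule sum_mono) (rule term_le)
    also have "\<dots> = ennreal (A0 * D1 / \<sigma> ^ CARD('d) * e * (\<Sum>l\<in>{1..K}. tm l))"
      unfolding sum_distrib_left by (rule sum_ennreal) (rule mult_nonneg_nonneg[OF W tm0])
    also have "\<dots> \<le> ennreal (A0 * D1 / \<sigma> ^ CARD('d) * e * (E * u))"
      using dyadic_sum[OF g A d3 \<eta>(1,2) \<delta>(1) \<eta>(3), of K] W unfolding uA tm_def E_def
      by (intro ennreal_leI mult_left_mono) auto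
    finally show ?thesis .
  qed
  have Qb: "Q x \<le> ennreal (?d * A1 * (?d / c0) ^ CARD('d) * exp (ct * ?d / c0) / \<sigma> ^ CARD('d) * u * e)"
    using Q_bound[OF b, of "?d - 2 - \<epsilon>" x] d3 \<epsilon> unfolding u_def e_def g_def by simp
  have "F b x = cpow (F (pt K)) (CARD('d) - (CARD('d) - 1)) x"
    using d3 pt(7) by (simp add: Suc_diff_le)
  also have "\<dots> \<le> ennreal (taylor_const (CARD('d) - 1)) *
    (Q x + (\<Sum>l\<in>{1..K}. ennreal ((1/2) ^ l) ^ (CARD('d) - 1) * cpow (F (pt l)) CARD('d) x))"
    using d3 by (intro taylor pt) auto
  also have "\<dots> \<le> ennreal (taylor_const (CARD('d) - 1)) *
    (ennreal (?d * A1 * (?d / c0) ^ CARD('d) * exp (ct * ?d / c0) / \<sigma> ^ CARD('d) * u * e) +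
     ennreal (A0 * D1 / \<sigma> ^ CARD('d) * e * (E * u)))"
    by (intro mult_left_mono add_mono Qb sum_le) auto
  also have "\<dots> = ennreal (taylor_const (CARD('d) - 1) *
    (?d * A1 * (?d / c0) ^ CARD('d) * exp (ct * ?d / c0) / \<sigma> ^ CARD('d) * u * e +
     A0 * D1 / \<sigma> ^ CARD('d) * e * (E * u)))"
  proof -
    have "0 \<le> ?d * A1 * (?d / c0) ^ CARD('d) * exp (ct * ?d / c0) / \<sigma> ^ CARD('d) * u * e"
      using A_pos \<sigma> c0 u0 e by simp
    moreover have "0 \<le> E"
    proof -
      have "2 powr (- 1 / 4) < (2::real) powr 0" by (intro powr_less_mono) auto
      then show ?thesis using g by (simp add: E_def)
    qed
    then have "0 \<le> A0 * D1 / \<sigma> ^ CARD('d) * e * (E * u)"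
      by (intro mult_nonneg_nonneg[OF W] mult_nonneg_nonneg u0)
    moreover have "0 \<le> taylor_const (CARD('d) - 1)" using taylor_const_ge_1[of "CARD('d) - 1"] by simp
    ultimately show ?thesis by (simp only: ennreal_mult' ennreal_plus)
  qed
  also have "taylor_const (CARD('d) - 1) *
    (?d * A1 * (?d / c0) ^ CARD('d) * exp (ct * ?d / c0) / \<sigma> ^ CARD('d) * u * e +
     A0 * D1 / \<sigma> ^ CARD('d) * e * (E * u)) = final_const / \<sigma> ^ CARD('d) * u * e"
  proof -
    have "tc * (P / S * u * e + w / S * e * (E * u)) = tc * (P + w * E) / S * u * e" for tc P S u e w E :: real
      by (simp add: algebra_simps add_divide_distrib)
    then show ?thesis unfolding final_const_def E_def g_def by this
  qed
  finally show ?thesis unfolding u_def e_def g_def .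
qed

end

section \<open>Differential inequalities\<close>

lemma l1_ennreal_eq_infsum:
  fixes f :: "('d::finite) lattice \<Rightarrow> real"
  assumes "f summable_on UNIV" "\<And>x. 0 \<le> f x"
  shows "l1 (\<lambda>x. ennreal (f x)) = ennreal (infsum f UNIV)"
proof -
  have "ennreal (infsum f UNIV) = (SUP F\<in>{F. finite F \<and> F \<subseteq> UNIV}. ennreal (sum f F))"
    by (rule infsum_nonneg_is_SUPREMUM_ennreal) (use assms in auto)
  also have "\<dots> = (SUP F\<in>{F. finite F \<and> F \<subseteq> UNIV}. sum (\<lambda>x. ennreal (f x)) F)"
    using assms(2) by (simp add: sum_ennreal)
  also have "\<dots> = l1 (\<lambda>x. ennreal (f x))"
    unfolding l1_def by (rule nonneg_infsum_complete[symmetric]) simp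
  finally show ?thesis ..
qed

lemma summable_enn2real:
  fixes f :: "('d::finite) lattice \<Rightarrow> ennreal"
  assumes "l1 f < \<infinity>"
  shows "(\<lambda>x. enn2real (f x)) summable_on UNIV" "infsum (\<lambda>x. enn2real (f x)) UNIV = enn2real (l1 f)"
proof -
  have fin: "f x < \<infinity>" for x using assms l1_ge[of f x] by (simp add: order_le_less_trans)
  then have e: "ennreal (enn2real (f x)) = f x" for x by simp
  show s: "(\<lambda>x. enn2real (f x)) summable_on UNIV"
  proof (rule nonneg_bdd_above_summable_on)
    show "bdd_above (sum (\<lambda>x. enn2real (f x)) ` {F. F \<subseteq> UNIV \<and> finite F})"
    proof (rule bdd_aboveI2)
      fix F :: "'d lattice set" assume "F \<in> {F. F \<subseteq> UNIV \<and> finite F}"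
      then have "ennreal (\<Sum>x\<in>F. enn2real (f x)) \<le> l1 f"
        using l1_ge_sum[of F f] e by (simp add: sum_ennreal[symmetric])
      then show "(\<Sum>x\<in>F. enn2real (f x)) \<le> enn2real (l1 f)"
        using assms by (metis enn2real_mono enn2real_ennreal sum_nonneg enn2real_nonneg infinity_ennreal_def)
    qed
  qed auto
  have "ennreal (infsum (\<lambda>x. enn2real (f x)) UNIV) = l1 f"
    using l1_ennreal_eq_infsum[OF s] e by simp
  then show "infsum (\<lambda>x. enn2real (f x)) UNIV = enn2real (l1 f)"
    by (metis enn2real_ennreal enn2real_nonneg infsum_nonneg)
qed

lemma conv_enn2real:
  fixes f g :: "('d::finite) lattice \<Rightarrow> ennreal"
  assumes "conv f g x < \<infinity>"
  shows "(\<lambda>y. enn2real (f y) * enn2real (g (x - y))) summable_on UNIV"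
    and "conv (\<lambda>y. enn2real (f y)) (\<lambda>y. enn2real (g y)) x = enn2real (conv f g x)"
  using summable_enn2real[of "\<lambda>y. f y * g (x - y)"] assms
  by (simp_all add: conv_eq conv_def[of "\<lambda>y. enn2real (f y)"] enn2real_mult)

lemma conv_le_mass:
  fixes f g :: "('d::finite) lattice \<Rightarrow> ennreal"
  shows "conv f g x \<le> l1 f * l1 g"
  by (rule conv_le_sup) (rule l1_ge)

lemma infsum_diff_real:
  fixes f g :: "'a \<Rightarrow> real"
  assumes "f summable_on A" "g summable_on A"
  shows "infsum (\<lambda>x. f x - g x) A = infsum f A - infsum g A"
  using infsum_add[of f A "\<lambda>x. - g x"] assms by (simp add: summable_on_uminus infsum_uminus)

text \<open>Finite masses make both parts summable, so the signed real convolution of Assumption 1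
  (ii) splits into a difference of nonnegative ones, to which the \<open>ennreal\<close> calculus of
  masses and moments applies.\<close>

lemma conv_enn2real_diff:
  fixes f g h :: "('d::finite) lattice \<Rightarrow> ennreal"
  assumes f: "l1 f < \<infinity>" and g: "l1 g < \<infinity>" and h: "l1 h < \<infinity>"
  shows "conv (conv (\<lambda>z. enn2real (f z)) (\<lambda>z. enn2real (g z) - enn2real (h z))) (\<lambda>z. enn2real (f z)) x =
    enn2real (conv (conv f g) f x) - enn2real (conv (conv f h) f x)"
proof -
  have fin: "conv f k y < \<infinity>" if "l1 k < \<infinity>" for k y
    using order_le_less_trans[OF conv_le_mass[of f k y]] f that by (simp add: ennreal_mult_less_top)
  have fin2: "conv (conv f k) f y < \<infinity>" if "l1 k < \<infinity>" for k y
    using order_le_less_trans[OF conv_le_mass[of "conv f k" f y]] f that by (simp add: ennreal_mult_less_top l1_conv)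
  have 1: "conv (\<lambda>z. enn2real (f z)) (\<lambda>z. enn2real (g z) - enn2real (h z)) y =
      enn2real (conv f g y) - enn2real (conv f h y)" for y
  proof -
    have "conv (\<lambda>z. enn2real (f z)) (\<lambda>z. enn2real (g z) - enn2real (h z)) y =
        (\<Sum>\<^sub>\<infinity>z. enn2real (f z) * enn2real (g (y - z)) - enn2real (f z) * enn2real (h (y - z)))"
      by (simp add: conv_def right_diff_distrib)
    also have "\<dots> = conv (\<lambda>z. enn2real (f z)) (\<lambda>z. enn2real (g z)) y - conv (\<lambda>z. enn2real (f z)) (\<lambda>z. enn2real (h z)) y"
      unfolding conv_def[of "\<lambda>z. enn2real (f z)"]
      by (rule infsum_diff_real) (use conv_enn2real(1) fin g h in blast)+
    finally show ?thesis using conv_enn2real(2)[OF fin[OF g]] conv_enn2real(2)[OF fin[OF h]] by simp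
  qed
  have "conv (\<lambda>y. enn2real (conv f g y) - enn2real (conv f h y)) (\<lambda>z. enn2real (f z)) x =
      (\<Sum>\<^sub>\<infinity>z. enn2real (conv f g z) * enn2real (f (x - z)) - enn2real (conv f h z) * enn2real (f (x - z)))"
    by (simp add: conv_def left_diff_distrib)
  also have "\<dots> = conv (\<lambda>z. enn2real (conv f g z)) (\<lambda>z. enn2real (f z)) x - conv (\<lambda>z. enn2real (conv f h z)) (\<lambda>z. enn2real (f z)) x"
    unfolding conv_def[of "\<lambda>z. enn2real (conv f g z)"] conv_def[of "\<lambda>z. enn2real (conv f h z)"]
    by (rule infsum_diff_real) (use conv_enn2real(1) fin2 g h in blast)+
  finally show ?thesis
    unfolding 1 using conv_enn2real(2)[OF fin2[OF g]] conv_enn2real(2)[OF fin2[OF h]] by simp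
qed

text \<open>Half of the exponential rate absorbs the quadratic weight, and the other half is
  summable.\<close>

lemma exp_decay_moments:
  fixes f :: "('d::finite) lattice \<Rightarrow> ennreal"
  assumes "exp_decay f"
  shows "l1 f < \<infinity>" "second_moment f < \<infinity>"
proof -
  obtain A a where a: "0 < a" and f: "\<And>x. f x \<le> ennreal (A * exp (- a * supnorm x))"
    using assms unfolding exp_decay_def by blast
  have bound: "l1 (\<lambda>x::'d lattice. ennreal B * ennreal (exp (- b * supnorm x))) < \<infinity>" if "0 < b" for B b
    using l1_exp_finite[OF that, where 'd = 'd] by (simp add: l1_cmult ennreal_mult_less_top)
  have "l1 f \<le> l1 (\<lambda>x::'d lattice. ennreal \<bar>A\<bar> * ennreal (exp (- a * supnorm x)))"
  proof (rule l1_mono)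
    fix x
    have "f x \<le> ennreal (\<bar>A\<bar> * exp (- a * supnorm x))"
      by (rule order_trans[OF f]) (intro ennreal_leI mult_right_mono, auto)
    then show "f x \<le> ennreal \<bar>A\<bar> * ennreal (exp (- a * supnorm x))" by (simp add: ennreal_mult)
  qed
  also have "\<dots> < \<infinity>" by (rule bound[OF a])
  finally show "l1 f < \<infinity>" .
  have sq: "s\<^sup>2 \<le> (8 / a\<^sup>2) * exp (a / 2 * s)" if "0 \<le> s" for s :: real
  proof -
    have "(a / 2 * s)\<^sup>2 / 2 \<le> exp (a / 2 * s)"
      using exp_lower_Taylor_quadratic[of "a / 2 * s"] a that by (smt (verit) mult_nonneg_nonneg divide_nonneg_pos)
    then show ?thesis using a by (simp add: power_mult_distrib power_divide field_simps)
  qed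
  define B where "B = real CARD('d) * (8 / a\<^sup>2) * \<bar>A\<bar>"
  have "second_moment f \<le> l1 (\<lambda>x::'d lattice. ennreal B * ennreal (exp (- (a / 2) * supnorm x)))"
    unfolding second_moment_def
  proof (rule l1_mono)
    fix x :: "'d lattice"
    have "ennreal ((norm2 x)\<^sup>2) * f x \<le> ennreal ((norm2 x)\<^sup>2) * ennreal (\<bar>A\<bar> * exp (- a * supnorm x))"
      by (intro mult_left_mono order_trans[OF f] ennreal_leI mult_right_mono) auto
    also have "\<dots> = ennreal ((norm2 x)\<^sup>2 * (\<bar>A\<bar> * exp (- a * supnorm x)))" by (simp add: ennreal_mult)
    also have "\<dots> \<le> ennreal (B * exp (- (a / 2) * supnorm x))"
    proof (rule ennreal_leI)
      have "(norm2 x)\<^sup>2 \<le> real CARD('d) * ((8 / a\<^sup>2) * exp (a / 2 * supnorm x))"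
        using norm2_sq_le[of x] sq[OF supnorm_nonneg[of x]] by (meson mult_left_mono of_nat_0_le_iff order_trans)
      then have "(norm2 x)\<^sup>2 * (\<bar>A\<bar> * exp (- a * supnorm x)) \<le>
          real CARD('d) * ((8 / a\<^sup>2) * exp (a / 2 * supnorm x)) * (\<bar>A\<bar> * exp (- a * supnorm x))"
        by (rule mult_right_mono) simp
      also have "\<dots> = B * (exp (a / 2 * supnorm x) * exp (- a * supnorm x))" by (simp add: B_def)
      also have "exp (a / 2 * supnorm x) * exp (- a * supnorm x) = exp (- (a / 2) * supnorm x)"
        by (simp flip: exp_add)
      finally show "(norm2 x)\<^sup>2 * (\<bar>A\<bar> * exp (- a * supnorm x)) \<le> B * exp (- (a / 2) * supnorm x)" .
    qed
    also have "\<dots> = ennreal B * ennreal (exp (- (a / 2) * supnorm x))"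
      by (rule ennreal_mult'') simp
    finally show "ennreal ((norm2 x)\<^sup>2) * f x \<le> ennreal B * ennreal (exp (- (a / 2) * supnorm x))" .
  qed
  also have "\<dots> < \<infinity>" using a by (intro bound) simp
  finally show "second_moment f < \<infinity>" .
qed

lemma norm2_parallelogram:
  "ennreal ((norm2 (y + z))\<^sup>2) + ennreal ((norm2 (y - z))\<^sup>2) = 2 * ennreal ((norm2 y)\<^sup>2) + 2 * ennreal ((norm2 z)\<^sup>2)"
proof -
  have "(norm2 (y + z))\<^sup>2 + (norm2 (y - z))\<^sup>2 = 2 * (norm2 y)\<^sup>2 + 2 * (norm2 z)\<^sup>2"
    unfolding norm2_sq sum_distrib_left sum.distrib[symmetric]
    by (intro sum.cong refl) (simp add: power2_eq_square algebra_simps)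
  then show ?thesis
    by (metis (no_types, lifting) ennreal_mult' ennreal_numeral ennreal_plus mult_nonneg_nonneg zero_le_numeral zero_le_power2)
qed

lemma second_moment_conv:
  assumes "\<And>z. g (- z) = g z"
  shows "second_moment (conv f g) = second_moment f * l1 g + l1 f * second_moment g"
  unfolding second_moment_def
  by (rule l1_conv_parallelogram[where w = "\<lambda>x. ennreal ((norm2 x)\<^sup>2)"]) (rule norm2_parallelogram, rule assms)

text \<open>The Lipschitz bound makes \<open>K\<close> a common majorant of all difference
  quotients. The limit point hypothesis supplies a sequence along which dominated convergence also
  yields integrability of \<open>f'\<close>.\<close>

lemma has_derivative_dominated:
  fixes f :: "('d::finite) lattice \<Rightarrow> real \<Rightarrow> real"
  assumes lp: "b islimpt S"
    and deriv: "\<And>x. (f x has_real_derivative f' x) (at b within S)" and b: "b \<in> S"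
    and int: "\<And>y. y \<in> S \<Longrightarrow> integrable lat (\<lambda>x. f x y)" and K: "integrable lat K"
    and dom: "\<And>x y. y \<in> S \<Longrightarrow> \<bar>f x y - f x b\<bar> \<le> \<bar>y - b\<bar> * K x"
  shows "integrable lat f'" "((\<lambda>y. \<integral>x. f x y \<partial>lat) has_real_derivative (\<integral>x. f' x \<partial>lat)) (at b within S)"
proof -
  have seq: "(\<lambda>n. (f x (Y n) - f x b) / (Y n - b)) \<longlonglongrightarrow> f' x" if "\<forall>n. Y n \<in> S - {b}" "Y \<longlonglongrightarrow> b" for x Y
    using deriv[of x] that unfolding has_field_derivative_iff tendsto_at_iff_sequentially comp_def by blast
  have lim: "(\<lambda>n. \<integral>x. (f x (Y n) - f x b) / (Y n - b) \<partial>lat) \<longlonglongrightarrow> (\<integral>x. f' x \<partial>lat) \<and> integrable lat f'"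
    if Y: "\<forall>n. Y n \<in> S - {b}" "Y \<longlonglongrightarrow> b" for Y
  proof -
    have le: "\<bar>(f x (Y n) - f x b) / (Y n - b)\<bar> \<le> K x" for x n
    proof -
      have "0 < \<bar>Y n - b\<bar>" using Y by simp
      then show ?thesis using dom[of "Y n" x] Y by (simp add: abs_divide divide_le_eq mult.commute)
    qed
    note dc = K AE_I2[OF seq[OF Y]] AE_I2[OF le]
    show ?thesis
      using integral_dominated_convergence[where f = f' and s = "\<lambda>n x. (f x (Y n) - f x b) / (Y n - b)" and w = K and M = lat]
        integrable_dominated_convergence[where f = f' and s = "\<lambda>n x. (f x (Y n) - f x b) / (Y n - b)" and w = K and M = lat]
        K seq[OF Y] le by auto
  qed
  have quot: "(\<integral>x. (f x y - f x b) / (y - b) \<partial>lat) = ((\<integral>x. f x y \<partial>lat) - (\<integral>x. f x b \<partial>lat)) / (y - b)" if "y \<in> S" for y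
    using int[OF that] int[OF b] by simp
  show "((\<lambda>y. \<integral>x. f x y \<partial>lat) has_real_derivative (\<integral>x. f' x \<partial>lat)) (at b within S)"
    unfolding has_field_derivative_iff tendsto_at_iff_sequentially comp_def
  proof (intro allI impI)
    fix Y assume Y: "\<forall>n. Y n \<in> S - {b}" "Y \<longlonglongrightarrow> b"
    have q: "(\<integral>x. (f x (Y n) - f x b) / (Y n - b) \<partial>lat) = ((\<integral>x. f x (Y n) \<partial>lat) - (\<integral>x. f x b \<partial>lat)) / (Y n - b)" for n
      using Y by (intro quot) simp
    show "(\<lambda>n. ((\<integral>x. f x (Y n) \<partial>lat) - (\<integral>x. f x b \<partial>lat)) / (Y n - b)) \<longlonglongrightarrow> (\<integral>x. f' x \<partial>lat)"
      using lim[OF Y, THEN conjunct1] unfolding q .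
  qed
  obtain Y where "\<forall>n. Y n \<in> S - {b}" "Y \<longlonglongrightarrow> b"
    using lp unfolding islimpt_sequential by blast
  then show "integrable lat f'" using lim by blast
qed

lemma ennreal_sum_products:
  "0 \<le> a \<Longrightarrow> 0 \<le> b \<Longrightarrow> 0 \<le> c \<Longrightarrow> 0 \<le> d \<Longrightarrow>
    ennreal a * ennreal b + ennreal c * ennreal d = ennreal (a * b + c * d)"
  by (simp add: ennreal_mult)

text \<open>Assumption 1 (i) controls increments to the right of \<open>b\<close>. A derivative
  within S is in particular the limit of the quotients from the right, so this suffices to bound
  it.\<close>

lemma deriv_le_right:
  fixes f k :: "real \<Rightarrow> real"
  assumes f: "(f has_real_derivative f') (at b within S)" and lp: "b islimpt (S \<inter> {b<..})"
    and le: "\<And>y. y \<in> S \<Longrightarrow> b < y \<Longrightarrow> f y \<le> f b + (y - b) * k y"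
    and k: "(k \<longlongrightarrow> k0) (at b within S)"
  shows "f' \<le> k0"
proof (rule tendsto_le)
  have sub: "at b within (S \<inter> {b<..}) \<le> at b within S" by (rule at_le) auto
  show "at b within (S \<inter> {b<..}) \<noteq> bot" using lp by (simp add: trivial_limit_within)
  show "(k \<longlongrightarrow> k0) (at b within (S \<inter> {b<..}))" by (rule tendsto_mono[OF sub k])
  show "((\<lambda>y. (f y - f b) / (y - b)) \<longlongrightarrow> f') (at b within (S \<inter> {b<..}))"
    using f unfolding has_field_derivative_iff by (rule tendsto_mono[OF sub])
  show "\<forall>\<^sub>F y in at b within (S \<inter> {b<..}). (f y - f b) / (y - b) \<le> k y"
    unfolding eventually_at_filter
    by (rule always_eventually) (use le in \<open>auto simp: divide_le_eq mult.commute algebra_simps\<close>)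
qed

lemma deriv_nonneg_mono_within:
  fixes f :: "real \<Rightarrow> real"
  assumes "a \<le> b" "{a..b} \<subseteq> S"
    and "\<And>y. y \<in> {a..b} \<Longrightarrow> (f has_real_derivative f' y) (at y within S)" "\<And>y. y \<in> {a..b} \<Longrightarrow> 0 \<le> f' y"
  shows "f a \<le> f b"
proof -
  have "\<exists>x\<in>{a..b}. f b - f a = (*) (f' x) (b - a)"
  proof (rule mvt_very_simple[OF assms(1)])
    fix x assume "a \<le> x" "x \<le> b"
    then have "(f has_real_derivative f' x) (at x within {a..b})"
      using assms(2,3) by (intro DERIV_subset[OF assms(3)]) auto
    then show "(f has_derivative (*) (f' x)) (at x within {a..b})"
      by (simp add: has_field_derivative_def)
  qed
  then obtain x where "x \<in> {a..b}" "f b - f a = f' x * (b - a)" by auto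
  then have "0 \<le> f b - f a" using assms by simp
  then show ?thesis by simp
qed

section \<open>Mass and second moment of the model as functions of \<beta>\<close>

locale model =
  fixes J :: "('d::finite) lattice \<Rightarrow> real" and \<beta>c :: ennreal
    and G :: "ennreal \<Rightarrow> 'd lattice \<Rightarrow> ennreal" and H :: "ennreal \<Rightarrow> 'd lattice \<Rightarrow> real" and c0 :: real
  assumes c0: "0 < c0" "c0 \<le> 1" and adm: "admissible c0 J" and cG: "class_G \<beta>c G"
    and as1: "assumption1 J \<beta>c G H" and \<beta>c_pos: "0 < \<beta>c"
begin

abbreviation I :: "real set" where "I \<equiv> subcritical \<beta>c"
definition g :: "real \<Rightarrow> 'd lattice \<Rightarrow> ennreal" where "g b = G (ennreal b)"
definition jl :: "'d lattice \<Rightarrow> ennreal" where "jl x = ennreal (J x)"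
definition hl :: "real \<Rightarrow> 'd lattice \<Rightarrow> ennreal" where "hl b x = ennreal (H (ennreal b) x)"
definition Fb :: "real \<Rightarrow> 'd lattice \<Rightarrow> ennreal" where "Fb b = F_conv J G (ennreal b)"
definition X :: "real \<Rightarrow> real" where "X b = enn2real (l1 (g b))"
definition W :: "real \<Rightarrow> real" where "W b = enn2real (second_moment (g b))"
text \<open>The second moment of \<open>Fb b\<close>, as second moments add along convolutions of
  even functions and J has mass 1. Unlike \<open>W\<close>, it is positive already at 0, where it
  equals \<sigma>^2.\<close>

definition V :: "real \<Rightarrow> real" where "V b = (kernel_sigma J)\<^sup>2 * X b + W b"
definition h0 :: "real \<Rightarrow> real" where "h0 b = enn2real (l1 (hl b))"
definition h2 :: "real \<Rightarrow> real" where "h2 b = enn2real (second_moment (hl b))"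

lemma I_iff: "b \<in> I \<longleftrightarrow> 0 \<le> b \<and> ennreal b < \<beta>c"
  by (simp add: subcritical_def)

lemma I0: "0 \<in> I"
  using \<beta>c_pos by (simp add: I_iff)

lemma I_down: "b \<in> I \<Longrightarrow> 0 \<le> a \<Longrightarrow> a \<le> b \<Longrightarrow> a \<in> I"
  unfolding I_iff using order_le_less_trans[OF ennreal_leI[of a b]] by auto

lemma I_above:
  assumes "b \<in> I" obtains B where "B \<in> I" "b < B"
proof -
  obtain z where z: "ennreal b < z" "z < \<beta>c" using assms dense unfolding I_iff by blast
  then obtain B where B: "z = ennreal B" "0 \<le> B" by (cases z) auto
  then show ?thesis using z assms that[of B] by (auto simp: I_iff ennreal_less_iff)
qed

lemma J_nonneg: "0 \<le> J x" and J_sum: "(J has_sum 1) UNIV" and J_sym: "lattice_symmetric J"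
  and J_fin: "finite {x. 0 < J x}" and J_range: "1 \<le> kernel_range J"
  and J_sigma: "c0 * kernel_range J \<le> kernel_sigma J"
  and J_sup: "J x \<le> inverse c0 * inverse (kernel_range J ^ CARD('d))"
  using adm unfolding admissible_def by auto

lemma jl_l1: "l1 jl = 1"
  using l1_ennreal_eq_infsum[of J] J_nonneg J_sum by (simp add: jl_def[abs_def] has_sum_imp_summable infsumI)

lemma J_supp: "J x \<noteq> 0 \<Longrightarrow> supnorm x \<le> kernel_range J"
  unfolding kernel_range_def using J_fin J_nonneg[of x] by (intro Max_ge) auto

lemma \<sigma>_pos: "0 < kernel_sigma J"
proof -
  have "0 < c0 * kernel_range J" using c0 J_range by simp
  then show ?thesis using J_sigma by simp
qed

lemma J2_summable: "(\<lambda>x. (norm2 x)\<^sup>2 * J x) summable_on UNIV"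
  by (rule finite_nonzero_values_imp_summable_on)
     (rule finite_subset[OF _ J_fin], use J_nonneg in \<open>auto simp: less_le\<close>)

lemma \<sigma>_sq: "(kernel_sigma J)\<^sup>2 = infsum (\<lambda>x. (norm2 x)\<^sup>2 * J x) UNIV"
  unfolding kernel_sigma_def by (rule real_sqrt_pow2) (simp add: infsum_nonneg J_nonneg)

lemma jl_second: "second_moment jl = ennreal ((kernel_sigma J)\<^sup>2)"
proof -
  have "second_moment jl = l1 (\<lambda>x. ennreal ((norm2 x)\<^sup>2 * J x))"
    unfolding second_moment_def jl_def by (simp add: ennreal_mult J_nonneg)
  also have "\<dots> = ennreal ((kernel_sigma J)\<^sup>2)"
    unfolding \<sigma>_sq by (rule l1_ennreal_eq_infsum[OF J2_summable]) (simp add: J_nonneg)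
  finally show ?thesis .
qed

text \<open>The converse of the admissibility bound c0 R \<le> \<sigma>. It turns the sup bound on
  J, given in terms of R, into one in units of \<sigma>^(-d).\<close>

lemma \<sigma>_le: "kernel_sigma J \<le> real CARD('d) * kernel_range J"
proof -
  let ?d = "real CARD('d)" and ?R = "kernel_range J"
  have d1: "1 \<le> ?d" by (simp add: Suc_leI)
  have "second_moment jl \<le> l1 (\<lambda>x. ennreal (?d * ?R\<^sup>2) * jl x)"
    unfolding second_moment_def
  proof (rule l1_mono)
    fix x
    show "ennreal ((norm2 x)\<^sup>2) * jl x \<le> ennreal (?d * ?R\<^sup>2) * jl x"
    proof (cases "J x = 0")
      case False
      have "(supnorm x)\<^sup>2 \<le> ?R\<^sup>2" using J_supp[OF False] supnorm_nonneg[of x] by (intro power_mono) auto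
      then have "?d * (supnorm x)\<^sup>2 \<le> ?d * ?R\<^sup>2" by (intro mult_left_mono) auto
      then have "(norm2 x)\<^sup>2 \<le> ?d * ?R\<^sup>2" using norm2_sq_le[of x] by linarith
      then show ?thesis by (intro mult_right_mono ennreal_leI) auto
    qed (simp add: jl_def)
  qed
  also have "\<dots> = ennreal (?d * ?R\<^sup>2)" unfolding l1_cmult jl_l1 by simp
  finally have "(kernel_sigma J)\<^sup>2 \<le> ?d * ?R\<^sup>2"
    unfolding jl_second by (subst (asm) ennreal_le_iff) auto
  also have "\<dots> \<le> (?d * ?R)\<^sup>2"
    using d1 self_le_power[of ?d 2] unfolding power_mult_distrib by (intro mult_right_mono) auto
  finally show ?thesis using J_range d1 \<sigma>_pos by (intro power2_le_imp_le[of "kernel_sigma J"]) auto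
qed

lemma jl_bound: "jl x \<le> ennreal (real CARD('d) ^ CARD('d) / c0 / kernel_sigma J ^ CARD('d))"
  unfolding jl_def
proof (rule ennreal_leI)
  have "kernel_sigma J ^ CARD('d) \<le> (real CARD('d) * kernel_range J) ^ CARD('d)"
    using \<sigma>_le \<sigma>_pos by (intro power_mono) auto
  then have "inverse (kernel_range J ^ CARD('d)) \<le> real CARD('d) ^ CARD('d) / kernel_sigma J ^ CARD('d)"
    using \<sigma>_pos J_range by (simp add: power_mult_distrib field_simps)
  then have "inverse c0 * inverse (kernel_range J ^ CARD('d)) \<le>
      inverse c0 * (real CARD('d) ^ CARD('d) / kernel_sigma J ^ CARD('d))"
    using c0 by (intro mult_left_mono) auto
  then show "J x \<le> real CARD('d) ^ CARD('d) / c0 / kernel_sigma J ^ CARD('d)"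
    using J_sup[of x] by (simp add: field_simps)
qed

lemma jl_sym: "lattice_symmetric jl"
  using J_sym unfolding jl_def[abs_def] lattice_symmetric_def by simp

lemma g_zero: "g 0 = delta0"
  using cG unfolding class_G_def g_def by simp

lemma g_sym: "b \<in> I \<Longrightarrow> lattice_symmetric (g b)"
  using cG unfolding class_G_def g_def I_iff by auto

lemma g_decay: "b \<in> I \<Longrightarrow> exp_decay (g b)"
  using cG unfolding class_G_def g_def I_iff by auto

lemma g_mono: "b \<in> I \<Longrightarrow> 0 \<le> a \<Longrightarrow> a \<le> b \<Longrightarrow> g a x \<le> g b x"
proof -
  assume *: "b \<in> I" "0 \<le> a" "a \<le> b"
  have "mono_on {..<\<beta>c} (\<lambda>\<beta>. G \<beta> x)" using cG unfolding class_G_def by blast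
  then show ?thesis unfolding g_def
    using * I_down[OF *] by (auto simp: I_iff ennreal_leI intro: mono_onD)
qed

lemma g_l1: "b \<in> I \<Longrightarrow> l1 (g b) = ennreal (X b)"
  using exp_decay_moments(1)[OF g_decay] by (simp add: X_def)

lemma g_second: "b \<in> I \<Longrightarrow> second_moment (g b) = ennreal (W b)"
  using exp_decay_moments(2)[OF g_decay] by (simp add: W_def)

lemma X_nonneg: "0 \<le> X b" and W_nonneg: "0 \<le> W b" and h0_nonneg: "0 \<le> h0 b" and h2_nonneg: "0 \<le> h2 b"
  by (simp_all add: X_def W_def h0_def h2_def)

lemma Fb_eq: "Fb b = conv jl (g b)"
  by (simp add: Fb_def F_conv_def g_def jl_def[abs_def])

lemma even_sym: "lattice_symmetric f \<Longrightarrow> f (- x) = f x"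
  by (rule lattice_symmetric_uminus)

lemma Fb_l1: "b \<in> I \<Longrightarrow> l1 (Fb b) = ennreal (X b)"
  by (simp add: Fb_eq l1_conv jl_l1 g_l1)

lemma Fb_second: "b \<in> I \<Longrightarrow> second_moment (Fb b) = ennreal (V b)"
proof -
  assume b: "b \<in> I"
  have "second_moment (Fb b) = second_moment jl * l1 (g b) + l1 jl * second_moment (g b)"
    unfolding Fb_eq by (rule second_moment_conv) (rule even_sym[OF g_sym[OF b]])
  then show ?thesis
    by (simp add: b V_def jl_l1 jl_second g_l1 g_second ennreal_mult X_nonneg W_nonneg)
qed

lemma X0: "X 0 = 1"
  by (simp add: X_def g_zero l1_delta0)

lemma W0: "W 0 = 0"
proof -
  have "(\<lambda>x. ennreal ((norm2 x)\<^sup>2) * delta0 x) = (\<lambda>x::'d lattice. 0)"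
    by (auto simp: delta0_def norm2_def)
  then have "second_moment (g 0) = 0" unfolding g_zero second_moment_def by simp
  then show ?thesis by (simp add: W_def)
qed

lemma g_renewal:
  assumes "b \<in> I" "0 \<le> a" "a \<le> b"
  shows "g b x \<le> g a x + ennreal (b - a) * conv (conv (g a) jl) (g b) x"
proof -
  have *: "\<forall>\<beta>' \<beta> x. \<beta>' \<le> \<beta> \<and> \<beta> < \<beta>c \<longrightarrow>
      G \<beta> x \<le> G \<beta>' x + (\<beta> - \<beta>') * conv (conv (G \<beta>') (\<lambda>z. ennreal (J z))) (G \<beta>) x"
    using as1 unfolding assumption1_def assumption1_i_def by blast
  have "ennreal a \<le> ennreal b" "ennreal b < \<beta>c" using assms by (auto simp: I_iff ennreal_leI)
  then have "G (ennreal b) x \<le> G (ennreal a) x + (ennreal b - ennreal a) * conv (conv (G (ennreal a)) (\<lambda>z. ennreal (J z))) (G (ennreal b)) x"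
    using * by blast
  then show ?thesis unfolding g_def jl_def[abs_def] using assms by (simp add: ennreal_minus)
qed

lemma Fb_renewal:
  assumes "b \<in> I" "0 \<le> a" "a \<le> b"
  shows "Fb b x \<le> Fb a x + ennreal (b - a) * conv (Fb a) (Fb b) x"
proof -
  have "Fb b x \<le> conv jl (\<lambda>x. g a x + ennreal (b - a) * conv (conv (g a) jl) (g b) x) x"
    unfolding Fb_eq by (rule conv_mono) (auto intro: g_renewal[OF assms])
  also have "\<dots> = Fb a x + ennreal (b - a) * conv jl (conv (conv (g a) jl) (g b)) x"
    unfolding conv_add_right conv_cmult_right Fb_eq ..
  also have "conv jl (conv (conv (g a) jl) (g b)) = conv (Fb a) (Fb b)"
    unfolding Fb_eq by (simp only: conv_assoc)
  finally show ?thesis .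
qed

lemma Fb_mono: "b \<in> I \<Longrightarrow> 0 \<le> a \<Longrightarrow> a \<le> b \<Longrightarrow> Fb a x \<le> Fb b x"
  unfolding Fb_eq by (intro conv_mono g_mono) auto

lemma X_ge_1: "b \<in> I \<Longrightarrow> 1 \<le> X b"
proof -
  assume b: "b \<in> I"
  have "l1 (g 0) \<le> l1 (g b)" using b by (intro l1_mono g_mono) (auto simp: I_iff)
  then have "ennreal 1 \<le> ennreal (X b)" by (simp add: g_zero l1_delta0 g_l1[OF b])
  then show ?thesis using X_nonneg[of b] by (subst (asm) ennreal_le_iff) auto
qed

lemma V_pos: "b \<in> I \<Longrightarrow> 0 < V b"
proof -
  assume b: "b \<in> I"
  have "0 < (kernel_sigma J)\<^sup>2 * X b" using \<sigma>_pos X_ge_1[OF b] by (intro mult_pos_pos) auto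
  then show ?thesis using W_nonneg[of b] by (simp add: V_def)
qed

lemma ennreal_mult_X: "ennreal (X a) * ennreal (X b) = ennreal (X a * X b)"
  by (simp add: ennreal_mult X_nonneg)

text \<open>The renewal inequality for F, summed against 1 and against the squared norm. The second
  moment of the convolution has no cross term because F is even.\<close>

lemma increments:
  assumes ab: "b \<in> I" "0 \<le> a" "a \<le> b"
  shows "X a \<le> X b" "X b \<le> X a + (b - a) * (X a * X b)"
    and "V a \<le> V b" "V b \<le> V a + (b - a) * (V a * X b + X a * V b)"
proof -
  have aI: "a \<in> I" by (rule I_down[OF ab])
  note pos = X_nonneg V_pos[OF aI] V_pos[OF ab(1)]
  have "l1 (Fb a) \<le> l1 (Fb b)" by (intro l1_mono Fb_mono[OF ab])
  then show "X a \<le> X b" unfolding Fb_l1[OF aI] Fb_l1[OF ab(1)] using X_nonneg by (subst (asm) ennreal_le_iff) auto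
  have "second_moment (Fb a) \<le> second_moment (Fb b)"
    unfolding second_moment_def by (intro l1_mono mult_left_mono Fb_mono[OF ab]) auto
  then show "V a \<le> V b" unfolding Fb_second[OF aI] Fb_second[OF ab(1)] using pos by (subst (asm) ennreal_le_iff) auto
  let ?c = "conv (Fb a) (Fb b)"
  have sym_b: "Fb b (- x) = Fb b x" for x
    unfolding Fb_eq by (rule even_sym[OF lattice_symmetric_conv[OF jl_sym g_sym[OF ab(1)]]])
  have "l1 (Fb b) \<le> l1 (\<lambda>x. Fb a x + ennreal (b - a) * ?c x)"
    by (rule l1_mono) (rule Fb_renewal[OF ab])
  also have "\<dots> = ennreal (X a + (b - a) * (X a * X b))"
    unfolding l1_add l1_cmult l1_conv Fb_l1[OF aI] Fb_l1[OF ab(1)] ennreal_mult_X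
    using ab X_nonneg by (simp add: ennreal_mult' [symmetric])
  finally show "X b \<le> X a + (b - a) * (X a * X b)"
    unfolding Fb_l1[OF ab(1)] using ab X_nonneg by (subst (asm) ennreal_le_iff) auto
  have "second_moment (Fb b) \<le> l1 (\<lambda>x. ennreal ((norm2 x)\<^sup>2) * Fb a x + ennreal (b - a) * (ennreal ((norm2 x)\<^sup>2) * ?c x))"
    unfolding second_moment_def
  proof (rule l1_mono)
    fix x
    have "ennreal ((norm2 x)\<^sup>2) * Fb b x \<le> ennreal ((norm2 x)\<^sup>2) * (Fb a x + ennreal (b - a) * ?c x)"
      by (intro mult_left_mono Fb_renewal[OF ab]) auto
    then show "ennreal ((norm2 x)\<^sup>2) * Fb b x \<le> ennreal ((norm2 x)\<^sup>2) * Fb a x + ennreal (b - a) * (ennreal ((norm2 x)\<^sup>2) * ?c x)"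
      by (simp add: distrib_left mult.left_commute)
  qed
  also have "\<dots> = second_moment (Fb a) + ennreal (b - a) * second_moment ?c"
    unfolding l1_add l1_cmult second_moment_def ..
  also have "second_moment ?c = ennreal (V a * X b + X a * V b)"
    unfolding second_moment_conv[of "Fb b", OF sym_b] Fb_second[OF aI] Fb_second[OF ab(1)] Fb_l1[OF aI] Fb_l1[OF ab(1)]
    using pos by (simp add: ennreal_mult)
  also have "second_moment (Fb a) + ennreal (b - a) * ennreal (V a * X b + X a * V b) =
      ennreal (V a + (b - a) * (V a * X b + X a * V b))"
  proof -
    define w where "w = V a * X b + X a * V b"
    have w: "0 \<le> w" using pos by (simp add: w_def)
    have "ennreal (b - a) * ennreal w = ennreal ((b - a) * w)" by (rule ennreal_mult'[symmetric]) (use ab in simp)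
    moreover have "ennreal (V a) + ennreal ((b - a) * w) = ennreal (V a + (b - a) * w)"
      by (rule ennreal_plus[symmetric]) (use ab pos w in auto)
    ultimately show ?thesis unfolding Fb_second[OF aI] w_def[symmetric] by simp
  qed
  finally show "V b \<le> V a + (b - a) * (V a * X b + X a * V b)"
    unfolding Fb_second[OF ab(1)] using ab pos X_nonneg
    by (subst (asm) ennreal_le_iff) (auto intro!: add_nonneg_nonneg mult_nonneg_nonneg)
qed

definition D :: "real \<Rightarrow> 'd lattice \<Rightarrow> real" where "D b x = beta_deriv G \<beta>c (ennreal b) x"

lemma deriv_G:
  assumes "b \<in> I" shows "(real_G G x has_real_derivative D b x) (at b within I)"
proof -
  have "real_G G x differentiable_on I" using cG unfolding class_G_def by blast
  then have "real_G G x differentiable (at b within I)" using assms unfolding differentiable_on_def by blast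
  then have "(real_G G x has_vector_derivative vector_derivative (real_G G x) (at b within I)) (at b within I)"
    by (simp add: vector_derivative_works)
  moreover have "enn2real (ennreal b) = b" using assms by (simp add: I_iff)
  ultimately show ?thesis by (simp add: has_real_derivative_iff_has_vector_derivative D_def beta_deriv_def)
qed

lemma real_G_eq: "real_G G x b = enn2real (g b x)"
  by (simp add: real_G_def g_def)

lemma g_finite: "b \<in> I \<Longrightarrow> g b x < \<infinity>"
  using l1_ge[of "g b" x] g_l1[of b] by (simp add: order_le_less_trans)

lemma limpt_right: "b \<in> I \<Longrightarrow> b islimpt (I \<inter> {b<..})"
proof -
  assume b: "b \<in> I"
  obtain B where B: "B \<in> I" "b < B" by (rule I_above[OF b])
  have "{b<..<B} \<subseteq> I \<inter> {b<..}" using I_down[OF B(1)] b by (auto simp: I_iff)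
  then show ?thesis using islimpt_greaterThanLessThan1[OF B(2)] islimpt_subset by blast
qed

text \<open>Below a fixed B > b, renewal and monotonicity bound increments of G by their length
  times K = G_B * J * G_B, which has finite mass and second moment. This locally uniform Lipschitz
  bound allows differentiation under the sum, with w = 1 for the mass and the squared norm for the
  second moment.\<close>

lemma deriv_weighted:
  assumes b: "b \<in> I" and w: "\<And>x. 0 \<le> w x"
    and fin: "\<And>f. l1 f < \<infinity> \<Longrightarrow> second_moment f < \<infinity> \<Longrightarrow> l1 (\<lambda>x. ennreal (w x) * f x) < \<infinity>"
  shows "integrable lat (\<lambda>x. w x * D b x)"
    and "((\<lambda>y. enn2real (l1 (\<lambda>x. ennreal (w x) * g y x))) has_real_derivative (\<integral>x. w x * D b x \<partial>lat)) (at b within I)"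
proof -
  obtain B where B: "B \<in> I" "b < B" by (rule I_above[OF b])
  define S where "S = I \<inter> {..<B}"
  have bS: "b \<in> S" using b B by (simp add: S_def)
  have at_eq: "at b within S = at b within I"
    by (rule at_within_nhd[of b "{..<B}"]) (use B in \<open>auto simp: S_def\<close>)
  have "{b<..<B} \<subseteq> S" using I_down[OF B(1)] b by (auto simp: S_def I_iff)
  then have lp: "b islimpt S" using islimpt_greaterThanLessThan1[OF B(2)] islimpt_subset by blast
  define K where "K = conv (conv (g B) jl) (g B)"
  have gB: "l1 (g B) < \<infinity>" "second_moment (g B) < \<infinity>" using g_l1[OF B(1)] g_second[OF B(1)] by simp_all
  have K1: "l1 K < \<infinity>" using gB by (simp add: K_def l1_conv jl_l1 ennreal_mult_less_top)
  have K2: "second_moment K < \<infinity>"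
  proof -
    have "second_moment (conv (g B) jl) = second_moment (g B) * l1 jl + l1 (g B) * second_moment jl"
      by (rule second_moment_conv) (rule even_sym[OF jl_sym])
    moreover have "second_moment K = second_moment (conv (g B) jl) * l1 (g B) + l1 (conv (g B) jl) * second_moment (g B)"
      unfolding K_def by (rule second_moment_conv) (rule even_sym[OF g_sym[OF B(1)]])
    ultimately show ?thesis using gB by (simp add: l1_conv jl_l1 jl_second ennreal_mult_less_top)
  qed
  have Kfin: "K x < \<infinity>" for x using K1 l1_ge[of K x] by (simp add: order_le_less_trans)
  have int: "integrable lat (\<lambda>x. w x * enn2real (f x))" and
    val: "(\<integral>x. w x * enn2real (f x) \<partial>lat) = enn2real (l1 (\<lambda>x. ennreal (w x) * f x))"
    if "l1 f < \<infinity>" "second_moment f < \<infinity>" for f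
    using integrable_enn2real[OF fin[OF that]] integral_enn2real[OF fin[OF that]] w
    by (simp_all add: enn2real_mult)
  have dom0: "\<bar>enn2real (g c x) - enn2real (g a x)\<bar> \<le> (c - a) * enn2real (K x)"
    if "c \<in> S" "a \<in> S" "a \<le> c" for a c x
  proof -
    have aI: "a \<in> I" "c \<in> I" "0 \<le> a" "a \<le> B" "c \<le> B" "0 \<le> c" using that by (auto simp: S_def I_iff)
    have "conv (conv (g a) jl) (g c) x \<le> K x"
      unfolding K_def by (intro conv_mono g_mono[OF B(1)] aI) auto
    then have "g c x \<le> g a x + ennreal (c - a) * K x"
      using g_renewal[OF aI(2,3) that(3), of x] by (meson add_left_mono mult_left_mono order_trans zero_le)
    also have "\<dots> = ennreal (enn2real (g a x) + (c - a) * enn2real (K x))"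
      using g_finite[OF aI(1), of x] Kfin[of x] that(3) by (simp add: ennreal_mult)
    finally have "enn2real (g c x) \<le> enn2real (g a x) + (c - a) * enn2real (K x)"
      using that(3) by (intro enn2real_leI) auto
    moreover have "enn2real (g a x) \<le> enn2real (g c x)"
      using g_mono[OF aI(2,3) that(3), of x] g_finite[OF aI(2), of x] by (intro enn2real_mono) auto
    ultimately show ?thesis by simp
  qed
  have dom1: "\<bar>enn2real (g y x) - enn2real (g b x)\<bar> \<le> \<bar>y - b\<bar> * enn2real (K x)" if "y \<in> S" for y x
    using dom0[OF that bS, of x] dom0[OF bS that, of x] by (cases "b \<le> y") (auto simp: abs_minus_commute)
  have A: "((\<lambda>y. w x * real_G G x y) has_real_derivative w x * D b x) (at b within S)" for x
    unfolding at_eq by (rule DERIV_cmult[OF deriv_G[OF b]])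
  have B: "integrable lat (\<lambda>x. w x * real_G G x y)" if "y \<in> S" for y
    unfolding real_G_eq using that by (intro int) (simp_all add: S_def g_l1 g_second)
  have C: "\<bar>w x * real_G G x y - w x * real_G G x b\<bar> \<le> \<bar>y - b\<bar> * (w x * enn2real (K x))" if "y \<in> S" for x y
  proof -
    have "\<bar>w x * real_G G x y - w x * real_G G x b\<bar> = w x * \<bar>enn2real (g y x) - enn2real (g b x)\<bar>"
      unfolding real_G_eq right_diff_distrib[symmetric] abs_mult using w[of x] by simp
    also have "\<dots> \<le> w x * (\<bar>y - b\<bar> * enn2real (K x))" by (intro mult_left_mono dom1 that w)
    finally show ?thesis by (simp add: mult.left_commute)
  qed
  note * = has_derivative_dominated[where f = "\<lambda>x y. w x * real_G G x y", OF lp A bS B int[OF K1 K2] C]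
  show "integrable lat (\<lambda>x. w x * D b x)" by (rule *(1))
  from *(2) have "((\<lambda>y. \<integral>x. w x * real_G G x y \<partial>lat) has_real_derivative (\<integral>x. w x * D b x \<partial>lat)) (at b within I)"
    unfolding at_eq .
  then show "((\<lambda>y. enn2real (l1 (\<lambda>x. ennreal (w x) * g y x))) has_real_derivative (\<integral>x. w x * D b x \<partial>lat)) (at b within I)"
  proof (rule has_field_derivative_transform_within[where d = 1])
    fix y assume y: "y \<in> I"
    show "(\<integral>x. w x * real_G G x y \<partial>lat) = enn2real (l1 (\<lambda>x. ennreal (w x) * g y x))"
      unfolding real_G_eq using y by (intro val) (simp_all add: g_l1 g_second)
  qed (use b in auto)
qed

lemma as1_ii: "assumption1_ii J \<beta>c G H"
  using as1 unfolding assumption1_def by blast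

lemma hl_decay: "b \<in> I \<Longrightarrow> exp_decay (hl b)"
  using as1_ii unfolding assumption1_ii_def hl_def[abs_def] I_iff by blast

lemma H_nonneg: "b \<in> I \<Longrightarrow> 0 \<le> H (ennreal b) x"
  using as1_ii unfolding assumption1_ii_def I_iff by blast

lemma hl_even: "b \<in> I \<Longrightarrow> hl b (- x) = hl b x"
proof -
  assume b: "b \<in> I"
  have "\<forall>\<beta><\<beta>c. \<forall>x. H \<beta> x = H \<beta> (- x)" using as1_ii unfolding assumption1_ii_def by blast
  then show ?thesis using b unfolding hl_def I_iff by metis
qed

lemma D_lower: "b \<in> I \<Longrightarrow> D b x \<ge> conv (conv (\<lambda>z. enn2real (g b z)) (\<lambda>z. J z - H (ennreal b) z)) (\<lambda>z. enn2real (g b z)) x"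
  using as1_ii unfolding assumption1_ii_def D_def g_def I_iff by blast

lemma hl_l1: "b \<in> I \<Longrightarrow> l1 (hl b) = ennreal (h0 b)" and hl_second: "b \<in> I \<Longrightarrow> second_moment (hl b) = ennreal (h2 b)"
  using exp_decay_moments[OF hl_decay] by (simp_all add: h0_def h2_def)

lemma D_lower':
  assumes "b \<in> I"
  shows "enn2real (conv (conv (g b) jl) (g b) x) - enn2real (conv (conv (g b) (hl b)) (g b) x) \<le> D b x"
proof -
  have e: "(\<lambda>z. J z - H (ennreal b) z) = (\<lambda>z. enn2real (jl z) - enn2real (hl b z))"
    using J_nonneg H_nonneg[OF assms] by (simp add: jl_def hl_def)
  show ?thesis
    using D_lower[OF assms, of x] unfolding e
    by (subst (asm) conv_enn2real_diff) (simp_all add: g_l1 hl_l1 assms jl_l1)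
qed

lemma integral_lower:
  assumes b: "b \<in> I" and w: "\<And>x. 0 \<le> w x"
    and fin: "\<And>f. l1 f < \<infinity> \<Longrightarrow> second_moment f < \<infinity> \<Longrightarrow> l1 (\<lambda>x. ennreal (w x) * f x) < \<infinity>"
    and v1: "l1 (\<lambda>x. ennreal (w x) * conv (conv (g b) jl) (g b) x) = ennreal v1" "0 \<le> v1"
    and v2: "l1 (\<lambda>x. ennreal (w x) * conv (conv (g b) (hl b)) (g b) x) = ennreal v2" "0 \<le> v2"
  shows "v1 - v2 \<le> (\<integral>x. w x * D b x \<partial>lat)"
proof -
  let ?a = "\<lambda>x. w x * enn2real (conv (conv (g b) jl) (g b) x)"
  let ?c = "\<lambda>x. w x * enn2real (conv (conv (g b) (hl b)) (g b) x)"
  have a: "integrable lat ?a" "(\<integral>x. ?a x \<partial>lat) = v1"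
    using integrable_enn2real[of "\<lambda>x. ennreal (w x) * conv (conv (g b) jl) (g b) x"]
      integral_enn2real[of "\<lambda>x. ennreal (w x) * conv (conv (g b) jl) (g b) x"] v1 w
    by (simp_all add: enn2real_mult)
  have c: "integrable lat ?c" "(\<integral>x. ?c x \<partial>lat) = v2"
    using integrable_enn2real[of "\<lambda>x. ennreal (w x) * conv (conv (g b) (hl b)) (g b) x"]
      integral_enn2real[of "\<lambda>x. ennreal (w x) * conv (conv (g b) (hl b)) (g b) x"] v2 w
    by (simp_all add: enn2real_mult)
  have "v1 - v2 = (\<integral>x. ?a x - ?c x \<partial>lat)" using a c by simp
  also have "\<dots> \<le> (\<integral>x. w x * D b x \<partial>lat)"
  proof (rule integral_mono)
    show "integrable lat (\<lambda>x. ?a x - ?c x)" using a c by simp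
    show "integrable lat (\<lambda>x. w x * D b x)" by (rule deriv_weighted(1)[OF b w fin])
    show "?a x - ?c x \<le> w x * D b x" for x
      unfolding right_diff_distrib[symmetric] by (intro mult_left_mono D_lower' b w)
  qed
  finally show ?thesis .
qed

text \<open>The lower bound sums Assumption 1 (ii), where G * J * G has mass X^2 and G * H * G has
  mass X^2 h0. The upper bound is the increment inequality from Assumption 1 (i), divided by y - b
  as y decreases to b.\<close>

lemma X_deriv:
  assumes b: "b \<in> I"
  obtains X' where "(X has_real_derivative X') (at b within I)"
    "(X b)\<^sup>2 - (X b)\<^sup>2 * h0 b \<le> X'" "X' \<le> (X b)\<^sup>2"
proof -
  let ?X' = "\<integral>x. 1 * D b x \<partial>lat"
  have 1: "((\<lambda>y. enn2real (l1 (\<lambda>x. ennreal 1 * g y x))) has_real_derivative ?X') (at b within I)"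
    by (rule deriv_weighted(2)[OF b]) auto
  then have d: "(X has_real_derivative ?X') (at b within I)" by (simp add: X_def[abs_def])
  have "(X b)\<^sup>2 - (X b)\<^sup>2 * h0 b \<le> ?X'"
    by (rule integral_lower[OF b])
       (auto simp: l1_conv jl_l1 g_l1[OF b] hl_l1[OF b] ennreal_mult[symmetric] X_nonneg h0_nonneg power2_eq_square mult_ac)
  moreover have "?X' \<le> X b * X b"
  proof (rule deriv_le_right[OF d limpt_right[OF b]])
    fix y assume "y \<in> I" "b < y"
    then show "X y \<le> X b + (y - b) * (X b * X y)" using b by (intro increments) (auto simp: I_iff)
  next
    have "(X \<longlongrightarrow> X b) (at b within I)"
      using DERIV_continuous[OF d] by (simp add: continuous_within)
    then show "((\<lambda>y. X b * X y) \<longlongrightarrow> X b * X b) (at b within I)" by (intro tendsto_intros)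
  qed
  ultimately show ?thesis using d that by (simp add: power2_eq_square)
qed

lemma V_deriv:
  assumes b: "b \<in> I"
  obtains V' where "(V has_real_derivative V') (at b within I)"
    "2 * X b * V b - 2 * X b * V b * h0 b - (X b)\<^sup>2 * h2 b \<le> V'" "V' \<le> 2 * X b * V b"
proof -
  let ?s = "(kernel_sigma J)\<^sup>2"
  obtain X' where X': "(X has_real_derivative X') (at b within I)" "(X b)\<^sup>2 - (X b)\<^sup>2 * h0 b \<le> X'" "X' \<le> (X b)\<^sup>2"
    by (rule X_deriv[OF b])
  let ?W' = "\<integral>x. (norm2 x)\<^sup>2 * D b x \<partial>lat"
  have "((\<lambda>y. enn2real (l1 (\<lambda>x. ennreal ((norm2 x)\<^sup>2) * g y x))) has_real_derivative ?W') (at b within I)"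
    by (rule deriv_weighted(2)[OF b]) (auto simp: second_moment_def)
  then have dW: "(W has_real_derivative ?W') (at b within I)" by (simp add: W_def[abs_def] second_moment_def)
  have dV: "(V has_real_derivative (?s * X' + ?W')) (at b within I)"
    unfolding V_def[abs_def] by (intro DERIV_add DERIV_cmult X' dW)
  have m1: "second_moment (conv (conv (g b) jl) (g b)) = ennreal ((W b + X b * ?s) * X b + X b * W b)"
  proof -
    have a: "second_moment (conv (g b) jl) = ennreal (W b + X b * ?s)"
      by (subst second_moment_conv)
         (auto simp: even_sym[OF jl_sym] g_l1[OF b] g_second[OF b] jl_l1 jl_second ennreal_mult X_nonneg W_nonneg)
    have "second_moment (conv (conv (g b) jl) (g b)) =
        second_moment (conv (g b) jl) * l1 (g b) + l1 (conv (g b) jl) * second_moment (g b)"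
      by (rule second_moment_conv) (rule even_sym[OF g_sym[OF b]])
    also have "\<dots> = ennreal (W b + X b * ?s) * ennreal (X b) + ennreal (X b) * ennreal (W b)"
      unfolding a l1_conv jl_l1 g_l1[OF b] g_second[OF b] by simp
    also have "\<dots> = ennreal ((W b + X b * ?s) * X b + X b * W b)"
      using X_nonneg W_nonneg by (intro ennreal_sum_products) auto
    finally show ?thesis .
  qed
  have m2: "second_moment (conv (conv (g b) (hl b)) (g b)) = ennreal ((W b * h0 b + X b * h2 b) * X b + X b * h0 b * W b)"
  proof -
    have a: "second_moment (conv (g b) (hl b)) = ennreal (W b * h0 b + X b * h2 b)"
      by (subst second_moment_conv)
         (auto simp: hl_even[OF b] g_l1[OF b] g_second[OF b] hl_l1[OF b] hl_second[OF b] ennreal_mult X_nonneg W_nonneg h0_nonneg h2_nonneg)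
    have "second_moment (conv (conv (g b) (hl b)) (g b)) =
        second_moment (conv (g b) (hl b)) * l1 (g b) + l1 (conv (g b) (hl b)) * second_moment (g b)"
      by (rule second_moment_conv) (rule even_sym[OF g_sym[OF b]])
    also have "\<dots> = ennreal (W b * h0 b + X b * h2 b) * ennreal (X b) + ennreal (X b * h0 b) * ennreal (W b)"
      unfolding a l1_conv hl_l1[OF b] g_l1[OF b] g_second[OF b] using X_nonneg h0_nonneg by (simp add: ennreal_mult)
    also have "\<dots> = ennreal ((W b * h0 b + X b * h2 b) * X b + X b * h0 b * W b)"
      using X_nonneg W_nonneg h0_nonneg h2_nonneg by (intro ennreal_sum_products) auto
    finally show ?thesis .
  qed
  have "((W b + X b * ?s) * X b + X b * W b) - ((W b * h0 b + X b * h2 b) * X b + X b * h0 b * W b) \<le> ?W'"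
    by (rule integral_lower[OF b])
       (use m1 m2 X_nonneg W_nonneg h0_nonneg h2_nonneg in \<open>auto simp: second_moment_def\<close>)
  moreover have "?s * ((X b)\<^sup>2 - (X b)\<^sup>2 * h0 b) \<le> ?s * X'" using X'(2) by (intro mult_left_mono) auto
  \<comment> \<open>The available bound charges h0 once to the kernel part \<sigma>^2 X^2; charging
    it twice loses \<sigma>^2 X^2 h0 \<ge> 0 and lets everything be written in terms of
    \<open>V\<close>.\<close>
  moreover have "2 * X b * V b - 2 * X b * V b * h0 b - (X b)\<^sup>2 * h2 b \<le>
     ?s * ((X b)\<^sup>2 - (X b)\<^sup>2 * h0 b) + (((W b + X b * ?s) * X b + X b * W b) - ((W b * h0 b + X b * h2 b) * X b + X b * h0 b * W b))"
  proof -
    have "0 \<le> ?s * (X b)\<^sup>2 * h0 b" using h0_nonneg by simp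
    then show ?thesis by (simp add: V_def algebra_simps power2_eq_square)
  qed
  ultimately have low: "2 * X b * V b - 2 * X b * V b * h0 b - (X b)\<^sup>2 * h2 b \<le> ?s * X' + ?W'" by linarith
  have "?s * X' + ?W' \<le> V b * X b + X b * V b"
  proof (rule deriv_le_right[OF dV limpt_right[OF b]])
    fix y assume "y \<in> I" "b < y"
    then show "V y \<le> V b + (y - b) * (V b * X y + X b * V y)" using b by (intro increments) (auto simp: I_iff)
  next
    have "(X \<longlongrightarrow> X b) (at b within I)" "(V \<longlongrightarrow> V b) (at b within I)"
      using DERIV_continuous[OF X'(1)] DERIV_continuous[OF dV] by (simp_all add: continuous_within)
    then show "((\<lambda>y. V b * X y + X b * V y) \<longlongrightarrow> V b * X b + X b * V b) (at b within I)" by (intro tendsto_intros)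
  qed
  then show ?thesis using dV low that by (simp add: mult_ac)
qed

lemma X_cont: "continuous_on I X"
  unfolding continuous_on_eq_continuous_within
proof
  fix b assume "b \<in> I"
  then show "continuous (at b within I) X" by (rule X_deriv) (rule DERIV_continuous)
qed

lemma V_cont: "continuous_on I V"
  unfolding continuous_on_eq_continuous_within
proof
  fix b assume "b \<in> I"
  then show "continuous (at b within I) V" by (rule V_deriv) (rule DERIV_continuous)
qed

end

section \<open>Integrated inequalities, the stopping argument and the critical point\<close>

context model
begin

text \<open>The logarithmic derivatives satisfy (1 - \<delta>) X \<le> X'/X \<le> X and 2 (1 -
  \<delta>) X \<le> V'/V \<le> 2 X. Hence -1/X - (1 - \<delta>) \<beta>, log V - 2 (1 - \<delta>)
  log X and 2 / (1 - \<delta>) log X - log V are nondecreasing, which are the three comparisons of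
  \<open>flow\<close>.\<close>

lemma flow_of_error:
  assumes \<delta>: "0 \<le> \<delta>" "\<delta> \<le> 1 / 100"
    and err: "\<And>b. b \<in> I \<Longrightarrow> h0 b + h2 b / (V b / X b) \<le> \<delta>"
  shows "flow Fb I X V c0 (kernel_sigma J) \<delta>"
proof -
  have Xp: "0 < X b" if "b \<in> I" for b using X_ge_1[OF that] by simp
  have "\<forall>b\<in>I. \<exists>X'. (X has_real_derivative X') (at b within I) \<and> (1 - \<delta>) * (X b)\<^sup>2 \<le> X'  \<and> X' \<le> (X b)\<^sup>2"
  proof
    fix b assume b: "b \<in> I"
    obtain X' where X': "(X has_real_derivative X') (at b within I)" "(X b)\<^sup>2 - (X b)\<^sup>2 * h0 b \<le> X'" "X' \<le> (X b)\<^sup>2"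
      by (rule X_deriv[OF b])
    have "0 \<le> h2 b / (V b / X b)" using h2_nonneg V_pos[OF b] Xp[OF b] by simp
    then have "h0 b \<le> \<delta>" using err[OF b] by linarith
    then have "(X b)\<^sup>2 * h0 b \<le> (X b)\<^sup>2 * \<delta>" by (intro mult_left_mono) auto
    then show "\<exists>X'. (X has_real_derivative X') (at b within I) \<and> (1 - \<delta>) * (X b)\<^sup>2 \<le> X'  \<and> X' \<le> (X b)\<^sup>2"
      using X' by (intro exI[of _ X']) (simp add: algebra_simps)
  qed
  then obtain X' where X': "\<And>b. b \<in> I \<Longrightarrow> (X has_real_derivative X' b) (at b within I)"
    "\<And>b. b \<in> I \<Longrightarrow> (1 - \<delta>) * (X b)\<^sup>2 \<le> X' b" "\<And>b. b \<in> I \<Longrightarrow> X' b \<le> (X b)\<^sup>2"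
    by (metis (no_types, lifting))
  have "\<forall>b\<in>I. \<exists>V'. (V has_real_derivative V') (at b within I) \<and> 2 * (1 - \<delta>) * (X b * V b) \<le> V' \<and> V' \<le> 2 * (X b * V b)"
  proof
    fix b assume b: "b \<in> I"
    obtain V' where V': "(V has_real_derivative V') (at b within I)"
      "2 * X b * V b - 2 * X b * V b * h0 b - (X b)\<^sup>2 * h2 b \<le> V'" "V' \<le> 2 * X b * V b"
      by (rule V_deriv[OF b])
    \<comment> \<open>V / X is \<xi>^2, so h2 appears in the normalisation that the error E
      controls. Doubling it in the next line gives h0 and h2 / \<xi>^2 the same coefficient.\<close>
    have "(X b)\<^sup>2 * h2 b = (X b * V b) * (h2 b / (V b / X b))"
      using Xp[OF b] V_pos[OF b] by (simp add: field_simps power2_eq_square)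
    also have "\<dots> \<le> 2 * (X b * V b) * (h2 b / (V b / X b))"
      using Xp[OF b] V_pos[OF b] h2_nonneg by (intro mult_right_mono) auto
    finally have "2 * X b * V b * h0 b + (X b)\<^sup>2 * h2 b \<le> 2 * (X b * V b) * (h0 b + h2 b / (V b / X b))"
      by (simp add: distrib_left mult.assoc)
    also have "\<dots> \<le> 2 * (X b * V b) * \<delta>"
      using Xp[OF b] V_pos[OF b] by (intro mult_left_mono err[OF b]) auto
    finally have "2 * (1 - \<delta>) * (X b * V b) \<le> V'" using V'(2) by (simp add: algebra_simps)
    then show "\<exists>V'. (V has_real_derivative V') (at b within I) \<and> 2 * (1 - \<delta>) * (X b * V b) \<le> V' \<and> V' \<le> 2 * (X b * V b)"
      using V' by (intro exI[of _ V']) simp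
  qed
  then obtain V' where V': "\<And>b. b \<in> I \<Longrightarrow> (V has_real_derivative V' b) (at b within I)"
    "\<And>b. b \<in> I \<Longrightarrow> 2 * (1 - \<delta>) * (X b * V b) \<le> V' b" "\<And>b. b \<in> I \<Longrightarrow> V' b \<le> 2 * (X b * V b)"
    by (metis (no_types, lifting))
  have sub: "{a..b} \<subseteq> I" if "b \<in> I" "0 \<le> a" for a b
    using I_down[OF that(1)] that(2) by auto
  have lnX: "((\<lambda>y. ln (X y)) has_real_derivative X' y / X y) (at y within I)" if "y \<in> I" for y
    using DERIV_chain2[OF DERIV_ln_divide[OF Xp[OF that]] X'(1)[OF that]] by simp
  have lnV: "((\<lambda>y. ln (V y)) has_real_derivative V' y / V y) (at y within I)" if "y \<in> I" for y
    using DERIV_chain2[OF DERIV_ln_divide[OF V_pos[OF that]] V'(1)[OF that]] by simp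
  have Xr: "(1 - \<delta>) * X y \<le> X' y / X y" "X' y / X y \<le> X y" if "y \<in> I" for y
    using X'(2,3)[OF that] Xp[OF that] by (simp_all add: field_simps power2_eq_square)
  have Vr: "2 * (1 - \<delta>) * X y \<le> V' y / V y" "V' y / V y \<le> 2 * X y" if "y \<in> I" for y
    using V'(2,3)[OF that] V_pos[OF that] by (simp_all add: field_simps)
  have inv: "(1 - \<delta>) * (b - a) \<le> 1 / X a - 1 / X b" if ab: "b \<in> I" "0 \<le> a" "a \<le> b" for a b
  proof -
    have "- (1 / X a) - (1 - \<delta>) * a \<le> - (1 / X b) - (1 - \<delta>) * b"
    proof (rule deriv_nonneg_mono_within[OF ab(3) sub[OF ab(1,2)]])
      fix y assume y: "y \<in> {a..b}"
      then have yI: "y \<in> I" using sub[OF ab(1,2)] by blast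
      show "((\<lambda>y. - (1 / X y) - (1 - \<delta>) * y) has_real_derivative X' y / (X y)\<^sup>2 - (1 - \<delta>)) (at y within I)"
        using Xp[OF yI] by (auto intro!: derivative_eq_intros X'(1)[OF yI] simp: power2_eq_square)
      show "0 \<le> X' y / (X y)\<^sup>2 - (1 - \<delta>)"
        using X'(2)[OF yI] Xp[OF yI] by (simp add: le_divide_eq)
    qed
    then show ?thesis by (simp add: algebra_simps)
  qed
  have low: "V a / X a * (X b / X a) powr (1 - 2 * \<delta>) \<le> V b / X b" if ab: "b \<in> I" "0 \<le> a" "a \<le> b" for a b
  proof -
    have aI: "a \<in> I" by (rule I_down[OF ab])
    note pos = Xp[OF aI] Xp[OF ab(1)] V_pos[OF aI] V_pos[OF ab(1)]
    have "ln (V a) - 2 * (1 - \<delta>) * ln (X a) \<le> ln (V b) - 2 * (1 - \<delta>) * ln (X b)"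
    proof (rule deriv_nonneg_mono_within[OF ab(3) sub[OF ab(1,2)]])
      fix y assume y: "y \<in> {a..b}"
      then have yI: "y \<in> I" using sub[OF ab(1,2)] by blast
      show "((\<lambda>y. ln (V y) - 2 * (1 - \<delta>) * ln (X y)) has_real_derivative V' y / V y - 2 * (1 - \<delta>) * (X' y / X y)) (at y within I)"
        by (intro DERIV_diff DERIV_cmult lnX lnV yI)
      have "2 * (1 - \<delta>) * (X' y / X y) \<le> 2 * (1 - \<delta>) * X y" using \<delta> Xr(2)[OF yI] by (intro mult_left_mono) auto
      then show "0 \<le> V' y / V y - 2 * (1 - \<delta>) * (X' y / X y)" using Vr(1)[OF yI] by linarith
    qed
    then have "ln (V a / X a * (X b / X a) powr (1 - 2 * \<delta>)) \<le> ln (V b / X b)"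
      using pos by (simp add: ln_mult ln_div ln_powr algebra_simps)
    then show ?thesis using pos by (subst (asm) ln_le_cancel_iff) auto
  qed
  have up: "V b / X b \<le> V a / X a * (X b / X a) powr ((1 + \<delta>) / (1 - \<delta>))" if ab: "b \<in> I" "0 \<le> a" "a \<le> b" for a b
  proof -
    have aI: "a \<in> I" by (rule I_down[OF ab])
    note pos = Xp[OF aI] Xp[OF ab(1)] V_pos[OF aI] V_pos[OF ab(1)]
    define k where "k = 2 / (1 - \<delta>)"
    have k: "(1 + \<delta>) / (1 - \<delta>) = k - 1" "0 \<le> k" "k * (1 - \<delta>) = 2" using \<delta> by (simp_all add: k_def field_simps)
    have "k * ln (X a) - ln (V a) \<le> k * ln (X b) - ln (V b)"
    proof (rule deriv_nonneg_mono_within[OF ab(3) sub[OF ab(1,2)]])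
      fix y assume y: "y \<in> {a..b}"
      then have yI: "y \<in> I" using sub[OF ab(1,2)] by blast
      show "((\<lambda>y. k * ln (X y) - ln (V y)) has_real_derivative k * (X' y / X y) - V' y / V y) (at y within I)"
        by (intro DERIV_diff DERIV_cmult lnX lnV yI)
      have "k * ((1 - \<delta>) * X y) \<le> k * (X' y / X y)" using k(2) Xr(1)[OF yI] by (intro mult_left_mono) auto
      moreover have "k * ((1 - \<delta>) * X y) = 2 * X y" using k(3) by (simp add: mult.assoc[symmetric])
      ultimately show "0 \<le> k * (X' y / X y) - V' y / V y" using Vr(2)[OF yI] by linarith
    qed
    then have "ln (V b / X b) \<le> ln (V a / X a * (X b / X a) powr ((1 + \<delta>) / (1 - \<delta>)))"
      unfolding k(1) using pos by (simp add: ln_mult ln_div ln_powr algebra_simps)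
    then show ?thesis using pos by (subst (asm) ln_le_cancel_iff) auto
  qed
  have F0: "Fb 0 = jl" by (simp add: Fb_eq g_zero)
  show ?thesis
  proof
    show "0 < c0" "c0 \<le> 1" "0 < kernel_sigma J" "0 \<le> \<delta>" "\<delta> \<le> 1 / 100" "0 \<in> I" "X 0 = 1" "continuous_on I X"
      using c0 \<sigma>_pos \<delta> I0 X0 X_cont by auto
    show "V 0 = (kernel_sigma J)\<^sup>2" by (simp add: V_def X0 W0)
    show "lattice_symmetric (Fb b)" if "b \<in> I" for b
      unfolding Fb_eq by (rule lattice_symmetric_conv[OF jl_sym g_sym[OF that]])
    show "Fb 0 x \<le> ennreal (real CARD('d) ^ CARD('d) / c0 / kernel_sigma J ^ CARD('d))" for x
      unfolding F0 by (rule jl_bound)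
    show "supnorm x \<le> kernel_sigma J / c0" if "Fb 0 x \<noteq> 0" for x
    proof -
      have "J x \<noteq> 0" using that by (auto simp: F0 jl_def)
      then have "supnorm x \<le> kernel_range J" by (rule J_supp)
      also have "\<dots> \<le> kernel_sigma J / c0" using J_sigma c0 by (simp add: field_simps)
      finally show ?thesis .
    qed
  qed (use I_down Fb_renewal Fb_mono Fb_l1 Fb_second Xp V_pos inv low up in \<open>auto simp: I_iff\<close>)
qed

definition err :: "real \<Rightarrow> real" where "err b = h0 b + h2 b / (V b / X b)"

lemma xi_below_eq: "b \<in> I \<Longrightarrow> xi_below J G (ennreal b) = ennreal (sqrt (V b / X b))"
proof -
  assume b: "b \<in> I"
  have "second_moment (F_conv J G (ennreal b)) / chi G (ennreal b) = ennreal (V b / X b)"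
    using Fb_second[OF b] g_l1[OF b] V_pos[OF b] X_ge_1[OF b]
    by (simp add: Fb_def chi_def g_def divide_ennreal)
  then show ?thesis using V_pos[OF b] X_ge_1[OF b] by (simp add: xi_below_def esqrt_def)
qed

lemma err_term:
  assumes b: "b \<in> I"
  shows "l1 (\<lambda>x. ennreal (H (ennreal b) x)) + second_moment (\<lambda>x. ennreal (H (ennreal b) x)) / (Defs.xi J \<beta>c G (ennreal b))\<^sup>2
    = ennreal (err b)"
proof -
  have pos: "0 < V b / X b" using V_pos[OF b] X_ge_1[OF b] by simp
  have "Defs.xi J \<beta>c G (ennreal b) = ennreal (sqrt (V b / X b))"
    using b xi_below_eq[OF b] by (simp add: Defs.xi_def I_iff)
  then have "(Defs.xi J \<beta>c G (ennreal b))\<^sup>2 = ennreal (V b / X b)"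
    using pos by (simp add: ennreal_power)
  then have "l1 (\<lambda>x. ennreal (H (ennreal b) x)) + second_moment (\<lambda>x. ennreal (H (ennreal b) x)) / (Defs.xi J \<beta>c G (ennreal b))\<^sup>2 =
      ennreal (h0 b) + ennreal (h2 b / (V b / X b))"
    using hl_l1[OF b] hl_second[OF b] divide_ennreal[OF h2_nonneg pos] by (simp add: hl_def[abs_def])
  also have "\<dots> = ennreal (err b)"
    unfolding err_def by (rule ennreal_plus[symmetric]) (rule h0_nonneg, rule divide_nonneg_pos[OF h2_nonneg pos])
  finally show ?thesis .
qed

lemma E_ge: "b \<in> I \<Longrightarrow> ennreal b \<le> \<beta> \<Longrightarrow> ennreal (err b) \<le> E_err J \<beta>c G H \<beta>"
  unfolding E_err_def err_term[symmetric] by (rule SUP_upper) (simp add: I_iff)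

lemma below_real: "t < \<beta>c \<Longrightarrow> \<exists>b\<in>I. t = ennreal b"
proof -
  assume t: "t < \<beta>c"
  then have "t < top" by (rule less_le_trans) simp
  then have "t = ennreal (enn2real t)" by simp
  then show ?thesis using t by (intro bexI[of _ "enn2real t"]) (auto simp: I_iff)
qed

lemma err_nonneg: "b \<in> I \<Longrightarrow> 0 \<le> err b"
  using h0_nonneg h2_nonneg V_pos X_nonneg by (simp add: err_def less_imp_le)

text \<open>This is where \<open>norm_continuous\<close> enters. From pointwise continuity of H
  alone, Fatou's lemma would give only lower semicontinuity of h0 and h2, which does not exclude
  upward jumps of the error.\<close>

lemma err_cont:
  assumes nc: "norm_continuous \<beta>c H"
  shows "continuous_on I err"
proof -
  have cb: "continuous_on I ennreal" by (intro continuous_on_ennreal continuous_on_id)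
  have im: "ennreal ` I \<subseteq> {..<\<beta>c}" by (auto simp: I_iff)
  have 0: "continuous_on I (\<lambda>b. l1 (hl b))"
    using continuous_on_compose2[OF _ cb im] nc unfolding norm_continuous_def hl_def[abs_def] by blast
  have 2: "continuous_on I (\<lambda>b. second_moment (hl b))"
    using continuous_on_compose2[OF _ cb im] nc unfolding norm_continuous_def hl_def[abs_def] by blast
  have h0: "continuous_on I h0"
    unfolding continuous_on_def
  proof
    fix b assume b: "b \<in> I"
    have "((\<lambda>b. l1 (hl b)) \<longlongrightarrow> ennreal (h0 b)) (at b within I)"
      using 0 b hl_l1[OF b] unfolding continuous_on_def by metis
    then show "(h0 \<longlongrightarrow> h0 b) (at b within I)"
      unfolding h0_def[abs_def] using tendsto_enn2real[of "\<lambda>b. l1 (hl b)" "h0 b"] h0_nonneg by (simp add: h0_def)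
  qed
  have h2: "continuous_on I h2"
    unfolding continuous_on_def
  proof
    fix b assume b: "b \<in> I"
    have "((\<lambda>b. second_moment (hl b)) \<longlongrightarrow> ennreal (h2 b)) (at b within I)"
      using 2 b hl_second[OF b] unfolding continuous_on_def by metis
    then show "(h2 \<longlongrightarrow> h2 b) (at b within I)"
      unfolding h2_def[abs_def] using tendsto_enn2real[of "\<lambda>b. second_moment (hl b)" "h2 b"] h2_nonneg by (simp add: h2_def)
  qed
  have nz: "\<forall>b\<in>I. V b / X b \<noteq> 0" "\<forall>b\<in>I. X b \<noteq> 0"
    using V_pos X_ge_1 by fastforce+
  show ?thesis
    unfolding err_def[abs_def] by (intro continuous_intros h0 h2 V_cont X_cont nz)
qed

text \<open>The set of good \<open>\<beta>\<close> is open to the right by continuity of the error, so its supremum can only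
  be \<open>\<beta>c\<close>.\<close>

lemma beta_thr_eq:
  assumes nc: "norm_continuous \<beta>c H" and \<delta>: "0 < \<delta>"
    and E: "E_err J \<beta>c G H (beta_thr J \<beta>c G H \<delta>) < ennreal \<delta>"
  shows "beta_thr J \<beta>c G H \<delta> = \<beta>c"
proof (rule ccontr)
  let ?t = "beta_thr J \<beta>c G H \<delta>"
  assume ne: "?t \<noteq> \<beta>c"
  have "?t \<le> \<beta>c" unfolding beta_thr_def by (rule Sup_least) auto
  then have "?t < \<beta>c" using ne by simp
  then obtain b where b: "b \<in> I" "?t = ennreal b" using below_real by blast
  have b0: "0 \<le> b" using b by (simp add: I_iff)
  obtain e where e: "E_err J \<beta>c G H ?t = ennreal e" "0 \<le> e" "e < \<delta>"
    using E by (cases "E_err J \<beta>c G H ?t") (auto simp: ennreal_less_iff)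
  \<comment> \<open>Passing to the supremum in \<open>E_err\<close> turns strict bounds on its terms
    into a non-strict one; the midpoint keeps that bound strictly below \<delta>.\<close>
  define e' where "e' = (e + \<delta>) / 2"
  have e': "e < e'" "e' < \<delta>" using e by (simp_all add: e'_def)
  have "ennreal (err b) \<le> ennreal e" using E_ge[OF b(1), of ?t] b(2) e(1) by simp
  then have "err b < e'" using e e' by (subst (asm) ennreal_le_iff) auto
  moreover have "(err \<longlongrightarrow> err b) (at b within I)" using err_cont[OF nc] b(1) by (simp add: continuous_on_def)
  ultimately have "\<forall>\<^sub>F y in at b within I. err y < e'" by (intro order_tendstoD)
  then obtain r where r: "0 < r" "\<And>y. y \<in> I \<Longrightarrow> y \<noteq> b \<Longrightarrow> dist y b < r \<Longrightarrow> err y < e'"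
    unfolding eventually_at by blast
  obtain B where B: "B \<in> I" "b < B" by (rule I_above[OF b(1)])
  define c where "c = min B (b + r / 2)"
  have c: "b < c" "c \<in> I" "c < b + r"
    using B r b0 I_down[OF B(1), of c] by (auto simp: c_def)
  have "E_err J \<beta>c G H (ennreal c) \<le> ennreal e'"
    unfolding E_err_def
  proof (rule SUP_least)
    fix t assume "t \<in> {t. t \<le> ennreal c \<and> t < \<beta>c}"
    then obtain y where y: "y \<in> I" "t = ennreal y" "ennreal y \<le> ennreal c" using below_real by blast
    have y0: "0 \<le> y" using y by (simp add: I_iff)
    have yc: "y \<le> c" using y(3) y0 c b0 by (subst (asm) ennreal_le_iff) auto
    have "err y \<le> e'"
    proof (cases "y \<le> b")
      case True
      then have "ennreal (err y) \<le> ennreal e" using E_ge[OF y(1), of ?t] b(2) e(1) by (simp add: ennreal_leI)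
      then show ?thesis using e e' by (subst (asm) ennreal_le_iff) auto
    next
      case False
      then show ?thesis using r(2)[OF y(1)] yc c by (simp add: dist_real_def less_imp_le)
    qed
    then show "l1 (\<lambda>x. ennreal (H t x)) + second_moment (\<lambda>x. ennreal (H t x)) / (Defs.xi J \<beta>c G t)\<^sup>2 \<le> ennreal e'"
      unfolding y(2) err_term[OF y(1)] by (rule ennreal_leI)
  qed
  also have "\<dots> < ennreal \<delta>" using e e' by (simp add: ennreal_less_iff)
  finally have "ennreal c \<in> {\<beta>. \<beta> < \<beta>c \<and> E_err J \<beta>c G H \<beta> < ennreal \<delta>}" using c by (simp add: I_iff)
  then have "ennreal c \<le> ?t" unfolding beta_thr_def by (rule Sup_upper)
  then show False using b(2) c b0 by simp
qed

lemma at_left_nontrivial: "at_left \<beta>c \<noteq> bot"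
proof
  assume "at_left \<beta>c = bot"
  then have "\<forall>\<^sub>F x in at_left \<beta>c. False" by simp
  then obtain z where "z < \<beta>c" "\<forall>y>z. y < \<beta>c \<longrightarrow> False"
    unfolding eventually_at_left[OF \<beta>c_pos] by blast
  moreover obtain w where "z < w" "w < \<beta>c" using dense[OF \<open>z < \<beta>c\<close>] by blast
  ultimately show False by blast
qed

lemma xi_le:
  assumes fl: "flow Fb I X V c0 (kernel_sigma J) \<delta>" and b: "b \<in> I"
  shows "xi_below J G (ennreal b) \<le> Defs.xi J \<beta>c G \<beta>c"
proof -
  interpret fl: flow Fb I X V c0 "kernel_sigma J" \<delta> by (rule fl)
  have mono: "xi_below J G s \<le> xi_below J G t" if st: "s \<le> t" "t < \<beta>c" for s t
  proof -
    obtain u where u: "u \<in> I" "t = ennreal u" using below_real[OF st(2)] by blast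
    have "s < \<beta>c" using st by simp
    then obtain v where v: "v \<in> I" "s = ennreal v" using below_real by blast
    have "v \<le> u" using st(1) u v by (simp add: I_iff)
    then have "fl.xi v \<le> fl.xi u" using v u by (intro fl.xi_mono) (auto simp: I_iff)
    then show ?thesis unfolding u v xi_below_eq[OF u(1)] xi_below_eq[OF v(1)]
      by (intro ennreal_leI) (simp add: fl.xi_def fl.xi2_def)
  qed
  define L where "L = (SUP t\<in>{..<\<beta>c}. xi_below J G t)"
  have "(xi_below J G \<longlongrightarrow> L) (at_left \<beta>c)"
  proof (rule order_tendstoI)
    fix a assume "a < L"
    then obtain t where t: "t < \<beta>c" "a < xi_below J G t" unfolding L_def less_SUP_iff by auto
    have "\<forall>\<^sub>F y in at_left \<beta>c. t < y \<and> y < \<beta>c"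
      using eventually_at_left[OF t(1)] t(1) by blast
    then show "\<forall>\<^sub>F y in at_left \<beta>c. a < xi_below J G y"
      by eventually_elim (use mono[of t] t in \<open>auto intro: less_le_trans less_imp_le\<close>)
  next
    fix a assume a: "L < a"
    have "\<forall>\<^sub>F y in at_left \<beta>c. y < \<beta>c" by (simp add: eventually_at_filter)
    then show "\<forall>\<^sub>F y in at_left \<beta>c. xi_below J G y < a"
    proof eventually_elim
      case (elim y)
      have "xi_below J G y \<le> L" unfolding L_def by (rule SUP_upper) (use elim in simp)
      then show ?case using a by simp
    qed
  qed
  then have "Lim (at_left \<beta>c) (xi_below J G) = L" by (rule tendsto_Lim[OF at_left_nontrivial])
  then have "Defs.xi J \<beta>c G \<beta>c = L" by (simp add: Defs.xi_def)
  moreover have "xi_below J G (ennreal b) \<le> L"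
    unfolding L_def by (rule SUP_upper) (use b in \<open>simp add: I_iff\<close>)
  ultimately show ?thesis by simp
qed

lemma exp_factor_mono:
  assumes "0 \<le> c" "0 \<le> r" "0 < s" "ennreal s \<le> \<xi>"
  shows "exp (- c * r / s) \<le> exp_factor c r \<xi>"
proof (cases "\<xi> = \<infinity>")
  case True
  then show ?thesis using assms by (simp add: exp_factor_def)
next
  case False
  then obtain u where u: "\<xi> = ennreal u" "0 \<le> u" by (cases \<xi>) auto
  then have su: "s \<le> u" using assms by simp
  have "c * r / u \<le> c * r / s" using assms su by (intro divide_left_mono) auto
  then show ?thesis using u by (simp add: exp_factor_def)
qed

lemma model_bound:
  assumes d3: "3 \<le> CARD('d)" and \<epsilon>: "0 < \<epsilon>" "\<epsilon> < 1"
    and \<delta>: "0 < \<delta>" "\<delta> \<le> 1 / 100" "\<delta> \<le> \<epsilon> / (20 * real CARD('d))"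
      "\<delta> * (16 * flow.D1 TYPE('d) c0) powr (8 / \<epsilon>) \<le> 1 / 4"
    and nc: "norm_continuous \<beta>c H"
    and E: "E_err J \<beta>c G H (beta_thr J \<beta>c G H \<delta>) < ennreal \<delta>"
    and C: "2 * flow.final_const TYPE('d) c0 \<le> C" "0 \<le> C"
    and c: "0 < flow.ct TYPE('d) c0 \<Longrightarrow> c = flow.ct TYPE('d) c0 / 2"
  shows "beta_thr J \<beta>c G H \<delta> = \<beta>c \<and> \<beta>c < \<infinity> \<and>
    (\<forall>\<beta>\<le>\<beta>c. \<forall>x. G \<beta> x \<le> delta0 x + ennreal (
       C / kernel_sigma J ^ CARD('d) *
       (kernel_sigma J / max (kernel_sigma J) (supnorm x)) powr (real CARD('d) - 2 - \<epsilon>) *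
       exp_factor c (supnorm x) (Defs.xi J \<beta>c G \<beta>)))"
proof -
  let ?\<sigma> = "kernel_sigma J"
  have thr: "beta_thr J \<beta>c G H \<delta> = \<beta>c" by (rule beta_thr_eq[OF nc \<delta>(1) E])
  have err_le: "err b \<le> \<delta>" if "b \<in> I" for b
  proof -
    have "ennreal (err b) \<le> E_err J \<beta>c G H \<beta>c" by (rule E_ge[OF that]) (use that in \<open>simp add: I_iff less_imp_le\<close>)
    also have "\<dots> < ennreal \<delta>" using E unfolding thr .
    finally show ?thesis using \<delta> err_nonneg[OF that] by (simp add: ennreal_less_iff)
  qed
  have fl: "flow Fb I X V c0 ?\<sigma> \<delta>"
    using \<delta> err_le by (intro flow_of_error) (auto simp: err_def)
  interpret fl: flow Fb I X V c0 ?\<sigma> \<delta> by (rule fl)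
  have c_eq: "c = fl.ct / 2" using c fl.ct_pos by simp
  have c0': "0 \<le> c" using c_eq fl.ct_pos by simp
  \<comment> \<open>1 / X starts at 1, stays positive and falls at rate at least 1 - \<delta> \<ge>
    1/2, so the subcritical interval has length at most 2. This forces \<beta>c <
    \<infinity>.\<close>
  have b_le: "b \<le> 2" if "b \<in> I" for b
  proof -
    have "(1 - \<delta>) * b \<le> 1 - 1 / X b" using fl.inv_lower[OF that order_refl] that X0 by (simp add: I_iff)
    also have "\<dots> \<le> 1" using X_ge_1[OF that] by simp
    finally have "(1 - \<delta>) * b \<le> 1" .
    moreover have "(1 / 2) * b \<le> (1 - \<delta>) * b" using \<delta> that by (intro mult_right_mono) (auto simp: I_iff)
    ultimately show ?thesis by simp
  qed
  have fin: "\<beta>c < \<infinity>"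
  proof (rule ccontr)
    assume "\<not> \<beta>c < \<infinity>"
    then have "\<beta>c = top" by (simp add: not_less top_unique)
    then have "3 \<in> I" unfolding I_iff by simp
    then show False using b_le[of 3] by simp
  qed
  define B where "B x e = C / ?\<sigma> ^ CARD('d) * (?\<sigma> / max ?\<sigma> (supnorm x)) powr (real CARD('d) - 2 - \<epsilon>) * e" for x :: "'d lattice" and e
  have B_mono: "B x e \<le> B x e'" if "e \<le> e'" for x e e'
    unfolding B_def using that C(2) \<sigma>_pos by (intro mult_left_mono) auto
  have below: "G (ennreal b) x \<le> delta0 x + ennreal (B x (exp (- c * supnorm x / sqrt (V b / X b))))" if b: "b \<in> I" for b x
  proof -
    let ?u = "(?\<sigma> / max ?\<sigma> (supnorm x)) powr (real CARD('d) - 2 - \<epsilon>)"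
    let ?e = "exp (- c * supnorm x / sqrt (V b / X b))"
    have b0: "0 \<le> b" using b by (simp add: I_iff)
    have "Fb b x \<le> ennreal (fl.final_const / ?\<sigma> ^ CARD('d) * ?u * exp (- (fl.ct / 2) * supnorm x / fl.xi b))"
      using \<delta> \<epsilon> d3 by (intro fl.flow_bound b) auto
    then have F: "Fb b x \<le> ennreal (fl.final_const / ?\<sigma> ^ CARD('d) * ?u * ?e)"
      by (simp add: c_eq fl.xi_def fl.xi2_def)
    \<comment> \<open>Renewal from parameter 0, where G is \<open>delta0\<close>, passes from F to
      G. The factor b \<le> 2 is the 2 in the condition on \<open>C\<close>.\<close>
    have "g b x \<le> g 0 x + ennreal (b - 0) * conv (conv (g 0) jl) (g b) x"
      by (rule g_renewal[OF b order_refl b0])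
    then have "g b x \<le> delta0 x + ennreal b * Fb b x" by (simp add: g_zero Fb_eq)
    also have "\<dots> \<le> delta0 x + ennreal 2 * ennreal (fl.final_const / ?\<sigma> ^ CARD('d) * ?u * ?e)"
      using b_le[OF b] F by (intro add_left_mono mult_mono ennreal_leI) auto
    also have "ennreal 2 * ennreal (fl.final_const / ?\<sigma> ^ CARD('d) * ?u * ?e) = ennreal (2 * (fl.final_const / ?\<sigma> ^ CARD('d) * ?u * ?e))"
      by (rule ennreal_mult'[symmetric]) simp
    also have "delta0 x + \<dots> \<le> delta0 x + ennreal (B x ?e)"
    proof (intro add_left_mono ennreal_leI)
      have "2 * fl.final_const / ?\<sigma> ^ CARD('d) * ?u * ?e \<le> C / ?\<sigma> ^ CARD('d) * ?u * ?e"
        using C(1) \<sigma>_pos by (intro mult_right_mono divide_right_mono) auto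
      then show "2 * (fl.final_const / ?\<sigma> ^ CARD('d) * ?u * ?e) \<le> B x ?e" by (simp add: B_def)
    qed
    finally show ?thesis unfolding g_def .
  qed
  have s_pos: "0 < sqrt (V b / X b)" if "b \<in> I" for b
    using V_pos[OF that] X_ge_1[OF that] by simp
  have main: "G \<beta> x \<le> delta0 x + ennreal (B x (exp_factor c (supnorm x) (Defs.xi J \<beta>c G \<beta>)))" if \<beta>: "\<beta> \<le> \<beta>c" for \<beta> x
  proof (cases "\<beta> < \<beta>c")
    case True
    then obtain b where b: "b \<in> I" "\<beta> = ennreal b" using below_real by blast
    have "exp (- c * supnorm x / sqrt (V b / X b)) \<le> exp_factor c (supnorm x) (Defs.xi J \<beta>c G \<beta>)"
      using True xi_below_eq[OF b(1)] b(2)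
      by (intro exp_factor_mono c0' supnorm_nonneg s_pos b) (simp add: Defs.xi_def)
    from ennreal_leI[OF B_mono[OF this, of x]] show ?thesis
      unfolding b(2) using below[OF b(1), of x] by (meson add_left_mono order_trans)
  next
    case False
    then have \<beta>_eq: "\<beta> = \<beta>c" using \<beta> by simp
    \<comment> \<open>Below \<beta>c the decay is first weakened to the larger length
      \<xi>(\<beta>c), so the bound no longer moves with \<beta> and survives the limit.\<close>
    have nt: "at_left \<beta>c \<noteq> bot" by (rule at_left_nontrivial)
    have "((\<lambda>\<beta>. G \<beta> x) \<longlongrightarrow> G \<beta>c x) (at_left \<beta>c)" using cG fin unfolding class_G_def by blast
    moreover have "\<forall>\<^sub>F \<beta> in at_left \<beta>c. G \<beta> x \<le> delta0 x + ennreal (B x (exp_factor c (supnorm x) (Defs.xi J \<beta>c G \<beta>c)))"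
    proof -
      have "\<forall>\<^sub>F y in at_left \<beta>c. y < \<beta>c" by (simp add: eventually_at_filter)
      then show ?thesis
      proof eventually_elim
        case (elim y)
        then obtain b where b: "b \<in> I" "y = ennreal b" using below_real by blast
        have "exp (- c * supnorm x / sqrt (V b / X b)) \<le> exp_factor c (supnorm x) (Defs.xi J \<beta>c G \<beta>c)"
          using xi_le[OF fl b(1)] xi_below_eq[OF b(1)]
          by (intro exp_factor_mono c0' supnorm_nonneg s_pos b) simp
        from ennreal_leI[OF B_mono[OF this, of x]] show ?case
          unfolding b(2) using below[OF b(1), of x] by (meson add_left_mono order_trans)
      qed
    qed
    ultimately show ?thesis unfolding \<beta>_eq using nt by (rule tendsto_upperbound)
  qed
  show ?thesis using thr fin main unfolding B_def by blast
qed

end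

theorem theorem1p6:
  fixes c0 :: real
  assumes "CARD('d::finite) > 2"
    and "0 < c0" and "c0 \<le> 1"
  shows "\<exists>c>0. \<exists>C>0. \<forall>\<epsilon>. 0 < \<epsilon> \<and> \<epsilon> < 1 \<longrightarrow> (\<exists>\<delta>. 0 < \<delta> \<and> \<delta> < 1 \<and>
    (\<forall>(J :: 'd lattice \<Rightarrow> real) (\<beta>c :: ennreal) (G :: ennreal \<Rightarrow> 'd lattice \<Rightarrow> ennreal)
       (H :: ennreal \<Rightarrow> 'd lattice \<Rightarrow> real).
       admissible c0 J \<and> class_G \<beta>c G \<and> assumption1 J \<beta>c G H \<and> norm_continuous \<beta>c H \<and>
       E_err J \<beta>c G H (beta_thr J \<beta>c G H \<delta>) < ennreal \<delta> \<longrightarrow>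
       beta_thr J \<beta>c G H \<delta> = \<beta>c \<and> \<beta>c < \<infinity> \<and>
       (\<forall>\<beta>\<le>\<beta>c. \<forall>x. G \<beta> x \<le> delta0 x + ennreal (
          C / kernel_sigma J ^ CARD('d) *
          (kernel_sigma J / max (kernel_sigma J) (supnorm x)) powr (real CARD('d) - 2 - \<epsilon>) *
          exp_factor c (supnorm x) (xi J \<beta>c G \<beta>)))))"
proof -
  \<comment> \<open>Positivity of \<open>flow.ct\<close> is proved inside \<open>flow\<close>, and
    no instance exists before J and G are fixed. The case split gives c > 0 unconditionally and
    agrees with ct / 2 in every instance; the max in \<open>C\<close> plays the same part.\<close>
  define c where "c = (if 0 < flow.ct TYPE('d) c0 then flow.ct TYPE('d) c0 / 2 else 1)"
  define C where "C = max 1 (2 * flow.final_const TYPE('d) c0)"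
  have "0 < c" "0 < C" by (simp_all add: c_def C_def)
  show ?thesis
  proof (rule exI[of _ c], rule conjI[OF \<open>0 < c\<close>], rule exI[of _ C], rule conjI[OF \<open>0 < C\<close>], intro allI impI, elim conjE)
    fix \<epsilon> :: real assume \<epsilon>: "0 < \<epsilon>" "\<epsilon> < 1"
    define M where "M = (16 * flow.D1 TYPE('d) c0) powr (8 / \<epsilon>)"
    \<comment> \<open>The minimum of the three upper bounds that \<open>model_bound\<close> imposes.
      \<open>max 1 M\<close> keeps the last quotient positive and finite, as the lower bound on
      \<open>D1\<close> is again proved inside \<open>flow\<close>.\<close>
    define \<delta> where "\<delta> = min (1 / 100) (min (\<epsilon> / (20 * real CARD('d))) (1 / (4 * max 1 M)))"
    have \<delta>: "0 < \<delta>" "\<delta> < 1" "\<delta> \<le> 1 / 100" "\<delta> \<le> \<epsilon> / (20 * real CARD('d))" "\<delta> \<le> 1 / (4 * max 1 M)"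
      using \<epsilon> by (auto simp: \<delta>_def min_less_iff_disj)
    have "\<delta> * M \<le> \<delta> * max 1 M" using \<delta> by (intro mult_left_mono) auto
    also have "\<dots> \<le> 1 / 4" using \<delta>(5) by (simp add: field_simps)
    finally have \<delta>M: "\<delta> * M \<le> 1 / 4" .
    show "\<exists>\<delta>. 0 < \<delta> \<and> \<delta> < 1 \<and>
      (\<forall>(J :: 'd lattice \<Rightarrow> real) (\<beta>c :: ennreal) (G :: ennreal \<Rightarrow> 'd lattice \<Rightarrow> ennreal)
       (H :: ennreal \<Rightarrow> 'd lattice \<Rightarrow> real).
       admissible c0 J \<and> class_G \<beta>c G \<and> assumption1 J \<beta>c G H \<and> norm_continuous \<beta>c H \<and>
       E_err J \<beta>c G H (beta_thr J \<beta>c G H \<delta>) < ennreal \<delta> \<longrightarrow>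
       beta_thr J \<beta>c G H \<delta> = \<beta>c \<and> \<beta>c < \<infinity> \<and>
       (\<forall>\<beta>\<le>\<beta>c. \<forall>x. G \<beta> x \<le> delta0 x + ennreal (
          C / kernel_sigma J ^ CARD('d) *
          (kernel_sigma J / max (kernel_sigma J) (supnorm x)) powr (real CARD('d) - 2 - \<epsilon>) *
          exp_factor c (supnorm x) (xi J \<beta>c G \<beta>))))"
    proof (rule exI[of _ \<delta>], intro conjI[OF \<delta>(1)] conjI[OF \<delta>(2)] allI impI, elim conjE)
      fix J :: "'d lattice \<Rightarrow> real" and \<beta>c :: ennreal and G :: "ennreal \<Rightarrow> 'd lattice \<Rightarrow> ennreal"
        and H :: "ennreal \<Rightarrow> 'd lattice \<Rightarrow> real"
      assume as: "admissible c0 J" "class_G \<beta>c G" "assumption1 J \<beta>c G H" "norm_continuous \<beta>c H"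
        "E_err J \<beta>c G H (beta_thr J \<beta>c G H \<delta>) < ennreal \<delta>"
      show "beta_thr J \<beta>c G H \<delta> = \<beta>c \<and> \<beta>c < \<infinity> \<and>
       (\<forall>\<beta>\<le>\<beta>c. \<forall>x. G \<beta> x \<le> delta0 x + ennreal (
          C / kernel_sigma J ^ CARD('d) *
          (kernel_sigma J / max (kernel_sigma J) (supnorm x)) powr (real CARD('d) - 2 - \<epsilon>) *
          exp_factor c (supnorm x) (xi J \<beta>c G \<beta>)))"
      proof (cases "\<beta>c = 0")
        case True
        \<comment> \<open>For \<beta>c = 0 the supremum runs over the empty set and equals 0 =
          \<beta>c, and the only parameter left is 0, where G is \<open>delta0\<close>.\<close>
        have "{\<beta>. \<beta> < \<beta>c \<and> E_err J \<beta>c G H \<beta> < ennreal \<delta>} = {}" using True by auto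
        then have "beta_thr J \<beta>c G H \<delta> = \<beta>c" unfolding beta_thr_def using True by (simp add: bot_ennreal)
        moreover have "G 0 = delta0" using as(2) unfolding class_G_def by blast
        ultimately show ?thesis using True by (auto simp: add_increasing2)
      next
        case False
        interpret model J \<beta>c G H c0
          by unfold_locales (use assms as False in \<open>auto simp: zero_less_iff_neq_zero\<close>)
        show ?thesis
          by (rule model_bound) (use assms(1) \<epsilon> \<delta> \<delta>M as in \<open>auto simp: M_def C_def c_def\<close>)
      qed
    qed
  qed
qed

end
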